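(* Let $k=\mathbb{F}_q$ be a finite field of odd characteristic and $(Q,\sigma)$ a quiver with involution and duality structure $(s,\tau)$. For any two $\sigma$-compatible stabilities $\theta$ and $\theta'$, the identity $$\overset{\longleftarrow}{\prod_{\mu\in\mathbb{Q}_{>0}}}A_\mu^{\theta}\star A^{\sigma,\theta}=\overset{\longleftarrow}{\prod_{\mu\in\mathbb{Q}_{>0}}}A_\mu^{\theta'}\star A^{\sigma,\theta'}$$ holds in $\hat{\mathbb{S}}_Q$, where in the ordered products the factors are arranged so that $\mu$ increases from right to left.
   Context: Quivers. $Q$ is a quiver with finite sets of nodes $Q_0$ and arrows $Q_1$; $\Lambda_Q=\mathbb{Z}Q_0$, $\Lambda_Q^+=\mathbb{Z}_{\ge 0}Q_0$. A representation $M$ consists of finite dimensional $k$-vector spaces $M_i$ and linear maps $m_\alpha:M_i\to M_j$ for arrows $\alpha:i\to j$; $\mathbf{dim}\,M=\sum_i(\dim M_i)\,i$. The Euler form on $\Lambda_Q$ is $\chi(d,d')=\sum_{i\in Q_0}d_id'_i-\sum_{\alpha:i\to j}d_id'_j$, and $\langle d,d'\rangle=\chi(d,d')-\chi(d',d)$. Involutions and duality structures. An involution $\sigma$ of $Q$ is a pair of involutions of $Q_0$ and $Q_1$ such that $\alpha:i\to j$ is sent to $\sigma(\alpha):\sigma(j)\to\sigma(i)$, and every arrow of the form $i\to\sigma(i)$ is fixed by $\sigma$. It acts on $\Lambda_Q$; $\Lambda_Q^{\sigma,+}\subset\Lambda_Q^+$ denotes the $\sigma$-invariants, and $H(d)=d+\sigma(d)$.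 A duality structure is a pair $s:Q_0\to\{\pm1\}$, $\tau:Q_1\to\{\pm1\}$ with $s$ $\sigma$-invariant and $\tau_\alpha\tau_{\sigma(\alpha)}=s_is_j$ for every $\alpha:i\to j$. Self-dual representations. A self-dual representation is a representation $M$ with a non-degenerate bilinear form $\langle\cdot,\cdot\rangle$ on $\bigoplus_iM_i$ such that $M_i$ and $M_j$ are orthogonal unless $i=\sigma(j)$; $\langle x,x'\rangle=s_i\langle x',x\rangle$ for $x,x'\in M_i+M_{\sigma(i)}$; and $\langle m_\alpha x,x'\rangle=\tau_\alpha\langle x,m_{\sigma(\alpha)}x'\rangle$ for every $\alpha:i\to j$, $x\in M_i$, $x'\in M_{\sigma(j)}$. Isometries are isomorphisms preserving the forms; $\mathrm{Aut}_S(M)$ is the group of self-isometries. A subrepresentation is isotropic if the form vanishes on it. Stability. A stability is $\theta\in\mathrm{Hom}_{\mathbb Z}(\Lambda_Q,\mathbb Z)$, $\sigma$-compatible if $\theta\circ\sigma=-\theta$. The slope of a non-zero representation $U$ is $\mu(U)=\theta(\mathbf{dim}\,U)/\dim U$, where $\dim U=\sum_i\dim U_i$. A representation $U$ is semistable if $\mu(V)\le\mu(U)$ for all non-zero subrepresentations $V\subsetneq U$. A self-dual representation $M$ (which has slope $0$) is semistable if $\mu(V)\le0$ for all non-zero isotropic subrepresentations $V\subset M$ (equivalently, if it is semistable as an ordinary representation). The function $\mathcal{E}:\Lambda_Q\to\mathbb{Z}$. Write $Q_0=Q_0^+\sqcup Q_0^\sigma\sqcup Q_0^-$ with $Q_0^\sigma$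 the $\sigma$-fixed nodes and $\sigma(Q_0^+)=Q_0^-$, and similarly $Q_1=Q_1^+\sqcup Q_1^\sigma\sqcup Q_1^-$. Then $$\mathcal{E}(d)=\sum_{i\in Q_0^\sigma}\frac{d_i(d_i-s_i)}2+\sum_{i\in Q_0^+}d_{\sigma(i)}d_i-\sum_{(\alpha:\sigma(i)\to i)\in Q_1^\sigma}\frac{d_i(d_i+\tau_\alpha s_i)}2-\sum_{(\alpha:i\to j)\in Q_1^+}d_{\sigma(i)}d_j.$$ Put $\tilde{\mathcal E}(d)=\mathcal{E}(d)-\mathcal{E}(\sigma(d))$. Quantum torus and its module. $\hat{\mathbb{T}}_Q$ is the $\mathbb{Q}(q^{1/2})$-vector space with topological basis $\{x_d\}_{d\in\Lambda_Q^+}$ (infinite sums allowed) and product $x_d\cdot x_{d'}=q^{\frac12\langle d,d'\rangle}x_{d+d'}$. $\hat{\mathbb{S}}_Q$ is the $\mathbb{Q}(q^{1/2})$-vector space with topological basis $\{\xi_e\}_{e\in\Lambda_Q^{\sigma,+}}$, a $\hat{\mathbb{T}}_Q$-module via $x_d\star\xi_e=q^{\frac12(\langle d,e\rangle-\tilde{\mathcal E}(d))}\xi_{H(d)+e}$. Series. For $\mu\in\mathbb{Q}$, $$A_\mu^\theta=\sum_U\frac{q^{\frac12\chi(\mathbf{dim}\,U,\mathbf{dim}\,U)}}{\#\mathrm{Aut}(U)}x_{\mathbf{dim}\,U}\in\hat{\mathbb{T}}_Q,$$ the sum over isomorphism classes of $\mathbb{F}_q$-representations $U$ that are zero or semistable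 of slope $\mu$ with respect to $\theta$; and $$A^{\sigma,\theta}=\sum_M\frac{q^{\frac12\mathcal{E}(\mathbf{dim}\,M)}}{\#\mathrm{Aut}_S(M)}\xi_{\mathbf{dim}\,M}\in\hat{\mathbb{S}}_Q,$$ the sum over isometry classes of self-dual $\mathbb{F}_q$-representations $M$ that are zero or semistable with respect to $\theta$. *)

theory Defs
  imports
    Complex_Main
    "HOL-Library.FuncSet"
    "HOL-Library.Cardinality"
    "HOL-Algebra.Free_Abelian_Groups"
    "Graph_Theory.Digraph"
begin

section \<open>Lattices, Euler forms and stabilities\<close>

text \<open>
  A quiver is a \<open>fin_digraph\<close>; an arrow \<open>\<alpha> : i \<rightarrow> j\<close> has tail \<open>i\<close> and head \<open>j\<close>, loops and
  multiple arrows being allowed.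
\<close>

abbreviation coef :: "('v \<Rightarrow>\<^sub>0 int) \<Rightarrow> 'v \<Rightarrow> int"
  where "coef \<equiv> Poly_Mapping.lookup"

definition Lam :: "('v, 'a) pre_digraph \<Rightarrow> ('v \<Rightarrow>\<^sub>0 int) set"
  where "Lam Q = carrier (free_Abelian_group (verts Q))"

definition Lam_pos :: "('v, 'a) pre_digraph \<Rightarrow> ('v \<Rightarrow>\<^sub>0 int) set"
  where "Lam_pos Q = {d \<in> Lam Q. \<forall>i\<in>verts Q. 0 \<le> coef d i}"

definition euler_form :: "('v, 'a) pre_digraph \<Rightarrow> ('v \<Rightarrow>\<^sub>0 int) \<Rightarrow> ('v \<Rightarrow>\<^sub>0 int) \<Rightarrow> int"
  where "euler_form Q d d' =
    (\<Sum>i\<in>verts Q. coef d i * coef d' i) -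
    (\<Sum>\<alpha>\<in>arcs Q. coef d (tail Q \<alpha>) * coef d' (head Q \<alpha>))"

definition skew_form :: "('v, 'a) pre_digraph \<Rightarrow> ('v \<Rightarrow>\<^sub>0 int) \<Rightarrow> ('v \<Rightarrow>\<^sub>0 int) \<Rightarrow> int"
  where "skew_form Q d d' = euler_form Q d d' - euler_form Q d' d"

text \<open>The data \<open>\<sigma>\<close> (on nodes and on arrows), \<open>s\<close> and \<open>\<tau>\<close>.\<close>

record ('v, 'a) duality_data =
  nsig :: "'v \<Rightarrow> 'v"
  asig :: "'a \<Rightarrow> 'a"
  nsgn :: "'v \<Rightarrow> int"
  asgn :: "'a \<Rightarrow> int"

definition quiver_involution :: "('v, 'a) pre_digraph \<Rightarrow> ('v, 'a) duality_data \<Rightarrow> bool"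
  where "quiver_involution Q D \<longleftrightarrow>
    (\<forall>i\<in>verts Q. nsig D i \<in> verts Q \<and> nsig D (nsig D i) = i) \<and>
    (\<forall>\<alpha>\<in>arcs Q. asig D \<alpha> \<in> arcs Q \<and> asig D (asig D \<alpha>) = \<alpha>) \<and>
    (\<forall>\<alpha>\<in>arcs Q. tail Q (asig D \<alpha>) = nsig D (head Q \<alpha>) \<and>
                head Q (asig D \<alpha>) = nsig D (tail Q \<alpha>)) \<and>
    (\<forall>\<alpha>\<in>arcs Q. head Q \<alpha> = nsig D (tail Q \<alpha>) \<longrightarrow> asig D \<alpha> = \<alpha>)"

definition duality_structure :: "('v, 'a) pre_digraph \<Rightarrow> ('v, 'a) duality_data \<Rightarrow> bool"
  where "duality_structure Q D \<longleftrightarrow>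
    (\<forall>i\<in>verts Q. nsgn D i \<in> {1, -1} \<and> nsgn D (nsig D i) = nsgn D i) \<and>
    (\<forall>\<alpha>\<in>arcs Q. asgn D \<alpha> \<in> {1, -1} \<and>
       asgn D \<alpha> * asgn D (asig D \<alpha>) = nsgn D (tail Q \<alpha>) * nsgn D (head Q \<alpha>))"

definition sig_lam :: "('v, 'a) duality_data \<Rightarrow> ('v \<Rightarrow>\<^sub>0 int) \<Rightarrow> ('v \<Rightarrow>\<^sub>0 int)"
  where "sig_lam D = frag_extend (\<lambda>i. frag_of (nsig D i))"

definition Lam_sig_pos :: "('v, 'a) pre_digraph \<Rightarrow> ('v, 'a) duality_data \<Rightarrow> ('v \<Rightarrow>\<^sub>0 int) set"
  where "Lam_sig_pos Q D = {d \<in> Lam_pos Q. sig_lam D d = d}"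

definition hyperbolic :: "('v, 'a) duality_data \<Rightarrow> ('v \<Rightarrow>\<^sub>0 int) \<Rightarrow> ('v \<Rightarrow>\<^sub>0 int)"
  where "hyperbolic D d = d + sig_lam D d"

text \<open>
  A choice \<open>P0 = Q\<^sub>0\<^sup>+\<close>, \<open>P1 = Q\<^sub>1\<^sup>+\<close> of decompositions of the nodes and arrows. The function
  \<open>sd_euler\<close> below does not depend on the choice.
\<close>

definition sig_decomposition ::
  "('v, 'a) pre_digraph \<Rightarrow> ('v, 'a) duality_data \<Rightarrow> 'v set \<Rightarrow> 'a set \<Rightarrow> bool"
  where "sig_decomposition Q D P0 P1 \<longleftrightarrow>
    verts Q = P0 \<union> {i \<in> verts Q. nsig D i = i} \<union> nsig D ` P0 \<and>
    P0 \<inter> {i \<in> verts Q. nsig D i = i} = {} \<and> P0 \<inter> nsig D ` P0 = {} \<and>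
    arcs Q = P1 \<union> {\<alpha> \<in> arcs Q. asig D \<alpha> = \<alpha>} \<union> asig D ` P1 \<and>
    P1 \<inter> {\<alpha> \<in> arcs Q. asig D \<alpha> = \<alpha>} = {} \<and> P1 \<inter> asig D ` P1 = {}"

text \<open>The function \<open>\<E>\<close>. Both occurrences of \<open>div 2\<close> are exact, the signs being odd.\<close>

definition sd_euler ::
  "('v, 'a) pre_digraph \<Rightarrow> ('v, 'a) duality_data \<Rightarrow> 'v set \<Rightarrow> 'a set \<Rightarrow> ('v \<Rightarrow>\<^sub>0 int) \<Rightarrow> int"
  where "sd_euler Q D P0 P1 d =
    (\<Sum>i | i \<in> verts Q \<and> nsig D i = i. (coef d i * (coef d i - nsgn D i)) div 2) +
    (\<Sum>i\<in>P0. coef d (nsig D i) * coef d i) -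
    (\<Sum>\<alpha> | \<alpha> \<in> arcs Q \<and> asig D \<alpha> = \<alpha>.
       (coef d (head Q \<alpha>) * (coef d (head Q \<alpha>) + asgn D \<alpha> * nsgn D (head Q \<alpha>))) div 2) -
    (\<Sum>\<alpha>\<in>P1. coef d (nsig D (tail Q \<alpha>)) * coef d (head Q \<alpha>))"

definition sd_euler_tilde ::
  "('v, 'a) pre_digraph \<Rightarrow> ('v, 'a) duality_data \<Rightarrow> 'v set \<Rightarrow> 'a set \<Rightarrow> ('v \<Rightarrow>\<^sub>0 int) \<Rightarrow> int"
  where "sd_euler_tilde Q D P0 P1 d = sd_euler Q D P0 P1 d - sd_euler Q D P0 P1 (sig_lam D d)"

definition stability :: "('v, 'a) pre_digraph \<Rightarrow> (('v \<Rightarrow>\<^sub>0 int) \<Rightarrow> int) \<Rightarrow> bool"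
  where "stability Q \<theta> \<longleftrightarrow> \<theta> \<in> hom (free_Abelian_group (verts Q)) integer_group"

definition sig_compatible ::
  "('v, 'a) pre_digraph \<Rightarrow> ('v, 'a) duality_data \<Rightarrow> (('v \<Rightarrow>\<^sub>0 int) \<Rightarrow> int) \<Rightarrow> bool"
  where "sig_compatible Q D \<theta> \<longleftrightarrow> (\<forall>d\<in>Lam Q. \<theta> (sig_lam D d) = - \<theta> d)"

section \<open>Representations\<close>

text \<open>
  All vector spaces are finite-dimensional subspaces of the countably infinite-dimensional space
  \<open>nat \<Rightarrow>\<^sub>0 'k\<close> of finitely supported sequences. Every finite-dimensional space is isomorphic to
  one of these, so every isomorphism class of representations is realised.
\<close>

definition kscale :: "'k::field \<Rightarrow> (nat \<Rightarrow>\<^sub>0 'k) \<Rightarrow> (nat \<Rightarrow>\<^sub>0 'k)"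
  where "kscale c = Poly_Mapping.map ((*) c)"

lemma lookup_kscale: "Poly_Mapping.lookup (kscale c x) n = c * Poly_Mapping.lookup x n"
  by (simp add: kscale_def map.rep_eq when_def)

interpretation kvec: vector_space "kscale :: 'k::field \<Rightarrow> _"
  by unfold_locales
    (auto intro!: poly_mapping_eqI simp: lookup_kscale lookup_add algebra_simps)

definition fd_subspace :: "(nat \<Rightarrow>\<^sub>0 'k::field) set \<Rightarrow> bool"
  where "fd_subspace V \<longleftrightarrow> (\<exists>B. finite B \<and> V = kvec.span B)"

definition linear_between ::
  "(nat \<Rightarrow>\<^sub>0 'k::field) set \<Rightarrow> (nat \<Rightarrow>\<^sub>0 'k) set \<Rightarrow> ((nat \<Rightarrow>\<^sub>0 'k) \<Rightarrow> (nat \<Rightarrow>\<^sub>0 'k)) \<Rightarrow> bool"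
  where "linear_between V W f \<longleftrightarrow> f \<in> V \<rightarrow> W \<and>
    (\<forall>x\<in>V. \<forall>y\<in>V. f (x + y) = f x + f y) \<and> (\<forall>c. \<forall>x\<in>V. f (kscale c x) = kscale c (f x))"

record (overloaded) ('v, 'a, 'k::zero) qrep =
  vsp :: "'v \<Rightarrow> (nat \<Rightarrow>\<^sub>0 'k) set"
  vmap :: "'a \<Rightarrow> (nat \<Rightarrow>\<^sub>0 'k) \<Rightarrow> (nat \<Rightarrow>\<^sub>0 'k)"

definition representation ::
  "('v, 'a) pre_digraph \<Rightarrow> ('v, 'a, 'k::field, 'z) qrep_scheme \<Rightarrow> bool"
  where "representation Q M \<longleftrightarrow>
    (\<forall>i\<in>verts Q. fd_subspace (vsp M i)) \<and>
    (\<forall>\<alpha>\<in>arcs Q. linear_between (vsp M (tail Q \<alpha>)) (vsp M (head Q \<alpha>)) (vmap M \<alpha>))"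

text \<open>
  Subrepresentations are families of subspaces; dimension vector and slope depend only on the
  family of spaces and are defined for such families.
\<close>

definition subrepresentation ::
  "('v, 'a) pre_digraph \<Rightarrow> ('v, 'a, 'k::field, 'z) qrep_scheme \<Rightarrow> ('v \<Rightarrow> (nat \<Rightarrow>\<^sub>0 'k) set) \<Rightarrow> bool"
  where "subrepresentation Q M V \<longleftrightarrow>
    (\<forall>i\<in>verts Q. kvec.subspace (V i) \<and> V i \<subseteq> vsp M i) \<and>
    (\<forall>\<alpha>\<in>arcs Q. vmap M \<alpha> ` V (tail Q \<alpha>) \<subseteq> V (head Q \<alpha>))"

definition zero_family :: "('v, 'a) pre_digraph \<Rightarrow> ('v \<Rightarrow> (nat \<Rightarrow>\<^sub>0 'k::field) set) \<Rightarrow> bool"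
  where "zero_family Q V \<longleftrightarrow> (\<forall>i\<in>verts Q. V i = {0})"

definition dimvec ::
  "('v, 'a) pre_digraph \<Rightarrow> ('v \<Rightarrow> (nat \<Rightarrow>\<^sub>0 'k::field) set) \<Rightarrow> ('v \<Rightarrow>\<^sub>0 int)"
  where "dimvec Q V = (\<Sum>i\<in>verts Q. frag_cmul (int (kvec.dim (V i))) (frag_of i))"

definition slope ::
  "('v, 'a) pre_digraph \<Rightarrow> (('v \<Rightarrow>\<^sub>0 int) \<Rightarrow> int) \<Rightarrow> ('v \<Rightarrow> (nat \<Rightarrow>\<^sub>0 'k::field) set) \<Rightarrow> rat"
  where "slope Q \<theta> V = of_int (\<theta> (dimvec Q V)) / of_nat (\<Sum>i\<in>verts Q. kvec.dim (V i))"

definition semistable ::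
  "('v, 'a) pre_digraph \<Rightarrow> (('v \<Rightarrow>\<^sub>0 int) \<Rightarrow> int) \<Rightarrow> ('v, 'a, 'k::field) qrep \<Rightarrow> bool"
  where "semistable Q \<theta> U \<longleftrightarrow>
    (\<forall>V. subrepresentation Q U V \<and> \<not> zero_family Q V \<and> (\<exists>i\<in>verts Q. V i \<noteq> vsp U i)
       \<longrightarrow> slope Q \<theta> V \<le> slope Q \<theta> (vsp U))"

definition rep_iso ::
  "('v, 'a) pre_digraph \<Rightarrow> ('v, 'a, 'k::field, 'z) qrep_scheme \<Rightarrow> ('v, 'a, 'k, 'z) qrep_scheme \<Rightarrow>
    ('v \<Rightarrow> (nat \<Rightarrow>\<^sub>0 'k) \<Rightarrow> (nat \<Rightarrow>\<^sub>0 'k)) \<Rightarrow> bool"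
  where "rep_iso Q M N f \<longleftrightarrow>
    (\<forall>i\<in>verts Q. linear_between (vsp M i) (vsp N i) (f i) \<and> bij_betw (f i) (vsp M i) (vsp N i)) \<and>
    (\<forall>\<alpha>\<in>arcs Q. \<forall>x\<in>vsp M (tail Q \<alpha>).
       f (head Q \<alpha>) (vmap M \<alpha> x) = vmap N \<alpha> (f (tail Q \<alpha>) x))"

definition iso_rel ::
  "('v, 'a) pre_digraph \<Rightarrow> (('v, 'a, 'k::field) qrep \<times> ('v, 'a, 'k) qrep) set"
  where "iso_rel Q = {(U, U'). representation Q U \<and> representation Q U' \<and> (\<exists>f. rep_iso Q U U' f)}"

text \<open>
  Automorphisms are taken in the extensional function spaces, so that distinct elements of the set
  are distinct as morphisms.
\<close>

definition Aut ::
  "('v, 'a) pre_digraph \<Rightarrow> ('v, 'a, 'k::field) qrep \<Rightarrow> ('v \<Rightarrow> (nat \<Rightarrow>\<^sub>0 'k) \<Rightarrow> (nat \<Rightarrow>\<^sub>0 'k)) set"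
  where "Aut Q U = {f \<in> (\<Pi>\<^sub>E i\<in>verts Q. vsp U i \<rightarrow>\<^sub>E vsp U i). rep_iso Q U U f}"

section \<open>Self-dual representations\<close>

text \<open>
  Elements of \<open>\<Oplus>\<^sub>i M\<^sub>i\<close> are extensional families; the form of a self-dual representation is only
  meaningful on these.
\<close>

record (overloaded) ('v, 'a, 'k::zero) sdrep = "('v, 'a, 'k) qrep" +
  bform :: "('v \<Rightarrow> (nat \<Rightarrow>\<^sub>0 'k)) \<Rightarrow> ('v \<Rightarrow> (nat \<Rightarrow>\<^sub>0 'k)) \<Rightarrow> 'k"

abbreviation dsum ::
  "('v, 'a) pre_digraph \<Rightarrow> ('v \<Rightarrow> (nat \<Rightarrow>\<^sub>0 'k::field) set) \<Rightarrow> ('v \<Rightarrow> (nat \<Rightarrow>\<^sub>0 'k)) set"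
  where "dsum Q V \<equiv> (\<Pi>\<^sub>E i\<in>verts Q. V i)"

definition emb :: "('v, 'a) pre_digraph \<Rightarrow> 'v \<Rightarrow> (nat \<Rightarrow>\<^sub>0 'k::field) \<Rightarrow> 'v \<Rightarrow> (nat \<Rightarrow>\<^sub>0 'k)"
  where "emb Q i x = (\<lambda>j\<in>verts Q. if j = i then x else 0)"

definition bilinear_form_on ::
  "('v, 'a) pre_digraph \<Rightarrow> ('v \<Rightarrow> (nat \<Rightarrow>\<^sub>0 'k::field) set) \<Rightarrow>
    (('v \<Rightarrow> (nat \<Rightarrow>\<^sub>0 'k)) \<Rightarrow> ('v \<Rightarrow> (nat \<Rightarrow>\<^sub>0 'k)) \<Rightarrow> 'k) \<Rightarrow> bool"
  where "bilinear_form_on Q V b \<longleftrightarrow>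
    (\<forall>x\<in>dsum Q V. \<forall>y\<in>dsum Q V. \<forall>z\<in>dsum Q V.
       b (\<lambda>i\<in>verts Q. x i + y i) z = b x z + b y z \<and>
       b z (\<lambda>i\<in>verts Q. x i + y i) = b z x + b z y) \<and>
    (\<forall>c. \<forall>x\<in>dsum Q V. \<forall>z\<in>dsum Q V.
       b (\<lambda>i\<in>verts Q. kscale c (x i)) z = c * b x z \<and>
       b z (\<lambda>i\<in>verts Q. kscale c (x i)) = c * b z x)"

definition nondegenerate_on ::
  "('v, 'a) pre_digraph \<Rightarrow> ('v \<Rightarrow> (nat \<Rightarrow>\<^sub>0 'k::field) set) \<Rightarrow>
    (('v \<Rightarrow> (nat \<Rightarrow>\<^sub>0 'k)) \<Rightarrow> ('v \<Rightarrow> (nat \<Rightarrow>\<^sub>0 'k)) \<Rightarrow> 'k) \<Rightarrow> bool"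
  where "nondegenerate_on Q V b \<longleftrightarrow>
    (\<forall>x\<in>dsum Q V. (\<forall>y\<in>dsum Q V. b x y = 0) \<longrightarrow> x = (\<lambda>i\<in>verts Q. 0)) \<and>
    (\<forall>y\<in>dsum Q V. (\<forall>x\<in>dsum Q V. b x y = 0) \<longrightarrow> y = (\<lambda>i\<in>verts Q. 0))"

definition self_dual ::
  "('v, 'a) pre_digraph \<Rightarrow> ('v, 'a) duality_data \<Rightarrow> ('v, 'a, 'k::field) sdrep \<Rightarrow> bool"
  where "self_dual Q D M \<longleftrightarrow>
    representation Q M \<and>
    bilinear_form_on Q (vsp M) (bform M) \<and>
    nondegenerate_on Q (vsp M) (bform M) \<and>
    (\<forall>i\<in>verts Q. \<forall>j\<in>verts Q. i \<noteq> nsig D j \<longrightarrow>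
       (\<forall>x\<in>vsp M i. \<forall>y\<in>vsp M j. bform M (emb Q i x) (emb Q j y) = 0)) \<and>
    (\<forall>i\<in>verts Q. \<forall>x\<in>dsum Q (vsp M). \<forall>x'\<in>dsum Q (vsp M).
       (\<forall>j\<in>verts Q - {i, nsig D i}. x j = 0 \<and> x' j = 0) \<longrightarrow>
       bform M x x' = of_int (nsgn D i) * bform M x' x) \<and>
    (\<forall>\<alpha>\<in>arcs Q. \<forall>x\<in>vsp M (tail Q \<alpha>). \<forall>x'\<in>vsp M (nsig D (head Q \<alpha>)).
       bform M (emb Q (head Q \<alpha>) (vmap M \<alpha> x)) (emb Q (nsig D (head Q \<alpha>)) x') =
       of_int (asgn D \<alpha>) *
         bform M (emb Q (tail Q \<alpha>) x) (emb Q (nsig D (tail Q \<alpha>)) (vmap M (asig D \<alpha>) x')))"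

definition isotropic ::
  "('v, 'a) pre_digraph \<Rightarrow> ('v, 'a, 'k::field) sdrep \<Rightarrow> ('v \<Rightarrow> (nat \<Rightarrow>\<^sub>0 'k) set) \<Rightarrow> bool"
  where "isotropic Q M V \<longleftrightarrow> (\<forall>x\<in>dsum Q V. \<forall>y\<in>dsum Q V. bform M x y = 0)"

definition sd_semistable ::
  "('v, 'a) pre_digraph \<Rightarrow> (('v \<Rightarrow>\<^sub>0 int) \<Rightarrow> int) \<Rightarrow> ('v, 'a, 'k::field) sdrep \<Rightarrow> bool"
  where "sd_semistable Q \<theta> M \<longleftrightarrow>
    (\<forall>V. subrepresentation Q M V \<and> \<not> zero_family Q V \<and> isotropic Q M V \<longrightarrow> slope Q \<theta> V \<le> 0)"

definition isometry ::
  "('v, 'a) pre_digraph \<Rightarrow> ('v, 'a, 'k::field) sdrep \<Rightarrow> ('v, 'a, 'k) sdrep \<Rightarrow>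
    ('v \<Rightarrow> (nat \<Rightarrow>\<^sub>0 'k) \<Rightarrow> (nat \<Rightarrow>\<^sub>0 'k)) \<Rightarrow> bool"
  where "isometry Q M N f \<longleftrightarrow> rep_iso Q M N f \<and>
    (\<forall>x\<in>dsum Q (vsp M). \<forall>y\<in>dsum Q (vsp M).
       bform N (\<lambda>i\<in>verts Q. f i (x i)) (\<lambda>i\<in>verts Q. f i (y i)) = bform M x y)"

definition isometry_rel ::
  "('v, 'a) pre_digraph \<Rightarrow> ('v, 'a) duality_data \<Rightarrow>
    (('v, 'a, 'k::field) sdrep \<times> ('v, 'a, 'k) sdrep) set"
  where "isometry_rel Q D =
    {(M, N). self_dual Q D M \<and> self_dual Q D N \<and> (\<exists>f. isometry Q M N f)}"

definition Aut_S ::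
  "('v, 'a) pre_digraph \<Rightarrow> ('v, 'a, 'k::field) sdrep \<Rightarrow> ('v \<Rightarrow> (nat \<Rightarrow>\<^sub>0 'k) \<Rightarrow> (nat \<Rightarrow>\<^sub>0 'k)) set"
  where "Aut_S Q M = {f \<in> (\<Pi>\<^sub>E i\<in>verts Q. vsp M i \<rightarrow>\<^sub>E vsp M i). isometry Q M M f}"

section \<open>The quantum torus and its module\<close>

text \<open>
  Here \<open>q\<close> is the order of the finite field and \<open>q\<^sup>1\<^sup>/\<^sup>2\<close> its positive square root, so
  \<open>\<rat>(q\<^sup>1\<^sup>/\<^sup>2)\<close> is a subfield of the reals. An element \<open>\<Sum>\<^sub>d f\<^sub>d x\<^sub>d\<close> of the completed torus is the
  function \<open>f\<close>, extended by zero; likewise for the module with basis \<open>\<xi>\<^sub>e\<close>.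
\<close>

type_synonym 'v series = "('v \<Rightarrow>\<^sub>0 int) \<Rightarrow> real"

definition coeff_field :: "nat \<Rightarrow> real set"
  where "coeff_field q = {a + b * sqrt (real q) | a b. a \<in> \<rat> \<and> b \<in> \<rat>}"

definition qhalf :: "nat \<Rightarrow> int \<Rightarrow> real"
  where "qhalf q n = sqrt (real q) powi n"

definition torus :: "nat \<Rightarrow> ('v, 'a) pre_digraph \<Rightarrow> 'v series set"
  where "torus q Q = {f. range f \<subseteq> coeff_field q \<and> (\<forall>d. d \<notin> Lam_pos Q \<longrightarrow> f d = 0)}"

definition torus_module ::
  "nat \<Rightarrow> ('v, 'a) pre_digraph \<Rightarrow> ('v, 'a) duality_data \<Rightarrow> 'v series set"
  where "torus_module q Q D =
    {g. range g \<subseteq> coeff_field q \<and> (\<forall>e. e \<notin> Lam_sig_pos Q D \<longrightarrow> g e = 0)}"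

definition torus_one :: "'v series"
  where "torus_one d = (if d = 0 then 1 else 0)"

definition torus_mult ::
  "nat \<Rightarrow> ('v, 'a) pre_digraph \<Rightarrow> 'v series \<Rightarrow> 'v series \<Rightarrow> 'v series"
  where "torus_mult q Q f g c =
    (\<Sum>(d, d') | d \<in> Lam_pos Q \<and> d' \<in> Lam_pos Q \<and> d + d' = c.
       qhalf q (skew_form Q d d') * f d * g d')"

definition torus_act ::
  "nat \<Rightarrow> ('v, 'a) pre_digraph \<Rightarrow> ('v, 'a) duality_data \<Rightarrow> 'v set \<Rightarrow> 'a set \<Rightarrow>
    'v series \<Rightarrow> 'v series \<Rightarrow> 'v series"
  where "torus_act q Q D P0 P1 f g c =
    (\<Sum>(d, e) | d \<in> Lam_pos Q \<and> e \<in> Lam_sig_pos Q D \<and> hyperbolic D d + e = c.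
       qhalf q (skew_form Q d e - sd_euler_tilde Q D P0 P1 d) * f d * g e)"

text \<open>
  The factors of a finite ordered product are arranged so that the index increases from right to
  left. The infinite product is the coefficientwise limit over finite sets of indices, each
  coefficient being eventually constant; such a limit is unique.
\<close>

definition finite_ordered_prod ::
  "nat \<Rightarrow> ('v, 'a) pre_digraph \<Rightarrow> (rat \<Rightarrow> 'v series) \<Rightarrow> rat set \<Rightarrow> 'v series"
  where "finite_ordered_prod q Q A F =
    foldr (\<lambda>\<mu> P. torus_mult q Q (A \<mu>) P) (rev (sorted_list_of_set F)) torus_one"

definition has_ordered_prod ::
  "nat \<Rightarrow> ('v, 'a) pre_digraph \<Rightarrow> (rat \<Rightarrow> 'v series) \<Rightarrow> rat set \<Rightarrow> 'v series \<Rightarrow> bool"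
  where "has_ordered_prod q Q A I P \<longleftrightarrow> P \<in> torus q Q \<and>
    (\<forall>d. \<forall>\<^sub>F F in finite_subsets_at_top I. finite_ordered_prod q Q A F d = P d)"

section \<open>The generating series\<close>

text \<open>
  The coefficient of \<open>x\<^sub>d\<close> collects the (finitely many) isomorphism classes of dimension vector
  \<open>d\<close>; the summand does not depend on the chosen element of a class.
\<close>

definition A_series ::
  "'k::{field,finite} itself \<Rightarrow> ('v, 'a) pre_digraph \<Rightarrow> (('v \<Rightarrow>\<^sub>0 int) \<Rightarrow> int) \<Rightarrow> rat \<Rightarrow> 'v series"
  where "A_series K Q \<theta> \<mu> d =
    (\<Sum>C \<in> {U :: ('v, 'a, 'k) qrep. representation Q U \<and>
              (zero_family Q (vsp U) \<or> semistable Q \<theta> U \<and> slope Q \<theta> (vsp U) = \<mu>) \<and>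
              dimvec Q (vsp U) = d} // iso_rel Q.
       qhalf (CARD('k)) (euler_form Q d d) / real (card (Aut Q (SOME U. U \<in> C))))"

definition A_sd_series ::
  "'k::{field,finite} itself \<Rightarrow> ('v, 'a) pre_digraph \<Rightarrow> ('v, 'a) duality_data \<Rightarrow>
    'v set \<Rightarrow> 'a set \<Rightarrow> (('v \<Rightarrow>\<^sub>0 int) \<Rightarrow> int) \<Rightarrow> 'v series"
  where "A_sd_series K Q D P0 P1 \<theta> e =
    (\<Sum>C \<in> {M :: ('v, 'a, 'k) sdrep. self_dual Q D M \<and>
              (zero_family Q (vsp M) \<or> sd_semistable Q \<theta> M) \<and>
              dimvec Q (vsp M) = e} // isometry_rel Q D.
       qhalf (CARD('k)) (sd_euler Q D P0 P1 e) / real (card (Aut_S Q (SOME M. M \<in> C))))"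

end

theory Submission
  imports Defs
begin

text \<open>
  The acted-on series equals, for every \<open>\<theta>\<close>, the series whose coefficient at \<open>\<xi>\<^sub>c\<close> is
  \<open>q\<^sup>1\<^sup>/\<^sup>2 \<^sup>\<E>\<^sup>(\<^sup>c\<^sup>)\<close> times the number of all self-dual representations of dimension \<open>c\<close>, weighted
  by the inverse orders of their isometry groups. Among the subrepresentations of a self-dual \<open>M\<close> on
  which \<open>\<theta>\<close> is maximal there is a smallest one, \<open>U\<close>. It is isotropic, all proper subrepresentations
  of \<open>U\<close> have smaller \<open>\<theta>\<close>-value, and \<open>U\<^sup>\<bottom>/U\<close> is a semistable self-dual representation. Counting
  representations together with a frame adapted to \<open>U \<subseteq> U\<^sup>\<bottom> \<subseteq> M\<close> evaluates the weighted number of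
  the \<open>M\<close> with \<open>dim U = d\<close>. In the same way, splitting off the largest subrepresentation of maximal
  slope expresses the weighted number of the possible \<open>U\<close> by the ordered product of the \<open>A\<^sub>\<mu>\<close>.
\<close>

text \<open>Isomorphism classes are never listed. The sum of 1/#Aut over a family of representations
  equals the number of matrix systems realising members of the family divided by the number of
  frames, so each identity becomes a count of matrix systems with prescribed zero blocks; the orders
  of the general linear groups cancel and only powers of q survive. The obstacle on the self-dual
  side is that form and arrow maps constrain each other. Replacing the map m along an arrow by the
  form <m x, y> turns all these constraints into one linear symmetry condition on matrix entries,
  and in a basis adapted to \<open>U\<close> and its orthogonal the blocks of such a system are
  independent. Entries that the symmetry fixes with sign -1 must vanish; this is where odd
  characteristic enters. A single cut suffices there, since M modulo the orthogonal of
  \<open>U\<close> is dual to \<open>U\<close>. What remains is to match powers of q, an identity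
  between the quadratic functions \<chi> and \<E>, proved by polarising 2\<E>.\<close>

type_synonym 'k vec = "nat \<Rightarrow>\<^sub>0 'k"

text \<open>The entries of all matrices of a self-dual model at once: the first component names a
  node or an arrow, the other two are row and column.\<close>

type_synonym ('v, 'a, 'k) esys = "('v + 'a) \<times> nat \<times> nat => 'k"

section \<open>Coordinate subspaces and matrices\<close>

abbreviation (input) "entry \<equiv> Poly_Mapping.lookup"

interpretation kpair: vector_space_pair "kscale :: 'k::field => _" "kscale :: 'k::field => _"
 by unfold_locales

text \<open>Index sets are arbitrary sets of naturals rather than initial segments, so that flags
  and complements live in one ambient space: \<open>coords A <= coords (A Un B)\<close>, with
  complement \<open>coords B\<close> for disjoint \<open>A\<close> and \<open>B\<close>.\<close>

definition coords :: "nat set => ('k::field) vec set"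
 where "coords I = {x. \<forall>j. j ~: I --> entry x j = 0}"

definition comb :: "nat set => (nat => 'k::field) => 'k vec"
 where "comb I c = (\<Sum>i\<in>I. Poly_Mapping.single i (c i))"

abbreviation unitv :: "nat => ('k::field) vec"
 where "unitv j \<equiv> Poly_Mapping.single j 1"

definition proj :: "nat set => ('k::field) vec => 'k vec"
 where "proj I x = comb I (entry x)"

text \<open>The matrix is a total function of which only the entries in \<open>I\<close> times
  \<open>J\<close> matter. Passing to a block therefore means changing \<open>I\<close> and
  \<open>J\<close> and keeping \<open>a\<close>.\<close>

definition mat_app :: "nat set => nat set => (nat => nat => 'k::field) => 'k vec => 'k vec"
 where "mat_app I J a x = comb I (%i. \<Sum>j\<in>J. a i j * entry x j)"

lemma lookup_comb:
 assumes "finite I"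
 shows "entry (comb I c) j = (if j : I then c j else 0)"
proof -
 have "entry (comb I c) j = (\<Sum>i\<in>I. c i when i = j)"
  by (simp add: comb_def lookup_sum lookup_single)
 also have "\<dots> = (if j : I then c j else 0)"
  using assms by (simp add: when_def)
 finally show ?thesis .
qed

lemma lookup_proj:
 "finite I ==> entry (proj I x) j = (if j : I then entry x j else 0)"
 by (simp add: proj_def lookup_comb)

lemma lookup_mat_app:
 "finite I ==> entry (mat_app I J a x) i =
   (if i : I then \<Sum>j\<in>J. a i j * entry x j else 0)"
 by (simp add: mat_app_def lookup_comb)

lemma coords_lookup: "x : coords I ==> j ~: I ==> entry x j = 0"
 by (simp add: coords_def)

lemma subspace_coords: "kvec.subspace (coords I)"
 by (auto simp: kvec.subspace_def coords_def lookup_add lookup_kscale)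

lemma coords_mono: "I <= J ==> coords I <= coords J"
 by (auto simp: coords_def)

lemma coords_empty [simp]: "coords {} = {0}"
 by (auto simp: coords_def intro: poly_mapping_eqI)

lemma zero_in_coords [simp]: "0 : coords I"
 by (auto simp: coords_def)

lemma unitv_in_coords [simp]: "unitv j : coords I \<longleftrightarrow> j : I"
 by (auto simp: coords_def lookup_single when_def)

lemma comb_in_coords: "finite I ==> comb I c : coords I"
 by (simp add: coords_def lookup_comb)

lemma proj_in_coords [simp]: "finite I ==> proj I x : coords I"
 by (simp add: proj_def comb_in_coords)

lemma mat_app_in_coords [simp]: "finite I ==> mat_app I J a x : coords I"
 by (simp add: mat_app_def comb_in_coords)

lemma proj_id: "finite I ==> x : coords I ==> proj I x = x"
 by (rule poly_mapping_eqI) (auto simp: lookup_proj coords_def)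

lemma proj_disjoint: "finite I ==> x : coords J ==> I Int J = {} ==> proj I x = 0"
 by (rule poly_mapping_eqI) (auto simp: lookup_proj coords_def)

lemma proj_add: "finite I ==> proj I (x + y) = proj I x + proj I y"
 by (rule poly_mapping_eqI) (simp add: lookup_proj lookup_add)

lemma proj_kscale: "finite I ==> proj I (kscale c x) = kscale c (proj I x)"
 by (rule poly_mapping_eqI) (simp add: lookup_proj lookup_kscale)

lemma proj_0 [simp]: "finite I ==> proj I 0 = 0"
 by (rule poly_mapping_eqI) (simp add: lookup_proj)

lemma proj_decomp:
 "finite A ==> finite B ==> A Int B = {} ==> x : coords (A Un B) ==> proj A x + proj B x = x"
 by (rule poly_mapping_eqI) (auto simp: lookup_proj lookup_add coords_def)

lemma proj_eq_0_iff:
 "finite A ==> finite B ==> A Int B = {} ==> x : coords (A Un B) ==> proj B x = 0 \<longleftrightarrow> x : coords A"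
 using proj_decomp[of A B x] proj_in_coords[of A x] proj_disjoint[of B x A] by (auto simp: Int_commute simp del: proj_in_coords)

lemma mat_app_add: "finite I ==> mat_app I J a (x + y) = mat_app I J a x + mat_app I J a y"
 by (rule poly_mapping_eqI)
  (simp add: lookup_mat_app lookup_add distrib_left sum.distrib)

lemma mat_app_kscale: "finite I ==> mat_app I J a (kscale c x) = kscale c (mat_app I J a x)"
 by (rule poly_mapping_eqI)
  (simp add: lookup_mat_app lookup_kscale sum_distrib_left mult.left_commute)

lemma mat_app_unitv:
 "finite J ==> j : J ==> mat_app I J a (unitv j) = comb I (%i. a i j)"
 by (simp add: mat_app_def lookup_single when_def if_distrib cong: if_cong)

lemma linear_between_mat_app: "finite I ==> linear_between V (coords I) (mat_app I J a)"
 by (simp add: linear_between_def mat_app_add mat_app_kscale)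

lemma linear_between_in: "linear_between V W f ==> x : V ==> f x : W"
 by (auto simp: linear_between_def)

lemma linear_between_add: "linear_between V W f ==> x : V ==> y : V ==> f (x + y) = f x + f y"
 by (auto simp: linear_between_def)

lemma linear_between_kscale: "linear_between V W f ==> x : V ==> f (kscale c x) = kscale c (f x)"
 by (auto simp: linear_between_def)

lemma linear_between_0: "linear_between V W f ==> kvec.subspace V ==> f 0 = 0"
 using linear_between_kscale[of V W f 0 0] kvec.subspace_0[of V] by simp

lemma linear_between_diff:
 assumes "linear_between V W f" "kvec.subspace V" "x : V" "y : V"
 shows "f (x - y) = f x - f y"
 using linear_between_add[OF assms(1) kvec.subspace_diff[OF assms(2-4)] assms(4)] by simp

lemma linear_between_cong:
 "kvec.subspace V ==> (!!x. x : V ==> f x = g x) ==> linear_between V W f = linear_between V W g"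
 unfolding linear_between_def
 by (auto simp: kvec.subspace_add kvec.subspace_scale Pi_iff)

lemma linear_between_comp:
 "linear_between V W f ==> linear_between W X g ==> linear_between V X (%x. g (f x))"
 by (auto simp: linear_between_def Pi_iff)

lemma linear_between_mono:
 "linear_between V W f ==> V' <= V ==> f ` V' <= W' ==> linear_between V' W' f"
 by (auto simp: linear_between_def Pi_iff subset_iff)

lemma linear_between_proj: "finite I ==> linear_between V (coords I) (proj I)"
 by (simp add: linear_between_def proj_add proj_kscale)

lemma linear_between_sum:
 assumes "linear_between V W f" "kvec.subspace V" "finite S" "!!i. i : S ==> g i : V"
 shows "f (\<Sum>i\<in>S. g i) = (\<Sum>i\<in>S. f (g i))"
 using assms(3,4)
proof (induction S)
 case empty
 then show ?case using linear_between_0 assms by fastforce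
next
 case (insert a S)
 have "(\<Sum>i\<in>S. g i) : V" using insert assms(2) by (simp add: kvec.subspace_sum)
 then show ?case using insert assms(1) by (simp add: linear_between_add)
qed

lemma coords_expand:
 assumes "finite J" "x : coords J"
 shows "x = (\<Sum>j\<in>J. kscale (entry x j) (unitv j))"
proof -
 have "x = comb J (entry x)"
  using assms proj_id unfolding proj_def by metis
 also have "\<dots> = (\<Sum>j\<in>J. kscale (entry x j) (unitv j))"
  unfolding comb_def
  by (rule sum.cong) (auto intro!: poly_mapping_eqI simp: lookup_kscale lookup_single when_def)
 finally show ?thesis .
qed

lemma linear_between_coords:
 assumes "linear_between (coords J) W f" "finite J" "x : coords J"
 shows "f x = (\<Sum>j\<in>J. kscale (entry x j) (f (unitv j)))"
proof -
 have "f x = f (\<Sum>j\<in>J. kscale (entry x j) (unitv j))"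
  using coords_expand assms by metis
 also have "\<dots> = (\<Sum>j\<in>J. f (kscale (entry x j) (unitv j)))"
  by (rule linear_between_sum[OF assms(1) subspace_coords assms(2)])
   (simp add: kvec.subspace_scale subspace_coords)
 also have "\<dots> = (\<Sum>j\<in>J. kscale (entry x j) (f (unitv j)))"
  by (rule sum.cong) (simp_all add: linear_between_kscale[OF assms(1)])
 finally show ?thesis .
qed

lemma linear_between_coords_eqI:
 assumes "linear_between (coords J) W f" "linear_between (coords J) W' g" "finite J"
  and "!!j. j : J ==> f (unitv j) = g (unitv j)" "x : coords J"
 shows "f x = g x"
 unfolding linear_between_coords[OF assms(1,3,5)] linear_between_coords[OF assms(2,3,5)]
 by (rule sum.cong) (simp_all add: assms(4))

lemma mat_app_of_linear:
 assumes "linear_between (coords J) (coords I) f" "finite J" "finite I" "x : coords J"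
  and "!!i j. i : I ==> j : J ==> a i j = entry (f (unitv j)) i"
 shows "mat_app I J a x = f x"
proof (rule linear_between_coords_eqI[OF linear_between_mat_app assms(1,2) _ assms(4)])
 fix j assume j: "j : J"
 then have "f (unitv j) : coords I" using assms(1) by (simp add: linear_between_in)
 then have "entry (f (unitv j)) i = 0" if "i ~: I" for i
  using that by (simp add: coords_def)
 then show "mat_app I J a (unitv j) = f (unitv j)"
  unfolding mat_app_unitv[OF assms(2) j]
  by (intro poly_mapping_eqI) (simp add: lookup_comb[OF assms(3)] assms(5) j)
qed (rule assms(3))

section \<open>Dimensions over a finite field, obtained by counting\<close>

lemma finite_coords: "finite I ==> finite (coords I :: ('k::{field,finite}) vec set)"
 and card_coords: "finite I ==> card (coords I :: ('k::{field,finite}) vec set) = CARD('k) ^ card I"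
proof -
 assume I: "finite I"
 have *: "bij_betw (%x. restrict (entry x) I) (coords I :: 'k vec set) (I \<rightarrow>\<^sub>E UNIV)"
 proof (rule bij_betw_byWitness[where f' = "comb I"])
  show "\<forall>a\<in>coords I. comb I (restrict (entry a) I) = a"
   using I by (auto intro!: poly_mapping_eqI simp: lookup_comb coords_def)
  show "\<forall>a'\<in>I \<rightarrow>\<^sub>E UNIV. restrict (entry (comb I a')) I = a'"
   using I by (simp add: lookup_comb fun_eq_iff PiE_def extensional_def)
 qed (auto simp: I comb_in_coords)
 show "finite (coords I :: 'k vec set)"
  using bij_betw_finite[OF *] I by (simp add: finite_PiE)
 show "card (coords I :: 'k vec set) = CARD('k) ^ card I"
  using bij_betw_same_card[OF *] I by (simp add: card_PiE)
qed

lemma card_field_gt_1: "1 < CARD('k::{field,finite})"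
proof -
 have "card {0, 1 :: 'k} <= CARD('k)" by (rule card_mono) auto
 then show ?thesis by simp
qed

text \<open>A basis \<open>B\<close> identifies \<open>V\<close> with the functions from
  \<open>B\<close> to the field. As the field has more than one element, statements on dimensions
  become statements on cardinalities from here on.\<close>

lemma card_subspace:
 fixes V :: "('k::{field,finite}) vec set"
 assumes V: "kvec.subspace V" "finite V"
 shows "card V = CARD('k) ^ kvec.dim V"
proof -
 obtain B where B: "B <= V" "kvec.independent B" "V <= kvec.span B" "card B = kvec.dim V"
  using kvec.basis_exists by blast
 have fB: "finite B" using B V finite_subset by blast
 have sp: "kvec.span B = V"
  using B V by (simp add: kvec.span_minimal subset_antisym)
 have "bij_betw (%u. \<Sum>v\<in>B. kscale (u v) v) (B \<rightarrow>\<^sub>E (UNIV :: 'k set)) V"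
  unfolding bij_betw_def
 proof
  show "inj_on (%u. \<Sum>v\<in>B. kscale (u v) v) (B \<rightarrow>\<^sub>E (UNIV :: 'k set))"
  proof (rule inj_onI)
   fix u w assume u: "u : B \<rightarrow>\<^sub>E (UNIV :: 'k set)" and w: "w : B \<rightarrow>\<^sub>E (UNIV :: 'k set)"
    and eq: "(\<Sum>v\<in>B. kscale (u v) v) = (\<Sum>v\<in>B. kscale (w v) v)"
   have "(\<Sum>v\<in>B. kscale (u v - w v) v) = 0"
    using eq by (simp add: kvec.scale_left_diff_distrib sum_subtractf)
   then have "u v - w v = 0" if "v : B" for v
    using kvec.independentD[OF B(2) fB subset_refl, of "%v. u v - w v"] that by blast
   then show "u = w" using u w by (auto intro: PiE_ext)
  qed
  have "V = range (%u. \<Sum>v\<in>B. kscale (u v) v)"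
   using kvec.span_finite[OF fB] sp by simp
  also have "\<dots> = (%u. \<Sum>v\<in>B. kscale (u v) v) ` (B \<rightarrow>\<^sub>E UNIV)"
  proof (intro equalityI subsetI)
   fix x assume "x : range (%u. \<Sum>v\<in>B. kscale (u v) v)"
   then obtain u where "x = (\<Sum>v\<in>B. kscale (u v) v)" by blast
   then have "x = (\<Sum>v\<in>B. kscale (restrict u B v) v)" by simp
   then show "x : (%u. \<Sum>v\<in>B. kscale (u v) v) ` (B \<rightarrow>\<^sub>E UNIV)"
    by (intro image_eqI[of _ _ "restrict u B"]) auto
  qed auto
  finally show "(%u. \<Sum>v\<in>B. kscale (u v) v) ` (B \<rightarrow>\<^sub>E UNIV) = V" by simp
 qed
 then have "card (B \<rightarrow>\<^sub>E (UNIV :: 'k set)) = card V" by (rule bij_betw_same_card)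
 then show ?thesis using B fB by (simp add: card_PiE)
qed

lemma dim_eq_iff_card:
 fixes V W :: "('k::{field,finite}) vec set"
 assumes "kvec.subspace V" "finite V" "kvec.subspace W" "finite W"
 shows "kvec.dim V = kvec.dim W \<longleftrightarrow> card V = card W"
 using assms card_field_gt_1[where 'k='k] by (simp add: card_subspace)

lemma dim_coords: "finite I ==> kvec.dim (coords I :: ('k::{field,finite}) vec set) = card I"
 using card_subspace[OF subspace_coords finite_coords, of I, where 'k='k] card_coords[of I, where 'k='k]
  card_field_gt_1[where 'k='k]
 by simp

lemma dim_zero_space: "kvec.dim {0 :: nat \<Rightarrow>\<^sub>0 'k::{field,finite}} = 0"
 using dim_coords[of "{}"] by simp

lemma dim_eq_0_iff:
 fixes V :: "('k::{field,finite}) vec set"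
 assumes "kvec.subspace V" "finite V"
 shows "kvec.dim V = 0 \<longleftrightarrow> V = {0}"
proof
 assume "kvec.dim V = 0"
 then have "card V = 1" using card_subspace[OF assms] by simp
 then show "V = {0}" using kvec.subspace_0[OF assms(1)] card_1_singletonE by blast
qed (simp add: dim_zero_space)

text \<open>Over a finite field finite dimension is finiteness, so that no basis has to be carried
  along.\<close>

lemma fd_subspace_iff:
 fixes V :: "('k::{field,finite}) vec set"
 shows "fd_subspace V \<longleftrightarrow> kvec.subspace V & finite V"
proof
 assume "fd_subspace V"
 then obtain B where B: "finite B" "V = kvec.span B" unfolding fd_subspace_def by blast
 have "V = range (%u. \<Sum>v\<in>B. kscale (u v) v)"
  using kvec.span_finite[OF B(1)] B by simp
 also have "\<dots> <= (%u. \<Sum>v\<in>B. kscale (u v) v) ` (B \<rightarrow>\<^sub>E (UNIV :: 'k set))"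
 proof
  fix x assume "x : range (%u. \<Sum>v\<in>B. kscale (u v) v)"
  then obtain u where "x = (\<Sum>v\<in>B. kscale (u v) v)" by blast
  then have "x = (\<Sum>v\<in>B. kscale (restrict u B v) v)" by simp
  then show "x : (%u. \<Sum>v\<in>B. kscale (u v) v) ` (B \<rightarrow>\<^sub>E UNIV)"
   by (intro image_eqI[of _ _ "restrict u B"]) auto
 qed
 finally have "finite V"
  by (rule finite_subset) (simp add: finite_PiE B(1))
 then show "kvec.subspace V & finite V"
  using B by (simp add: kvec.subspace_span)
next
 assume "kvec.subspace V & finite V"
 then show "fd_subspace V" unfolding fd_subspace_def
  by (intro exI[of _ V]) (simp add: kvec.span_eq_iff[THEN iffD2])
qed

lemma dim_mono:
 fixes V W :: "('k::{field,finite}) vec set"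
 assumes "kvec.subspace V" "kvec.subspace W" "finite W" "V <= W"
 shows "kvec.dim V <= kvec.dim W"
proof -
 have "finite V" using assms finite_subset by blast
 then have "CARD('k) ^ kvec.dim V <= CARD('k) ^ kvec.dim W"
  using card_mono[OF assms(3,4)] assms by (simp add: card_subspace)
 then show ?thesis using card_field_gt_1[where 'k='k] by simp
qed

lemma dim_eq_imp_eq:
 fixes V W :: "('k::{field,finite}) vec set"
 assumes "kvec.subspace V" "kvec.subspace W" "finite W" "V <= W" "kvec.dim V = kvec.dim W"
 shows "V = W"
 using card_subset_eq[OF assms(3,4)] card_subspace[OF assms(1) finite_subset[OF assms(4,3)]]
  card_subspace[OF assms(2,3)] assms(5) by simp

definition ssum :: "('k::field) vec set => 'k vec set => 'k vec set"
 where "ssum V W = {x + y | x y. x : V & y : W}"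

lemma subspace_ssum: "kvec.subspace V ==> kvec.subspace W ==> kvec.subspace (ssum V W)"
 unfolding ssum_def by (rule kvec.subspace_sums)

lemma ssum_upper1: "kvec.subspace W ==> V <= ssum V W"
 unfolding ssum_def by clarsimp (metis add.right_neutral kvec.subspace_0)

lemma ssum_upper2: "kvec.subspace V ==> W <= ssum V W"
 unfolding ssum_def by clarsimp (metis add.left_neutral kvec.subspace_0)

lemma ssum_least: "kvec.subspace X ==> V <= X ==> W <= X ==> ssum V W <= X"
 unfolding ssum_def by (auto intro: kvec.subspace_add)

text \<open>The fibres of addition on \<open>V \<times> W\<close> are translates of
  \<open>V Int W\<close>; comparing cardinalities gives the dimension formula.\<close>

lemma dim_ssum_inter:
 fixes V W :: "('k::{field,finite}) vec set"
 assumes V: "kvec.subspace V" "finite V" and W: "kvec.subspace W" "finite W"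
 shows "kvec.dim (ssum V W) + kvec.dim (V Int W) = kvec.dim V + kvec.dim W"
proof -
 have fS: "finite (ssum V W)"
  unfolding ssum_def using finite_image_set2[of "%x. x : V" "%y. y : W" "(+)"] V W by simp
 have sI: "kvec.subspace (V Int W)" using V W by (simp add: kvec.subspace_inter)
 have fibre: "card {p : V \<times> W. fst p + snd p = z} = card (V Int W)" if "z : ssum V W" for z
 proof -
  obtain x y where xy: "x : V" "y : W" "z = x + y" using \<open>z : ssum V W\<close> unfolding ssum_def by blast
  have "bij_betw (%u. (x + u, y - u)) (V Int W) {p : V \<times> W. fst p + snd p = z}"
  proof (rule bij_betw_byWitness[where f' = "%p. fst p - x"])
   show "(%u. (x + u, y - u)) ` (V Int W) <= {p : V \<times> W. fst p + snd p = z}"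
    using xy V W by (auto simp: kvec.subspace_add kvec.subspace_diff)
   show "(%p. fst p - x) ` {p : V \<times> W. fst p + snd p = z} <= V Int W"
   proof (rule image_subsetI)
    fix p assume p: "p : {p : V \<times> W. fst p + snd p = z}"
    then have "fst p - x = y - snd p" using xy by (simp add: algebra_simps)
    then show "fst p - x : V Int W"
     using kvec.subspace_diff[OF V(1) _ xy(1), of "fst p"] kvec.subspace_diff[OF W(1) xy(2), of "snd p"] p
     by auto
   qed
   show "\<forall>a'\<in>{p : V \<times> W. fst p + snd p = z}. (x + (fst a' - x), y - (fst a' - x)) = a'"
    using xy by (auto simp: algebra_simps)
  qed auto
  then show ?thesis using bij_betw_same_card by fastforce
 qed
 have "card (V \<times> W) = (\<Sum>z\<in>ssum V W. card {p : V \<times> W. fst p + snd p = z})"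
 proof -
  have "V \<times> W = (\<Union>z\<in>ssum V W. {p : V \<times> W. fst p + snd p = z})"
   unfolding ssum_def by fastforce
  then show ?thesis
   using V W fS by (subst card_UN_disjoint[symmetric]) (auto)
 qed
 then have "card V * card W = card (ssum V W) * card (V Int W)"
  by (simp add: card_cartesian_product fibre)
 then have "CARD('k) ^ (kvec.dim (ssum V W) + kvec.dim (V Int W)) = CARD('k) ^ (kvec.dim V + kvec.dim W)"
  using V W sI fS by (simp add: card_subspace subspace_ssum power_add)
 then show ?thesis using card_field_gt_1[where 'k='k] by simp
qed

lemma linear_between_image_subspace:
 assumes f: "linear_between V W f" and V: "kvec.subspace V"
 shows "kvec.subspace (f ` V)"
 unfolding kvec.subspace_def
proof (intro conjI ballI allI)
 show "0 : f ` V" using linear_between_0[OF f(1) V(1)] kvec.subspace_0[OF V(1)] by force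
 fix x y assume "x : f ` V" "y : f ` V"
 then obtain x' y' where "x' : V" "y' : V" "x = f x'" "y = f y'" by blast
 then show "x + y : f ` V"
  using linear_between_add[OF f] kvec.subspace_add[OF V] by (intro image_eqI[of _ _ "x' + y'"]) auto
next
 fix c x assume "x : f ` V"
 then obtain x' where "x' : V" "x = f x'" by blast
 then show "kscale c x : f ` V"
  using linear_between_kscale[OF f] kvec.subspace_scale[OF V] by (intro image_eqI[of _ _ "kscale c x'"]) auto
qed

lemma dim_image_inj:
 fixes V :: "('k::{field,finite}) vec set"
 assumes f: "linear_between V W f" "inj_on f V" and V: "kvec.subspace V" "finite V"
 shows "kvec.dim (f ` V) = kvec.dim V"
proof -
 have s: "kvec.subspace (f ` V)" by (rule linear_between_image_subspace[OF f(1) V(1)])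
 have "card (f ` V) = card V" using f card_image by blast
 then show "kvec.dim (f ` V) = kvec.dim V" using s V dim_eq_iff_card by blast
qed

lemma linear_between_inj_iff:
 assumes f: "linear_between V W f" and V: "kvec.subspace V"
 shows "inj_on f V \<longleftrightarrow> (\<forall>x\<in>V. f x = 0 --> x = 0)"
proof
 assume "inj_on f V"
 then show "\<forall>x\<in>V. f x = 0 --> x = 0"
  using linear_between_0[OF f V] kvec.subspace_0[OF V] unfolding inj_on_def by metis
next
 assume *: "\<forall>x\<in>V. f x = 0 --> x = 0"
 show "inj_on f V"
 proof (rule inj_onI)
  fix x y assume "x : V" "y : V" "f x = f y"
  then have "f (x - y) = 0" "x - y : V"
   using linear_between_diff[OF f V] kvec.subspace_diff[OF V] by auto
  then show "x = y" using * by auto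
 qed
qed

lemma linear_between_inv:
 assumes f: "linear_between V W f" "bij_betw f V W" and V: "kvec.subspace V"
 shows "linear_between W V (the_inv_into V f)"
 unfolding linear_between_def
proof (intro conjI ballI allI)
 note inj = bij_betw_imp_inj_on[OF f(2)] and im = bij_betw_imp_surj_on[OF f(2)]
 show "the_inv_into V f : W \<rightarrow> V" using the_inv_into_into[OF inj _ subset_refl] im by auto
 fix x y assume "x : W" "y : W"
 then obtain x' y' where "x' : V" "y' : V" "x = f x'" "y = f y'" using im by blast
 then show "the_inv_into V f (x + y) = the_inv_into V f x + the_inv_into V f y"
  using linear_between_add[OF f(1), symmetric] kvec.subspace_add[OF V]
  by (simp add: the_inv_into_f_f[OF inj])
next
 note inj = bij_betw_imp_inj_on[OF f(2)] and im = bij_betw_imp_surj_on[OF f(2)]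
 fix c x assume "x : W"
 then obtain x' where "x' : V" "x = f x'" using im by blast
 then show "the_inv_into V f (kscale c x) = kscale c (the_inv_into V f x)"
  using linear_between_kscale[OF f(1), symmetric] kvec.subspace_scale[OF V]
  by (simp add: the_inv_into_f_f[OF inj])
qed

text \<open>The new coordinate is sent to a vector outside of the image. A kernel element with
  nonzero new coordinate would put that vector back into the image.\<close>

lemma linear_extend_one:
 fixes V :: "('k::{field,finite}) vec set"
 assumes f: "linear_between (coords A) V f" "inj_on f (coords A)" and V: "kvec.subspace V"
  and A: "finite A" "a ~: A" and v: "v : V" "v ~: f ` coords A"
 obtains g where "linear_between (coords (insert a A)) V g" "inj_on g (coords (insert a A))"
  "!!x. x : coords A ==> g x = f x"
proof
 define g where "g x = f (proj A x) + kscale (entry x a) v" for x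
 show g: "linear_between (coords (insert a A)) V g"
  unfolding linear_between_def g_def
  using f(1) V v A
  by (auto simp: proj_add proj_kscale linear_between_add linear_between_kscale linear_between_in
    lookup_add lookup_kscale kvec.scale_left_distrib kvec.scale_right_distrib add_ac
    intro!: kvec.subspace_add kvec.subspace_scale)
 show "inj_on g (coords (insert a A))"
  unfolding linear_between_inj_iff[OF g subspace_coords]
 proof (intro ballI impI)
  fix x assume x: "x : coords (insert a A)" "g x = 0"
  let ?c = "entry x a"
  have "?c = 0"
  proof (rule ccontr)
   assume c: "?c ~= 0"
   have "kscale ?c v = - f (proj A x)" using x(2) unfolding g_def by (simp add: eq_neg_iff_add_eq_0 add.commute)
   then have "kscale (inverse ?c) (kscale ?c v) = kscale (- inverse ?c) (f (proj A x))"
    by simp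
   then have "v = f (kscale (- inverse ?c) (proj A x))"
    using c A f(1) by (simp add: linear_between_kscale[OF f(1)] del: kvec.scale_minus_left)
   moreover have "kscale (- inverse ?c) (proj A x) : coords A"
    using A kvec.subspace_scale[OF subspace_coords] proj_in_coords by blast
   ultimately show False using v by blast
  qed
  then have "x : coords A" using x(1) by (auto simp: coords_def)
  moreover have "f (proj A x) = 0" using x(2) \<open>?c = 0\<close> unfolding g_def by simp
  ultimately show "x = 0"
   using f(2) proj_id[OF A(1), of x] unfolding linear_between_inj_iff[OF f(1) subspace_coords] by simp
 qed
 fix x :: "'k vec" assume "x : coords A"
 then show "g x = f x" unfolding g_def using A by (simp add: proj_id coords_lookup)
qed

text \<open>Induction on the number of missing coordinates; as long as some are missing, the image
  is too small to be \<open>V\<close>. Prescribing the map on \<open>coords A\<close> is what yields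
  frames adapted to a flag.\<close>

lemma linear_extend:
 fixes V :: "('k::{field,finite}) vec set"
 assumes V: "kvec.subspace V" "finite V" and I: "finite I" "card I = kvec.dim V"
  and f: "linear_between (coords A) V f" "inj_on f (coords A)" "A <= I"
 obtains g where "linear_between (coords I) V g" "bij_betw g (coords I) V"
  "!!x. x : coords A ==> g x = f x"
proof -
 have "\<exists>g. linear_between (coords I) V g & bij_betw g (coords I) V & (\<forall>x\<in>coords A. g x = f x)"
  using f
 proof (induction "card (I - A)" arbitrary: A f)
  case 0
  then have "I - A = {}" using I(1) by simp
  then have "A = I" using 0(4) by blast
  moreover have "f ` coords I = V"
  proof (rule card_subset_eq[OF V(2)])
   show "f ` coords I <= V" using linear_between_in[OF 0(2)] \<open>A = I\<close> by auto
   show "card (f ` coords I) = card V"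
    using 0(3) \<open>A = I\<close> I V by (simp add: card_image card_coords card_subspace)
  qed
  ultimately show ?case using 0(2,3) by (auto simp: bij_betw_def)
 next
  case (Suc n)
  have "I - A ~= {}" using Suc(2) by force
  then obtain a where a: "a : I" "a ~: A" by blast
  have fA: "finite A" using Suc.prems(3) I(1) finite_subset by blast
  have "card A < card I" using a Suc.prems(3) I(1) by (intro psubset_card_mono) auto
  then have "card (f ` coords A) < card V"
   using Suc.prems(2) fA V I card_field_gt_1[where 'k='k] by (simp add: card_image card_coords card_subspace)
  moreover have "f ` coords A <= V" using linear_between_in[OF Suc.prems(1)] by auto
  ultimately obtain v where v: "v : V" "v ~: f ` coords A"
   by (metis (no_types) nat_neq_iff subset_antisym subsetI)
  obtain g where g: "linear_between (coords (insert a A)) V g" "inj_on g (coords (insert a A))"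
   "!!x. x : coords A ==> g x = f x"
   using linear_extend_one[OF Suc.prems(1,2) V(1) fA a(2) v] by blast
  have "card (I - A - {a}) = card (I - A) - 1"
   using a by (intro card_Diff_singleton) blast
  moreover have "I - A - {a} = I - insert a A" by blast
  ultimately have n: "n = card (I - insert a A)"
   using Suc(2) by (metis diff_Suc_1)
  have "insert a A <= I" using Suc.prems(3) a by blast
  from Suc.hyps(1)[OF n g(1,2) this]
  obtain h where "linear_between (coords I) V h" "bij_betw h (coords I) V" "\<forall>x\<in>coords (insert a A). h x = g x"
   by blast
  moreover have "coords A <= (coords (insert a A) :: 'k vec set)"
   by (rule coords_mono) blast
  ultimately show ?case using g(3) by (intro exI[of _ h]) auto
 qed
 then show ?thesis using that by blast
qed

section \<open>Counting linear maps, isomorphisms and adapted frames\<close>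

text \<open>Extensional outside \<open>V\<close>, so that maps agreeing on \<open>V\<close> are
  equal and the sets can be counted.\<close>

definition Lin :: "('k::field) vec set => 'k vec set => ('k vec => 'k vec) set"
 where "Lin V W = {f : V \<rightarrow>\<^sub>E W. linear_between V W f}"

definition Iso :: "('k::field) vec set => 'k vec set => ('k vec => 'k vec) set"
 where "Iso V W = {f : Lin V W. bij_betw f V W}"

lemma LinD: "f : Lin V W ==> linear_between V W f" "f : Lin V W ==> f : extensional V"
 by (auto simp: Lin_def PiE_def)

lemma IsoD: "f : Iso V W ==> linear_between V W f" "f : Iso V W ==> f : extensional V"
  "f : Iso V W ==> bij_betw f V W"
 by (auto simp: Iso_def Lin_def PiE_def)

lemma restrict_Lin: "kvec.subspace V ==> linear_between V W f ==> restrict f V : Lin V W"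
 using linear_between_cong[of V "restrict f V" f W]
 by (auto simp: Lin_def dest: linear_between_in)

lemma restrict_Iso: "kvec.subspace V ==> linear_between V W f ==> bij_betw f V W ==> restrict f V : Iso V W"
 by (simp add: Iso_def restrict_Lin bij_betw_restrict_eq)

lemma finite_Lin: "finite V ==> finite W ==> finite (Lin V W)"
 unfolding Lin_def by (simp add: finite_PiE)

lemma finite_Iso: "finite V ==> finite W ==> finite (Iso V W)"
 unfolding Iso_def by (simp add: finite_Lin)

lemma bij_betw_filter:
 assumes "bij_betw h X Y" "!!a. a : X ==> h a : Y' \<longleftrightarrow> P a" "Y' <= Y"
 shows "bij_betw h {a : X. P a} Y'"
 using assms unfolding bij_betw_def by (auto intro: inj_on_subset)

lemma bij_betw_mat_Lin:
 fixes I J :: "nat set"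
 assumes "finite I" "finite J"
 shows "bij_betw (%a. restrict (mat_app I J (%i j. a (i, j))) (coords J))
  (I \<times> J \<rightarrow>\<^sub>E (UNIV :: 'k::field set)) (Lin (coords J) (coords I))"
proof (rule bij_betw_byWitness[where f' = "%f. restrict (%(i, j). entry (f (unitv j)) i) (I \<times> J)"])
 show "(%a. restrict (mat_app I J (%i j. a (i, j))) (coords J)) ` (I \<times> J \<rightarrow>\<^sub>E (UNIV :: 'k set))
   <= Lin (coords J) (coords I)"
  using restrict_Lin[OF subspace_coords linear_between_mat_app[OF assms(1)]] by blast
 show "\<forall>f\<in>Lin (coords J) (coords I). restrict (mat_app I J (%i j. restrict (%(i, j). entry (f (unitv j)) i) (I \<times> J) (i, j))) (coords J) = (f :: 'k vec => _)"
 proof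
  fix f :: "'k vec => 'k vec" assume f: "f : Lin (coords J) (coords I)"
  show "restrict (mat_app I J (%i j. restrict (%(i, j). entry (f (unitv j)) i) (I \<times> J) (i, j))) (coords J) = f"
  proof (rule extensionalityI[OF restrict_extensional LinD(2)[OF f]])
   fix x :: "'k vec" assume x: "x : coords J"
   have "mat_app I J (%i j. restrict (%(i, j). entry (f (unitv j)) i) (I \<times> J) (i, j)) x = f x"
    by (rule mat_app_of_linear[OF LinD(1)[OF f] assms(2,1) x]) simp
   then show "restrict (mat_app I J (%i j. restrict (%(i, j). entry (f (unitv j)) i) (I \<times> J) (i, j))) (coords J) x = f x"
    using x by simp
  qed
 qed
 show "\<forall>a\<in>I \<times> J \<rightarrow>\<^sub>E (UNIV :: 'k set).
   restrict (%(i, j). entry (restrict (mat_app I J (%i j. a (i, j))) (coords J) (unitv j)) i) (I \<times> J) = a"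
  using assms by (auto intro!: extensionalityI[of _ "I \<times> J"] simp: mat_app_unitv lookup_comb PiE_def)
 show "(%f. restrict (%(i, j). entry (f (unitv j)) i) (I \<times> J)) ` Lin (coords J) (coords I)
   <= I \<times> J \<rightarrow>\<^sub>E (UNIV :: 'k set)"
  by (intro image_subsetI restrict_PiE_iff[THEN iffD2]) simp
qed

lemma card_Lin:
 assumes "finite I" "finite J"
 shows "card (Lin (coords J) (coords I) :: (('k::{field,finite}) vec => _) set) = CARD('k) ^ (card I * card J)"
 using bij_betw_same_card[OF bij_betw_mat_Lin[OF assms, where 'k='k]] assms
 by (simp add: card_PiE card_cartesian_product)

lemma bij_betw_linear_coordsI:
 fixes f :: "('k::{field,finite}) vec => 'k vec"
 assumes "finite I" "finite J" "card I = card J" "linear_between (coords J) (coords I) f"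
  and "inj_on f (coords J)"
 shows "bij_betw f (coords J) (coords I)"
proof -
 have "f ` coords J = coords I"
 proof (rule card_subset_eq)
  show "f ` coords J <= coords I" using linear_between_in[OF assms(4)] by auto
  show "card (f ` coords J) = card (coords I :: 'k vec set)"
   using assms by (simp add: card_image card_coords)
 qed (use assms(1) finite_coords in blast)
 then show ?thesis using assms(5) by (simp add: bij_betw_def)
qed

text \<open>For square matrices a trivial kernel already means bijectivity. The left-hand side is
  the form in which nondegenerate pairings will occur.\<close>

lemma card_nondegenerate_matrices:
 assumes "finite I" "finite J" "card I = card J"
 shows "card {a : I \<times> J \<rightarrow>\<^sub>E (UNIV :: 'k::{field,finite} set).
   \<forall>x\<in>coords J. mat_app I J (%i j. a (i, j)) x = 0 --> x = 0}
  = card (Iso (coords J) (coords I) :: ('k vec => _) set)"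
proof -
 let ?h = "%a :: nat \<times> nat => 'k. restrict (mat_app I J (%i j. a (i, j))) (coords J)"
 have "?h a : Iso (coords J) (coords I) \<longleftrightarrow> (\<forall>x\<in>coords J. mat_app I J (%i j. a (i, j)) x = 0 --> x = 0)"
  if "a : I \<times> J \<rightarrow>\<^sub>E UNIV" for a
 proof -
  have l: "linear_between (coords J) (coords I) (mat_app I J (%i j. a (i, j)))"
   by (rule linear_between_mat_app[OF assms(1)])
  have "?h a : Iso (coords J) (coords I) \<longleftrightarrow> bij_betw (mat_app I J (%i j. a (i, j))) (coords J) (coords I)"
   using restrict_Lin[OF subspace_coords l] by (simp add: Iso_def bij_betw_restrict_eq)
  also have "\<dots> \<longleftrightarrow> inj_on (mat_app I J (%i j. a (i, j))) (coords J)"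
   using bij_betw_linear_coordsI[OF assms l] bij_betw_imp_inj_on by blast
  finally show ?thesis using linear_between_inj_iff[OF l subspace_coords] by simp
 qed
 then have "bij_betw ?h {a : I \<times> J \<rightarrow>\<^sub>E UNIV. \<forall>x\<in>coords J. mat_app I J (%i j. a (i, j)) x = 0 --> x = 0}
   (Iso (coords J) (coords I))"
  by (intro bij_betw_filter[OF bij_betw_mat_Lin[OF assms(1,2)]]) (auto simp: Iso_def)
 then show ?thesis by (rule bij_betw_same_card)
qed

lemma bij_betw_Iso_comp:
 assumes g: "linear_between V V' g" "bij_betw g V V'" and V: "kvec.subspace X" "kvec.subspace V"
 shows "bij_betw (%f. restrict (%x. g (f x)) X) (Iso X V) (Iso X V')"
proof (rule bij_betw_byWitness[where f' = "%f. restrict (%x. the_inv_into V g (f x)) X"])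
 note inj = bij_betw_imp_inj_on[OF g(2)] and im = bij_betw_imp_surj_on[OF g(2)]
 have in1: "f x : V" if "f : Iso X V" "x : X" for f x V
  using that IsoD(1) linear_between_in by blast
 show "\<forall>f\<in>Iso X V. restrict (%x. the_inv_into V g (restrict (%x. g (f x)) X x)) X = f"
 proof
  fix f assume f: "f : Iso X V"
  show "restrict (%x. the_inv_into V g (restrict (%x. g (f x)) X x)) X = f"
   by (rule extensionalityI[OF restrict_extensional IsoD(2)[OF f]])
    (simp add: the_inv_into_f_f[OF inj] in1[OF f])
 qed
 show "\<forall>f\<in>Iso X V'. restrict (%x. g (restrict (%x. the_inv_into V g (f x)) X x)) X = f"
 proof
  fix f assume f: "f : Iso X V'"
  show "restrict (%x. g (restrict (%x. the_inv_into V g (f x)) X x)) X = f"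
   by (rule extensionalityI[OF restrict_extensional IsoD(2)[OF f]])
    (simp add: f_the_inv_into_f_bij_betw[OF g(2)] in1[OF f])
 qed
 show "(%f. restrict (%x. g (f x)) X) ` Iso X V <= Iso X V'"
 proof (rule image_subsetI)
  fix f assume f: "f : Iso X V"
  have "bij_betw (g \<circ> f) X V'" using bij_betw_trans[OF IsoD(3)[OF f] g(2)] .
  then show "restrict (%x. g (f x)) X : Iso X V'"
   using restrict_Iso[OF V(1) linear_between_comp[OF IsoD(1)[OF f] g(1)]] by (simp add: comp_def)
 qed
 show "(%f. restrict (%x. the_inv_into V g (f x)) X) ` Iso X V' <= Iso X V"
 proof (rule image_subsetI)
  fix f assume f: "f : Iso X V'"
  have "bij_betw (the_inv_into V g \<circ> f) X V"
   using bij_betw_trans[OF IsoD(3)[OF f] bij_betw_the_inv_into[OF g(2)]] .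
  then show "restrict (%x. the_inv_into V g (f x)) X : Iso X V"
   using restrict_Iso[OF V(1) linear_between_comp[OF IsoD(1)[OF f] linear_between_inv[OF g V(2)]]]
   by (simp add: comp_def)
 qed
qed

lemma bij_betw_Iso_comp_left:
 assumes h: "linear_between X' X h" "bij_betw h X' X" and V: "kvec.subspace X" "kvec.subspace X'"
 shows "bij_betw (%f. restrict (%x. f (h x)) X') (Iso X V) (Iso X' V)"
proof (rule bij_betw_byWitness[where f' = "%f. restrict (%x. f (the_inv_into X' h x)) X"])
 note inj = bij_betw_imp_inj_on[OF h(2)] and im = bij_betw_imp_surj_on[OF h(2)]
 have hin: "h x : X" if "x : X'" for x using that im by blast
 have hin': "the_inv_into X' h x : X'" if "x : X" for x
  using that the_inv_into_into[OF inj _ subset_refl] im by blast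
 show "\<forall>f\<in>Iso X V. restrict (%x. restrict (%x. f (h x)) X' (the_inv_into X' h x)) X = f"
 proof
  fix f assume f: "f : Iso X V"
  show "restrict (%x. restrict (%x. f (h x)) X' (the_inv_into X' h x)) X = f"
   by (rule extensionalityI[OF restrict_extensional IsoD(2)[OF f]])
    (simp add: f_the_inv_into_f_bij_betw[OF h(2)] hin')
 qed
 show "\<forall>f\<in>Iso X' V. restrict (%x. restrict (%x. f (the_inv_into X' h x)) X (h x)) X' = f"
 proof
  fix f assume f: "f : Iso X' V"
  show "restrict (%x. restrict (%x. f (the_inv_into X' h x)) X (h x)) X' = f"
   by (rule extensionalityI[OF restrict_extensional IsoD(2)[OF f]])
    (simp add: the_inv_into_f_f[OF inj] hin)
 qed
 show "(%f. restrict (%x. f (h x)) X') ` Iso X V <= Iso X' V"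
 proof (rule image_subsetI)
  fix f assume f: "f : Iso X V"
  have "bij_betw (f \<circ> h) X' V" using bij_betw_trans[OF h(2) IsoD(3)[OF f]] .
  then show "restrict (%x. f (h x)) X' : Iso X' V"
   using restrict_Iso[OF V(2) linear_between_comp[OF h(1) IsoD(1)[OF f]]] by (simp add: comp_def)
 qed
 show "(%f. restrict (%x. f (the_inv_into X' h x)) X) ` Iso X' V <= Iso X V"
 proof (rule image_subsetI)
  fix f assume f: "f : Iso X' V"
  have "bij_betw (f \<circ> the_inv_into X' h) X V"
   using bij_betw_trans[OF bij_betw_the_inv_into[OF h(2)] IsoD(3)[OF f]] .
  then show "restrict (%x. f (the_inv_into X' h x)) X : Iso X V"
   using restrict_Iso[OF V(1) linear_between_comp[OF linear_between_inv[OF h V(2)] IsoD(1)[OF f]]]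
   by (simp add: comp_def)
 qed
qed

lemma exists_frame:
 fixes V :: "('k::{field,finite}) vec set"
 assumes "kvec.subspace V" "finite V" "finite I" "card I = kvec.dim V"
 obtains g where "linear_between (coords I) V g" "bij_betw g (coords I) V"
proof -
 have "linear_between (coords {}) V (%x. x)" "inj_on (%x. x) (coords {} :: 'k vec set)"
  using kvec.subspace_0[OF assms(1)] by (auto simp: linear_between_def)
 then show ?thesis using linear_extend[OF assms _ _ empty_subsetI] that by metis
qed

text \<open>The order of the general linear group of degree \<open>n\<close>. It cancels from all
  mass formulas, so that of its values only positivity and the value 1 at 0 are ever used.\<close>

definition gl :: "'k::{field,finite} itself => nat => nat"
 where "gl K n = card (Iso (coords {..<n}) (coords {..<n} :: 'k vec set))"

lemma card_Iso:
 fixes V :: "('k::{field,finite}) vec set"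
 assumes V: "kvec.subspace V" "finite V" and W: "kvec.subspace W" "finite W" "kvec.dim W = kvec.dim V"
 shows "card (Iso V W) = gl TYPE('k) (kvec.dim V)"
proof -
 let ?n = "kvec.dim V"
 obtain g where g: "linear_between (coords {..<?n}) V g" "bij_betw g (coords {..<?n}) V"
  using exists_frame[OF V, of "{..<?n}"] by auto
 obtain h where h: "linear_between (coords {..<?n}) W h" "bij_betw h (coords {..<?n}) W"
  using exists_frame[OF W(1,2), of "{..<?n}"] W(3) by auto
 show ?thesis
  unfolding gl_def
  using bij_betw_same_card[OF bij_betw_Iso_comp[OF h subspace_coords subspace_coords, of "{..<?n}"]]
   bij_betw_same_card[OF bij_betw_Iso_comp_left[OF g V(1) subspace_coords, of W]] by simp
qed

lemma gl_pos: "0 < gl TYPE('k::{field,finite}) n"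
proof -
 have "restrict (%x. x) (coords {..<n}) : Iso (coords {..<n}) (coords {..<n} :: 'k vec set)"
  by (rule restrict_Iso[OF subspace_coords]) (auto simp: linear_between_def bij_betw_def)
 then show ?thesis
  unfolding gl_def using finite_Iso[OF finite_coords finite_coords]
  by (metis card_gt_0_iff empty_iff finite_lessThan)
qed

lemma card_Iso_coords:
 "finite I ==> finite J ==> card I = card J ==>
  card (Iso (coords J) (coords I) :: (('k::{field,finite}) vec => _) set) = gl TYPE('k) (card I)"
 using card_Iso[OF subspace_coords finite_coords subspace_coords finite_coords, of J I]
 by (simp add: dim_coords)

text \<open>Block triangular shape: \<open>f\<close> amounts to its restriction to
  \<open>coords A\<close>, an isomorphism induced on the complement \<open>coords B\<close>, and an
  arbitrary map from \<open>coords B\<close> to \<open>coords A\<close>. Allowing any set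
  \<open>Z\<close> of restrictions makes the count iterable along longer flags.\<close>

lemma card_parabolic:
 fixes Z :: "(('k::{field,finite}) vec => 'k vec) set"
 assumes A: "finite A" and B: "finite B" and AB: "A Int B = {}" and Z: "Z <= Iso (coords A) (coords A)"
 shows "card {f : Iso (coords (A Un B)) (coords (A Un B)). restrict f (coords A) : Z}
  = card Z * gl TYPE('k) (card B) * CARD('k) ^ (card A * card B)"
proof -
 let ?I = "A Un B"
 let ?F = "%f :: 'k vec => 'k vec. (restrict f (coords A),
   restrict (%x. proj B (f x)) (coords B), restrict (%x. proj A (f x)) (coords B))"
 let ?G = "%(z, g, h). restrict (%x :: nat \<Rightarrow>\<^sub>0 'k. z (proj A x) + (g (proj B x) + (h (proj B x) :: nat \<Rightarrow>\<^sub>0 'k))) (coords ?I)"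
 let ?T = "Z \<times> (Iso (coords B) (coords B) \<times> (Lin (coords B) (coords A) :: ('k vec => _) set))
  :: (('k vec => 'k vec) \<times> ('k vec => 'k vec) \<times> _) set"
 let ?S = "{f : Iso (coords ?I) (coords ?I). restrict f (coords A) : Z}"
 have I: "finite ?I" using A B by simp
 have Ac: "coords A <= (coords ?I :: 'k vec set)" and Bc: "coords B <= (coords ?I :: 'k vec set)"
  by (rule coords_mono; blast)+
 have BA: "B Int A = {}" using AB by blast
 have lin: "linear_between (coords ?I) (coords ?I) (%x. z (proj A x) + (g (proj B x) + h (proj B x)))"
  if z: "linear_between (coords A) (coords A) z" and g: "linear_between (coords B) (coords B) g"
   and h: "linear_between (coords B) (coords A) h" for z g h :: "'k vec => 'k vec"
 proof -
  have "z (proj A x) : coords ?I" "g (proj B x) : coords ?I" "h (proj B x) : coords ?I" for x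
   using linear_between_in[OF z] linear_between_in[OF g] linear_between_in[OF h] A B Ac Bc
   by (auto simp: subset_iff)
  then have "(%x. z (proj A x) + (g (proj B x) + h (proj B x))) : coords ?I \<rightarrow> coords ?I"
   by (auto intro!: kvec.subspace_add[OF subspace_coords])
  then show ?thesis
   unfolding linear_between_def
   using A B linear_between_add[OF z] linear_between_add[OF g] linear_between_add[OF h]
    linear_between_kscale[OF z] linear_between_kscale[OF g] linear_between_kscale[OF h]
   by (simp add: proj_add proj_kscale kvec.scale_right_distrib add_ac)
 qed
 have "bij_betw ?F ?S ?T"
 proof (rule bij_betw_byWitness[where f' = ?G])
  show "\<forall>f\<in>?S. ?G (?F f) = f"
  proof
   fix f assume f: "f : ?S"
   then have fI: "f : Iso (coords ?I) (coords ?I)" by simp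
   note lf = IsoD(1)[OF fI]
   show "?G (?F f) = f"
   proof (rule extensionalityI[OF _ IsoD(2)[OF fI]])
    fix x :: "'k vec" assume x: "x : coords ?I"
    have pA: "proj A x : coords A" "proj A x : coords ?I" and pB: "proj B x : coords B" "proj B x : coords ?I"
     using A B Ac Bc proj_in_coords by blast+
    have "proj A (f (proj B x)) + proj B (f (proj B x)) = f (proj B x)"
     using proj_decomp[OF A B AB] linear_between_in[OF lf pB(2)] by blast
    moreover have "f (proj A x) + f (proj B x) = f x"
     using linear_between_add[OF lf pA(2) pB(2)] proj_decomp[OF A B AB x] by simp
    ultimately show "?G (?F f) x = f x"
     using pA pB x by (simp add: add.commute)
   qed simp
  qed
  show "\<forall>p\<in>?T. ?F (?G p) = p"
  proof
   fix p assume "p : ?T"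
   then obtain z g h where p: "p = (z, g, h)" and z: "z : Iso (coords A) (coords A)"
    and g: "g : Iso (coords B) (coords B)" and h: "h : Lin (coords B) (coords A)"
    using Z by blast
   have z0: "z 0 = 0" "g 0 = 0" "h 0 = 0"
    using linear_between_0[OF IsoD(1)[OF z] subspace_coords] linear_between_0[OF IsoD(1)[OF g] subspace_coords]
     linear_between_0[OF LinD(1)[OF h] subspace_coords] by auto
   have 1: "?G p x = z x" if x: "x : coords A" for x
    using x subsetD[OF Ac x] proj_id[OF A x] proj_disjoint[OF B x BA] by (simp add: p z0)
   have 2: "?G p x = g x + h x" if x: "x : coords B" for x
    using x subsetD[OF Bc x] proj_id[OF B x] proj_disjoint[OF A x AB] by (simp add: p z0)
   have e1: "restrict (?G p) (coords A) = z"
    by (rule extensionalityI[OF restrict_extensional IsoD(2)[OF z]]) (simp add: 1)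
   have e2: "restrict (%x. proj B (?G p x)) (coords B) = g"
   proof (rule extensionalityI[OF restrict_extensional IsoD(2)[OF g]])
    fix x :: "'k vec" assume x: "x : coords B"
    then show "restrict (%x. proj B (?G p x)) (coords B) x = g x"
     using 2[OF x] proj_id[OF B linear_between_in[OF IsoD(1)[OF g] x]]
      proj_disjoint[OF B linear_between_in[OF LinD(1)[OF h] x] BA] B by (simp add: proj_add)
   qed
   have e3: "restrict (%x. proj A (?G p x)) (coords B) = h"
   proof (rule extensionalityI[OF restrict_extensional LinD(2)[OF h]])
    fix x :: "'k vec" assume x: "x : coords B"
    then show "restrict (%x. proj A (?G p x)) (coords B) x = h x"
     using 2[OF x] proj_id[OF A linear_between_in[OF LinD(1)[OF h] x]]
      proj_disjoint[OF A linear_between_in[OF IsoD(1)[OF g] x] AB] A by (simp add: proj_add)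
   qed
   show "?F (?G p) = p" using e1 e2 e3 by (simp only: p)
  qed
  show "?F ` ?S <= ?T"
  proof (rule image_subsetI)
   fix f assume f: "f : ?S"
   then have fI: "f : Iso (coords ?I) (coords ?I)" and fZ: "restrict f (coords A) : Z" by simp_all
   note lf = IsoD(1)[OF fI]
   have fA: "f ` coords A = coords A"
    using IsoD(3) Z fZ by (metis bij_betw_imp_surj_on bij_betw_restrict_eq subsetD)
   have lB: "linear_between (coords B) (coords ?I) f"
    by (rule linear_between_mono[OF lf Bc]) (use linear_between_in[OF lf] Bc in blast)
   have l2: "linear_between (coords B) (coords B) (%x. proj B (f x))"
    by (rule linear_between_comp[OF lB linear_between_proj[OF B]])
   \<comment> \<open>If \<open>f x\<close> has no component in \<open>coords B\<close>, it lies in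
     \<open>coords A\<close>, which is already the image of \<open>coords A\<close>; so
     \<open>x\<close> lies in both coordinate spaces.\<close>
   have "inj_on (%x. proj B (f x)) (coords B)"
    unfolding linear_between_inj_iff[OF l2 subspace_coords]
   proof (intro ballI impI)
    fix x assume x: "x : coords B" "proj B (f x) = 0"
    then have "f x : coords A"
     using proj_eq_0_iff[OF A B AB] linear_between_in[OF lB] by blast
    then obtain y where y: "y : coords A" "f y = f x" using fA by (metis imageE)
    then have "y = x"
     using bij_betw_imp_inj_on[OF IsoD(3)[OF fI]] x(1) Ac Bc by (auto dest: inj_onD)
    then show "x = 0" using x y proj_id[OF A y(1)] proj_disjoint[OF A x(1) AB] by simp
   qed
   then have "restrict (%x. proj B (f x)) (coords B) : Iso (coords B) (coords B)"
    using bij_betw_linear_coordsI[OF B B refl l2] l2 by (simp add: restrict_Iso subspace_coords)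
   moreover have "restrict (%x. proj A (f x)) (coords B) : Lin (coords B) (coords A)"
    by (rule restrict_Lin[OF subspace_coords linear_between_comp[OF lB linear_between_proj[OF A]]])
   ultimately show "?F f : ?T"
    using fZ by simp
  qed
  show "?G ` ?T <= ?S"
  proof (rule image_subsetI)
   fix p assume "p : ?T"
   then obtain z g h where p: "p = (z, g, h)" and zZ: "z : Z" and z: "z : Iso (coords A) (coords A)"
    and g: "g : Iso (coords B) (coords B)" and h: "h : Lin (coords B) (coords A)"
    using Z by blast
   let ?f = "%x. z (proj A x) + (g (proj B x) + h (proj B x))"
   have z0: "z 0 = 0" "g 0 = 0" "h 0 = 0"
    using linear_between_0[OF IsoD(1)[OF z] subspace_coords] linear_between_0[OF IsoD(1)[OF g] subspace_coords]
     linear_between_0[OF LinD(1)[OF h] subspace_coords] by auto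
   have l: "linear_between (coords ?I) (coords ?I) ?f"
    by (rule lin[OF IsoD(1)[OF z] IsoD(1)[OF g] LinD(1)[OF h]])
   have "inj_on ?f (coords ?I)"
    unfolding linear_between_inj_iff[OF l subspace_coords]
   proof (intro ballI impI)
    fix x assume x: "x : coords ?I" "?f x = 0"
    have m: "z (proj A x) : coords A" "g (proj B x) : coords B" "h (proj B x) : coords A"
     using linear_between_in[OF IsoD(1)[OF z]] linear_between_in[OF IsoD(1)[OF g]]
      linear_between_in[OF LinD(1)[OF h]] A B by simp_all
    have "proj B (?f x) = g (proj B x)"
     using proj_id[OF B m(2)] proj_disjoint[OF B m(1) BA] proj_disjoint[OF B m(3) BA] B by (simp add: proj_add)
    then have "g (proj B x) = 0" using x(2) B by simp
    then have pB: "proj B x = 0"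
     using linear_between_inj_iff[OF IsoD(1)[OF g] subspace_coords] bij_betw_imp_inj_on[OF IsoD(3)[OF g]]
      proj_in_coords[OF B] by blast
    then have "z (proj A x) = 0" using x(2) z0 by simp
    then have "proj A x = 0"
     using linear_between_inj_iff[OF IsoD(1)[OF z] subspace_coords] bij_betw_imp_inj_on[OF IsoD(3)[OF z]]
      proj_in_coords[OF A] by blast
    then show "x = 0" using pB proj_decomp[OF A B AB x(1)] by simp
   qed
   then have "restrict ?f (coords ?I) : Iso (coords ?I) (coords ?I)"
    using bij_betw_linear_coordsI[OF I I refl l] l by (simp add: restrict_Iso subspace_coords)
   moreover have "restrict (restrict ?f (coords ?I)) (coords A) = z"
   proof (rule extensionalityI[OF restrict_extensional IsoD(2)[OF z]])
    fix x :: "'k vec" assume x: "x : coords A"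
    then show "restrict (restrict ?f (coords ?I)) (coords A) x = z x"
     using subsetD[OF Ac x] proj_id[OF A x] proj_disjoint[OF B x BA] by (simp add: z0)
   qed
   ultimately show "?G p : ?S" using zZ by (simp add: p)
  qed
 qed
 then have "card ?S = card Z * (card (Iso (coords B) (coords B) :: ('k vec => _) set) * card (Lin (coords B) (coords A) :: ('k vec => _) set))"
  by (simp add: bij_betw_same_card card_cartesian_product)
 then show ?thesis by (simp add: card_Iso_coords card_Lin A B mult.assoc)
qed

lemma restrict_Iso_iff:
 assumes f: "f : Iso V V" and U: "kvec.subspace U" "U <= V"
 shows "restrict f U : Iso U U \<longleftrightarrow> f ` U = U"
proof
 assume "restrict f U : Iso U U"
 then show "f ` U = U"
  using bij_betw_imp_surj_on[OF IsoD(3)] by fastforce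
next
 assume fU: "f ` U = U"
 have "linear_between U U f" by (rule linear_between_mono[OF IsoD(1)[OF f] U(2)]) (simp add: fU)
 moreover have "bij_betw f U U"
  using IsoD(3)[OF f] fU U(2) unfolding bij_betw_def by (auto intro: inj_on_subset)
 ultimately show "restrict f U : Iso U U" by (rule restrict_Iso[OF U(1)])
qed

text \<open>Two parabolic counts, nested: the isomorphisms of \<open>coords (A Un B)\<close> that
  preserve \<open>coords A\<close> serve as the set \<open>Z\<close> of the outer count.\<close>

lemma card_flag_stabilizer:
 assumes "finite A" "finite B" "finite C" "A Int B = {}" "(A Un B) Int C = {}"
 shows "card {f : Iso (coords (A Un B Un C)) (coords (A Un B Un C)).
   f ` coords A = coords A & f ` coords (A Un B) = (coords (A Un B) :: ('k::{field,finite}) vec set)}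
  = gl TYPE('k) (card A) * gl TYPE('k) (card B) * gl TYPE('k) (card C) *
   CARD('k) ^ (card A * card B + card A * card C + card B * card C)"
proof -
 let ?I = "A Un B Un C"
 have sub: "coords A <= (coords (A Un B) :: 'k vec set)" "coords (A Un B) <= (coords ?I :: 'k vec set)"
  by (rule coords_mono; blast)+
 define Z where "Z = {z : Iso (coords (A Un B)) (coords (A Un B) :: 'k vec set).
  restrict z (coords A) : Iso (coords A) (coords A)}"
 have "f ` coords A = coords A & f ` coords (A Un B) = coords (A Un B) \<longleftrightarrow> restrict f (coords (A Un B)) : Z"
  if f: "f : Iso (coords ?I) (coords ?I)" for f :: "'k vec => _"
 proof -
  have 1: "restrict f (coords (A Un B)) : Iso (coords (A Un B)) (coords (A Un B)) \<longleftrightarrow> f ` coords (A Un B) = coords (A Un B)"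
   by (rule restrict_Iso_iff[OF f subspace_coords sub(2)])
  have 2: "restrict f (coords A) : Iso (coords A) (coords A) \<longleftrightarrow> f ` coords A = coords A"
   using restrict_Iso_iff[OF f subspace_coords] sub by blast
  have 3: "restrict (restrict f (coords (A Un B))) (coords A) = restrict f (coords A)"
   using sub(1) by (auto simp: restrict_def fun_eq_iff)
  show ?thesis unfolding Z_def using 1 2 3 by auto
 qed
 then have "{f : Iso (coords ?I) (coords ?I). f ` coords A = coords A & f ` coords (A Un B) = (coords (A Un B) :: 'k vec set)}
  = {f : Iso (coords ?I) (coords ?I). restrict f (coords (A Un B)) : Z}" by blast
 also have "card \<dots> = card Z * gl TYPE('k) (card C) * CARD('k) ^ (card (A Un B) * card C)"
  by (rule card_parabolic) (use assms Z_def in auto)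
 also have "card Z = card (Iso (coords A) (coords A :: 'k vec set)) * gl TYPE('k) (card B) * CARD('k) ^ (card A * card B)"
  unfolding Z_def by (rule card_parabolic) (use assms in auto)
 finally show ?thesis
  using assms by (simp add: card_Un_disjoint card_Iso_coords power_add algebra_simps)
qed

text \<open>Adapted frames form a torsor under the stabiliser of the standard flag: one adapted
  frame \<open>g\<close> arises by extending twice, and composition with \<open>g\<close> is a
  bijection.\<close>

lemma card_flag_frames:
 fixes V :: "('k::{field,finite}) vec set"
 assumes fin: "finite A" "finite B" "finite C" "A Int B = {}" "(A Un B) Int C = {}"
  and V: "kvec.subspace V" "finite V" "kvec.subspace W" "kvec.subspace U" "U <= W" "W <= V"
  and dim: "kvec.dim U = card A" "kvec.dim W = card (A Un B)" "kvec.dim V = card (A Un B Un C)"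
 shows "card {f : Iso (coords (A Un B Un C)) V. f ` coords A = U & f ` coords (A Un B) = W}
  = gl TYPE('k) (card A) * gl TYPE('k) (card B) * gl TYPE('k) (card C) *
   CARD('k) ^ (card A * card B + card A * card C + card B * card C)"
proof -
 let ?I = "A Un B Un C"
 have sub: "coords A <= (coords (A Un B) :: 'k vec set)" "coords (A Un B) <= (coords ?I :: 'k vec set)"
  by (rule coords_mono; blast)+
 have fW: "finite W" by (rule finite_subset[OF V(6,2)])
 have fU: "finite U" by (rule finite_subset[OF V(5) fW])
 obtain f1 where f1: "linear_between (coords A) U f1" "bij_betw f1 (coords A) U"
  using exists_frame[OF V(4) fU fin(1)] dim by metis
 have "linear_between (coords A) W f1"
  by (rule linear_between_mono[OF f1(1) subset_refl]) (use f1 V bij_betw_imp_surj_on in blast)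
 then obtain f2 where f2: "linear_between (coords (A Un B)) W f2" "bij_betw f2 (coords (A Un B)) W"
   "!!x. x : coords A ==> f2 x = f1 x"
  using linear_extend[OF V(3) fW _ _ _ bij_betw_imp_inj_on[OF f1(2)], of "A Un B"] fin dim by auto
 have "linear_between (coords (A Un B)) V f2"
  by (rule linear_between_mono[OF f2(1) subset_refl]) (use f2 V bij_betw_imp_surj_on in blast)
 then obtain g where g: "linear_between (coords ?I) V g" "bij_betw g (coords ?I) V"
   "!!x. x : coords (A Un B) ==> g x = f2 x"
  using linear_extend[OF V(1,2) _ _ _ bij_betw_imp_inj_on[OF f2(2)], of ?I] fin dim by auto
 have gW: "g ` coords (A Un B) = W"
  using g(3) bij_betw_imp_surj_on[OF f2(2)] by simp
 have gU: "g ` coords A = U"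
 proof -
  have "g x = f1 x" if "x : coords A" for x
   using g(3)[of x] f2(3)[OF that] subsetD[OF sub(1) that] by simp
  then show ?thesis using bij_betw_imp_surj_on[OF f1(2)] by simp
 qed
 have subA: "coords A <= (coords ?I :: 'k vec set)" using sub by simp
 note injg = bij_betw_imp_inj_on[OF g(2)]
 have "bij_betw (%f. restrict (%x. g (f x)) (coords ?I))
  {f : Iso (coords ?I) (coords ?I). f ` coords A = coords A & f ` coords (A Un B) = coords (A Un B)}
  {f : Iso (coords ?I) V. f ` coords A = U & f ` coords (A Un B) = W}"
 proof (rule bij_betw_filter[OF bij_betw_Iso_comp[OF g(1,2) subspace_coords subspace_coords]])
  fix f assume f: "f : Iso (coords ?I) (coords ?I :: 'k vec set)"
  have fS: "f ` S <= coords ?I" if "S <= coords ?I" for S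
   using that linear_between_in[OF IsoD(1)[OF f]] by blast
  have *: "restrict (%x. g (f x)) (coords ?I) ` S = g ` T \<longleftrightarrow> f ` S = T"
   if "S <= coords ?I" "T <= coords ?I" for S T
  proof -
   have "restrict (%x. g (f x)) (coords ?I) ` S = g ` (f ` S)"
    unfolding image_image using that(1) by (intro image_cong) auto
   then show ?thesis using inj_on_image_eq_iff[OF injg fS[OF that(1)] that(2)] by simp
  qed
  show "restrict (%x. g (f x)) (coords ?I) : {f : Iso (coords ?I) V. f ` coords A = U & f ` coords (A Un B) = W}
   \<longleftrightarrow> f ` coords A = coords A & f ` coords (A Un B) = coords (A Un B)"
   using *[OF subA subA] *[OF sub(2) sub(2)]
    bij_betwE[OF bij_betw_Iso_comp[OF g(1,2) subspace_coords[of ?I] subspace_coords[of ?I]]] f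
   unfolding gU gW by simp
 qed auto
 from bij_betw_same_card[OF this] show ?thesis
  unfolding card_flag_stabilizer[OF fin, where 'k='k] by (rule sym)
qed

section \<open>Maximisers of additive functions on modular lattices\<close>

text \<open>An abstraction of the subrepresentations of a fixed representation. The laws for meets
  do not ask for membership in \<open>L\<close>, because intersections behave well for all families,
  whereas sums need subspaces.\<close>

locale modular_lattice =
 fixes L :: "'x::order set" and join meet :: "'x => 'x => 'x" and bt tp :: 'x
 assumes finite_L: "finite L"
  and join_in: "A : L ==> B : L ==> join A B : L"
  and meet_in: "A : L ==> B : L ==> meet A B : L"
  and join_ge1: "A : L ==> B : L ==> A <= join A B"
  and join_ge2: "A : L ==> B : L ==> B <= join A B"
  and join_least: "A : L ==> B : L ==> C : L ==> A <= C ==> B <= C ==> join A B <= C"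
  and meet_le1: "meet A B <= A"
  and meet_le2: "meet A B <= B"
  and meet_greatest: "C <= A ==> C <= B ==> C <= meet A B"
  and bt_in: "bt : L" and bt_le: "A : L ==> bt <= A"
  and tp_in: "tp : L" and tp_ge: "A : L ==> A <= tp"
begin

definition modular :: "('x => rat) => bool"
 where "modular ph \<longleftrightarrow> (\<forall>A\<in>L. \<forall>B\<in>L. ph (join A B) + ph (meet A B) = ph A + ph B)"

definition smallest_max :: "('x => rat) => 'x => bool"
 where "smallest_max ph U \<longleftrightarrow> U : L & (\<forall>V\<in>L. ph V <= ph U & (ph V = ph U --> U <= V))"

definition largest_max :: "('x => rat) => 'x => bool"
 where "largest_max ph U \<longleftrightarrow> U : L & (\<forall>V\<in>L. ph V <= ph U & (ph V = ph U --> V <= U))"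

lemma modularD: "modular ph ==> A : L ==> B : L ==> ph (join A B) + ph (meet A B) = ph A + ph B"
 by (simp add: modular_def)

lemma smallest_max_unique: "smallest_max ph U ==> smallest_max ph U' ==> U = U'"
 unfolding smallest_max_def by (meson order_antisym)

lemma largest_max_unique: "largest_max ph U ==> largest_max ph U' ==> U = U'"
 unfolding largest_max_def by (meson order_antisym)

lemma max_value:
 obtains m where "!!V. V : L ==> ph V <= m" "\<exists>V\<in>L. ph V = (m :: rat)"
proof -
 have "Max (ph ` L) : ph ` L" using finite_L bt_in by (intro Max_in) auto
 then have "\<exists>V\<in>L. ph V = Max (ph ` L)" by force
 moreover have "ph V <= Max (ph ` L)" if "V : L" for V using that finite_L by simp
 ultimately show ?thesis using that[of "Max (ph ` L)"] by blast
qed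

text \<open>The values at meet and join of two maximisers add up to twice the maximum, so both are
  maximisers. A minimal maximiser is therefore below all others.\<close>

lemma ex_smallest_max:
 assumes "modular ph"
 shows "\<exists>U. smallest_max ph U"
proof -
 obtain m where m: "!!V. V : L ==> ph V <= m" "\<exists>V\<in>L. ph V = m" using max_value[of ph] by blast
 have "finite {V : L. ph V = m}" "{V : L. ph V = m} ~= {}" using finite_L m(2) by auto
 from finite_has_minimal[OF this]
 obtain U where U: "U : L" "ph U = m" "!!V. V : L ==> ph V = m ==> V <= U ==> U = V" by auto
 have "U <= V" if V: "V : L" "ph V = m" for V
 proof -
  have "ph (meet U V) = m"
   using modularD[OF assms U(1) V(1)] m(1)[OF join_in[OF U(1) V(1)]] m(1)[OF meet_in[OF U(1) V(1)]] U V by simp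
  then have "U = meet U V" using U(3) meet_in[OF U(1) V(1)] meet_le1 by blast
  then show ?thesis using meet_le2[of U V] by simp
 qed
 then have "smallest_max ph U" using U m unfolding smallest_max_def by simp
 then show ?thesis ..
qed

lemma ex_largest_max:
 assumes "modular ph"
 shows "\<exists>U. largest_max ph U"
proof -
 obtain m where m: "!!V. V : L ==> ph V <= m" "\<exists>V\<in>L. ph V = m" using max_value[of ph] by blast
 have "finite {V : L. ph V = m}" "{V : L. ph V = m} ~= {}" using finite_L m(2) by auto
 from finite_has_maximal[OF this]
 obtain U where U: "U : L" "ph U = m" "!!V. V : L ==> ph V = m ==> U <= V ==> U = V" by auto
 have "V <= U" if V: "V : L" "ph V = m" for V
 proof -
  have "ph (join U V) = m"
   using modularD[OF assms U(1) V(1)] m(1)[OF join_in[OF U(1) V(1)]] m(1)[OF meet_in[OF U(1) V(1)]] U V by simp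
  then have "U = join U V" using U(3) join_in[OF U(1) V(1)] join_ge1[OF U(1) V(1)] by blast
  then show ?thesis using join_ge2[OF U(1) V(1)] by simp
 qed
 then have "largest_max ph U" using U m unfolding largest_max_def by simp
 then show ?thesis ..
qed

text \<open>One Harder-Narasimhan step: a condition on the whole lattice together with
  \<open>U\<close> is traded for separate conditions below \<open>U\<close> and above
  \<open>U\<close>. In the application \<open>ph\<close> is \<open>t\<close> minus a positive
  multiple of the dimension, which is what \<open>strict\<close> encodes. Every \<open>V\<close> is
  compared with \<open>U\<close> through \<open>meet U V\<close> and
  \<open>join U V\<close>.\<close>

lemma largest_max_iff:
 assumes t: "modular t" and ph: "modular ph" and U: "U : L"
  and strict: "!!A B. A : L ==> B : L ==> A <= B ==> A ~= B ==> ph A <= ph B ==> t A < t B"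
 shows "(\<forall>V\<in>L. V ~= tp --> t V < t tp) & (\<forall>V\<in>L. ph V <= ph bt) & largest_max ph U \<longleftrightarrow>
  ((\<forall>V\<in>L. V <= U --> ph V <= ph bt) & ph U = ph bt) &
  (\<forall>V\<in>L. U <= V --> V ~= tp --> t V < t tp) & (\<forall>V\<in>L. U <= V --> V ~= U --> ph V < ph U)"
  (is "?l \<longleftrightarrow> ?r")
proof
 assume l: ?l
 then have max: "!!V. V : L ==> ph V <= ph U" "!!V. V : L ==> ph V = ph U ==> V <= U"
  unfolding largest_max_def by auto
 have "ph U = ph bt" using l max(1)[OF bt_in] U by (intro antisym) auto
 moreover have "ph V < ph U" if "V : L" "U <= V" "V ~= U" for V
  using max[OF that(1)] that by (meson le_less order_antisym)
 ultimately show ?r using l by blast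
next
 assume r: ?r
 have le: "ph V <= ph bt & (ph V = ph bt --> V <= U)" if V: "V : L" for V
 proof -
  let ?m = "meet U V" and ?j = "join U V"
  have mj: "?m : L" "?j : L" "?m <= U" "U <= ?j" "V <= ?j"
   using V U meet_in join_in meet_le1 join_ge1 join_ge2 by auto
  have 1: "ph ?m <= ph bt" using r mj by blast
  have 2: "ph ?j < ph U | ?j = U" using r mj by blast
  have 3: "ph ?j + ph ?m = ph U + ph V" using modularD[OF ph U V] by simp
  have 4: "ph U = ph bt" using r by (elim conjE)
  show ?thesis
  proof (cases "?j = U")
   case True
   then show ?thesis using 1 3 mj(5) by simp
  next
   case False
   then have "ph V < ph bt" using 1 2 3 4 by linarith
   then show ?thesis by simp
  qed
 qed
 have lt: "t V < t tp" if V: "V : L" "V ~= tp" for V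
 proof -
  let ?m = "meet U V" and ?j = "join U V"
  have mj: "?m : L" "?j : L" "?m <= U" "U <= ?j" "V <= ?j" "?m <= V"
   using V U meet_in join_in meet_le1 meet_le2 join_ge1 join_ge2 by auto
  have 1: "?j ~= tp ==> t ?j < t tp" using r mj by blast
  \<comment> \<open>Below \<open>U\<close> the function \<open>ph\<close> is bounded by its value at
    \<open>bt\<close>, which \<open>U\<close> attains; so \<open>strict\<close> applies to
    \<open>?m\<close> and \<open>U\<close>.\<close>
  have 2: "?m ~= U ==> t ?m < t U" using strict[OF mj(1) U mj(3)] r mj by simp
  have 3: "?m = U ==> ?j = V"
   using antisym[OF join_least[OF U V(1) V(1) _ order_refl] mj(5)] mj(6) by simp
  have 4: "t ?j + t ?m = t U + t V" using modularD[OF t U V(1)] by simp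
  show ?thesis
  proof (cases "?m = U")
   case True
   then show ?thesis using 1 3 V(2) by simp
  next
   case False
   moreover have "t ?j <= t tp" using 1 by (cases "?j = tp") simp_all
   ultimately show ?thesis using 2 4 by linarith
  qed
 qed
 have "ph U = ph bt" using r by (elim conjE)
 then have "largest_max ph U" unfolding largest_max_def using U le by simp
 then show ?l using lt le by (intro conjI ballI impI) simp_all
qed

text \<open>The orthogonal of the smallest maximiser has the same value, so it is a maximiser too
  and contains the smallest one.\<close>

lemma smallest_max_le_perp:
 assumes perp: "!!V. V : L ==> perp V : L" "!!V. V : L ==> t (perp V) = t V"
  and U: "smallest_max t U"
 shows "U <= perp U"
 using U perp unfolding smallest_max_def by metis

text \<open>Modularity splits the value at \<open>V\<close> into contributions from
  \<open>U\<close>, from \<open>perp U\<close> over \<open>U\<close> and from the part above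
  \<open>perp U\<close>. The last is controlled by the first, because \<open>perp\<close> carries
  \<open>join V (perp U)\<close> to an element below \<open>U\<close> with the same value.\<close>

lemma smallest_max_perp_iff:
 assumes t: "modular t" and U: "U : L" "U <= perp U"
  and perp: "!!V. V : L ==> perp V : L" "!!V. V : L ==> t (perp V) = t V"
   "!!V. V : L ==> perp (perp V) = V" "!!V W. V : L ==> W : L ==> V <= W ==> perp W <= perp V"
 shows "smallest_max t U \<longleftrightarrow>
  (\<forall>V\<in>L. V <= U --> V ~= U --> t V < t U) & (\<forall>V\<in>L. U <= V --> V <= perp U --> t V <= t U)"
  (is "_ \<longleftrightarrow> ?r")
proof
 assume "smallest_max t U"
 then show ?r unfolding smallest_max_def by (meson le_less order_antisym)
next
 assume r: ?r
 let ?W = "perp U"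
 have W: "?W : L" "t ?W = t U" using perp U by auto
 have "t V <= t U & (t V = t U --> U <= V)" if V: "V : L" for V
 proof -
  let ?j = "join V ?W" and ?m = "meet V ?W"
  have jm: "?j : L" "?m : L" "?W <= ?j" "?m <= ?W" "?m <= V"
   using V W join_in meet_in join_ge2 meet_le1 meet_le2 by auto
  have "perp ?j <= U" using perp(4)[OF W(1) jm(1,3)] perp(3)[OF U(1)] by simp
  then have "perp ?j ~= U ==> t (perp ?j) < t U" using r perp(1)[OF jm(1)] by blast
  then have j: "t ?j <= t U"
   using perp(2)[OF jm(1)] by (cases "perp ?j = U") simp_all
  let ?j' = "join ?m U" and ?m' = "meet ?m U"
  have jm': "?j' : L" "?m' : L" "U <= ?j'" "?m' <= U" "?m' <= ?m" "?j' <= ?W"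
   using jm U W join_in meet_in join_ge2 meet_le1 meet_le2 join_least by auto
  have m1: "t ?j' <= t U" using r jm' by blast
  have m2: "?m' ~= U ==> t ?m' < t U" using r jm' by blast
  have e: "t V = t ?j + t ?m - t ?W" "t ?m = t ?j' + t ?m' - t U"
   using modularD[OF t V W(1)] modularD[OF t jm(2) U(1)] by simp_all
  show ?thesis
  proof (cases "?m' = U")
   case True
   then have "U <= V" using jm' jm by (metis order_trans)
   moreover have "t V <= t U" using e W(2) j m1 unfolding True by linarith
   ultimately show ?thesis by simp
  next
   case False
   then have "t V < t U" using m2 e W(2) j m1 by linarith
   then show ?thesis by simp
  qed
 qed
 then show "smallest_max t U" unfolding smallest_max_def using U by blast
qed

text \<open>The smallest maximiser is isotropic, and its value bounds all others.\<close>

lemma isotropic_semistable_iff: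
 assumes t: "modular t"
  and perp: "!!V. V : L ==> perp V : L" "!!V. V : L ==> t (perp V) = t V"
 shows "(\<forall>V\<in>L. V <= perp V --> t V <= c) \<longleftrightarrow> (\<forall>V\<in>L. t V <= c)"
proof
 assume *: "\<forall>V\<in>L. V <= perp V --> t V <= c"
 obtain U where U: "smallest_max t U" using ex_smallest_max[OF t] ..
 then have "t U <= c" using * smallest_max_le_perp[OF perp U] unfolding smallest_max_def by blast
 then show "\<forall>V\<in>L. t V <= c" using U unfolding smallest_max_def by (meson order_trans)
qed blast

end

section \<open>The lattice of subrepresentations and its subquotients\<close>

text \<open>Fixing the value \<open>{0}\<close> off the nodes makes the order and equality of
  families the pointwise ones and keeps the set finite.\<close>

definition subs :: "('v, 'a) pre_digraph => ('v, 'a, 'k::field, 'z) qrep_scheme => ('v => 'k vec set) set"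
 where "subs Q M = {V. subrepresentation Q M V & (\<forall>i. i ~: verts Q --> V i = {0})}"

text \<open>One additive function for several purposes: weight 1 gives the total dimension, the
  values of \<theta> at the nodes give \<theta>, and \<theta> minus a constant \<mu> compares slopes
  with \<mu>. The weights are rational because \<mu> is.\<close>

definition wdim :: "('v, 'a) pre_digraph => ('v => rat) => ('v => ('k::field) vec set) => rat"
 where "wdim Q w V = (\<Sum>i\<in>verts Q. w i * of_nat (kvec.dim (V i)))"

definition onverts :: "('v, 'a) pre_digraph => ('v => ('k::field) vec set) => 'v => 'k vec set"
 where "onverts Q V = (%i. if i : verts Q then V i else {0})"

abbreviation fsum :: "('v => ('k::field) vec set) => ('v => 'k vec set) => 'v => 'k vec set"
 where "fsum V W \<equiv> %i. ssum (V i) (W i)"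

abbreviation finter :: "('v => ('k::field) vec set) => ('v => 'k vec set) => 'v => 'k vec set"
 where "finter V W \<equiv> %i. V i Int W i"

lemma ssum_zero [simp]: "ssum {0} {0} = {0}"
 by (simp add: ssum_def)

lemma onverts_subs_iff: "onverts Q V : subs Q M \<longleftrightarrow> subrepresentation Q M (onverts Q V)"
 by (simp add: subs_def onverts_def)

locale quiver = fin_digraph Q for Q :: "('v, 'a) pre_digraph"
begin

lemma repD:
 assumes "representation Q (M :: ('v, 'a, 'k::{field,finite}, 'z) qrep_scheme)" "i : verts Q"
 shows "kvec.subspace (vsp M i)" "finite (vsp M i)"
 using assms unfolding representation_def fd_subspace_iff by auto

lemma rep_linear:
 assumes "representation Q M" "ar : arcs Q"
 shows "linear_between (vsp M (tail Q ar)) (vsp M (head Q ar)) (vmap M ar)"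
 using assms unfolding representation_def by blast

lemma subsD:
 assumes "representation Q (M :: ('v, 'a, 'k::{field,finite}, 'z) qrep_scheme)" "V : subs Q M"
 shows "kvec.subspace (V i)" "finite (V i)" "i : verts Q ==> V i <= vsp M i"
  "i ~: verts Q ==> V i = {0}"
  "ar : arcs Q ==> x : V (tail Q ar) ==> vmap M ar x : V (head Q ar)"
proof -
 have s: "subrepresentation Q M V" "!!i. i ~: verts Q ==> V i = {0}" using assms(2) unfolding subs_def by auto
 show "kvec.subspace (V i)"
  using s unfolding subrepresentation_def by (cases "i : verts Q") (auto simp: kvec.subspace_single_0)
 show 1: "i : verts Q ==> V i <= vsp M i" using s unfolding subrepresentation_def by auto
 show "finite (V i)"
  using 1 s(2)[of i] repD[OF assms(1), of i] finite_subset by (cases "i : verts Q") fastforce+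
 show "i ~: verts Q ==> V i = {0}" by (rule s(2))
 show "ar : arcs Q ==> x : V (tail Q ar) ==> vmap M ar x : V (head Q ar)"
  using s unfolding subrepresentation_def by blast
qed

lemma subsI:
 assumes "!!i. i : verts Q ==> kvec.subspace (V i)" "!!i. i : verts Q ==> V i <= vsp M i"
  "!!i. i ~: verts Q ==> V i = {0}"
  "!!ar x. ar : arcs Q ==> x : V (tail Q ar) ==> vmap M ar x : V (head Q ar)"
 shows "V : subs Q M"
 using assms unfolding subs_def subrepresentation_def by blast

lemma finite_subs:
 assumes "representation Q (M :: ('v, 'a, 'k::{field,finite}, 'z) qrep_scheme)"
 shows "finite (subs Q M)"
proof (rule finite_subset)
 show "subs Q M <= {V. \<forall>i. (i : verts Q --> V i : Pow (\<Union>i\<in>verts Q. vsp M i)) & (i ~: verts Q --> V i = {0})}"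
 proof
  fix V assume V: "V : subs Q M"
  show "V : {V. \<forall>i. (i : verts Q --> V i : Pow (\<Union>i\<in>verts Q. vsp M i)) & (i ~: verts Q --> V i = {0})}"
   using subsD(3,4)[OF assms V] by blast
 qed
 show "finite {V. \<forall>i. (i : verts Q --> V i : Pow (\<Union>i\<in>verts Q. vsp M i)) & (i ~: verts Q --> V i = {0})}"
  using repD[OF assms] by (intro finite_set_of_finite_funs) auto
qed

lemma wdim_modular:
 assumes "!!i. i : verts Q ==> kvec.subspace (V i)" "!!i. i : verts Q ==> finite (V i)"
  "!!i. i : verts Q ==> kvec.subspace (W i)" "!!i. i : verts Q ==> finite (W i :: ('k::{field,finite}) vec set)"
 shows "wdim Q w (fsum V W) + wdim Q w (finter V W) = wdim Q w V + wdim Q w W"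
proof -
 have "w i * of_nat (kvec.dim (ssum (V i) (W i))) + w i * of_nat (kvec.dim (V i Int W i))
   = w i * of_nat (kvec.dim (V i)) + w i * of_nat (kvec.dim (W i))" if "i : verts Q" for i
  using dim_ssum_inter[OF assms[OF that]] unfolding distrib_left[symmetric] of_nat_add[symmetric] by simp
 then show ?thesis unfolding wdim_def sum.distrib[symmetric] by (intro sum.cong) auto
qed

lemma wdim_zero: "wdim Q w (%_. {0 :: nat \<Rightarrow>\<^sub>0 'k::{field,finite}}) = 0"
 by (simp add: wdim_def dim_zero_space)

lemma wdim_onverts [simp]: "wdim Q w (onverts Q V) = wdim Q w V"
 unfolding wdim_def onverts_def by (intro sum.cong) auto

lemma modular_lattice_subs:
 assumes M: "representation Q (M :: ('v, 'a, 'k::{field,finite}, 'z) qrep_scheme)"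
 shows "modular_lattice (subs Q M) fsum finter (%_. {0}) (onverts Q (vsp M))"
proof
 show "finite (subs Q M)" by (rule finite_subs[OF M])
next
 fix V W assume V: "V : subs Q M" and W: "W : subs Q M"
 note v = subsD[OF M V] and w = subsD[OF M W]
 show "finter V W : subs Q M"
  using v w by (intro subsI) (auto intro!: kvec.subspace_inter)
 show "fsum V W : subs Q M"
 proof (rule subsI)
  fix i assume i: "i : verts Q"
  show "kvec.subspace (ssum (V i) (W i))" using v(1) w(1) by (rule subspace_ssum)
  show "ssum (V i) (W i) <= vsp M i" by (rule ssum_least[OF repD(1)[OF M i] v(3)[OF i] w(3)[OF i]])
 next
  fix i assume "i ~: verts Q"
  then show "ssum (V i) (W i) = {0}" using v(4) w(4) by simp
 next
  fix ar x assume a: "ar : arcs Q" "x : ssum (V (tail Q ar)) (W (tail Q ar))"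
  then obtain y z where yz: "x = y + z" "y : V (tail Q ar)" "z : W (tail Q ar)" unfolding ssum_def by blast
  have "y : vsp M (tail Q ar)" "z : vsp M (tail Q ar)"
   using yz v(3) w(3) tail_in_verts[OF a(1)] by blast+
  then have "vmap M ar x = vmap M ar y + vmap M ar z"
   using linear_between_add[OF rep_linear[OF M a(1)]] yz(1) by simp
  then show "vmap M ar x : ssum (V (head Q ar)) (W (head Q ar))"
   unfolding ssum_def using v(5)[OF a(1) yz(2)] w(5)[OF a(1) yz(3)] by blast
 qed
 show "V <= fsum V W" by (rule le_funI, rule ssum_upper1[OF w(1)])
 show "W <= fsum V W" by (rule le_funI, rule ssum_upper2[OF v(1)])
next
 fix V W X assume "V : subs Q M" "W : subs Q M" and X: "X : subs Q M" and le: "V <= X" "W <= X"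
 show "fsum V W <= X"
  by (rule le_funI, rule ssum_least[OF subsD(1)[OF M X]]) (use le in \<open>auto dest: le_funD\<close>)
next
 fix V W :: "'v => 'k vec set"
 show "finter V W <= V" "finter V W <= W" by (auto simp: le_fun_def)
 fix X assume "X <= V" "X <= W"
 then show "X <= finter V W" unfolding le_fun_def by blast
next
 show "(%_. {0}) : subs Q M"
 proof (rule subsI)
  fix ar and x :: "'k vec" assume a: "ar : arcs Q" "x : {0}"
  then show "vmap M ar x : {0}"
   using linear_between_0[OF rep_linear[OF M a(1)] repD(1)[OF M tail_in_verts[OF a(1)]]] by simp
 qed (use kvec.subspace_0[OF repD(1)[OF M]] in \<open>auto simp: kvec.subspace_single_0\<close>)
 show "onverts Q (vsp M) : subs Q M"
  using repD[OF M] linear_between_in[OF rep_linear[OF M]] tail_in_verts head_in_verts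
  by (intro subsI) (auto simp: onverts_def)
next
 fix V assume V: "V : subs Q M"
 show "(%_. {0}) <= V" using kvec.subspace_0[OF subsD(1)[OF M V]] by (auto simp: le_fun_def)
 show "V <= onverts Q (vsp M)" using subsD(3,4)[OF M V] by (auto simp: le_fun_def onverts_def)
qed

lemma modular_wdim:
 assumes M: "representation Q (M :: ('v, 'a, 'k::{field,finite}, 'z) qrep_scheme)"
 shows "modular_lattice.modular (subs Q M) fsum finter (wdim Q w)"
 unfolding modular_lattice.modular_def[OF modular_lattice_subs[OF M]]
 using wdim_modular subsD(1,2)[OF M] by blast

lemma wdim_strict_mono:
 assumes M: "representation Q (M :: ('v, 'a, 'k::{field,finite}, 'z) qrep_scheme)"
  and VW: "V : subs Q M" "W : subs Q M" "V <= W" "V ~= W"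
 shows "wdim Q (%_. 1) V < wdim Q (%_. 1) W"
proof -
 have le: "kvec.dim (V i) <= kvec.dim (W i)" for i
  by (rule dim_mono[OF subsD(1)[OF M VW(1)] subsD(1,2)[OF M VW(2)] le_funD[OF VW(3)]])
 obtain i where i: "V i ~= W i" using VW(4) by blast
 then have iv: "i : verts Q" using subsD(4)[OF M VW(1), of i] subsD(4)[OF M VW(2), of i] by auto
 have "kvec.dim (V i) ~= kvec.dim (W i)"
  using dim_eq_imp_eq[OF subsD(1)[OF M VW(1)] subsD(1,2)[OF M VW(2)] le_funD[OF VW(3)]] i by blast
 then have "(\<Sum>i\<in>verts Q. kvec.dim (V i)) < (\<Sum>i\<in>verts Q. kvec.dim (W i))"
  using le iv by (intro sum_strict_mono_ex1) (auto simp: le_less)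
 then show ?thesis
  unfolding wdim_def by (simp add: of_nat_sum[symmetric] del: of_nat_sum)
qed

end

lemma proj_mat_app:
 assumes "finite I" "finite J" "I' <= I" "J' <= J" "y : coords J'"
 shows "proj I' (mat_app I J a y) = mat_app I' J' a y"
proof (rule poly_mapping_eqI)
 fix i
 have fI: "finite I'" by (rule finite_subset[OF assms(3,1)])
 have "(\<Sum>j\<in>J. a i j * entry y j) = (\<Sum>j\<in>J'. a i j * entry y j)"
  using assms(2,4) coords_lookup[OF assms(5)] by (intro sum.mono_neutral_right) auto
 then show "entry (proj I' (mat_app I J a y)) i = entry (mat_app I' J' a y) i"
  using assms(1,3) fI by (auto simp: lookup_proj lookup_mat_app)
qed

lemma mat_app_cong:
 "(!!i j. i : I ==> j : J ==> a i j = b i j) ==> mat_app I J a x = mat_app I J b x"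
 unfolding mat_app_def comb_def by (intro sum.cong refl arg_cong2[where f = Poly_Mapping.single]) simp

lemma ssum_coords_inter:
 assumes "finite A" "finite N" "A Int N = {}" "V <= coords N"
 shows "ssum V (coords A) Int coords N = V"
proof (intro equalityI subsetI)
 fix x assume "x : ssum V (coords A) Int coords N"
 then obtain v a where x: "x = v + a" "v : V" "a : coords A" "x : coords N" unfolding ssum_def by blast
 have "v : coords N" using x(2) assms(4) by blast
 then have "proj A x = a"
  using proj_disjoint[OF assms(1) _ assms(3)] proj_id[OF assms(1) x(3)] x(1) by (simp add: proj_add[OF assms(1)])
 moreover have "proj A x = 0" by (rule proj_disjoint[OF assms(1) x(4) assms(3)])
 ultimately show "x : V" using x(1,2) by simp
next
 fix x assume "x : V"
 then show "x : ssum V (coords A) Int coords N"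
  using subsetD[OF assms(4)] subsetD[OF ssum_upper1[OF subspace_coords]] by simp
qed

lemma coords_inter_ssum:
 assumes "finite A" "finite N" "A Int N = {}" "kvec.subspace V" "coords A <= V" "V <= coords (A Un N)"
 shows "ssum (V Int coords N) (coords A) = V"
proof (intro equalityI subsetI)
 fix x assume "x : ssum (V Int coords N) (coords A)"
 then show "x : V" unfolding ssum_def using assms(4,5) by (auto intro: kvec.subspace_add)
next
 fix x assume x: "x : V"
 then have d: "proj A x + proj N x = x" using proj_decomp[OF assms(1-3)] assms(6) by blast
 have "proj A x : V" using proj_in_coords[OF assms(1)] assms(5) by blast
 then have "x - proj A x : V" by (rule kvec.subspace_diff[OF assms(4) x])
 then have "proj N x : V Int coords N" using d proj_in_coords[OF assms(2)] by (metis IntI add_diff_cancel_left')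
 moreover have "x = proj N x + proj A x" using d by (simp add: add.commute)
 ultimately show "x : ssum (V Int coords N) (coords A)"
  unfolding ssum_def using proj_in_coords[OF assms(1)] by blast
qed

lemma dim_ssum_coords:
 assumes "finite A" "finite N" "A Int N = {}" "kvec.subspace V" "V <= (coords N :: ('k::{field,finite}) vec set)"
 shows "kvec.dim (ssum V (coords A)) = kvec.dim V + kvec.dim (coords A :: 'k vec set)"
proof -
 have fV: "finite V" by (rule finite_subset[OF assms(5) finite_coords[OF assms(2)]])
 have "V Int coords A = {0}"
 proof (intro equalityI subsetI)
  fix x assume x: "x : V Int coords A"
  then have "proj A x = x" "proj A x = 0"
   using assms(3,5) proj_id[OF assms(1), of x] proj_disjoint[OF assms(1), of x N] by auto
  then show "x : {0}" by simp
 qed (use kvec.subspace_0[OF assms(4)] in auto)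
 then show ?thesis
  using dim_ssum_inter[OF assms(4) fV subspace_coords finite_coords[OF assms(1)]] by (simp add: dim_zero_space)
qed

context quiver
begin

definition kcf :: "('v => nat set) => 'v => ('k::field) vec set"
 where "kcf J = onverts Q (%i. coords (J i))"

lemma kcf_in [simp]: "i : verts Q ==> kcf J i = coords (J i)"
 and kcf_out [simp]: "i ~: verts Q ==> kcf J i = {0}"
 by (simp_all add: kcf_def onverts_def)

lemma onverts_in [simp]: "i : verts Q ==> onverts Q V i = V i"
 and onverts_out [simp]: "i ~: verts Q ==> onverts Q V i = {0}"
 by (simp_all add: onverts_def)

lemma onverts_eqI: "(!!i. i : verts Q ==> V i = W i) ==> (!!i. i ~: verts Q ==> W i = {0}) ==> onverts Q V = W"
 by (rule ext) (simp add: onverts_def)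

lemma kcf_mono: "(!!i. i : verts Q ==> A i <= B i) ==> kcf A <= kcf B"
 unfolding le_fun_def kcf_def onverts_def by (auto intro: subsetD[OF coords_mono])

text \<open>The correspondence theorem, with \<open>coords (N i)\<close> as a model of
  \<open>coords (A i Un N i)\<close> modulo \<open>coords (A i)\<close>; the arrow maps of the model
  are those of \<open>M\<close> followed by the projection along \<open>coords (A i)\<close>. The
  inverse of \<open>\<Phi>\<close> intersects with \<open>coords (N i)\<close>. The record types of
  \<open>M\<close> and \<open>M'\<close> may differ, so that self-dual representations are
  covered.\<close>

lemma subquotient:
 fixes M :: "('v, 'a, 'k::{field,finite}, 'z) qrep_scheme" and M' :: "('v, 'a, 'k, 'y) qrep_scheme"
 assumes M: "representation Q M" and M': "representation Q M'"
  and fin: "!!i. i : verts Q ==> finite (A i)" "!!i. i : verts Q ==> finite (N i)"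
   "!!i. i : verts Q ==> A i Int N i = {}"
  and v': "!!i. i : verts Q ==> vsp M' i = coords (N i)"
  and m': "!!ar x. ar : arcs Q ==> x : coords (N (tail Q ar)) ==> vmap M' ar x = proj (N (head Q ar)) (vmap M ar x)"
  and A: "kcf A : subs Q M" and AN: "kcf (%i. A i Un N i) : subs Q M"
 defines "\<Phi> \<equiv> %V. onverts Q (%i. ssum (V i) (coords (A i)))"
 shows "bij_betw \<Phi> (subs Q M') {V : subs Q M. kcf A <= V & V <= kcf (%i. A i Un N i)}"
  and "V : subs Q M' ==> wdim Q w (\<Phi> V) = wdim Q w V + wdim Q w (kcf A :: 'v => 'k vec set)"
  and "\<Phi> (%_. {0}) = kcf A"
  and "\<Phi> (onverts Q (vsp M')) = kcf (%i. A i Un N i)"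
proof -
 let ?S = "{V : subs Q M. kcf A <= V & V <= kcf (%i. A i Un N i)}"
 let ?\<Psi> = "%V. onverts Q (%i. V i Int coords (N i) :: 'k vec set)"
 have sub': "V i <= coords (N i)" if "V : subs Q M'" "i : verts Q" for V i
  using subsD(3)[OF M' that] v'[OF that(2)] by simp
 have mem: "vmap M ar x : coords (A (head Q ar) Un N (head Q ar))"
  if "ar : arcs Q" "x : coords (A (tail Q ar) Un N (tail Q ar))" for ar x
  using subsD(5)[OF M AN that(1), of x] that head_in_verts[OF that(1)] tail_in_verts[OF that(1)] by simp
 have memA: "vmap M ar x : coords (A (head Q ar))" if "ar : arcs Q" "x : coords (A (tail Q ar))" for ar x
  using subsD(5)[OF M A that(1), of x] that head_in_verts[OF that(1)] tail_in_verts[OF that(1)] by simp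
 have vM: "coords (A i Un N i) <= vsp M i" if "i : verts Q" for i
  using subsD(3)[OF M AN that] that by simp
 have cA: "coords (A i) <= (coords (A i Un N i) :: 'k vec set)"
  and cN: "coords (N i) <= (coords (A i Un N i) :: 'k vec set)" for i
  by (rule coords_mono; blast)+
 have into: "\<Phi> V : ?S" if V: "V : subs Q M'" for V
 proof -
  have le: "ssum (V i) (coords (A i)) <= coords (A i Un N i)" if "i : verts Q" for i
   using ssum_least[OF subspace_coords _ cA] sub'[OF V that] cN by blast
  have "\<Phi> V : subs Q M"
   unfolding \<Phi>_def
  proof (rule subsI)
   fix i assume i: "i : verts Q"
   show "kvec.subspace (onverts Q (%i. ssum (V i) (coords (A i))) i)"
    using i subspace_ssum[OF subsD(1)[OF M' V] subspace_coords] by simp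
   show "onverts Q (%i. ssum (V i) (coords (A i))) i <= vsp M i"
    using i le[OF i] vM[OF i] by simp
  next
   fix ar x assume a: "ar : arcs Q" and x: "x : onverts Q (%i. ssum (V i) (coords (A i))) (tail Q ar)"
   let ?t = "tail Q ar" and ?h = "head Q ar"
   have th: "?t : verts Q" "?h : verts Q" using a by auto
   from x th obtain y z where yz: "x = y + z" "y : V ?t" "z : coords (A ?t)" unfolding ssum_def by auto
   have yN: "y : coords (N ?t)" using sub'[OF V th(1)] yz by blast
   have "vmap M ar x = vmap M ar y + vmap M ar z"
    using linear_between_add[OF rep_linear[OF M a]] yz yN cA cN vM[OF th(1)] by blast
   moreover have "proj (A ?h) (vmap M ar y) + vmap M' ar y = vmap M ar y"
    unfolding m'[OF a yN] by (rule proj_decomp[OF fin[OF th(2)] mem[OF a subsetD[OF cN yN]]])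
   ultimately have "vmap M ar x = (proj (A ?h) (vmap M ar y) + vmap M' ar y) + vmap M ar z"
    by (simp only:)
   then have "vmap M ar x = vmap M' ar y + (proj (A ?h) (vmap M ar y) + vmap M ar z)"
    by (simp only: add_ac)
   moreover have "proj (A ?h) (vmap M ar y) + vmap M ar z : coords (A ?h)"
    by (rule kvec.subspace_add[OF subspace_coords proj_in_coords[OF fin(1)[OF th(2)]] memA[OF a yz(3)]])
   ultimately show "vmap M ar x : onverts Q (%i. ssum (V i) (coords (A i))) ?h"
    using subsD(5)[OF M' V a yz(2)] th unfolding ssum_def by auto
  qed simp
  moreover have "kcf A <= \<Phi> V"
   unfolding \<Phi>_def kcf_def using ssum_upper2[OF subsD(1)[OF M' V]] by (auto simp: le_fun_def onverts_def)
  moreover have "\<Phi> V <= kcf (%i. A i Un N i)"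
   unfolding \<Phi>_def kcf_def using le by (auto simp: le_fun_def onverts_def)
  ultimately show ?thesis by simp
 qed
 have bk: "?\<Psi> V : subs Q M'" if V: "V : ?S" for V
 proof (rule subsI)
  have Vs: "V : subs Q M" using V by simp
  fix i assume i: "i : verts Q"
  show "kvec.subspace (?\<Psi> V i)"
   using i kvec.subspace_inter[OF subsD(1)[OF M Vs] subspace_coords] by simp
  show "?\<Psi> V i <= vsp M' i" using i v' by simp
 next
  fix ar x assume a: "ar : arcs Q" and x: "x : ?\<Psi> V (tail Q ar)"
  let ?t = "tail Q ar" and ?h = "head Q ar"
  have th: "?t : verts Q" "?h : verts Q" using a by auto
  have Vs: "V : subs Q M" and VA: "coords (A ?h) <= V ?h"
   using V th by (auto dest!: le_funD[where x = ?h])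
  have x': "x : V ?t" "x : coords (N ?t)" using x th by auto
  have y: "vmap M ar x : V ?h" by (rule subsD(5)[OF M Vs a x'(1)])
  have "proj (A ?h) (vmap M ar x) + vmap M' ar x = vmap M ar x"
   unfolding m'[OF a x'(2)] by (rule proj_decomp[OF fin[OF th(2)] mem[OF a subsetD[OF cN x'(2)]]])
  then have "vmap M' ar x = vmap M ar x - proj (A ?h) (vmap M ar x)"
   by (metis add_diff_cancel_left')
  moreover have "\<dots> : V ?h"
   using kvec.subspace_diff[OF subsD(1)[OF M Vs] y] VA proj_in_coords[OF fin(1)[OF th(2)]] by blast
  moreover have "vmap M' ar x : coords (N ?h)"
   unfolding m'[OF a x'(2)] by (rule proj_in_coords[OF fin(2)[OF th(2)]])
  ultimately show "vmap M' ar x : ?\<Psi> V ?h" using th by simp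
 qed simp
 show "bij_betw \<Phi> (subs Q M') ?S"
 proof (rule bij_betw_byWitness[where f' = ?\<Psi>])
  show "\<forall>V\<in>subs Q M'. ?\<Psi> (\<Phi> V) = V"
  proof
   fix V assume V: "V : subs Q M'"
   show "?\<Psi> (\<Phi> V) = V"
    using ssum_coords_inter[OF fin sub'[OF V]] subsD(4)[OF M' V] by (intro onverts_eqI) (simp_all add: \<Phi>_def)
  qed
  show "\<forall>V\<in>?S. \<Phi> (?\<Psi> V) = V"
  proof
   fix V assume V: "V : ?S"
   then have Vs: "V : subs Q M" by simp
   have "coords (A i) <= V i" "V i <= coords (A i Un N i)" if "i : verts Q" for i
    using V that by (auto dest!: le_funD[where x = i])
   then show "\<Phi> (?\<Psi> V) = V"
    unfolding \<Phi>_def using coords_inter_ssum[OF fin subsD(1)[OF M Vs]] subsD(4)[OF M Vs]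
    by (intro onverts_eqI) simp_all
  qed
 qed (use into bk in blast)+
 show "wdim Q w (\<Phi> V) = wdim Q w V + wdim Q w (kcf A :: 'v => 'k vec set)" if V: "V : subs Q M'"
  unfolding wdim_def \<Phi>_def sum.distrib[symmetric]
  using dim_ssum_coords[OF fin subsD(1)[OF M' V] sub'[OF V]]
  by (intro sum.cong) (simp_all add: distrib_left)
 show "\<Phi> (%_. {0}) = kcf A"
  unfolding \<Phi>_def by (intro onverts_eqI) (simp_all add: ssum_def)
 show "\<Phi> (onverts Q (vsp M')) = kcf (%i. A i Un N i)"
  unfolding \<Phi>_def
 proof (intro onverts_eqI)
  fix i assume i: "i : verts Q"
  have "coords (A i Un N i) Int coords (N i) = (coords (N i) :: 'k vec set)" using cN by blast
  then show "ssum (onverts Q (vsp M') i) (coords (A i)) = kcf (%i. A i Un N i) i"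
   using coords_inter_ssum[OF fin[OF i] subspace_coords cA subset_refl] i v' by simp
 qed simp
qed

definition fimg :: "('v => ('k::field) vec => 'k vec) => ('v => 'k vec set) => 'v => 'k vec set"
 where "fimg f V = onverts Q (%i. f i ` V i)"

lemma rep_isoD:
 assumes "rep_iso Q M N f"
 shows "i : verts Q ==> linear_between (vsp M i) (vsp N i) (f i)"
  "i : verts Q ==> bij_betw (f i) (vsp M i) (vsp N i)"
  "ar : arcs Q ==> x : vsp M (tail Q ar) ==> f (head Q ar) (vmap M ar x) = vmap N ar (f (tail Q ar) x)"
 using assms unfolding rep_iso_def by blast+

lemma rep_iso_inv:
 fixes M N :: "('v, 'a, 'k::{field,finite}, 'z) qrep_scheme"
 assumes M: "representation Q M" and f: "rep_iso Q M N f"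
 shows "rep_iso Q N M (%i. the_inv_into (vsp M i) (f i))"
 unfolding rep_iso_def
proof (intro conjI ballI)
 fix i assume i: "i : verts Q"
 show "linear_between (vsp N i) (vsp M i) (the_inv_into (vsp M i) (f i))"
  by (rule linear_between_inv[OF rep_isoD(1,2)[OF f i] repD(1)[OF M i]])
 show "bij_betw (the_inv_into (vsp M i) (f i)) (vsp N i) (vsp M i)"
  by (rule bij_betw_the_inv_into[OF rep_isoD(2)[OF f i]])
next
 fix ar x assume a: "ar : arcs Q" and x: "x : vsp N (tail Q ar)"
 have th: "tail Q ar : verts Q" "head Q ar : verts Q" using a by auto
 obtain y where y: "y : vsp M (tail Q ar)" "x = f (tail Q ar) y"
  using rep_isoD(2)[OF f th(1)] x unfolding bij_betw_def by blast
 have inj: "inj_on (f (tail Q ar)) (vsp M (tail Q ar))" "inj_on (f (head Q ar)) (vsp M (head Q ar))"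
  using rep_isoD(2)[OF f] th unfolding bij_betw_def by blast+
 show "the_inv_into (vsp M (head Q ar)) (f (head Q ar)) (vmap N ar x) =
   vmap M ar (the_inv_into (vsp M (tail Q ar)) (f (tail Q ar)) x)"
  using rep_isoD(3)[OF f a y(1), symmetric] linear_between_in[OF rep_linear[OF M a] y(1)] y
  by (simp add: the_inv_into_f_f[OF inj(1)] the_inv_into_f_f[OF inj(2)])
qed

lemma fimg_in_subs:
 fixes M N :: "('v, 'a, 'k::{field,finite}, 'z) qrep_scheme"
 assumes M: "representation Q M" and f: "rep_iso Q M N f" and V: "V : subs Q M"
 shows "fimg f V : subs Q N" "wdim Q w (fimg f V) = wdim Q w V"
proof -
 have lin: "linear_between (V i) (vsp N i) (f i)" if "i : verts Q" for i
  using linear_between_mono[OF rep_isoD(1)[OF f that] subsD(3)[OF M V that]]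
   linear_between_in[OF rep_isoD(1)[OF f that]] subsD(3)[OF M V that] by blast
 have inj: "inj_on (f i) (V i)" if "i : verts Q" for i
  using rep_isoD(2)[OF f that] subsD(3)[OF M V that] unfolding bij_betw_def by (blast intro: inj_on_subset)
 show "fimg f V : subs Q N"
  unfolding fimg_def
 proof (rule subsI)
  fix i assume i: "i : verts Q"
  show "kvec.subspace (onverts Q (%i. f i ` V i) i)"
   using i linear_between_image_subspace[OF lin[OF i] subsD(1)[OF M V]] by simp
  show "onverts Q (%i. f i ` V i) i <= vsp N i"
   using i linear_between_in[OF lin[OF i]] by auto
 next
  fix ar x assume a: "ar : arcs Q" "x : onverts Q (%i. f i ` V i) (tail Q ar)"
  have th: "tail Q ar : verts Q" "head Q ar : verts Q" using a by auto
  from a th obtain y where y: "y : V (tail Q ar)" "x = f (tail Q ar) y" by auto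
  then have "vmap N ar x = f (head Q ar) (vmap M ar y)"
   using rep_isoD(3)[OF f a(1)] subsD(3)[OF M V th(1)] by auto
  then show "vmap N ar x : onverts Q (%i. f i ` V i) (head Q ar)"
   using th subsD(5)[OF M V a(1) y(1)] by simp
 qed simp
 show "wdim Q w (fimg f V) = wdim Q w V"
  unfolding wdim_def fimg_def using dim_image_inj[OF lin inj subsD(1,2)[OF M V]] by (intro sum.cong) simp_all
qed

lemma fimg_inv:
 fixes M N :: "('v, 'a, 'k::{field,finite}, 'z) qrep_scheme"
 assumes M: "representation Q M" and f: "rep_iso Q M N f" and V: "V : subs Q M"
 shows "fimg (%i. the_inv_into (vsp M i) (f i)) (fimg f V) = V"
 unfolding fimg_def
proof (rule onverts_eqI)
 fix i assume i: "i : verts Q"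
 have inj: "inj_on (f i) (vsp M i)" using rep_isoD(2)[OF f i] unfolding bij_betw_def by blast
 have "the_inv_into (vsp M i) (f i) ` f i ` V i = (%x. x) ` V i"
  unfolding image_image using the_inv_into_f_f[OF inj] subsD(3)[OF M V i] by (intro image_cong) auto
 then show "the_inv_into (vsp M i) (f i) ` onverts Q (%i. f i ` V i) i = V i" using i by simp
qed (use subsD(4)[OF M V] in simp)

lemma fimg_inv':
 fixes M N :: "('v, 'a, 'k::{field,finite}, 'z) qrep_scheme"
 assumes N: "representation Q N" and f: "rep_iso Q M N f" and V: "V : subs Q N"
 shows "fimg f (fimg (%i. the_inv_into (vsp M i) (f i)) V) = V"
 unfolding fimg_def
proof (rule onverts_eqI)
 fix i assume i: "i : verts Q"
 have "f i ` the_inv_into (vsp M i) (f i) ` V i = (%x. x) ` V i"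
  unfolding image_image using f_the_inv_into_f_bij_betw[OF rep_isoD(2)[OF f i]] subsD(3)[OF N V i]
  by (intro image_cong) auto
 then show "f i ` onverts Q (%i. the_inv_into (vsp M i) (f i) ` V i) i = V i" using i by simp
qed (use subsD(4)[OF N V] in simp)

lemma bij_betw_fimg:
 fixes M N :: "('v, 'a, 'k::{field,finite}, 'z) qrep_scheme"
 assumes M: "representation Q M" and N: "representation Q N" and f: "rep_iso Q M N f"
 shows "bij_betw (fimg f) (subs Q M) (subs Q N)"
 using fimg_inv[OF M f] fimg_inv'[OF N f] fimg_in_subs(1)[OF M f] fimg_in_subs(1)[OF N rep_iso_inv[OF M f]]
 by (intro bij_betw_byWitness[where f' = "fimg (%i. the_inv_into (vsp M i) (f i))"]) blast+

lemma fimg_mono: "V <= W ==> fimg f V <= fimg f W"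
 unfolding fimg_def le_fun_def onverts_def by (auto simp: subset_iff)

lemma fimg_le_iff:
 fixes M N :: "('v, 'a, 'k::{field,finite}, 'z) qrep_scheme"
 assumes M: "representation Q M" and f: "rep_iso Q M N f" and V: "V : subs Q M" "W : subs Q M"
 shows "fimg f V <= fimg f W \<longleftrightarrow> V <= W"
 using fimg_mono fimg_inv[OF M f V(1)] fimg_inv[OF M f V(2)] by metis

lemma fimg_zero:
 assumes M: "representation Q (M :: ('v, 'a, 'k::{field,finite}, 'z) qrep_scheme)" and f: "rep_iso Q M N f"
 shows "fimg f (%_. {0}) = (%_. {0})"
 unfolding fimg_def using linear_between_0[OF rep_isoD(1)[OF f] repD(1)[OF M]] by (intro onverts_eqI) simp_all

lemma fimg_whole:
 assumes f: "rep_iso Q M N f"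
 shows "fimg f (onverts Q (vsp M)) = onverts Q (vsp N)"
 unfolding fimg_def using rep_isoD(2)[OF f] by (intro onverts_eqI) (simp_all add: bij_betw_def)

end

section \<open>Mass formula for a finite groupoid\<close>

text \<open>Each frame of \<open>M\<close> pulls its structure back to exactly one \<open>x\<close>,
  and the frames that lead to a given \<open>x\<close> isomorphic to \<open>M\<close> are as many as
  the automorphisms of \<open>M\<close>. So in each class the number of \<open>x\<close> times the
  order of the automorphism group is \<open>n\<close>. The statement is abstract because it serves
  isomorphisms as well as isometries.\<close>

lemma groupoid_mass:
 fixes S :: "'o set" and r :: "('o \<times> 'o) set" and X :: "'x set" and iso :: "'o => 'o => 'f set"
  and aut :: "'o => 'f set"
 assumes X: "finite X" "!!x. x : X ==> \<rho> x : S"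
  and r: "equiv Obj r" "S <= Obj" "!!M N. M : S ==> (M, N) : r ==> N : S"
  and fr: "!!M. M : S ==> finite (fr M)" "!!M. M : S ==> card (fr M) = n" "0 < n"
  and uniq: "!!M ph. M : S ==> ph : fr M ==> \<exists>!x. x : X & ph : iso (\<rho> x) M"
  and sub: "!!x M. x : X ==> M : S ==> iso (\<rho> x) M <= fr M"
  and iso: "!!x M. x : X ==> M : S ==> (M, \<rho> x) : r ==> card (iso (\<rho> x) M) = card (aut M)"
   "!!x M. x : X ==> M : S ==> iso (\<rho> x) M ~= {} ==> (M, \<rho> x) : r"
 shows "(\<Sum>C\<in>S // r. 1 / real (card (aut (SOME M. M : C)))) = real (card X) / real n"
proof -
 let ?c = "%C. SOME M. M : C"
 have C: "?c C : S" "C = r `` {?c C}" if "C : S // r" for C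
 proof -
  obtain M where M: "M : S" "C = r `` {M}" using \<open>C : S // r\<close> by (rule quotientE)
  have "M : C" unfolding M(2) by (rule equiv_class_self[OF r(1) subsetD[OF r(2) M(1)]])
  then have c: "?c C : C" by (rule someI)
  then have "(M, ?c C) : r" using M by blast
  then show "?c C : S" "C = r `` {?c C}"
   using r(3)[OF M(1)] equiv_class_eq[OF r(1)] unfolding M(2) by blast+
 qed
 have count: "n = card {x : X. \<rho> x : C} * card (aut (?c C))" if "C : S // r" for C
 proof -
  let ?M = "?c C"
  note M = C[OF that]
  have "fr ?M = (\<Union>x\<in>{x : X. \<rho> x : C}. iso (\<rho> x) ?M)"
  proof (intro equalityI subsetI)
   fix ph assume ph: "ph : fr ?M"
   then obtain x where x: "x : X" "ph : iso (\<rho> x) ?M" using uniq[OF M(1)] by blast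
   then have "(?M, \<rho> x) : r" using iso(2)[OF x(1) M(1)] by blast
   then have "\<rho> x : C" using M(2) by blast
   then show "ph : (\<Union>x\<in>{x : X. \<rho> x : C}. iso (\<rho> x) ?M)" using x by blast
  qed (use sub[OF _ M(1)] in blast)
  moreover have "card (\<Union>x\<in>{x : X. \<rho> x : C}. iso (\<rho> x) ?M) = (\<Sum>x\<in>{x : X. \<rho> x : C}. card (iso (\<rho> x) ?M))"
  proof (rule card_UN_disjoint)
   show "\<forall>x\<in>{x : X. \<rho> x : C}. finite (iso (\<rho> x) ?M)"
    using finite_subset[OF sub[OF _ M(1)] fr(1)[OF M(1)]] by blast
   show "\<forall>x\<in>{x : X. \<rho> x : C}. \<forall>y\<in>{x : X. \<rho> x : C}. x ~= y --> iso (\<rho> x) ?M Int iso (\<rho> y) ?M = {}"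
    using uniq[OF M(1)] sub[OF _ M(1)] by blast
  qed (use X in simp)
  moreover have "\<dots> = (\<Sum>x\<in>{x : X. \<rho> x : C}. card (aut ?M))"
  proof (rule sum.cong[OF refl])
   fix x assume x: "x : {x : X. \<rho> x : C}"
   then have "(?M, \<rho> x) : r" using M(2) by blast
   then show "card (iso (\<rho> x) ?M) = card (aut ?M)" using iso(1) x M(1) by blast
  qed
  ultimately show ?thesis using fr(2)[OF M(1)] by simp
 qed
 \<comment> \<open>As \<open>n\<close> is positive, the count just proved forces every class to
   contain some \<open>\<rho> x\<close>.\<close>
 have fin: "finite (S // r)"
 proof (rule finite_subset)
  show "S // r <= (%x. r `` {\<rho> x}) ` X"
  proof
   fix C' assume C': "C' : S // r"
   have "card {x : X. \<rho> x : C'} ~= 0" using count[OF C'] fr(3) by (cases "card {x : X. \<rho> x : C'}") simp_all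
   then have "{x : X. \<rho> x : C'} ~= {}" by force
   then obtain x where x: "x : X" "\<rho> x : C'" by blast
   then have "(?c C', \<rho> x) : r" using C(2)[OF C'] by blast
   from equiv_class_eq[OF r(1) this] have "C' = r `` {\<rho> x}" using C(2)[OF C'] by (simp only:)
   then show "C' : (%x. r `` {\<rho> x}) ` X" using x(1) by blast
  qed
 qed (use X in simp)
 have "card X = card (\<Union>C\<in>S // r. {x : X. \<rho> x : C})"
 proof (rule arg_cong[where f = card], intro equalityI subsetI)
  fix x assume x: "x : X"
  then have "r `` {\<rho> x} : S // r" using X(2) by (intro quotientI) blast
  moreover have "\<rho> x : r `` {\<rho> x}" by (rule equiv_class_self[OF r(1) subsetD[OF r(2) X(2)[OF x]]])
  ultimately show "x : (\<Union>C\<in>S // r. {x : X. \<rho> x : C})" using x by blast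
 qed auto
 also have "\<dots> = (\<Sum>C\<in>S // r. card {x : X. \<rho> x : C})"
 proof (rule card_UN_disjoint[OF fin])
  show "\<forall>C\<in>S // r. \<forall>C'\<in>S // r. C ~= C' --> {x : X. \<rho> x : C} Int {x : X. \<rho> x : C'} = {}"
  proof (intro ballI impI)
   fix C1 C2 assume C12: "C1 : S // r" "C2 : S // r" "C1 ~= C2"
   then have "C1 : Obj // r" "C2 : Obj // r" using r(2) unfolding quotient_def by blast+
   then have "C1 Int C2 = {}" using quotient_disj[OF r(1)] C12(3) by blast
   then show "{x : X. \<rho> x : C1} Int {x : X. \<rho> x : C2} = {}" by blast
  qed
 qed (use X in simp)
 finally have "real (card X) / real n = (\<Sum>C\<in>S // r. real (card {x : X. \<rho> x : C}) / real n)"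
  by (simp add: sum_divide_distrib)
 also have "\<dots> = (\<Sum>C\<in>S // r. 1 / real (card (aut (?c C))))"
 proof (rule sum.cong[OF refl])
  fix C' assume C': "C' : S // r"
  have "real n = real (card {x : X. \<rho> x : C'}) * real (card (aut (?c C')))"
   using count[OF C'] of_nat_mult by metis
  moreover have "real n ~= 0" using fr(3) by simp
  ultimately show "real (card {x : X. \<rho> x : C'}) / real n = 1 / real (card (aut (?c C')))"
   by (auto simp: divide_simps)
 qed
 finally show ?thesis by simp
qed

section \<open>Representations given by matrices, and the classes cut out by a stability\<close>

context quiver
begin

text \<open>The block of entries that lead from \<open>B\<close> at the tail to \<open>A\<close> at
  the head; the row index comes first.\<close>

definition arrow_ix :: "('v => nat set) => ('v => nat set) => ('a \<times> nat \<times> nat) set"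
 where "arrow_ix A B = (SIGMA ar:arcs Q. A (head Q ar) \<times> B (tail Q ar))"

definition rho :: "('v => nat set) => ('a \<times> nat \<times> nat => 'k::field) => ('v, 'a, 'k) qrep"
 where "rho J x = \<lparr>vsp = kcf J, vmap = %ar. mat_app (J (head Q ar)) (J (tail Q ar)) (%i j. x (ar, i, j))\<rparr>"

lemma rho_simps [simp]:
 "vsp (rho J x) = kcf J"
 "vmap (rho J x) ar = mat_app (J (head Q ar)) (J (tail Q ar)) (%i j. x (ar, i, j))"
 by (simp_all add: rho_def)

lemma rep_rho:
 fixes x :: "'a \<times> nat \<times> nat => 'k::{field,finite}"
 assumes "!!i. i : verts Q ==> finite (J i)"
 shows "representation Q (rho J x)"
 unfolding representation_def
 using assms by (simp add: fd_subspace_iff subspace_coords finite_coords linear_between_mat_app)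

lemma rho_cong:
 assumes "!!p. p : arrow_ix J J ==> x p = y p"
 shows "subs Q (rho J x) = subs Q (rho J y)"
proof -
 have "vmap (rho J x) ar = vmap (rho J y) ar" if "ar : arcs Q" for ar
  using assms that by (auto simp: fun_eq_iff arrow_ix_def intro!: mat_app_cong)
 then show ?thesis
  unfolding subs_def subrepresentation_def by auto
qed

text \<open>The entries from \<open>A\<close> to \<open>B\<close> are the components with which
  images of unit vectors of \<open>coords A\<close> leave that space.\<close>

lemma kcf_sub_rho_iff:
 fixes x :: "'a \<times> nat \<times> nat => 'k::{field,finite}"
 assumes fin: "!!i. i : verts Q ==> finite (A i)" "!!i. i : verts Q ==> finite (B i)"
  "!!i. i : verts Q ==> A i Int B i = {}"
 shows "kcf A : subs Q (rho (%i. A i Un B i) x) \<longleftrightarrow> (\<forall>p\<in>arrow_ix B A. x p = 0)"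
proof
 assume s: "kcf A : subs Q (rho (%i. A i Un B i) x)"
 show "\<forall>p\<in>arrow_ix B A. x p = 0"
 proof
  fix p assume "p : arrow_ix B A"
  then obtain ar i j where p: "p = (ar, i, j)" "ar : arcs Q" "i : B (head Q ar)" "j : A (tail Q ar)"
   unfolding arrow_ix_def by blast
  have th: "tail Q ar : verts Q" "head Q ar : verts Q" using p(2) by auto
  have "unitv j : kcf A (tail Q ar)" using p th by simp
  then have "mat_app (A (head Q ar) Un B (head Q ar)) (A (tail Q ar) Un B (tail Q ar)) (%i j. x (ar, i, j)) (unitv j)
    : coords (A (head Q ar))"
   using subsD(5)[OF rep_rho s p(2)] fin th by simp
  moreover have "mat_app (A (head Q ar) Un B (head Q ar)) (A (tail Q ar) Un B (tail Q ar)) (%i j. x (ar, i, j)) (unitv j)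
    = comb (A (head Q ar) Un B (head Q ar)) (%i. x (ar, i, j))"
   using fin th p by (intro mat_app_unitv) auto
  moreover have "i ~: A (head Q ar)" using fin(3)[OF th(2)] p(3) by blast
  ultimately have "entry (comb (A (head Q ar) Un B (head Q ar)) (%i. x (ar, i, j))) i = 0"
   by (simp add: coords_def)
  then show "x p = 0" using fin th p by (simp add: lookup_comb)
 qed
next
 assume z: "\<forall>p\<in>arrow_ix B A. x p = 0"
 show "kcf A : subs Q (rho (%i. A i Un B i) x)"
 proof (rule subsI)
  fix i assume i: "i : verts Q"
  show "kvec.subspace (kcf A i)" using i by (simp add: subspace_coords)
  show "kcf A i <= vsp (rho (%i. A i Un B i) x) i" using i coords_mono[of "A i" "A i Un B i"] by simp
 next
  fix ar and y :: "'k vec" assume a: "ar : arcs Q" "y : kcf A (tail Q ar)"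
  have th: "tail Q ar : verts Q" "head Q ar : verts Q" using a by auto
  have y: "y : coords (A (tail Q ar))" using a th by simp
  have "(\<Sum>j\<in>A (tail Q ar) Un B (tail Q ar). x (ar, i, j) * entry y j) = 0" if i: "i : B (head Q ar)" for i
  proof (rule sum.neutral, rule ballI)
   fix j assume "j : A (tail Q ar) Un B (tail Q ar)"
   show "x (ar, i, j) * entry y j = 0"
    using z a i coords_lookup[OF y, of j] by (cases "j : A (tail Q ar)") (auto simp: arrow_ix_def)
  qed
  then show "vmap (rho (%i. A i Un B i) x) ar y : kcf A (head Q ar)"
   using th fin by (simp add: coords_def lookup_mat_app)
 qed simp
qed

text \<open>Every nonzero quotient has positive weight: the torsion class of representations with
  only positive Harder-Narasimhan slopes. \<open>fle\<close> and \<open>flt\<close> are bounds on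
  subrepresentations; with weight \<open>t\<close> minus \<mu> they bound slopes by \<mu>, and
  \<open>sst\<close> then means zero or semistable of slope \<mu>.\<close>

definition tors :: "('v => rat) => ('v, 'a, 'k::field, 'z) qrep_scheme => bool"
 where "tors t M \<longleftrightarrow> (\<forall>V\<in>subs Q M. V ~= onverts Q (vsp M) --> wdim Q t V < wdim Q t (onverts Q (vsp M)))"

definition fle :: "('v => rat) => ('v, 'a, 'k::field, 'z) qrep_scheme => bool"
 where "fle w M \<longleftrightarrow> (\<forall>V\<in>subs Q M. wdim Q w V <= 0)"

definition flt :: "('v => rat) => ('v, 'a, 'k::field, 'z) qrep_scheme => bool"
 where "flt w M \<longleftrightarrow> (\<forall>V\<in>subs Q M. V ~= (%_. {0}) --> wdim Q w V < 0)"

definition sst :: "('v => rat) => ('v, 'a, 'k::field, 'z) qrep_scheme => bool"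
 where "sst w M \<longleftrightarrow> fle w M & wdim Q w (onverts Q (vsp M)) = 0"

definition lmax :: "('v => rat) => ('v, 'a, 'k::field, 'z) qrep_scheme => ('v => 'k vec set) => bool"
 where "lmax w M U \<longleftrightarrow> U : subs Q M &
  (\<forall>V\<in>subs Q M. wdim Q w V <= wdim Q w U & (wdim Q w V = wdim Q w U --> V <= U))"

lemma lmax_eq:
 assumes "representation Q (M :: ('v, 'a, 'k::{field,finite}, 'z) qrep_scheme)"
 shows "lmax w M U = modular_lattice.largest_max (subs Q M) (wdim Q w) U"
 unfolding lmax_def modular_lattice.largest_max_def[OF modular_lattice_subs[OF assms]] ..

lemma ball_bij_betw: "bij_betw h S T ==> (\<forall>V\<in>T. P V) \<longleftrightarrow> (\<forall>V\<in>S. P (h V))"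
 unfolding bij_betw_def by blast

lemma wdim_shift: "wdim Q (%i. w i + \<mu>) V = wdim Q w V + \<mu> * wdim Q (%_. 1) V"
 unfolding wdim_def by (simp add: sum.distrib sum_distrib_left distrib_right)

text \<open>\<open>largest_max_iff\<close> read off the diagonal blocks of a block triangular
  system: the interval below \<open>kcf A\<close> is the lattice of the block \<open>A\<close>, the
  interval above it that of the block \<open>B\<close>. The subquotient lemma is applied to both,
  for the lower interval with empty index sets as the bottom.\<close>

lemma ord_split:
 fixes x :: "'a \<times> nat \<times> nat => 'k::{field,finite}"
 assumes fin: "!!i. i : verts Q ==> finite (A i)" "!!i. i : verts Q ==> finite (B i)"
   "!!i. i : verts Q ==> A i Int B i = {}"
  and z: "\<forall>p\<in>arrow_ix B A. x p = 0" and t: "!!i. t i = w i + \<mu>" "0 < \<mu>"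
 defines "M \<equiv> rho (%i. A i Un B i) x"
 shows "tors t M & fle w M & lmax w M (kcf A) \<longleftrightarrow>
  sst w (rho A x) & tors t (rho B x) & flt w (rho B x)"
proof -
 have fAB: "finite (A i Un B i)" if "i : verts Q" for i using fin that by simp
 have M: "representation Q M" unfolding M_def by (rule rep_rho[OF fAB])
 have MA: "representation Q (rho A x)" and MB: "representation Q (rho B x)"
  by (rule rep_rho, rule fin, assumption)+
 have U: "kcf A : subs Q M" unfolding M_def by (rule kcf_sub_rho_iff[OF fin, THEN iffD2, OF _ _ _ z])
 interpret modular_lattice "subs Q M" fsum finter "%_. {0}" "onverts Q (vsp M)"
  by (rule modular_lattice_subs[OF M])
 have kc0: "kcf (%_. {}) = (%_. {0 :: nat \<Rightarrow>\<^sub>0 'k})"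
  unfolding kcf_def by (intro onverts_eqI) simp_all
 have whole: "kcf (%i. A i Un B i) = onverts Q (vsp M)"
  unfolding M_def rho_simps by (rule ext) (simp add: kcf_def onverts_def)
 define \<Phi> where "\<Phi> V = onverts Q (%i. ssum (V i) (coords {} :: 'k vec set))" for V
 define \<Psi> where "\<Psi> V = onverts Q (%i. ssum (V i) (coords (A i) :: 'k vec set))" for V
 have mA: "vmap (rho A x) ar y = proj (A (head Q ar)) (vmap M ar y)"
  if "ar : arcs Q" "y : coords (A (tail Q ar))" for ar y
  unfolding M_def rho_simps
  by (rule proj_mat_app[symmetric]) (use that fAB in auto)
 have mB: "vmap (rho B x) ar y = proj (B (head Q ar)) (vmap M ar y)"
  if "ar : arcs Q" "y : coords (B (tail Q ar))" for ar y
  unfolding M_def rho_simps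
  by (rule proj_mat_app[symmetric]) (use that fAB in auto)
 have e: "finite {}" "{} Int A i = {}" for i :: 'v by simp_all
 have vA: "vsp (rho A x) i = coords (A i)" and vB: "vsp (rho B x) i = coords (B i)" if "i : verts Q" for i
  using that by simp_all
 have U0: "kcf (%_. {}) : subs Q M" and U1: "kcf (%i. {} Un A i) : subs Q M"
  and U2: "kcf (%i. A i Un B i) : subs Q M"
  using bt_in tp_in U kc0 whole by simp_all
 have A: "bij_betw \<Phi> (subs Q (rho A x)) {V : subs Q M. kcf (%_. {}) <= V & V <= kcf (%i. {} Un A i)}"
  "!!V u. V : subs Q (rho A x) ==> wdim Q u (\<Phi> V) = wdim Q u V + wdim Q u (kcf (%_. {}) :: 'v => 'k vec set)"
  "\<Phi> (%_. {0}) = kcf (%_. {})" "\<Phi> (onverts Q (vsp (rho A x))) = kcf (%i. {} Un A i)"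
  by (rule subquotient[OF M MA e(1) fin(1) e(2) vA mA U0 U1, folded \<Phi>_def]; assumption)+
 have B: "bij_betw \<Psi> (subs Q (rho B x)) {V : subs Q M. kcf A <= V & V <= kcf (%i. A i Un B i)}"
  "!!V u. V : subs Q (rho B x) ==> wdim Q u (\<Psi> V) = wdim Q u V + wdim Q u (kcf A :: 'v => 'k vec set)"
  "\<Psi> (%_. {0}) = kcf A" "\<Psi> (onverts Q (vsp (rho B x))) = kcf (%i. A i Un B i)"
  by (rule subquotient[OF M MB fin vB mB U U2, folded \<Psi>_def]; assumption)+
 have rA: "{V : subs Q M. kcf (%_. {}) <= V & V <= kcf (%i. {} Un A i)} = {V : subs Q M. V <= kcf A}"
  using bt_le unfolding kc0 by auto
 have rB: "{V : subs Q M. kcf A <= V & V <= kcf (%i. A i Un B i)} = {V : subs Q M. kcf A <= V}"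
  using tp_ge unfolding whole by auto
 have z0: "wdim Q u (%_. {0 :: nat \<Rightarrow>\<^sub>0 'k}) = 0" for u by (rule wdim_zero)
 have wA: "wdim Q u (\<Phi> V) = wdim Q u V" if "V : subs Q (rho A x)" for V u
  using A(2)[OF that, of u] unfolding kc0 z0 by simp
 have tB: "onverts Q (vsp (rho B x)) : subs Q (rho B x)" "(%_. {0}) : subs Q (rho B x)"
  and tA: "onverts Q (vsp (rho A x)) : subs Q (rho A x)"
  using modular_lattice.tp_in[OF modular_lattice_subs[OF MA]] modular_lattice.tp_in[OF modular_lattice_subs[OF MB]]
   modular_lattice.bt_in[OF modular_lattice_subs[OF MB]] by simp_all
 have injB: "\<Psi> V = \<Psi> W \<longleftrightarrow> V = W" if "V : subs Q (rho B x)" "W : subs Q (rho B x)" for V W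
  using bij_betw_imp_inj_on[OF B(1)] that by (auto dest: inj_onD)
 have r1: "((\<forall>V\<in>subs Q M. V <= kcf A --> wdim Q w V <= wdim Q w (%_. {0 :: nat \<Rightarrow>\<^sub>0 'k})) &
   wdim Q w (kcf A :: 'v => 'k vec set) = wdim Q w (%_. {0 :: nat \<Rightarrow>\<^sub>0 'k})) \<longleftrightarrow> sst w (rho A x)"
 proof -
  have "(\<forall>V\<in>{V : subs Q M. V <= kcf A}. wdim Q w V <= 0) \<longleftrightarrow> fle w (rho A x)"
   unfolding fle_def rA[symmetric] ball_bij_betw[OF A(1)] using wA by simp
  moreover have "wdim Q w (kcf A :: 'v => 'k vec set) = wdim Q w (onverts Q (vsp (rho A x)))"
   by simp
  ultimately show ?thesis unfolding sst_def z0 by auto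
 qed
 have r2: "(\<forall>V\<in>subs Q M. kcf A <= V --> V ~= onverts Q (vsp M) --> wdim Q t V < wdim Q t (onverts Q (vsp M)))
   \<longleftrightarrow> tors t (rho B x)"
 proof -
  have "(\<forall>V\<in>{V : subs Q M. kcf A <= V}. V ~= onverts Q (vsp M) --> wdim Q t V < wdim Q t (onverts Q (vsp M)))
   \<longleftrightarrow> tors t (rho B x)"
   unfolding tors_def ball_bij_betw[OF B(1), unfolded rB] B(4)[symmetric, unfolded whole]
   by (rule ball_cong[OF refl]) (simp only: B(2) tB injB add_less_cancel_right)
  then show ?thesis by auto
 qed
 have r3: "(\<forall>V\<in>subs Q M. kcf A <= V --> V ~= kcf A --> wdim Q w V < wdim Q w (kcf A :: 'v => 'k vec set))
   \<longleftrightarrow> flt w (rho B x)"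
 proof -
  have "(\<forall>V\<in>{V : subs Q M. kcf A <= V}. V ~= \<Psi> (%_. {0}) --> wdim Q w V < wdim Q w (\<Psi> (%_. {0})))
   \<longleftrightarrow> flt w (rho B x)"
   unfolding flt_def ball_bij_betw[OF B(1), unfolded rB]
   by (rule ball_cong[OF refl]) (simp only: B(2) tB injB add_less_cancel_right z0)
  then show ?thesis unfolding B(3) by auto
 qed
 have strict: "wdim Q t V < wdim Q t W"
  if "V : subs Q M" "W : subs Q M" "V <= W" "V ~= W" "wdim Q w V <= wdim Q w W" for V W
 proof -
  have "\<mu> * wdim Q (%_. 1) V < \<mu> * wdim Q (%_. 1) W"
   using wdim_strict_mono[OF M that(1-4)] t(2) by simp
  moreover have "t = (%i. w i + \<mu>)" using t(1) by (rule ext)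
  ultimately show ?thesis using that(5) by (simp add: wdim_shift)
 qed
 show ?thesis
 proof (rule trans[OF _ trans[OF largest_max_iff[OF modular_wdim[OF M, of t] modular_wdim[OF M, of w] U]]], goal_cases)
  case 1
  show ?case by (simp only: tors_def fle_def lmax_eq[OF M] z0)
 next
  case (2 V W)
  then show ?case by (rule strict)
 next
  case 3
  show ?case by (simp only: r1 r2 r3 conj_assoc)
 qed
qed

end

text \<open>Conditions on disjoint sets of entries are independent. This is how matrix systems are
  counted block by block.\<close>

lemma card_PiE_Un:
 assumes "X Int Y = {}" "S <= X \<rightarrow>\<^sub>E UNIV" "S' <= Y \<rightarrow>\<^sub>E UNIV"
 shows "card {x : X Un Y \<rightarrow>\<^sub>E UNIV. restrict x X : S & restrict x Y : S'} = card S * card S'"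
proof -
 have "bij_betw (%x. (restrict x X, restrict x Y))
  {x : X Un Y \<rightarrow>\<^sub>E UNIV. restrict x X : S & restrict x Y : S'} (S \<times> S')"
 proof (rule bij_betw_byWitness[where f' = "%(u, v). %p. if p : X then u p else v p"])
  show "\<forall>x\<in>{x : X Un Y \<rightarrow>\<^sub>E UNIV. restrict x X : S & restrict x Y : S'}.
    (case (restrict x X, restrict x Y) of (u, v) => %p. if p : X then u p else v p) = x"
   by (auto simp: fun_eq_iff PiE_def extensional_def)
  have *: "restrict (%p. if p : X then u p else v p) X = u" "restrict (%p. if p : X then u p else v p) Y = v"
   "(%p. if p : X then u p else v p) : X Un Y \<rightarrow>\<^sub>E UNIV" if "u : S" "v : S'" for u v
  proof -
   have u: "u : extensional X" and v: "v : extensional Y" using assms that by (auto simp: PiE_def)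
   show "restrict (%p. if p : X then u p else v p) X = u"
    by (rule extensionalityI[OF restrict_extensional u]) simp
   show "restrict (%p. if p : X then u p else v p) Y = v"
    using assms(1) by (intro extensionalityI[OF restrict_extensional v]) auto
   show "(%p. if p : X then u p else v p) : X Un Y \<rightarrow>\<^sub>E UNIV"
    using v by (simp add: PiE_def extensional_def)
  qed
  show "\<forall>p\<in>S \<times> S'. (restrict ((case p of (u, v) => %p. if p : X then u p else v p)) X,
    restrict ((case p of (u, v) => %p. if p : X then u p else v p)) Y) = p"
   using *(1,2) by auto
  show "(%(u, v). %p. if p : X then u p else v p) ` (S \<times> S')
    <= {x : X Un Y \<rightarrow>\<^sub>E UNIV. restrict x X : S & restrict x Y : S'}"
  proof (rule image_subsetI)
   fix p assume "p : S \<times> S'"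
   then obtain u v where p: "p = (u, v)" "u : S" "v : S'" by blast
   then show "(case p of (u, v) => %p. if p : X then u p else v p)
     : {x : X Un Y \<rightarrow>\<^sub>E UNIV. restrict x X : S & restrict x Y : S'}"
    using *[OF p(2,3)] by (simp only: p(1) prod.case mem_Collect_eq simp_thms)
  qed
 qed auto
 then show ?thesis by (simp add: bij_betw_same_card card_cartesian_product)
qed

lemma gl_0: "gl TYPE('k::{field,finite}) 0 = 1"
proof -
 have "Iso {0} {0} <= {0 :: nat \<Rightarrow>\<^sub>0 'k} \<rightarrow>\<^sub>E {0 :: nat \<Rightarrow>\<^sub>0 'k}"
  unfolding Iso_def Lin_def by blast
 then have "card (Iso {0} {0 :: nat \<Rightarrow>\<^sub>0 'k}) <= card ({0 :: nat \<Rightarrow>\<^sub>0 'k} \<rightarrow>\<^sub>E {0 :: nat \<Rightarrow>\<^sub>0 'k})"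
  by (intro card_mono finite_PiE) auto
 then have "card (Iso {0} {0 :: nat \<Rightarrow>\<^sub>0 'k}) <= 1"
  by (simp add: card_PiE)
 then show ?thesis using gl_pos[of 0, where 'k='k] unfolding gl_def by simp
qed

section \<open>Frames and masses of representations\<close>

context quiver
begin

definition Isos :: "('v, 'a, 'k::field, 'z) qrep_scheme => ('v, 'a, 'k, 'z) qrep_scheme =>
  ('v => 'k vec => 'k vec) set"
 where "Isos M N = {f : (\<Pi>\<^sub>E i\<in>verts Q. vsp M i \<rightarrow>\<^sub>E vsp N i). rep_iso Q M N f}"

text \<open>Frames ignore the arrows, so that their number depends on the dimension vector
  alone.\<close>

definition frames :: "('v => nat set) => ('v, 'a, 'k::field, 'z) qrep_scheme =>
  ('v => 'k vec => 'k vec) set"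
 where "frames J M = (\<Pi>\<^sub>E i\<in>verts Q. Iso (coords (J i)) (vsp M i))"

lemma IsosD: "f : Isos M N ==> rep_iso Q M N f"
 by (simp add: Isos_def)

lemma rep_iso_comp:
 assumes "rep_iso Q M N f" "rep_iso Q N P g"
 shows "rep_iso Q M P (%i x. g i (f i x))"
 unfolding rep_iso_def
proof (intro conjI ballI)
 fix i assume i: "i : verts Q"
 show "linear_between (vsp M i) (vsp P i) (%x. g i (f i x))"
  by (rule linear_between_comp[OF rep_isoD(1)[OF assms(1) i] rep_isoD(1)[OF assms(2) i]])
 show "bij_betw (%x. g i (f i x)) (vsp M i) (vsp P i)"
  using bij_betw_trans[OF rep_isoD(2)[OF assms(1) i] rep_isoD(2)[OF assms(2) i]] by (simp add: comp_def)
next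
 fix ar x assume a: "ar : arcs Q" "x : vsp M (tail Q ar)"
 have "f (tail Q ar) x : vsp N (tail Q ar)"
  using linear_between_in[OF rep_isoD(1)[OF assms(1) tail_in_verts[OF a(1)]] a(2)] .
 then show "g (head Q ar) (f (head Q ar) (vmap M ar x)) = vmap P ar (g (tail Q ar) (f (tail Q ar) x))"
  using rep_isoD(3)[OF assms(1) a] rep_isoD(3)[OF assms(2) a(1)] by simp
qed

lemma rep_iso_id: "representation Q M ==> rep_iso Q M M (%i x. x)"
 by (simp add: rep_iso_def linear_between_def bij_betw_def)

lemma rep_iso_cong:
 assumes "representation Q (M :: ('v, 'a, 'k::{field,finite}, 'z) qrep_scheme)"
  and eq: "!!i x. i : verts Q ==> x : vsp M i ==> f i x = g i x" and f: "rep_iso Q M N f"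
 shows "rep_iso Q M N g"
 unfolding rep_iso_def
proof (intro conjI ballI)
 fix i assume i: "i : verts Q"
 show "linear_between (vsp M i) (vsp N i) (g i)"
  using rep_isoD(1)[OF f i] linear_between_cong[OF repD(1)[OF assms(1) i], of "f i" "g i"] eq[OF i] by simp
 show "bij_betw (g i) (vsp M i) (vsp N i)"
  using rep_isoD(2)[OF f i] bij_betw_cong[of "vsp M i" "f i" "g i"] eq[OF i] by simp
next
 fix ar x assume a: "ar : arcs Q" "x : vsp M (tail Q ar)"
 then show "g (head Q ar) (vmap M ar x) = vmap N ar (g (tail Q ar) x)"
  using rep_isoD(3)[OF f a] eq[OF head_in_verts[OF a(1)] linear_between_in[OF rep_linear[OF assms(1) a(1)] a(2)]]
   eq[OF tail_in_verts[OF a(1)] a(2)] by simp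
qed

definition mkext :: "('v => ('k::field) vec set) => ('v => 'k vec => 'k vec) =>
  'v => 'k vec => 'k vec"
 where "mkext V f = (\<lambda>i\<in>verts Q. restrict (f i) (V i))"

lemma mkext_apply [simp]: "i : verts Q ==> x : V i ==> mkext V f i x = f i x"
 by (simp add: mkext_def)

lemma mkext_Isos:
 assumes "representation Q (M :: ('v, 'a, 'k::{field,finite}, 'z) qrep_scheme)" "rep_iso Q M N f"
 shows "mkext (vsp M) f : Isos M N"
 unfolding Isos_def
proof (intro CollectI conjI)
 show "mkext (vsp M) f : (\<Pi>\<^sub>E i\<in>verts Q. vsp M i \<rightarrow>\<^sub>E vsp N i)"
  unfolding mkext_def restrict_PiE_iff using linear_between_in[OF rep_isoD(1)[OF assms(2)]] by simp
 show "rep_iso Q M N (mkext (vsp M) f)"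
  by (rule rep_iso_cong[OF assms(1) _ assms(2)]) simp
qed

lemma Isos_eqI:
 assumes "f : (\<Pi>\<^sub>E i\<in>verts Q. V i \<rightarrow>\<^sub>E W i)" "g : (\<Pi>\<^sub>E i\<in>verts Q. V i \<rightarrow>\<^sub>E W' i)"
  and "!!i x. i : verts Q ==> x : V i ==> f i x = g i x"
 shows "f = g"
proof (rule extensionalityI[of f "verts Q"])
 show "f : extensional (verts Q)" "g : extensional (verts Q)" using assms(1,2) by (auto simp: PiE_iff)
 fix i assume i: "i : verts Q"
 have "f i : extensional (V i)" "g i : extensional (V i)"
  using PiE_mem[OF assms(1) i] PiE_mem[OF assms(2) i] by (auto simp: PiE_iff)
 then show "f i = g i" by (rule extensionalityI) (rule assms(3)[OF i])
qed

lemma bij_betw_Isos_comp: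
 fixes M N :: "('v, 'a, 'k::{field,finite}, 'z) qrep_scheme"
 assumes M: "representation Q M" and N: "representation Q N" and f: "rep_iso Q M N f"
 shows "bij_betw (%h. mkext (vsp M) (%i x. h i (f i x))) (Isos N P) (Isos M P)"
proof (rule bij_betw_byWitness[where f' = "%h. mkext (vsp N) (%i x. h i (the_inv_into (vsp M i) (f i) x))"])
 note g = rep_iso_inv[OF M f]
 have fin: "f i x : vsp N i" if "i : verts Q" "x : vsp M i" for i x
  using linear_between_in[OF rep_isoD(1)[OF f that(1)] that(2)] .
 have gin: "the_inv_into (vsp M i) (f i) x : vsp M i" if "i : verts Q" "x : vsp N i" for i x
  using linear_between_in[OF rep_isoD(1)[OF g that(1)] that(2)] .
 have fg: "f i (the_inv_into (vsp M i) (f i) x) = x" if "i : verts Q" "x : vsp N i" for i x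
  using f_the_inv_into_f_bij_betw[OF rep_isoD(2)[OF f that(1)]] that(2) by blast
 have gf: "the_inv_into (vsp M i) (f i) (f i x) = x" if "i : verts Q" "x : vsp M i" for i x
  using the_inv_into_f_f[OF bij_betw_imp_inj_on[OF rep_isoD(2)[OF f that(1)]] that(2)] .
 have i1: "mkext (vsp M) (%i x. h i (f i x)) : Isos M P" if "h : Isos N P" for h
  by (rule mkext_Isos[OF M rep_iso_comp[OF f IsosD[OF that]]])
 have i2: "mkext (vsp N) (%i x. h i (the_inv_into (vsp M i) (f i) x)) : Isos N P" if "h : Isos M P" for h
  by (rule mkext_Isos[OF N rep_iso_comp[OF g IsosD[OF that]]])
 show "(%h. mkext (vsp M) (%i x. h i (f i x))) ` Isos N P <= Isos M P" using i1 by blast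
 show "(%h. mkext (vsp N) (%i x. h i (the_inv_into (vsp M i) (f i) x))) ` Isos M P <= Isos N P"
  using i2 by blast
 show "\<forall>h\<in>Isos N P. mkext (vsp N) (%i x. mkext (vsp M) (%i x. h i (f i x)) i (the_inv_into (vsp M i) (f i) x)) = h"
 proof
  fix h assume h: "h : Isos N P"
  show "mkext (vsp N) (%i x. mkext (vsp M) (%i x. h i (f i x)) i (the_inv_into (vsp M i) (f i) x)) = h"
   using i2[OF i1[OF h]] h by (intro Isos_eqI[of _ "vsp N" "vsp P" _ "vsp P"]) (auto simp: Isos_def gin fg)
 qed
 show "\<forall>h\<in>Isos M P. mkext (vsp M) (%i x. mkext (vsp N) (%i x. h i (the_inv_into (vsp M i) (f i) x)) i (f i x)) = h"
 proof
  fix h assume h: "h : Isos M P"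
  show "mkext (vsp M) (%i x. mkext (vsp N) (%i x. h i (the_inv_into (vsp M i) (f i) x)) i (f i x)) = h"
   using i1[OF i2[OF h]] h by (intro Isos_eqI[of _ "vsp M" "vsp P" _ "vsp P"]) (auto simp: Isos_def fin gf)
 qed
qed

lemma equiv_iso_rel: "equiv {U :: ('v, 'a, 'k::{field,finite}) qrep. representation Q U} (iso_rel Q)"
proof (rule equivI)
 show "refl_on {U :: ('v, 'a, 'k) qrep. representation Q U} (iso_rel Q)"
  using rep_iso_id by (auto simp: refl_on_def iso_rel_def)
 show "sym (iso_rel Q :: (('v, 'a, 'k) qrep \<times> _) set)"
  unfolding sym_def iso_rel_def using rep_iso_inv by blast
 show "trans (iso_rel Q :: (('v, 'a, 'k) qrep \<times> _) set)"
  unfolding trans_def iso_rel_def using rep_iso_comp by blast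
qed (auto simp: iso_rel_def)

text \<open>Conjugation by the frame: the entries of \<open>x\<close> are those of the arrow maps
  written in the frame, and evaluation at unit vectors shows that there is no other choice.\<close>

lemma frame_lifts:
 fixes M :: "('v, 'a, 'k::{field,finite}) qrep"
 assumes M: "representation Q M" and J: "!!i. i : verts Q ==> finite (J i)" and ph: "ph : frames J M"
 shows "\<exists>!x. x : arrow_ix J J \<rightarrow>\<^sub>E UNIV & ph : Isos (rho J x) M"
proof -
 have I: "linear_between (coords (J i)) (vsp M i) (ph i)" "bij_betw (ph i) (coords (J i)) (vsp M i)"
  "ph i : coords (J i) \<rightarrow>\<^sub>E vsp M i" if "i : verts Q" for i
  using PiE_mem[OF ph[unfolded frames_def] that] by (auto simp: Iso_def Lin_def)
 have ext: "ph : (\<Pi>\<^sub>E i\<in>verts Q. vsp (rho J x) i \<rightarrow>\<^sub>E vsp M i)" for x :: "'a \<times> nat \<times> nat => 'k"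
  using ph I(3) by (auto simp: frames_def PiE_iff)
 let ?g = "%ar y. the_inv_into (coords (J (head Q ar))) (ph (head Q ar)) (vmap M ar (ph (tail Q ar) y))"
 define x where "x = restrict (%(ar, i, j). entry (?g ar (unitv j)) i) (arrow_ix J J)"
 have g: "linear_between (coords (J (tail Q ar))) (coords (J (head Q ar))) (?g ar)" if a: "ar : arcs Q" for ar
  by (rule linear_between_comp[OF linear_between_comp[OF I(1) rep_linear[OF M a]]
   linear_between_inv[OF I(1,2) subspace_coords]]) (use a in auto)
 have x: "x : arrow_ix J J \<rightarrow>\<^sub>E UNIV" by (simp add: x_def)
 have "rep_iso Q (rho J x) M ph"
  unfolding rep_iso_def
 proof (intro conjI ballI)
  fix i assume "i : verts Q"
  then show "linear_between (vsp (rho J x) i) (vsp M i) (ph i)" "bij_betw (ph i) (vsp (rho J x) i) (vsp M i)"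
   using I by simp_all
 next
  fix ar y assume a: "ar : arcs Q" and y: "y : vsp (rho J x) (tail Q ar)"
  have th: "tail Q ar : verts Q" "head Q ar : verts Q" using a by auto
  have y': "y : coords (J (tail Q ar))" using y th by simp
  have "vmap (rho J x) ar y = ?g ar y"
   unfolding rho_simps by (rule mat_app_of_linear[OF g[OF a] J J y']) (use th a in \<open>auto simp: x_def arrow_ix_def\<close>)
  moreover have "ph (head Q ar) (?g ar y) = vmap M ar (ph (tail Q ar) y)"
   by (rule f_the_inv_into_f_bij_betw[OF I(2)[OF th(2)]])
    (use linear_between_in[OF rep_linear[OF M a]] linear_between_in[OF I(1)[OF th(1)] y'] in blast)
  ultimately show "ph (head Q ar) (vmap (rho J x) ar y) = vmap M ar (ph (tail Q ar) y)" by simp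
 qed
 then have "ph : Isos (rho J x) M" using ext unfolding Isos_def by blast
 moreover have "x1 = x2" if x1: "x1 : arrow_ix J J \<rightarrow>\<^sub>E UNIV" "ph : Isos (rho J x1) M"
  and x2: "x2 : arrow_ix J J \<rightarrow>\<^sub>E UNIV" "ph : Isos (rho J x2) M" for x1 x2
 proof (rule PiE_ext[OF x1(1) x2(1)])
  fix p assume "p : arrow_ix J J"
  then obtain ar i j where p: "p = (ar, i, j)" "ar : arcs Q" "i : J (head Q ar)" "j : J (tail Q ar)"
   unfolding arrow_ix_def by blast
  have th: "tail Q ar : verts Q" "head Q ar : verts Q" using p by auto
  have e: "unitv j : vsp (rho J x') (tail Q ar)" for x' :: "'a \<times> nat \<times> nat => 'k"
   using p th by simp
  have "ph (head Q ar) (vmap (rho J x1) ar (unitv j)) = ph (head Q ar) (vmap (rho J x2) ar (unitv j))"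
   using rep_isoD(3)[OF IsosD[OF x1(2)] p(2) e] rep_isoD(3)[OF IsosD[OF x2(2)] p(2) e] by simp
  then have "vmap (rho J x1) ar (unitv j) = vmap (rho J x2) ar (unitv j)"
   by (rule inj_onD[OF bij_betw_imp_inj_on[OF I(2)[OF th(2)]]]) (simp_all add: J[OF th(2)])
  then have "comb (J (head Q ar)) (%i. x1 (ar, i, j)) = comb (J (head Q ar)) (%i. x2 (ar, i, j))"
   unfolding rho_simps mat_app_unitv[OF J[OF th(1)] p(4)] .
  then have "entry (comb (J (head Q ar)) (%i. x1 (ar, i, j))) i =
    entry (comb (J (head Q ar)) (%i. x2 (ar, i, j))) i"
   by (rule arg_cong)
  then show "x1 p = x2 p" using p J[OF th(2)] by (simp add: lookup_comb)
 qed
 ultimately show ?thesis using x by blast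
qed

lemma Isos_subset_frames:
 assumes "!!i. i : verts Q ==> vsp N i = coords (J i)"
 shows "Isos N M <= frames J M"
proof
 fix f assume f: "f : Isos N M"
 have "f i : Iso (coords (J i)) (vsp M i)" if i: "i : verts Q" for i
  using f rep_isoD(1,2)[OF IsosD[OF f] i] i assms[OF i] by (auto simp: Isos_def Iso_def Lin_def PiE_iff)
 moreover have "f : extensional (verts Q)" using f by (auto simp: Isos_def PiE_iff)
 ultimately show "f : frames J M" unfolding frames_def PiE_iff by blast
qed

definition dims :: "('v, 'a, 'k::field, 'z) qrep_scheme => ('v => nat) => bool"
 where "dims M d \<longleftrightarrow> (\<forall>i\<in>verts Q. kvec.dim (vsp M i) = d i)"

lemma card_frames:
 fixes M :: "('v, 'a, 'k::{field,finite}, 'z) qrep_scheme"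
 assumes M: "representation Q M" and J: "!!i. i : verts Q ==> finite (J i)" and d: "dims M (%i. card (J i))"
 shows "card (frames J M) = (\<Prod>i\<in>verts Q. gl TYPE('k) (card (J i)))" "finite (frames J M)"
proof -
 have "card (Iso (coords (J i)) (vsp M i)) = gl TYPE('k) (card (J i))" if i: "i : verts Q" for i
  using card_Iso[OF subspace_coords finite_coords[OF J[OF i]] repD[OF M i]] d i J[OF i]
  by (simp add: dims_def dim_coords)
 then show "card (frames J M) = (\<Prod>i\<in>verts Q. gl TYPE('k) (card (J i)))"
  unfolding frames_def by (simp add: card_PiE)
 show "finite (frames J M)"
  unfolding frames_def using J repD(2)[OF M] by (intro finite_PiE finite_Iso finite_coords) auto
qed

text \<open>The groupoid cardinality of \<open>S\<close>, used for sets \<open>S\<close> closed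
  under isomorphism.\<close>

definition mass :: "('v, 'a, 'k::{field,finite}) qrep set => real"
 where "mass S = (\<Sum>C\<in>S // iso_rel Q. 1 / real (card (Aut Q (SOME U. U : C))))"

text \<open>\<open>FR\<close> selects the frames adapted to a structure that every member of
  \<open>S\<close> carries canonically, such as a distinguished subrepresentation; \<open>X\<close>
  consists of the systems for which that structure is in standard position.\<close>

lemma mass_eq:
 fixes S :: "('v, 'a, 'k::{field,finite}) qrep set"
 assumes J: "!!i. i : verts Q ==> finite (J i)"
  and S: "!!M. M : S ==> representation Q M" "!!M. M : S ==> dims M (%i. card (J i))"
   "!!M N f. M : S ==> representation Q N ==> rep_iso Q M N f ==> N : S"
  and X: "X <= arrow_ix J J \<rightarrow>\<^sub>E UNIV" "!!x. x : X ==> rho J x : S"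
  and FR: "!!M. M : S ==> FR M <= frames J M" "!!M. M : S ==> card (FR M) = n" "0 < n"
   "!!M x ph. M : S ==> x : arrow_ix J J \<rightarrow>\<^sub>E UNIV ==> ph : FR M ==> ph : Isos (rho J x) M ==> x : X"
   "!!M x ph. M : S ==> x : X ==> ph : Isos (rho J x) M ==> ph : FR M"
 shows "mass S = real (card X) / real n"
 unfolding mass_def
proof (rule groupoid_mass[where iso = Isos and fr = FR and \<rho> = "rho J", OF _ X(2) equiv_iso_rel])
 have "finite (arrow_ix J J)"
  unfolding arrow_ix_def using J by (intro finite_SigmaI finite_cartesian_product) auto
 then show "finite X" using finite_subset[OF X(1)] finite_PiE[of "arrow_ix J J" "%_. UNIV :: 'k set"] by simp
 show "S <= {U. representation Q U}" using S(1) by blast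
 show "!!M N. M : S ==> (M, N) : iso_rel Q ==> N : S" using S(3) unfolding iso_rel_def by blast
 show "!!M. M : S ==> finite (FR M)" by (rule finite_subset[OF FR(1) card_frames(2)[OF S(1) J S(2)]])
 show "!!M. M : S ==> card (FR M) = n" "0 < n" by (fact FR)+
 show "\<exists>!x. x : X & ph : Isos (rho J x) M" if "M : S" "ph : FR M" for M ph
 proof -
  from frame_lifts[OF S(1)[OF that(1)] J subsetD[OF FR(1)[OF that(1)] that(2)]]
  obtain x where x': "x : arrow_ix J J \<rightarrow>\<^sub>E UNIV & ph : Isos (rho J x) M"
   "\<forall>y. y : arrow_ix J J \<rightarrow>\<^sub>E UNIV & ph : Isos (rho J y) M --> y = x" by (rule ex1E)
  note x = conjunct1[OF x'(1)] conjunct2[OF x'(1)]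
  show ?thesis
  proof (rule ex1I[of _ x])
   show "x : X & ph : Isos (rho J x) M" using FR(4)[OF that(1) x(1) that(2) x(2)] x(2) by blast
   show "y = x" if "y : X & ph : Isos (rho J y) M" for y
    using x'(2)[rule_format, of y] subsetD[OF X(1), of y] that by simp
  qed
 qed
 show "Isos (rho J x) M <= FR M" if "x : X" "M : S" for x M using FR(5)[OF that(2,1)] by blast
 show "card (Isos (rho J x) M) = card (Aut Q M)" if x: "x : X" and M: "M : S" and r: "(M, rho J x) : iso_rel Q" for x M
 proof -
  obtain f where "rep_iso Q M (rho J x) f" using r unfolding iso_rel_def by blast
  from rep_iso_inv[OF S(1)[OF M] this]
  obtain g where g: "rep_iso Q (rho J x) M g" by blast
  have "Aut Q M = Isos M M" unfolding Aut_def Isos_def ..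
  then show ?thesis
   using bij_betw_same_card[OF bij_betw_Isos_comp[OF S(1)[OF X(2)[OF x]] S(1)[OF M] g]] by simp
 qed
 show "(M, rho J x) : iso_rel Q" if x: "x : X" and M: "M : S" and ne: "Isos (rho J x) M ~= {}" for x M
  proof -
  obtain f where "f : Isos (rho J x) M" using ne by blast
  from rep_iso_inv[OF S(1)[OF X(2)[OF x]] IsosD[OF this]] show ?thesis
   unfolding iso_rel_def using S(1)[OF M] S(1)[OF X(2)[OF x]] by blast
 qed
qed

lemma mass_full:
 fixes S :: "('v, 'a, 'k::{field,finite}) qrep set"
 assumes J: "!!i. i : verts Q ==> finite (J i)"
  and S: "!!M. M : S ==> representation Q M" "!!M. M : S ==> dims M (%i. card (J i))"
   "!!M N f. M : S ==> representation Q N ==> rep_iso Q M N f ==> N : S"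
 shows "mass S = real (card {x : arrow_ix J J \<rightarrow>\<^sub>E UNIV. rho J x : S}) / real (\<Prod>i\<in>verts Q. gl TYPE('k) (card (J i)))"
proof (rule mass_eq[where FR = "frames J", OF J S])
 show "card (frames J M) = (\<Prod>i\<in>verts Q. gl TYPE('k) (card (J i)))" if "M : S" for M
  by (rule card_frames(1)[OF S(1)[OF that] J S(2)[OF that]])
 show "x : {x : arrow_ix J J \<rightarrow>\<^sub>E UNIV. rho J x : S}"
  if "M : S" "x : arrow_ix J J \<rightarrow>\<^sub>E UNIV" "ph : Isos (rho J x) M" for M x ph
  using that S(3)[OF that(1) rep_rho[OF J] rep_iso_inv[OF rep_rho[OF J] IsosD[OF that(3)]]] by blast
 show "ph : frames J M" if "ph : Isos (rho J x) M" for M x ph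
  using Isos_subset_frames[of "rho J x" J M] that by auto
qed (auto intro!: prod_pos gl_pos)

lemma fimg_iso_wdim:
 fixes M N :: "('v, 'a, 'k::{field,finite}, 'z) qrep_scheme"
 assumes M: "representation Q M" and N: "representation Q N" and f: "rep_iso Q M N f"
 shows "wdim Q w (onverts Q (vsp N)) = wdim Q w (onverts Q (vsp M))"
 using fimg_in_subs(2)[OF M f modular_lattice.tp_in[OF modular_lattice_subs[OF M]]] fimg_whole[OF f] by metis

lemma fimg_inj:
 fixes M N :: "('v, 'a, 'k::{field,finite}, 'z) qrep_scheme"
 assumes M: "representation Q M" and N: "representation Q N" and f: "rep_iso Q M N f"
  and V: "V : subs Q M" "W : subs Q M"
 shows "fimg f V = fimg f W \<longleftrightarrow> V = W"
 using inj_onD[OF bij_betw_imp_inj_on[OF bij_betw_fimg[OF M N f]] _ V] by blast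

lemma tors_iso:
 fixes M N :: "('v, 'a, 'k::{field,finite}, 'z) qrep_scheme"
 assumes M: "representation Q M" and N: "representation Q N" and f: "rep_iso Q M N f"
 shows "tors t N \<longleftrightarrow> tors t M"
 unfolding tors_def ball_bij_betw[OF bij_betw_fimg[OF M N f]] fimg_iso_wdim[OF M N f]
 unfolding fimg_whole[OF f, symmetric]
proof (rule ball_cong[OF refl])
 fix V assume V: "V : subs Q M"
 show "(fimg f V ~= fimg f (onverts Q (vsp M)) --> wdim Q t (fimg f V) < wdim Q t (onverts Q (vsp M))) \<longleftrightarrow>
   (V ~= onverts Q (vsp M) --> wdim Q t V < wdim Q t (onverts Q (vsp M)))"
  unfolding fimg_in_subs(2)[OF M f V]
   fimg_inj[OF M N f V modular_lattice.tp_in[OF modular_lattice_subs[OF M]]] ..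
qed

lemma fle_iso:
 fixes M N :: "('v, 'a, 'k::{field,finite}, 'z) qrep_scheme"
 assumes M: "representation Q M" and N: "representation Q N" and f: "rep_iso Q M N f"
 shows "fle w N \<longleftrightarrow> fle w M"
 unfolding fle_def ball_bij_betw[OF bij_betw_fimg[OF M N f]]
 by (rule ball_cong[OF refl]) (simp add: fimg_in_subs(2)[OF M f])

lemma flt_iso:
 fixes M N :: "('v, 'a, 'k::{field,finite}, 'z) qrep_scheme"
 assumes M: "representation Q M" and N: "representation Q N" and f: "rep_iso Q M N f"
 shows "flt w N \<longleftrightarrow> flt w M"
 unfolding flt_def ball_bij_betw[OF bij_betw_fimg[OF M N f]]
proof (rule ball_cong[OF refl])
 fix V assume V: "V : subs Q M"
 have "fimg f V = fimg f (%_. {0}) \<longleftrightarrow> V = (%_. {0})"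
  by (rule fimg_inj[OF M N f V modular_lattice.bt_in[OF modular_lattice_subs[OF M]]])
 then show "(fimg f V ~= (%_. {0}) --> wdim Q w (fimg f V) < 0) \<longleftrightarrow>
   (V ~= (%_. {0}) --> wdim Q w V < 0)"
  unfolding fimg_zero[OF M f] fimg_in_subs(2)[OF M f V] by simp
qed

lemma sst_iso:
 fixes M N :: "('v, 'a, 'k::{field,finite}, 'z) qrep_scheme"
 assumes M: "representation Q M" and N: "representation Q N" and f: "rep_iso Q M N f"
 shows "sst w N \<longleftrightarrow> sst w M"
 unfolding sst_def fle_iso[OF assms] fimg_iso_wdim[OF assms] ..

lemma dims_iso:
 fixes M N :: "('v, 'a, 'k::{field,finite}, 'z) qrep_scheme"
 assumes M: "representation Q M" and N: "representation Q N" and f: "rep_iso Q M N f"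
 shows "dims N d \<longleftrightarrow> dims M d"
 unfolding dims_def
proof (rule ball_cong[OF refl])
 fix i assume i: "i : verts Q"
 have "kvec.dim (f i ` vsp M i) = kvec.dim (vsp M i)"
  by (rule dim_image_inj[OF rep_isoD(1)[OF f i] bij_betw_imp_inj_on[OF rep_isoD(2)[OF f i]] repD[OF M i]])
 then show "kvec.dim (vsp N i) = d i \<longleftrightarrow> kvec.dim (vsp M i) = d i"
  using bij_betw_imp_surj_on[OF rep_isoD(2)[OF f i]] by simp
qed

lemma lmax_iso:
 fixes M N :: "('v, 'a, 'k::{field,finite}, 'z) qrep_scheme"
 assumes M: "representation Q M" and N: "representation Q N" and f: "rep_iso Q M N f" and U: "U : subs Q M"
 shows "lmax w N (fimg f U) \<longleftrightarrow> lmax w M U"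
 unfolding lmax_def ball_bij_betw[OF bij_betw_fimg[OF M N f]]
 using U fimg_in_subs(1)[OF M f U]
 by (simp add: fimg_in_subs(2)[OF M f] fimg_le_iff[OF M f] cong: ball_cong)

lemma dims_rho:
 fixes x :: "'a \<times> nat \<times> nat => 'k::{field,finite}"
 shows "(!!i. i : verts Q ==> finite (J i)) ==> dims (rho J x) (%i. card (J i))"
 by (simp add: dims_def dim_coords)

text \<open>A diagonal block is counted as a function extensional on its own index set, but arises
  by restriction from a larger system; the stability conditions see only the entries of the
  block.\<close>

lemma rho_restrict:
 fixes x :: "'a \<times> nat \<times> nat => 'k::field"
 shows "tors t (rho J (restrict x (arrow_ix J J))) = tors t (rho J x)"
  "fle w (rho J (restrict x (arrow_ix J J))) = fle w (rho J x)"
  "flt w (rho J (restrict x (arrow_ix J J))) = flt w (rho J x)"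
  "sst w (rho J (restrict x (arrow_ix J J))) = sst w (rho J x)"
proof -
 have s: "subs Q (rho J (restrict x (arrow_ix J J))) = subs Q (rho J x)" by (rule rho_cong) simp
 show "tors t (rho J (restrict x (arrow_ix J J))) = tors t (rho J x)"
  "fle w (rho J (restrict x (arrow_ix J J))) = fle w (rho J x)"
  "flt w (rho J (restrict x (arrow_ix J J))) = flt w (rho J x)"
  "sst w (rho J (restrict x (arrow_ix J J))) = sst w (rho J x)"
  unfolding tors_def fle_def flt_def sst_def s by simp_all
qed

definition ss_reps :: "('v => rat) => ('v => nat) => ('v, 'a, 'k::{field,finite}) qrep set"
 where "ss_reps w d = {M. representation Q M & sst w M & dims M d}"

definition lt_reps :: "('v => rat) => ('v => rat) => ('v => nat) => ('v, 'a, 'k::{field,finite}) qrep set"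
 where "lt_reps t w d = {M. representation Q M & tors t M & flt w M & dims M d}"

definition le_reps :: "('v => rat) => ('v => rat) => ('v => nat) => ('v, 'a, 'k::{field,finite}) qrep set"
 where "le_reps t w d = {M. representation Q M & tors t M & fle w M & dims M d}"

text \<open>On \<open>le_reps\<close> the weight \<open>w\<close> is at most 0 and vanishes at the
  zero subrepresentation, so the largest maximiser is the largest subrepresentation of weight 0; for
  \<open>w\<close> equal to \<open>t\<close> minus \<mu> this is the largest one of slope \<mu>, or
  zero.\<close>

definition type_reps :: "('v => rat) => ('v => rat) => ('v => nat) => ('v => nat) => ('v, 'a, 'k::{field,finite}) qrep set"
 where "type_reps t w c d = {M : le_reps t w c. \<exists>U. lmax w M U & (\<forall>i\<in>verts Q. kvec.dim (U i) = d i)}"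

lemma reps_closed:
 fixes M :: "('v, 'a, 'k::{field,finite}) qrep"
 assumes N: "representation Q N" and f: "rep_iso Q M N f"
 shows "M : ss_reps w d ==> N : ss_reps w d"
  "M : lt_reps t w d ==> N : lt_reps t w d"
  "M : le_reps t w d ==> N : le_reps t w d"
  "M : type_reps t w c d ==> N : type_reps t w c d"
proof -
 show 1: "M : ss_reps w d ==> N : ss_reps w d"
  "M : lt_reps t w d ==> N : lt_reps t w d" for d
  unfolding ss_reps_def lt_reps_def
  using tors_iso[OF _ N f] fle_iso[OF _ N f] flt_iso[OF _ N f] sst_iso[OF _ N f] dims_iso[OF _ N f] N by blast+
 show 2: "M : le_reps t w d ==> N : le_reps t w d" for d
  unfolding le_reps_def using tors_iso[OF _ N f] fle_iso[OF _ N f] dims_iso[OF _ N f] N by blast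
 assume M: "M : type_reps t w c d"
 then have rM: "representation Q M" by (simp add: type_reps_def le_reps_def)
 from M obtain U where U: "lmax w M U" "\<forall>i\<in>verts Q. kvec.dim (U i) = d i" by (auto simp: type_reps_def)
 have Us: "U : subs Q M" using U(1) by (simp add: lmax_def)
 have "kvec.dim (fimg f U i) = d i" if i: "i : verts Q" for i
 proof -
  have "linear_between (U i) (vsp N i) (f i)"
   by (rule linear_between_mono[OF rep_isoD(1)[OF f i] subsD(3)[OF rM Us i]])
    (use linear_between_in[OF rep_isoD(1)[OF f i]] subsD(3)[OF rM Us i] in blast)
  moreover have "inj_on (f i) (U i)"
   by (rule inj_on_subset[OF bij_betw_imp_inj_on[OF rep_isoD(2)[OF f i]] subsD(3)[OF rM Us i]])
  ultimately show ?thesis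
   using dim_image_inj[OF _ _ subsD(1,2)[OF rM Us]] U(2) i by (simp add: fimg_def)
 qed
 moreover have "lmax w N (fimg f U)" using lmax_iso[OF rM N f Us] U(1) by simp
 ultimately show "N : type_reps t w c d" using 2 M unfolding type_reps_def by blast
qed

lemma card_flagged_frames:
 fixes M :: "('v, 'a, 'k::{field,finite}) qrep"
 assumes M: "representation Q M" and fin: "!!i. i : verts Q ==> finite (A i)" "!!i. i : verts Q ==> finite (B i)"
   "!!i. i : verts Q ==> A i Int B i = {}"
  and d: "dims M (%i. card (A i Un B i))" and U: "U : subs Q M" "!!i. i : verts Q ==> kvec.dim (U i) = card (A i)"
 shows "card {ph : frames (%i. A i Un B i) M. fimg ph (kcf A) = U} =
  (\<Prod>i\<in>verts Q. gl TYPE('k) (card (A i)) * gl TYPE('k) (card (B i)) * CARD('k) ^ (card (A i) * card (B i)))"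
proof -
 have "{ph : frames (%i. A i Un B i) M. fimg ph (kcf A) = U} =
  (\<Pi>\<^sub>E i\<in>verts Q. {f : Iso (coords (A i Un B i)) (vsp M i). f ` coords (A i) = U i})"
 proof (intro equalityI subsetI)
  fix ph assume p: "ph : {ph : frames (%i. A i Un B i) M. fimg ph (kcf A) = U}"
  have "ph i ` coords (A i) = U i" if "i : verts Q" for i
  proof -
   have "fimg ph (kcf A) i = U i" using p by simp
   then show ?thesis using that by (simp add: fimg_def)
  qed
  then show "ph : (\<Pi>\<^sub>E i\<in>verts Q. {f : Iso (coords (A i Un B i)) (vsp M i). f ` coords (A i) = U i})"
   using p by (simp add: frames_def PiE_iff)
 next
  fix ph assume p: "ph : (\<Pi>\<^sub>E i\<in>verts Q. {f : Iso (coords (A i Un B i)) (vsp M i). f ` coords (A i) = U i})"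
  have "fimg ph (kcf A) = U"
   unfolding fimg_def using p subsD(4)[OF M U(1)] by (intro onverts_eqI) (simp_all add: PiE_iff)
  then show "ph : {ph : frames (%i. A i Un B i) M. fimg ph (kcf A) = U}"
   using p by (simp add: frames_def PiE_iff)
 qed
 also have "card \<dots> = (\<Prod>i\<in>verts Q. card {f : Iso (coords (A i Un B i)) (vsp M i). f ` coords (A i) = U i})"
  by (simp add: card_PiE)
 also have "\<dots> = (\<Prod>i\<in>verts Q. gl TYPE('k) (card (A i)) * gl TYPE('k) (card (B i)) * CARD('k) ^ (card (A i) * card (B i)))"
 proof (rule prod.cong[OF refl])
  fix i assume i: "i : verts Q"
  \<comment> \<open>An empty third block turns the count for two-step flags into the count for a
    single subspace.\<close>
  have "{f : Iso (coords (A i Un B i Un {})) (vsp M i). f ` coords (A i) = U i & f ` coords (A i Un B i) = vsp M i}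
   = {f : Iso (coords (A i Un B i)) (vsp M i). f ` coords (A i) = U i}"
  proof -
   have "f ` coords (A i Un B i) = vsp M i" if "f : Iso (coords (A i Un B i)) (vsp M i)" for f
    by (rule bij_betw_imp_surj_on[OF IsoD(3)[OF that]])
   then show ?thesis by auto
  qed
  moreover have "card {f : Iso (coords (A i Un B i Un {})) (vsp M i). f ` coords (A i) = U i & f ` coords (A i Un B i) = vsp M i}
   = gl TYPE('k) (card (A i)) * gl TYPE('k) (card (B i)) * gl TYPE('k) (card ({} :: nat set)) *
    CARD('k) ^ (card (A i) * card (B i) + card (A i) * card ({} :: nat set) + card (B i) * card ({} :: nat set))"
   by (rule card_flag_frames)
    (use fin[OF i] repD[OF M i] subsD(1,3)[OF M U(1), of i] d U(2)[OF i] i in \<open>simp_all add: dims_def\<close>)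
  ultimately show "card {f : Iso (coords (A i Un B i)) (vsp M i). f ` coords (A i) = U i} =
    gl TYPE('k) (card (A i)) * gl TYPE('k) (card (B i)) * CARD('k) ^ (card (A i) * card (B i))"
   by (simp add: gl_0)
 qed
 finally show ?thesis .
qed

text \<open>Frames are adapted to the largest maximiser, with \<open>A\<close> indexing it and
  \<open>B\<close> a complement. The systems in standard position are block triangular; the free
  block from \<open>B\<close> to \<open>A\<close> contributes the numerator of the power of q, and
  the free off-diagonal part of the adapted frames contributes the denominator. The
  \<open>gl\<close> factors are absorbed by the two masses.\<close>

lemma mass_type:
 fixes c d :: "'v => nat"
 assumes t: "!!i. t i = w i + \<mu>" "0 < \<mu>" and dc: "!!i. i : verts Q ==> d i <= c i"
 shows "mass (type_reps t w c d :: ('v, 'a, 'k::{field,finite}) qrep set) =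
  mass (ss_reps w d :: ('v, 'a, 'k) qrep set) * mass (lt_reps t w (%i. c i - d i) :: ('v, 'a, 'k) qrep set) *
  (real CARD('k) ^ (\<Sum>ar\<in>arcs Q. d (head Q ar) * (c (tail Q ar) - d (tail Q ar))) /
   real CARD('k) ^ (\<Sum>i\<in>verts Q. d i * (c i - d i)))"
proof -
 define A where "A i = {..<d i}" for i
 define B where "B i = {d i..<c i}" for i
 let ?J = "%i. A i Un B i"
 have fin: "!!i. i : verts Q ==> finite (A i)" "!!i. i : verts Q ==> finite (B i)"
   "!!i. i : verts Q ==> A i Int B i = {}"
  and cA: "card (A i) = d i" and cB: "card (B i) = c i - d i" for i
  by (auto simp: A_def B_def)
 have fJ: "finite (?J i)" if "i : verts Q" for i using fin that by simp
 have cJ: "card (?J i) = c i" if "i : verts Q" for i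
  using that fin dc by (simp add: card_Un_disjoint cA cB)
 define Std where "Std = {x : arrow_ix ?J ?J \<rightarrow>\<^sub>E (UNIV :: 'k set). rho ?J x : le_reps t w c & lmax w (rho ?J x) (kcf A)}"
 define n where "n = (\<Prod>i\<in>verts Q. gl TYPE('k) (d i) * gl TYPE('k) (c i - d i) * CARD('k) ^ (d i * (c i - d i)))"
 have dims_c: "dims M c \<longleftrightarrow> dims M (%i. card (?J i))" for M :: "('v, 'a, 'k) qrep"
  unfolding dims_def using cJ by simp
 have dA: "kvec.dim (kcf A i :: 'k vec set) = d i" if "i : verts Q" for i
  using that fin by (simp add: dim_coords cA)
 let ?S = "type_reps t w c d :: ('v, 'a, 'k) qrep set"
 have 1: "mass ?S = real (card Std) / real n"
 proof (rule mass_eq[where J = ?J and FR = "%M. {ph : frames ?J M. lmax w M (fimg ph (kcf A))}", OF fJ])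
  show "!!M. M : ?S ==> representation Q M"
   "!!M. M : ?S ==> dims M (%i. card (?J i))"
   using dims_c by (auto simp: type_reps_def le_reps_def)
  show "!!M N f. M : ?S ==> representation Q N ==> rep_iso Q M N f ==> N : ?S"
   by (rule reps_closed(4))
  show "Std <= arrow_ix ?J ?J \<rightarrow>\<^sub>E UNIV" unfolding Std_def by blast
  show "!!x. x : Std ==> rho ?J x : ?S"
   unfolding Std_def type_reps_def using dA by blast
  show "card {ph : frames ?J M. lmax w M (fimg ph (kcf A))} = n" if M: "M : ?S" for M
  proof -
   have rM: "representation Q M" and dM: "dims M (%i. card (?J i))"
    using M dims_c by (auto simp: type_reps_def le_reps_def)
   obtain U where U: "lmax w M U" "\<forall>i\<in>verts Q. kvec.dim (U i) = d i" using M by (auto simp: type_reps_def)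
   have "lmax w M V \<longleftrightarrow> V = U" for V
    using U(1) modular_lattice.largest_max_unique[OF modular_lattice_subs[OF rM]] unfolding lmax_eq[OF rM] by blast
   then have "{ph : frames ?J M. lmax w M (fimg ph (kcf A))} = {ph : frames ?J M. fimg ph (kcf A) = U}" by simp
   moreover have "U : subs Q M" using U(1) by (simp add: lmax_def)
   ultimately show ?thesis
    using card_flagged_frames[OF rM fin dM, of U] U(2) unfolding n_def cA cB by simp
  qed
  show "0 < n" unfolding n_def by (intro prod_pos) (simp add: gl_pos)
  show "x : Std" if M: "M : ?S" and x: "x : arrow_ix ?J ?J \<rightarrow>\<^sub>E UNIV"
   and ph: "ph : {ph : frames ?J M. lmax w M (fimg ph (kcf A))}" "ph : Isos (rho ?J x) M" for M x ph
  proof -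
   have rM: "representation Q M" using M by (auto simp: type_reps_def le_reps_def)
   have rx: "representation Q (rho ?J x)" by (rule rep_rho[OF fJ])
   note f = IsosD[OF ph(2)]
   have "rho ?J x : le_reps t w c"
    using reps_closed(3)[OF rx rep_iso_inv[OF rx f]] M by (auto simp: type_reps_def)
   moreover have "lmax w (rho ?J x) (kcf A)"
   proof -
    have l: "lmax w M (fimg ph (kcf A))" using ph(1) by blast
    \<comment> \<open>The largest maximiser of the model is carried by \<open>ph\<close> to that of
      \<open>M\<close>, which is the image of \<open>kcf A\<close>; injectivity of \<open>ph\<close>
      identifies it with \<open>kcf A\<close>.\<close>
    obtain U where U: "lmax w (rho ?J x) U"
     using modular_lattice.ex_largest_max[OF modular_lattice_subs[OF rx] modular_wdim[OF rx]] unfolding lmax_eq[OF rx] by blast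
    have Us: "U : subs Q (rho ?J x)" using U by (simp add: lmax_def)
    have "lmax w M (fimg ph U)" using lmax_iso[OF rx rM f Us] U by simp
    then have e: "fimg ph U = fimg ph (kcf A)"
     using l modular_lattice.largest_max_unique[OF modular_lattice_subs[OF rM]] unfolding lmax_eq[OF rM] by blast
    have "U = kcf A"
    proof (rule ext)
     fix i
     show "U i = kcf A i"
     proof (cases "i : verts Q")
      case True
      have "fimg ph U i = fimg ph (kcf A) i" using e by simp
      then have "ph i ` U i = ph i ` coords (A i)" using True by (simp add: fimg_def)
      moreover have "inj_on (ph i) (vsp (rho ?J x) i)" by (rule bij_betw_imp_inj_on[OF rep_isoD(2)[OF f True]])
      moreover have "coords (A i) <= (vsp (rho ?J x) i :: 'k vec set)"
       using True coords_mono[of "A i" "A i Un B i"] by simp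
      ultimately show ?thesis
       using inj_on_image_eq_iff[of "ph i" "vsp (rho ?J x) i" "U i" "coords (A i)"] subsD(3)[OF rx Us True] True by simp
     qed (use subsD(4)[OF rx Us] in simp)
    qed
    then show ?thesis using U by simp
   qed
   ultimately show ?thesis unfolding Std_def using x by blast
  qed
  show "ph : {ph : frames ?J M. lmax w M (fimg ph (kcf A))}"
   if M: "M : ?S" and x: "x : Std" and ph: "ph : Isos (rho ?J x) M" for M x ph
  proof -
   have rM: "representation Q M" using M by (auto simp: type_reps_def le_reps_def)
   have rx: "representation Q (rho ?J x)" by (rule rep_rho[OF fJ])
   have l: "lmax w (rho ?J x) (kcf A)" using x by (simp add: Std_def)
   then have "kcf A : subs Q (rho ?J x)" by (simp add: lmax_def)
   then have "lmax w M (fimg ph (kcf A))" using lmax_iso[OF rx rM IsosD[OF ph]] l by simp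
   moreover have "ph : frames ?J M" using Isos_subset_frames[of "rho ?J x" ?J M] ph by auto
   ultimately show ?thesis by blast
  qed
 qed auto
 define XA where "XA = {x : arrow_ix A A \<rightarrow>\<^sub>E (UNIV :: 'k set). rho A x : ss_reps w d}"
 define XB where "XB = {x : arrow_ix B B \<rightarrow>\<^sub>E (UNIV :: 'k set). rho B x : lt_reps t w (%i. c i - d i)}"
 have dimsA: "dims M d \<longleftrightarrow> dims M (%i. card (A i))" and dimsB: "dims M (%i. c i - d i) \<longleftrightarrow> dims M (%i. card (B i))"
  for M :: "('v, 'a, 'k) qrep" by (simp_all add: dims_def cA cB)
 have rA: "representation Q (rho A x)" and rB: "representation Q (rho B x)" and rJ: "representation Q (rho ?J x)"
  and dsA: "dims (rho A x) (%i. card (A i))" and dsB: "dims (rho B x) (%i. card (B i))"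
  and dsJ: "dims (rho ?J x) (%i. card (?J i))" for x :: "'a \<times> nat \<times> nat => 'k"
  by (rule rep_rho dims_rho; use fin in simp)+
 have 2: "mass (ss_reps w d :: ('v, 'a, 'k) qrep set) = real (card XA) / real (\<Prod>i\<in>verts Q. gl TYPE('k) (d i))"
  unfolding XA_def cA[symmetric]
 proof (rule mass_full[where J = A])
  show "!!M N f. M : ss_reps w (%i. card (A i)) ==> representation Q N ==> rep_iso Q M N f ==>
    N : (ss_reps w (%i. card (A i)) :: ('v, 'a, 'k) qrep set)" by (rule reps_closed(1))
 qed (use fin(1) in \<open>simp_all add: ss_reps_def\<close>)
 have 3: "mass (lt_reps t w (%i. c i - d i) :: ('v, 'a, 'k) qrep set) = real (card XB) / real (\<Prod>i\<in>verts Q. gl TYPE('k) (c i - d i))"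
  unfolding XB_def cB[symmetric]
 proof (rule mass_full[where J = B])
  show "!!M N f. M : lt_reps t w (%i. card (B i)) ==> representation Q N ==> rep_iso Q M N f ==>
    N : (lt_reps t w (%i. card (B i)) :: ('v, 'a, 'k) qrep set)" by (rule reps_closed(2))
 qed (use fin(2) in \<open>simp_all add: lt_reps_def\<close>)
 \<comment> \<open>The sets are nested so that \<open>card_PiE_Un\<close> applies three times: it
   splits off the diagonal block \<open>A\<close>, then the diagonal block \<open>B\<close>, and
   finally separates the free block from the zero block.\<close>
 define Z2 where "Z2 = {z : arrow_ix A B Un arrow_ix B A \<rightarrow>\<^sub>E (UNIV :: 'k set).
  restrict z (arrow_ix A B) : arrow_ix A B \<rightarrow>\<^sub>E UNIV & restrict z (arrow_ix B A) : {restrict (%_. 0) (arrow_ix B A)}}"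
 define Z1 where "Z1 = {y : arrow_ix B B Un (arrow_ix A B Un arrow_ix B A) \<rightarrow>\<^sub>E UNIV.
  restrict y (arrow_ix B B) : XB & restrict y (arrow_ix A B Un arrow_ix B A) : Z2}"
 let ?R = "{x : arrow_ix A A Un (arrow_ix B B Un (arrow_ix A B Un arrow_ix B A)) \<rightarrow>\<^sub>E (UNIV :: 'k set).
  restrict x (arrow_ix A A) : XA & restrict x (arrow_ix B B Un (arrow_ix A B Un arrow_ix B A)) : Z1}"
 have 4: "Std = ?R"
 proof -
  have ix: "arrow_ix ?J ?J = arrow_ix A A Un (arrow_ix B B Un (arrow_ix A B Un arrow_ix B A))"
   unfolding arrow_ix_def by blast
  have rr: "restrict (restrict y S) T = restrict y T" if "T <= S" for y :: "'a \<times> nat \<times> nat => 'k" and S T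
   using that by (auto simp: fun_eq_iff restrict_def)
  have zz: "restrict x (arrow_ix B A) = restrict (%_. 0) (arrow_ix B A) \<longleftrightarrow> (\<forall>p\<in>arrow_ix B A. x p = 0)"
   for x :: "'a \<times> nat \<times> nat => 'k" by (auto simp: fun_eq_iff restrict_def)
  have R: "?R = {x : arrow_ix ?J ?J \<rightarrow>\<^sub>E UNIV. restrict x (arrow_ix A A) : XA & restrict x (arrow_ix B B) : XB
    & (\<forall>p\<in>arrow_ix B A. x p = 0)}"
   unfolding ix Z1_def Z2_def by (rule Collect_cong) (simp add: rr zz)
  have "rho ?J x : le_reps t w c & lmax w (rho ?J x) (kcf A) \<longleftrightarrow>
   restrict x (arrow_ix A A) : XA & restrict x (arrow_ix B B) : XB & (\<forall>p\<in>arrow_ix B A. x p = 0)"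
   for x :: "'a \<times> nat \<times> nat => 'k"
  proof (cases "\<forall>p\<in>arrow_ix B A. x p = 0")
   case True
   have "rho ?J x : le_reps t w c & lmax w (rho ?J x) (kcf A) \<longleftrightarrow>
     tors t (rho ?J x) & fle w (rho ?J x) & lmax w (rho ?J x) (kcf A)"
    unfolding le_reps_def dims_c using rJ dsJ by simp
   also have "\<dots> \<longleftrightarrow> sst w (rho A x) & tors t (rho B x) & flt w (rho B x)"
    by (rule ord_split[OF fin True t])
   also have "\<dots> \<longleftrightarrow> restrict x (arrow_ix A A) : XA & restrict x (arrow_ix B B) : XB"
    unfolding XA_def XB_def ss_reps_def lt_reps_def dimsA dimsB using rA rB dsA dsB by (simp add: rho_restrict)
   finally show ?thesis using True by simp
  next
   case False
   have "kcf A : subs Q (rho ?J x) \<longleftrightarrow> (\<forall>p\<in>arrow_ix B A. x p = 0)"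
    by (rule kcf_sub_rho_iff[OF fin])
   then have "~ lmax w (rho ?J x) (kcf A)"
    using False unfolding lmax_def by blast
   then show ?thesis using False by blast
  qed
  then show ?thesis unfolding Std_def R by simp
 qed
 have dj: "arrow_ix A A Int (arrow_ix B B Un (arrow_ix A B Un arrow_ix B A)) = {}"
  "arrow_ix B B Int (arrow_ix A B Un arrow_ix B A) = {}" "arrow_ix A B Int arrow_ix B A = {}"
  by (auto simp: arrow_ix_def A_def B_def)
 have "card Std = card XA * card Z1"
  unfolding 4 by (rule card_PiE_Un[OF dj(1)]) (auto simp: XA_def Z1_def)
 moreover have "card Z1 = card XB * card Z2"
  unfolding Z1_def by (rule card_PiE_Un[OF dj(2)]) (auto simp: XB_def Z2_def)
 moreover have "card Z2 = card (arrow_ix A B \<rightarrow>\<^sub>E (UNIV :: 'k set)) * card {restrict (%_. 0 :: 'k) (arrow_ix B A)}"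
  unfolding Z2_def by (rule card_PiE_Un[OF dj(3)]) auto
 moreover have "card (arrow_ix A B \<rightarrow>\<^sub>E (UNIV :: 'k set)) = CARD('k) ^ (\<Sum>ar\<in>arcs Q. d (head Q ar) * (c (tail Q ar) - d (tail Q ar)))"
 proof -
  have "finite (arrow_ix A B)" unfolding arrow_ix_def A_def B_def by auto
  moreover have "card (arrow_ix A B) = (\<Sum>ar\<in>arcs Q. d (head Q ar) * (c (tail Q ar) - d (tail Q ar)))"
   unfolding arrow_ix_def by (subst card_SigmaI) (auto simp: card_cartesian_product A_def B_def)
  ultimately show ?thesis by (simp add: card_PiE)
 qed
 ultimately have 5: "real (card Std) = real (card XA) * real (card XB) *
   real CARD('k) ^ (\<Sum>ar\<in>arcs Q. d (head Q ar) * (c (tail Q ar) - d (tail Q ar)))" by (simp add: mult.assoc)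
 have 6: "real n = real (\<Prod>i\<in>verts Q. gl TYPE('k) (d i)) * real (\<Prod>i\<in>verts Q. gl TYPE('k) (c i - d i)) *
   real CARD('k) ^ (\<Sum>i\<in>verts Q. d i * (c i - d i))"
  unfolding n_def by (simp add: prod.distrib power_sum)
 show ?thesis unfolding 1 2 3 5 6 by simp
qed

text \<open>The largest maximiser exists and is unique, so its dimension vector partitions the
  systems. All strata are divided by the same number of frames.\<close>

lemma mass_le_reps:
 fixes c :: "'v => nat"
 assumes t: "!!i. t i = w i + \<mu>" "0 < \<mu>"
 shows "mass (le_reps t w c :: ('v, 'a, 'k::{field,finite}) qrep set) =
  (\<Sum>d\<in>(\<Pi>\<^sub>E i\<in>verts Q. {..c i}). mass (ss_reps w d :: ('v, 'a, 'k) qrep set) *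
   mass (lt_reps t w (%i. c i - d i) :: ('v, 'a, 'k) qrep set) *
  (real CARD('k) ^ (\<Sum>ar\<in>arcs Q. d (head Q ar) * (c (tail Q ar) - d (tail Q ar))) /
   real CARD('k) ^ (\<Sum>i\<in>verts Q. d i * (c i - d i))))"
proof -
 define J where "J i = {..<c i}" for i :: 'v
 have J: "finite (J i)" "card (J i) = c i" for i by (simp_all add: J_def)
 let ?D = "\<Pi>\<^sub>E i\<in>verts Q. {..c i}"
 define X where "X d = {x : arrow_ix J J \<rightarrow>\<^sub>E (UNIV :: 'k set). rho J x : type_reps t w c d}" for d
 have full: "mass S = real (card {x : arrow_ix J J \<rightarrow>\<^sub>E UNIV. rho J x : S}) / real (\<Prod>i\<in>verts Q. gl TYPE('k) (c i))"
  if "S <= le_reps t w c" "!!M N f. M : S ==> representation Q N ==> rep_iso Q M N f ==> N : S"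
  for S :: "('v, 'a, 'k) qrep set"
 proof -
  have "mass S = real (card {x : arrow_ix J J \<rightarrow>\<^sub>E UNIV. rho J x : S}) / real (\<Prod>i\<in>verts Q. gl TYPE('k) (card (J i)))"
  proof (rule mass_full)
   show "!!M N f. M : S ==> representation Q N ==> rep_iso Q M N f ==> N : S" by (rule that(2))
   fix M assume "M : S"
   then have "M : le_reps t w c" by (rule subsetD[OF that(1)])
   then show "representation Q M" "dims M (%i. card (J i))" by (simp_all add: le_reps_def J)
  qed (rule J(1))
  then show ?thesis by (simp only: J)
 qed
 have "{x : arrow_ix J J \<rightarrow>\<^sub>E (UNIV :: 'k set). rho J x : le_reps t w c} = (\<Union>d\<in>?D. X d)"
 proof (intro equalityI subsetI)
  fix x assume x: "x : {x : arrow_ix J J \<rightarrow>\<^sub>E (UNIV :: 'k set). rho J x : le_reps t w c}"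
  have rx: "representation Q (rho J x)" by (rule rep_rho[OF J(1)])
  obtain U where U: "lmax w (rho J x) U"
   using modular_lattice.ex_largest_max[OF modular_lattice_subs[OF rx] modular_wdim[OF rx]] unfolding lmax_eq[OF rx] by blast
  have Us: "U : subs Q (rho J x)" using U by (simp add: lmax_def)
  define d where "d = restrict (%i. kvec.dim (U i)) (verts Q)"
  have "kvec.dim (U i) <= c i" if "i : verts Q" for i
   using dim_mono[OF subsD(1)[OF rx Us] repD[OF rx that] subsD(3)[OF rx Us that]] that J by (simp add: dim_coords)
  then have "d : ?D" by (simp add: d_def)
  moreover have "x : X d" unfolding X_def type_reps_def using x U by (auto simp: d_def)
  ultimately show "x : (\<Union>d\<in>?D. X d)" by blast
 qed (auto simp: X_def type_reps_def)
 moreover have "card (\<Union>d\<in>?D. X d) = (\<Sum>d\<in>?D. card (X d))"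
 proof (rule card_UN_disjoint)
  show "finite ?D" by (intro finite_PiE) auto
  have "finite (arrow_ix J J)" unfolding arrow_ix_def using J by auto
  then show "\<forall>d\<in>?D. finite (X d)" unfolding X_def by (simp add: finite_PiE)
  show "\<forall>d\<in>?D. \<forall>d'\<in>?D. d ~= d' --> X d Int X d' = {}"
  proof (intro ballI impI)
   fix d d' assume d: "d : ?D" "d' : ?D" "d ~= d'"
   show "X d Int X d' = {}"
   proof (rule ccontr)
    assume "X d Int X d' ~= {}"
    then obtain x :: "'a \<times> nat \<times> nat => 'k" where x: "rho J x : type_reps t w c d" "rho J x : type_reps t w c d'" unfolding X_def by blast
    then have rx: "representation Q (rho J x)" by (simp add: type_reps_def le_reps_def)
    obtain U where U: "lmax w (rho J x) U" "\<forall>i\<in>verts Q. kvec.dim (U i) = d i" using x(1) by (auto simp: type_reps_def)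
    obtain U' where U': "lmax w (rho J x) U'" "\<forall>i\<in>verts Q. kvec.dim (U' i) = d' i" using x(2) by (auto simp: type_reps_def)
    have "U = U'"
     by (rule modular_lattice.largest_max_unique[OF modular_lattice_subs[OF rx] U(1)[unfolded lmax_eq[OF rx]] U'(1)[unfolded lmax_eq[OF rx]]])
    then have "d i = d' i" if "i : verts Q" for i using U(2) U'(2) that by metis
    then have "d = d'" by (rule PiE_ext[OF d(1,2)])
    then show False using d(3) by simp
   qed
  qed
 qed
 ultimately have "mass (le_reps t w c :: ('v, 'a, 'k) qrep set) = (\<Sum>d\<in>?D. real (card (X d)) / real (\<Prod>i\<in>verts Q. gl TYPE('k) (c i)))"
  using full[OF subset_refl reps_closed(3)] by (simp add: sum_divide_distrib)
 also have "\<dots> = (\<Sum>d\<in>?D. mass (type_reps t w c d :: ('v, 'a, 'k) qrep set))"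
 proof (rule sum.cong[OF refl])
  fix d
  have "type_reps t w c d <= (le_reps t w c :: ('v, 'a, 'k) qrep set)" unfolding type_reps_def by blast
  then show "real (card (X d)) / real (\<Prod>i\<in>verts Q. gl TYPE('k) (c i)) = mass (type_reps t w c d :: ('v, 'a, 'k) qrep set)"
   unfolding X_def by (rule full[symmetric, OF _ reps_closed(4)])
 qed
 also have "\<dots> = (\<Sum>d\<in>?D. mass (ss_reps w d :: ('v, 'a, 'k) qrep set) *
   mass (lt_reps t w (%i. c i - d i) :: ('v, 'a, 'k) qrep set) *
  (real CARD('k) ^ (\<Sum>ar\<in>arcs Q. d (head Q ar) * (c (tail Q ar) - d (tail Q ar))) /
   real CARD('k) ^ (\<Sum>i\<in>verts Q. d i * (c i - d i))))"
 proof (rule sum.cong[OF refl])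
  fix d assume d: "d : ?D"
  have "d i <= c i" if "i : verts Q" for i using PiE_mem[OF d that] by simp
  from mass_type[OF t this] show "mass (type_reps t w c d :: ('v, 'a, 'k) qrep set) = mass (ss_reps w d :: ('v, 'a, 'k) qrep set) *
   mass (lt_reps t w (%i. c i - d i) :: ('v, 'a, 'k) qrep set) *
  (real CARD('k) ^ (\<Sum>ar\<in>arcs Q. d (head Q ar) * (c (tail Q ar) - d (tail Q ar))) /
   real CARD('k) ^ (\<Sum>i\<in>verts Q. d i * (c i - d i)))" .
 qed
 finally show ?thesis .
qed

end

section \<open>Bilinear forms, and self-dual representations as systems of forms\<close>

definition bilin :: "('k::field) vec set => 'k vec set =>
  ('k vec => 'k vec => 'k) => bool"
 where "bilin V W \<beta> \<longleftrightarrow>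
  (\<forall>x\<in>V. \<forall>x'\<in>V. \<forall>y\<in>W. \<beta> (x + x') y = \<beta> x y + \<beta> x' y) &
  (\<forall>c. \<forall>x\<in>V. \<forall>y\<in>W. \<beta> (kscale c x) y = c * \<beta> x y) &
  (\<forall>x\<in>V. \<forall>y\<in>W. \<forall>y'\<in>W. \<beta> x (y + y') = \<beta> x y + \<beta> x y') &
  (\<forall>c. \<forall>x\<in>V. \<forall>y\<in>W. \<beta> x (kscale c y) = c * \<beta> x y)"

definition bf :: "nat set => nat set => (nat => nat => 'k::field) => 'k vec => 'k vec => 'k"
 where "bf I J a u w = (\<Sum>i\<in>I. \<Sum>j\<in>J. entry u i * a i j * entry w j)"

lemma bilinD:
 assumes "bilin V W \<beta>"
 shows "x : V ==> x' : V ==> y : W ==> \<beta> (x + x') y = \<beta> x y + \<beta> x' y"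
  "x : V ==> y : W ==> \<beta> (kscale c x) y = c * \<beta> x y"
  "x : V ==> y : W ==> y' : W ==> \<beta> x (y + y') = \<beta> x y + \<beta> x y'"
  "x : V ==> y : W ==> \<beta> x (kscale c y) = c * \<beta> x y"
 using assms unfolding bilin_def by blast+

lemma bilin_flip: "bilin V W \<beta> ==> bilin W V (%y x. \<beta> x y)"
 unfolding bilin_def by blast

lemma bilin_comp:
 assumes "bilin V W \<beta>" "linear_between V' V f" "linear_between W' W g"
 shows "bilin V' W' (%x y. \<beta> (f x) (g y))"
 unfolding bilin_def
 by (simp add: linear_between_add[OF assms(2)] linear_between_add[OF assms(3)] linear_between_kscale[OF assms(2)]
   linear_between_kscale[OF assms(3)] bilinD[OF assms(1)] linear_between_in[OF assms(2)] linear_between_in[OF assms(3)])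

lemma bilin_0:
 assumes "bilin V W \<beta>"
 shows "0 : V ==> y : W ==> \<beta> 0 y = 0" "x : V ==> 0 : W ==> \<beta> x 0 = 0"
 using bilinD(2)[OF assms, of 0 y 0] bilinD(4)[OF assms, of x 0 0] by simp_all

lemma bilin_sum:
 assumes "bilin V W \<beta>" "kvec.subspace V" "finite S" "!!i. i : S ==> f i : V" "y : W"
 shows "\<beta> (\<Sum>i\<in>S. f i) y = (\<Sum>i\<in>S. \<beta> (f i) y)"
 using assms(3,4)
proof (induction S)
 case empty
 then show ?case using bilin_0(1)[OF assms(1) kvec.subspace_0[OF assms(2)] assms(5)] by simp
next
 case (insert a S)
 have "(\<Sum>i\<in>S. f i) : V" using insert.prems by (intro kvec.subspace_sum[OF assms(2)]) simp
 then show ?case using insert assms(5) by (simp add: bilinD(1)[OF assms(1)])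
qed

lemma bilin_expand_left:
 assumes "bilin (coords I) W \<beta>" "finite I" "u : coords I" "w : W"
 shows "\<beta> u w = (\<Sum>i\<in>I. entry u i * \<beta> (unitv i) w)"
proof -
 have "\<beta> u w = \<beta> (\<Sum>i\<in>I. kscale (entry u i) (unitv i)) w"
  by (rule arg_cong[OF coords_expand[OF assms(2,3)]])
 also have "\<dots> = (\<Sum>i\<in>I. \<beta> (kscale (entry u i) (unitv i)) w)"
  by (rule bilin_sum[OF assms(1) subspace_coords assms(2) _ assms(4)])
   (simp add: kvec.subspace_scale subspace_coords)
 also have "\<dots> = (\<Sum>i\<in>I. entry u i * \<beta> (unitv i) w)"
  by (rule sum.cong[OF refl]) (simp add: bilinD(2)[OF assms(1)] assms(4))
 finally show ?thesis .
qed

lemma bilin_coords: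
 assumes "bilin (coords I) (coords J) \<beta>" "finite I" "finite J" "u : coords I" "w : coords J"
 shows "\<beta> u w = bf I J (%i j. \<beta> (unitv i) (unitv j)) u w"
proof -
 have "\<beta> u w = (\<Sum>i\<in>I. entry u i * \<beta> (unitv i) w)"
  by (rule bilin_expand_left[OF assms(1,2,4,5)])
 also have "\<dots> = (\<Sum>i\<in>I. entry u i * (\<Sum>j\<in>J. entry w j * \<beta> (unitv i) (unitv j)))"
  by (rule sum.cong[OF refl]) (simp add: bilin_expand_left[OF bilin_flip[OF assms(1)] assms(3,5)])
 finally show ?thesis unfolding bf_def by (simp only: sum_distrib_left mult_ac)
qed

lemma bilin_bf: "bilin V W (bf I J a)"
 unfolding bilin_def bf_def
 by (simp add: lookup_add lookup_kscale distrib_left distrib_right sum.distrib sum_distrib_left mult_ac)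

lemma bf_cong: "(!!i j. i : I ==> j : J ==> a i j = b i j) ==> bf I J a u w = bf I J b u w"
 unfolding bf_def by (intro sum.cong) auto

lemma sum_lookup_unitv:
 assumes "finite J" "j : J"
 shows "(\<Sum>j'\<in>J. f j' * entry (unitv j) j') = (f j :: 'k::field)"
proof -
 have "(\<Sum>j'\<in>J. f j' * entry (unitv j) j') = (\<Sum>j'\<in>J. if j' = j then f j' else 0)"
  by (rule sum.cong[OF refl]) (simp add: lookup_single)
 then show ?thesis using assms by simp
qed

lemma bf_mat_app:
 assumes "finite J"
 shows "bf I J a u w = (\<Sum>j\<in>J. entry (mat_app J I (%j i. a i j) u) j * entry w j)"
proof -
 have "bf I J a u w = (\<Sum>j\<in>J. \<Sum>i\<in>I. entry u i * a i j * entry w j)"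
  unfolding bf_def by (rule sum.swap)
 also have "\<dots> = (\<Sum>j\<in>J. entry (mat_app J I (%j i. a i j) u) j * entry w j)"
  by (rule sum.cong[OF refl]) (simp add: lookup_mat_app assms sum_distrib_left sum_distrib_right mult_ac)
 finally show ?thesis .
qed

lemma bf_mat_app_left:
 assumes "finite I"
 shows "bf I J a u w = (\<Sum>i\<in>I. entry (mat_app I J a w) i * entry u i)"
 unfolding bf_def
 by (rule sum.cong[OF refl]) (simp add: lookup_mat_app assms sum_distrib_left sum_distrib_right mult_ac)

lemma bf_unitv_right:
 "finite J ==> j : J ==> bf I J a u (unitv j) = entry (mat_app J I (%j i. a i j) u) j"
 unfolding bf_mat_app by (rule sum_lookup_unitv)

lemma bf_unitv_left: "finite I ==> i : I ==> bf I J a (unitv i) w = entry (mat_app I J a w) i"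
 unfolding bf_mat_app_left by (rule sum_lookup_unitv)

lemma bf_unitv: "finite I ==> finite J ==> i : I ==> j : J ==> bf I J a (unitv i) (unitv j) = a i j"
 by (simp add: bf_unitv_left mat_app_unitv lookup_comb)

lemma bf_swap: "bf I J a u w = bf J I (%j i. a i j) w u"
 unfolding bf_def by (subst sum.swap) (simp add: mult_ac)

lemma bf_sub:
 assumes "finite I" "finite J" "I' <= I" "J' <= J" "u : coords I'" "w : coords J'"
 shows "bf I J a u w = bf I' J' a u w"
proof -
 have u: "entry u i = 0" if "i ~: I'" for i using coords_lookup[OF assms(5) that] .
 have w: "entry w j = 0" if "j ~: J'" for j using coords_lookup[OF assms(6) that] .
 have "bf I J a u w = (\<Sum>i\<in>I'. \<Sum>j\<in>J. entry u i * a i j * entry w j)"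
  unfolding bf_def using assms(1,3) u by (intro sum.mono_neutral_right) auto
 also have "\<dots> = bf I' J' a u w"
  unfolding bf_def
 proof (rule sum.cong[OF refl])
  fix i
  show "(\<Sum>j\<in>J. entry u i * a i j * entry w j) = (\<Sum>j\<in>J'. entry u i * a i j * entry w j)"
   using assms(2,4) w by (intro sum.mono_neutral_right) auto
 qed
 finally show ?thesis .
qed

text \<open>
 The duality of the form identifies the linear maps along an arrow with bilinear forms, so a
 self-dual representation becomes one bilinear form for each node and each arrow.
\<close>

locale sd_quiver = quiver Q for Q :: "('v, 'a) pre_digraph" +
 fixes D :: "('v, 'a) duality_data"
 assumes involution: "quiver_involution Q D" and duality: "duality_structure Q D"
begin

abbreviation (input) sg where "sg \<equiv> nsig D"

text \<open>Nodes and arrows are treated alike: each edge carries a form on the space at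
  \<open>src\<close> times the space at \<open>dst\<close>. For a node this is its pairing with the
  dual node. For an arrow it is <m x, y>, with x at the tail and y at the dual of the head, whence
  the asymmetric look of \<open>dst\<close>.\<close>

definition edges :: "('v + 'a) set"
 where "edges = verts Q <+> arcs Q"

fun src :: "'v + 'a => 'v"
 where "src (Inl v) = v" | "src (Inr ar) = tail Q ar"

fun dst :: "'v + 'a => 'v"
 where "dst (Inl v) = sg v" | "dst (Inr ar) = sg (head Q ar)"

fun einv :: "'v + 'a => 'v + 'a"
 where "einv (Inl v) = Inl (sg v)" | "einv (Inr ar) = Inr (asig D ar)"

text \<open>The sign of a form under exchange of its arguments. For an arrow, <m x, y> = \<tau> <x,
  m' y> = \<tau> s <m' y, x>, where m' is the map along the dual arrow and s the sign at the
  tail.\<close>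

fun eps :: "'v + 'a => int"
 where "eps (Inl v) = nsgn D v" | "eps (Inr ar) = asgn D ar * nsgn D (tail Q ar)"

lemma sig: "i : verts Q ==> sg i : verts Q" "i : verts Q ==> sg (sg i) = i"
 using involution unfolding quiver_involution_def by blast+

lemma asig: "ar : arcs Q ==> asig D ar : arcs Q" "ar : arcs Q ==> asig D (asig D ar) = ar"
 "ar : arcs Q ==> tail Q (asig D ar) = sg (head Q ar)"
 "ar : arcs Q ==> head Q (asig D ar) = sg (tail Q ar)"
 using involution unfolding quiver_involution_def by blast+

lemma nsgn: "i : verts Q ==> nsgn D i * nsgn D i = 1" "i : verts Q ==> nsgn D (sg i) = nsgn D i"
 using duality unfolding duality_structure_def by fastforce+

lemma edges_cases:
 assumes "e : edges"
 obtains v where "e = Inl v" "v : verts Q" | ar where "e = Inr ar" "ar : arcs Q"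
 using assms unfolding edges_def by blast

lemma edges_iff [simp]: "Inl v : edges \<longleftrightarrow> v : verts Q" "Inr ar : edges \<longleftrightarrow> ar : arcs Q"
 unfolding edges_def by auto

lemma finite_edges: "finite edges"
 unfolding edges_def by simp

lemma edge_facts:
 assumes "e : edges"
 shows "einv e : edges" "einv (einv e) = e" "src (einv e) = dst e" "dst (einv e) = src e"
  "src e : verts Q" "dst e : verts Q"
 using assms by (cases rule: edges_cases; simp add: sig asig)+

text \<open>For an arrow, invariance of \<open>eps\<close> under \<open>einv\<close> is exactly the
  compatibility between the signs of dual arrows and of nodes that a duality structure
  demands.\<close>

lemma eps_facts:
 assumes "e : edges"
 shows "eps e = 1 | eps e = -1" "eps e * eps e = 1" "eps (einv e) = eps e"
proof -
 have n: "nsgn D i = 1 | nsgn D i = -1" if "i : verts Q" for i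
  using duality that unfolding duality_structure_def by blast
 have a: "asgn D ar = 1 | asgn D ar = -1" if "ar : arcs Q" for ar
  using duality that unfolding duality_structure_def by blast
 have p: "asgn D ar * asgn D (asig D ar) = nsgn D (tail Q ar) * nsgn D (head Q ar)" if "ar : arcs Q" for ar
  using duality that unfolding duality_structure_def by blast
 have "(eps e = 1 | eps e = -1) & eps (einv e) = eps e"
  using assms
 proof (cases rule: edges_cases)
  case (1 v)
  then show ?thesis using n nsgn(2) by simp
 next
  case (2 ar)
  have th: "tail Q ar : verts Q" "head Q ar : verts Q" using 2 by auto
  show ?thesis
   using 2 p[OF 2(2)] n[OF th(1)] n[OF th(2)] a[OF 2(2)] a[OF asig(1)[OF 2(2)]] nsgn(2)[OF th(2)] asig(3)[OF 2(2)]
   by (elim disjE) simp_all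
 qed
 then show "eps e = 1 | eps e = -1" "eps (einv e) = eps e" by blast+
 then show "eps e * eps e = 1" by auto
qed

lemma of_int_eps_eps: "e : edges ==> of_int (eps e) * (of_int (eps e) * x) = (x :: 'k::field)"
 using eps_facts(1)[of e] by auto

definition nform :: "('v, 'a, 'k::field) sdrep => 'v => 'k vec => 'k vec => 'k"
 where "nform M v x y = bform M (emb Q v x) (emb Q (sg v) y)"

fun eform :: "('v, 'a, 'k::field) sdrep => 'v + 'a => 'k vec => 'k vec => 'k"
 where "eform M (Inl v) x y = nform M v x y"
 | "eform M (Inr ar) x y = nform M (head Q ar) (vmap M ar x) y"

text \<open>The conditions on the bilinear forms that are equivalent to \<open>self_dual\<close>.\<close>

definition sd_forms :: "('v, 'a, 'k::field) sdrep => ('v => 'k vec => 'k vec => 'k) => bool"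
 where "sd_forms M \<beta> \<longleftrightarrow> representation Q M &
  (\<forall>u\<in>dsum Q (vsp M). \<forall>w\<in>dsum Q (vsp M). bform M u w = (\<Sum>v\<in>verts Q. \<beta> v (u v) (w (sg v)))) &
  (\<forall>v\<in>verts Q. bilin (vsp M v) (vsp M (sg v)) (\<beta> v)) &
  (\<forall>v\<in>verts Q. \<forall>x\<in>vsp M v. \<forall>y\<in>vsp M (sg v). \<beta> v x y = of_int (nsgn D v) * \<beta> (sg v) y x) &
  (\<forall>v\<in>verts Q. \<forall>x\<in>vsp M v. (\<forall>y\<in>vsp M (sg v). \<beta> v x y = 0) --> x = 0) &
  (\<forall>ar\<in>arcs Q. \<forall>x\<in>vsp M (tail Q ar). \<forall>y\<in>vsp M (sg (head Q ar)).
    \<beta> (head Q ar) (vmap M ar x) y = of_int (asgn D ar) * \<beta> (tail Q ar) x (vmap M (asig D ar) y))"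

lemma emb_in_dsum:
 assumes "!!i. i : verts Q ==> 0 : V i" "x : V v"
 shows "emb Q v x : dsum Q V"
 unfolding emb_def using assms by auto

lemma emb_simps [simp]: "j : verts Q ==> emb Q v x j = (if j = v then x else 0)"
 by (simp add: emb_def)

lemma emb_add: "(\<lambda>i\<in>verts Q. emb Q v x i + emb Q v y i) = emb Q v (x + y)"
 by (auto simp: emb_def fun_eq_iff restrict_def)

lemma emb_kscale: "(\<lambda>i\<in>verts Q. kscale c (emb Q v x i)) = emb Q v (kscale c x)"
 by (auto simp: emb_def fun_eq_iff restrict_def)

text \<open>Induction over the set of components that have been switched on; at the end it is the
  whole vector.\<close>

lemma dsum_induct_sum:
 fixes V :: "'v => ('k::field) vec set"
 assumes V: "!!i. i : verts Q ==> 0 : V i" and u: "u : dsum Q V"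
  and add: "!!x y. x : dsum Q V ==> y : dsum Q V ==> F (\<lambda>i\<in>verts Q. x i + y i) = F x + F y"
  and zero: "F (\<lambda>i\<in>verts Q. 0) = (0 :: 'k)"
 shows "F u = (\<Sum>v\<in>verts Q. F (emb Q v (u v)))"
proof -
 have step: "F (\<lambda>i\<in>verts Q. if i : S then u i else 0) = (\<Sum>v\<in>S. F (emb Q v (u v)))" if "finite S" "S <= verts Q" for S
  using that
 proof (induction S)
  case empty
  have "(\<lambda>i\<in>verts Q. if i : {} then u i else 0) = (\<lambda>i\<in>verts Q. 0)" by (rule ext) (simp add: restrict_def)
  then show ?case using zero by (simp only: sum.empty)
 next
  case (insert a S)
  have m: "(\<lambda>i\<in>verts Q. if i : S then u i else 0) : dsum Q V" "emb Q a (u a) : dsum Q V"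
   using V u insert.prems by (auto intro!: emb_in_dsum)
  have eq: "(\<lambda>i\<in>verts Q. if i : insert a S then u i else 0) =
    (\<lambda>i\<in>verts Q. (\<lambda>i\<in>verts Q. if i : S then u i else 0) i + emb Q a (u a) i)"
   using insert.hyps(2) by (auto simp: fun_eq_iff restrict_def emb_def)
  have "F (\<lambda>i\<in>verts Q. if i : insert a S then u i else 0) =
    F (\<lambda>i\<in>verts Q. if i : S then u i else 0) + F (emb Q a (u a))"
   unfolding eq by (rule add[OF m])
  moreover have "F (\<lambda>i\<in>verts Q. if i : S then u i else 0) = (\<Sum>v\<in>S. F (emb Q v (u v)))"
   by (rule insert.IH) (use insert.prems in blast)
  moreover have "(\<Sum>v\<in>insert a S. F (emb Q v (u v))) = F (emb Q a (u a)) + (\<Sum>v\<in>S. F (emb Q v (u v)))"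
   by (rule sum.insert[OF insert.hyps(1,2)])
  ultimately show ?case by (metis add.commute)
 qed
 have "(\<lambda>i\<in>verts Q. if i : verts Q then u i else 0) = u"
  by (rule extensionalityI[OF restrict_extensional]) (use u in \<open>auto simp: PiE_iff\<close>)
 then show ?thesis using step[OF finite_verts subset_refl] by simp
qed

text \<open>When both arguments are expanded into components, orthogonality leaves only the pairing
  of each node with its dual.\<close>

lemma self_dual_forms:
 fixes M :: "('v, 'a, 'k::{field,finite}) sdrep"
 assumes M: "self_dual Q D M"
 shows "sd_forms M (nform M)"
proof -
 have R: "representation Q M" using M by (simp add: self_dual_def)
 have z: "0 : vsp M i" if "i : verts Q" for i using kvec.subspace_0[OF repD(1)[OF R that]] .
 have B: "bilinear_form_on Q (vsp M) (bform M)" and N: "nondegenerate_on Q (vsp M) (bform M)"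
  using M by (simp_all add: self_dual_def)
 have add: "bform M (\<lambda>i\<in>verts Q. x i + y i) w = bform M x w + bform M y w"
  "bform M w (\<lambda>i\<in>verts Q. x i + y i) = bform M w x + bform M w y"
  if "x : dsum Q (vsp M)" "y : dsum Q (vsp M)" "w : dsum Q (vsp M)" for x y w
  using B that unfolding bilinear_form_on_def by blast+
 have sc: "bform M (\<lambda>i\<in>verts Q. kscale c (x i)) w = c * bform M x w"
  "bform M w (\<lambda>i\<in>verts Q. kscale c (x i)) = c * bform M w x"
  if "x : dsum Q (vsp M)" "w : dsum Q (vsp M)" for x w c
  using B that unfolding bilinear_form_on_def by blast+
 have e: "emb Q v x : dsum Q (vsp M)" if "x : vsp M v" for v x
  by (rule emb_in_dsum[of "vsp M", OF z that])
 have z0: "(\<lambda>i\<in>verts Q. 0) : dsum Q (vsp M)" using z by simp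
 have b0: "bform M (\<lambda>i\<in>verts Q. 0) w = 0" "bform M w (\<lambda>i\<in>verts Q. 0) = 0" if "w : dsum Q (vsp M)" for w
  using sc[OF z0 that, of 0] by (simp_all cong: restrict_cong)
 have orth: "bform M (emb Q i x) (emb Q j y) = 0"
  if "i : verts Q" "j : verts Q" "i ~= sg j" "x : vsp M i" "y : vsp M j" for i j x y
  using M that unfolding self_dual_def by blast
 have right: "bform M (emb Q v x) w = nform M v x (w (sg v))"
  if v: "v : verts Q" "x : vsp M v" "w : dsum Q (vsp M)" for v x w
 proof -
  have wi: "w i : vsp M i" if "i : verts Q" for i using PiE_mem[OF v(3) that] .
  have "bform M (emb Q v x) w = (\<Sum>j\<in>verts Q. bform M (emb Q v x) (emb Q j (w j)))"
   by (rule dsum_induct_sum[where V = "vsp M" and F = "bform M (emb Q v x)", OF z v(3) add(2) b0(2)])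
    (use e[OF v(2)] in auto)
  also have "\<dots> = (\<Sum>j\<in>{sg v}. bform M (emb Q v x) (emb Q j (w j)))"
  proof (rule sum.mono_neutral_right)
   show "\<forall>j\<in>verts Q - {sg v}. bform M (emb Q v x) (emb Q j (w j)) = 0"
   proof
    fix j assume j: "j : verts Q - {sg v}"
    then have "v ~= sg j" using sig(2)[of j] by auto
    then show "bform M (emb Q v x) (emb Q j (w j)) = 0" using orth j v(1,2) wi by blast
   qed
  qed (use sig v in auto)
  finally show ?thesis by (simp add: nform_def)
 qed
 have full: "bform M u w = (\<Sum>v\<in>verts Q. nform M v (u v) (w (sg v)))"
  if u: "u : dsum Q (vsp M)" and w: "w : dsum Q (vsp M)" for u w
 proof -
  have "bform M u w = (\<Sum>v\<in>verts Q. bform M (emb Q v (u v)) w)"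
   by (rule dsum_induct_sum[where V = "vsp M" and F = "%u. bform M u w", OF z u add(1) b0(1)]) (use w in auto)
  also have "\<dots> = (\<Sum>v\<in>verts Q. nform M v (u v) (w (sg v)))"
   by (rule sum.cong[OF refl]) (use right[OF _ _ w] PiE_mem[OF u] in auto)
  finally show ?thesis .
 qed
 have bil: "bilin (vsp M v) (vsp M (sg v)) (nform M v)" if v: "v : verts Q" for v
  unfolding bilin_def nform_def
  by (simp add: emb_add[symmetric] emb_kscale[symmetric] add sc e)
 have sym: "nform M v x y = of_int (nsgn D v) * nform M (sg v) y x"
  if v: "v : verts Q" "x : vsp M v" "y : vsp M (sg v)" for v x y
 proof -
  have "bform M (emb Q v x) (emb Q (sg v) y) = of_int (nsgn D v) * bform M (emb Q (sg v) y) (emb Q v x)"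
  proof -
   have "\<forall>j\<in>verts Q - {v, sg v}. emb Q v x j = 0 & emb Q (sg v) y j = 0" by auto
   then show ?thesis using M v e unfolding self_dual_def by blast
  qed
  then show ?thesis using sig(2)[OF v(1)] by (simp add: nform_def)
 qed
 have nd: "x = 0" if v: "v : verts Q" "x : vsp M v" and h: "\<forall>y\<in>vsp M (sg v). nform M v x y = 0" for v x
 proof -
  have "bform M (emb Q v x) w = 0" if w: "w : dsum Q (vsp M)" for w
   using right[OF v w] h PiE_mem[OF w sig(1)[OF v(1)]] by simp
  then have "emb Q v x = (\<lambda>i\<in>verts Q. 0)" using N e[OF v(2)] unfolding nondegenerate_on_def by blast
  then have "emb Q v x v = 0" using v(1) by simp
  then show "x = 0" using v(1) by simp
 qed
 have adj: "nform M (head Q ar) (vmap M ar x) y = of_int (asgn D ar) * nform M (tail Q ar) x (vmap M (asig D ar) y)"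
  if "ar : arcs Q" "x : vsp M (tail Q ar)" "y : vsp M (sg (head Q ar))" for ar x y
  using M that unfolding self_dual_def nform_def by blast
 show ?thesis
  unfolding sd_forms_def using R full bil sym nd adj by (intro conjI ballI impI) simp_all
qed

text \<open>The family \<open>\<beta>\<close> is kept apart from \<open>nform M\<close> so that
  models can be given by explicit matrices; the second claim identifies the two on the
  representation spaces. Symmetry of the total form follows by reindexing its sum with the
  involution.\<close>

lemma forms_self_dual:
 fixes M :: "('v, 'a, 'k::{field,finite}) sdrep"
 assumes F: "sd_forms M \<beta>"
 shows "self_dual Q D M" "v : verts Q ==> x : vsp M v ==> y : vsp M (sg v) ==> nform M v x y = \<beta> v x y"
proof -
 have R: "representation Q M" and full: "!!u w. u : dsum Q (vsp M) ==> w : dsum Q (vsp M) ==>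
   bform M u w = (\<Sum>v\<in>verts Q. \<beta> v (u v) (w (sg v)))"
  and bil: "!!v. v : verts Q ==> bilin (vsp M v) (vsp M (sg v)) (\<beta> v)"
  and sym: "!!v x y. v : verts Q ==> x : vsp M v ==> y : vsp M (sg v) ==> \<beta> v x y = of_int (nsgn D v) * \<beta> (sg v) y x"
  and nd: "!!v x. v : verts Q ==> x : vsp M v ==> (\<forall>y\<in>vsp M (sg v). \<beta> v x y = 0) ==> x = 0"
  and adj: "!!ar x y. ar : arcs Q ==> x : vsp M (tail Q ar) ==> y : vsp M (sg (head Q ar)) ==>
    \<beta> (head Q ar) (vmap M ar x) y = of_int (asgn D ar) * \<beta> (tail Q ar) x (vmap M (asig D ar) y)"
  using F unfolding sd_forms_def by simp_all
 have z: "0 : vsp M i" if "i : verts Q" for i using kvec.subspace_0[OF repD(1)[OF R that]] .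
 have e: "emb Q v x : dsum Q (vsp M)" if "x : vsp M v" for v x
  by (rule emb_in_dsum[of "vsp M", OF z that])
 have b0: "\<beta> v 0 y = 0" "x : vsp M v ==> \<beta> v x 0 = 0" if "v : verts Q" "y : vsp M (sg v)" for v x y
  using bilin_0[OF bil[OF that(1)]] z that sig(1)[OF that(1)] by blast+
 have ee: "bform M (emb Q i x) (emb Q j y) = (if i = sg j then \<beta> i x y else 0)"
  if ij: "i : verts Q" "j : verts Q" "x : vsp M i" "y : vsp M j" for i j x y
 proof -
  have "bform M (emb Q i x) (emb Q j y) = (\<Sum>v\<in>verts Q. \<beta> v (emb Q i x v) (emb Q j y (sg v)))"
   by (rule full[OF e[OF ij(3)] e[OF ij(4)]])
  also have "\<dots> = (\<Sum>v\<in>{i}. \<beta> v (emb Q i x v) (emb Q j y (sg v)))"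
  proof (rule sum.mono_neutral_right)
   show "\<forall>v\<in>verts Q - {i}. \<beta> v (emb Q i x v) (emb Q j y (sg v)) = 0"
    using b0(1) PiE_mem[OF e[OF ij(4)] sig(1)] by simp
  qed (use ij in auto)
  also have "\<dots> = (if i = sg j then \<beta> i x y else 0)"
   using ij sig b0(2)[OF ij(1) z[OF sig(1)[OF ij(1)]] ij(3)] by auto
  finally show ?thesis .
 qed
 show "nform M v x y = \<beta> v x y" if "v : verts Q" "x : vsp M v" "y : vsp M (sg v)" for v x y
  unfolding nform_def using ee[OF that(1) sig(1)[OF that(1)] that(2,3)] sig(2)[OF that(1)] by simp
 have symf: "bform M x x' = of_int (nsgn D i) * bform M x' x"
  if i: "i : verts Q" and x: "x : dsum Q (vsp M)" "x' : dsum Q (vsp M)" and s: "\<forall>j\<in>verts Q - {i, sg i}. x j = 0 & x' j = 0" for i x x'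
 proof -
  have xm: "x j : vsp M j" "x' j : vsp M j" if "j : verts Q" for j
   using PiE_mem[OF x(1) that] PiE_mem[OF x(2) that] .
  have "bform M x' x = (\<Sum>v\<in>verts Q. \<beta> (sg v) (x' (sg v)) (x (sg (sg v))))"
   unfolding full[OF x(2,1)]
   by (rule sum.reindex_bij_witness[of _ "sg" "sg"]) (simp_all add: sig)
  also have "\<dots> = (\<Sum>v\<in>verts Q. \<beta> (sg v) (x' (sg v)) (x v))"
   by (rule sum.cong[OF refl]) (simp add: sig)
  finally have "of_int (nsgn D i) * bform M x' x = (\<Sum>v\<in>verts Q. of_int (nsgn D i) * \<beta> (sg v) (x' (sg v)) (x v))"
   by (simp add: sum_distrib_left)
  moreover have "\<dots> = (\<Sum>v\<in>verts Q. \<beta> v (x v) (x' (sg v)))"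
  proof (rule sum.cong[OF refl])
   fix v assume v: "v : verts Q"
   show "of_int (nsgn D i) * \<beta> (sg v) (x' (sg v)) (x v) = \<beta> v (x v) (x' (sg v))"
   \<comment> \<open>The sign at \<open>v\<close> may be replaced by that at \<open>i\<close>: the
     two agree on the orbit of \<open>i\<close>, and elsewhere the vectors vanish.\<close>
   proof (cases "v = i | v = sg i")
    case True
    then have "nsgn D v = nsgn D i" using nsgn(2)[OF i] by auto
    then show ?thesis using sym[OF v xm(1)[OF v] xm(2)[OF sig(1)[OF v]]] by simp
   next
    case False
    then have "x v = 0" using s v by blast
    then show ?thesis
     using b0(1)[OF v xm(2)[OF sig(1)[OF v]]] b0(2)[OF sig(1)[OF v] _ xm(2)[OF sig(1)[OF v]], of 0] z v sig(2)[OF v] by simp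
   qed
  qed
  ultimately show ?thesis using full[OF x] by simp
 qed
 have ndl: "x = (\<lambda>i\<in>verts Q. 0)" if x: "x : dsum Q (vsp M)" and h: "\<forall>y\<in>dsum Q (vsp M). bform M x y = 0 | bform M y x = 0" for x
 proof -
  have xm: "x j : vsp M j" if "j : verts Q" for j using PiE_mem[OF x that] .
  have "x v = 0" if v: "v : verts Q" for v
  proof (rule nd[OF v xm[OF v]], rule ballI)
   fix y assume y: "y : vsp M (sg v)"
   have ey: "emb Q (sg v) y : dsum Q (vsp M)" by (rule e[OF y])
   have "bform M x (emb Q (sg v) y) = (\<Sum>u\<in>{v}. \<beta> u (x u) (emb Q (sg v) y (sg u)))"
    unfolding full[OF x ey]
   proof (rule sum.mono_neutral_right)
    show "\<forall>u\<in>verts Q - {v}. \<beta> u (x u) (emb Q (sg v) y (sg u)) = 0"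
    proof
     fix u assume u: "u : verts Q - {v}"
     then have "sg u ~= sg v" using sig(2) v by (metis DiffE insertI1)
     then show "\<beta> u (x u) (emb Q (sg v) y (sg u)) = 0"
      using b0(2)[of u 0 "x u"] u sig(1) z xm by auto
    qed
   qed (use v in auto)
   then have 1: "bform M x (emb Q (sg v) y) = \<beta> v (x v) y" using sig v by simp
   have "bform M (emb Q (sg v) y) x = (\<Sum>u\<in>{sg v}. \<beta> u (emb Q (sg v) y u) (x (sg u)))"
    unfolding full[OF ey x]
   proof (rule sum.mono_neutral_right)
    show "\<forall>u\<in>verts Q - {sg v}. \<beta> u (emb Q (sg v) y u) (x (sg u)) = 0"
     using b0(1) sig(1) xm by simp
   qed (use v sig in auto)
   then have "bform M (emb Q (sg v) y) x = \<beta> (sg v) y (x v)" using sig v by simp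
   then show "\<beta> v (x v) y = 0"
    using h ey 1 sym[OF v xm[OF v] y] by auto
  qed
  then show ?thesis using x by (intro ext) (auto simp: PiE_def extensional_def)
 qed
 show "self_dual Q D M"
  unfolding self_dual_def
 proof (intro conjI ballI impI)
  show "representation Q M" by (rule R)
  show "bilinear_form_on Q (vsp M) (bform M)"
   unfolding bilinear_form_on_def
  proof (intro conjI ballI allI)
   fix x y w assume x: "x : dsum Q (vsp M)" and y: "y : dsum Q (vsp M)" and w: "w : dsum Q (vsp M)"
   have xy: "(\<lambda>i\<in>verts Q. x i + y i) : dsum Q (vsp M)"
    using kvec.subspace_add[OF repD(1)[OF R]] PiE_mem[OF x] PiE_mem[OF y] by simp
   show "bform M (\<lambda>i\<in>verts Q. x i + y i) w = bform M x w + bform M y w"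
    unfolding full[OF xy w] full[OF x w] full[OF y w] sum.distrib[symmetric]
    using bilinD(1)[OF bil] PiE_mem[OF x] PiE_mem[OF y] PiE_mem[OF w] sig(1) by (intro sum.cong) simp_all
   show "bform M w (\<lambda>i\<in>verts Q. x i + y i) = bform M w x + bform M w y"
    unfolding full[OF w xy] full[OF w x] full[OF w y] sum.distrib[symmetric]
    using bilinD(3)[OF bil] PiE_mem[OF x] PiE_mem[OF y] PiE_mem[OF w] sig(1) by (intro sum.cong) simp_all
  next
   fix c x w assume x: "x : dsum Q (vsp M)" and w: "w : dsum Q (vsp M)"
   have cx: "(\<lambda>i\<in>verts Q. kscale c (x i)) : dsum Q (vsp M)"
    using kvec.subspace_scale[OF repD(1)[OF R]] PiE_mem[OF x] by simp
   show "bform M (\<lambda>i\<in>verts Q. kscale c (x i)) w = c * bform M x w"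
    unfolding full[OF cx w] full[OF x w] sum_distrib_left
    using bilinD(2)[OF bil] PiE_mem[OF x] PiE_mem[OF w] sig(1) by (intro sum.cong) simp_all
   show "bform M w (\<lambda>i\<in>verts Q. kscale c (x i)) = c * bform M w x"
    unfolding full[OF w cx] full[OF w x] sum_distrib_left
    using bilinD(4)[OF bil] PiE_mem[OF x] PiE_mem[OF w] sig(1) by (intro sum.cong) simp_all
  qed
  show "nondegenerate_on Q (vsp M) (bform M)"
   unfolding nondegenerate_on_def using ndl by blast
 next
  fix i j x y assume "i : verts Q" "j : verts Q" "i ~= sg j" "x : vsp M i" "y : vsp M j"
  then show "bform M (emb Q i x) (emb Q j y) = 0" using ee by simp
 next
  fix i x x' assume "i : verts Q" "x : dsum Q (vsp M)" "x' : dsum Q (vsp M)"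
   "\<forall>j\<in>verts Q - {i, sg i}. x j = 0 & x' j = 0"
  then show "bform M x x' = of_int (nsgn D i) * bform M x' x" by (rule symf)
 next
  fix ar x y assume a: "ar : arcs Q" and x: "x : vsp M (tail Q ar)" and y: "y : vsp M (sg (head Q ar))"
  have th: "tail Q ar : verts Q" "head Q ar : verts Q" using a by auto
  have mx: "vmap M ar x : vsp M (head Q ar)" by (rule linear_between_in[OF rep_linear[OF R a] x])
  have my: "vmap M (asig D ar) y : vsp M (sg (tail Q ar))"
   using linear_between_in[OF rep_linear[OF R asig(1)[OF a]], of y] y asig[OF a] by simp
  show "bform M (emb Q (head Q ar) (vmap M ar x)) (emb Q (sg (head Q ar)) y) =
   of_int (asgn D ar) * bform M (emb Q (tail Q ar) x) (emb Q (sg (tail Q ar)) (vmap M (asig D ar) y))"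
   using ee[OF th(2) sig(1)[OF th(2)] mx y] ee[OF th(1) sig(1)[OF th(1)] x my] adj[OF a x y] sig(2) th by simp
 qed
qed

end

text \<open>A vector killed by the transpose pairs to zero with the image of the square matrix,
  which is all of \<open>coords I\<close>; pairing with unit vectors reads off its entries.\<close>

lemma transpose_inj:
 fixes a :: "nat => nat => 'k::{field,finite}"
 assumes fin: "finite I" "finite J" "card I = card J"
  and nd: "!!w. w : coords J ==> mat_app I J a w = 0 ==> w = 0"
  and y: "y : coords I" "mat_app J I (%j i. a i j) y = 0"
 shows "y = 0"
proof (rule poly_mapping_eqI)
 fix i
 have l: "linear_between (coords J) (coords I) (mat_app I J a)" by (rule linear_between_mat_app[OF fin(1)])
 have "inj_on (mat_app I J a) (coords J)" using nd linear_between_inj_iff[OF l subspace_coords] by blast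
 then have b: "bij_betw (mat_app I J a) (coords J) (coords I)" by (rule bij_betw_linear_coordsI[OF fin l])
 show "entry y i = entry 0 i"
 proof (cases "i : I")
  case True
  then obtain w where w: "w : coords J" "mat_app I J a w = unitv i"
   using bij_betw_imp_surj_on[OF b] by (metis imageE unitv_in_coords)
  have "bf I J a y w = 0" unfolding bf_mat_app[OF fin(2)] y(2) by simp
  moreover have "bf I J a y w = entry y i"
   unfolding bf_mat_app_left[OF fin(1)] w(2)
   using sum_lookup_unitv[OF fin(1) True, of "entry y"] by (simp add: mult.commute)
  ultimately show ?thesis by simp
 next
  case False
  then show ?thesis using coords_lookup[OF y(1)] by simp
 qed
qed

section \<open>Orthogonals and isometries\<close>

context sd_quiver
begin

lemma sdD:
 fixes M :: "('v, 'a, 'k::{field,finite}) sdrep"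
 assumes M: "self_dual Q D M"
 shows "representation Q M"
  "u : dsum Q (vsp M) ==> w : dsum Q (vsp M) ==> bform M u w = (\<Sum>v\<in>verts Q. nform M v (u v) (w (sg v)))"
  "v : verts Q ==> bilin (vsp M v) (vsp M (sg v)) (nform M v)"
  "v : verts Q ==> x : vsp M v ==> y : vsp M (sg v) ==> nform M v x y = of_int (nsgn D v) * nform M (sg v) y x"
  "v : verts Q ==> x : vsp M v ==> (!!y. y : vsp M (sg v) ==> nform M v x y = 0) ==> x = 0"
  "ar : arcs Q ==> x : vsp M (tail Q ar) ==> y : vsp M (sg (head Q ar)) ==>
   nform M (head Q ar) (vmap M ar x) y = of_int (asgn D ar) * nform M (tail Q ar) x (vmap M (asig D ar) y)"
 using self_dual_forms[OF M] unfolding sd_forms_def by simp_all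

lemma nsgn_cases: "v : verts Q ==> nsgn D v = 1 | nsgn D v = -1"
 using eps_facts(1)[of "Inl v"] by simp

lemma nform_nondeg_right:
 fixes M :: "('v, 'a, 'k::{field,finite}) sdrep"
 assumes M: "self_dual Q D M" and v: "v : verts Q" "y : vsp M v"
  and h: "!!x. x : vsp M (sg v) ==> nform M (sg v) x y = 0"
 shows "y = 0"
 by (rule sdD(5)[OF M v]) (use sdD(4)[OF M v] h in simp)

lemma eform_bilin:
 fixes M :: "('v, 'a, 'k::{field,finite}) sdrep"
 assumes M: "self_dual Q D M" and e: "e : edges"
 shows "bilin (vsp M (src e)) (vsp M (dst e)) (eform M e)"
 using e
proof (cases rule: edges_cases)
 case (1 v)
 then show ?thesis using sdD(3)[OF M] by (simp add: fun_eq_iff[symmetric] bilin_def)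
next
 case (2 ar)
 have "bilin (vsp M (tail Q ar)) (vsp M (sg (head Q ar))) (%x y. nform M (head Q ar) (vmap M ar x) y)"
  by (rule bilin_comp[OF sdD(3)[OF M] rep_linear[OF sdD(1)[OF M]]]) (use 2 in \<open>auto simp: linear_between_def\<close>)
 then show ?thesis using 2 by (simp add: bilin_def)
qed

lemma eform_sym:
 fixes M :: "('v, 'a, 'k::{field,finite}) sdrep"
 assumes M: "self_dual Q D M" and e: "e : edges" and xy: "x : vsp M (src e)" "y : vsp M (dst e)"
 shows "eform M (einv e) y x = of_int (eps e) * eform M e x y"
 using e
proof (cases rule: edges_cases)
 case (1 v)
 then show ?thesis using sdD(4)[OF M, of v x y] xy nsgn_cases[of v] by auto
next
 case (2 ar)
 let ?t = "tail Q ar" and ?h = "head Q ar"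
 have th: "?t : verts Q" "?h : verts Q" using 2 by auto
 have x: "x : vsp M ?t" and y: "y : vsp M (sg ?h)" using xy 2 by simp_all
 have my: "vmap M (asig D ar) y : vsp M (sg ?t)"
  using linear_between_in[OF rep_linear[OF sdD(1)[OF M] asig(1)[OF 2(2)]], of y] y asig[OF 2(2)] by simp
 have s: "eform M (einv e) y x = nform M (sg ?t) (vmap M (asig D ar) y) x"
  using 2 asig(4)[OF 2(2)] by simp
 have "eform M e x y = of_int (eps e) * nform M (sg ?t) (vmap M (asig D ar) y) x"
  using sdD(6)[OF M 2(2) x y] sdD(4)[OF M th(1) x my] 2 by (simp add: mult.assoc)
 then show ?thesis unfolding s by (simp only: of_int_eps_eps[OF e])
qed

text \<open>The condition at \<open>v\<close> involves \<open>V\<close> at the dual node only, since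
  no other node pairs with \<open>v\<close>.\<close>

definition perp :: "('v, 'a, 'k::field) sdrep => ('v => 'k vec set) => 'v => 'k vec set"
 where "perp M V = onverts Q (%v. {y : vsp M v. \<forall>x\<in>V (sg v). nform M (sg v) x y = 0})"

lemma perp_iff: "v : verts Q ==> y : perp M V v \<longleftrightarrow> y : vsp M v & (\<forall>x\<in>V (sg v). nform M (sg v) x y = 0)"
 by (simp add: perp_def)

text \<open>A frame at the dual node adapted to \<open>V\<close> turns pairing with its basis
  vectors into a coordinate map \<open>T\<close>, injective by nondegeneracy; the orthogonal of
  \<open>V\<close> becomes the coordinate subspace avoiding the indices of \<open>V\<close>.
  Injectivity at \<open>v\<close> and at the dual node makes the two dimensions equal, so
  \<open>T\<close> is onto.\<close>

lemma dim_sig_and_perp: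
 fixes M :: "('v, 'a, 'k::{field,finite}) sdrep"
 assumes M: "self_dual Q D M" and v: "v : verts Q"
  and V: "kvec.subspace (V (sg v))" "V (sg v) <= vsp M (sg v)"
 shows "kvec.dim (vsp M v) = kvec.dim (vsp M (sg v))" (is ?dims)
  "kvec.subspace (perp M V v)" (is ?sub)
  "kvec.dim (perp M V v) + kvec.dim (V (sg v)) = kvec.dim (vsp M v)" (is ?perp)
proof -
 note R = sdD(1)[OF M]
 \<comment> \<open>Stated for arbitrary node and family, since it is used both with \<open>V\<close>
   and, to compare dimensions, with the whole space.\<close>
 have T: "\<exists>T. linear_between (vsp M v) (coords {..<kvec.dim (vsp M (sg v))}) T & inj_on T (vsp M v) &
   (\<forall>y\<in>vsp M v. (\<forall>x\<in>V (sg v). nform M (sg v) x y = 0) \<longleftrightarrow>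
    T y : coords ({..<kvec.dim (vsp M (sg v))} - {..<kvec.dim (V (sg v))}))"
  if v: "v : verts Q" and V: "kvec.subspace (V (sg v))" "V (sg v) <= vsp M (sg v)" for v V
 proof -
  let ?W = "vsp M (sg v)"
  let ?A = "{..<kvec.dim (V (sg v))}" and ?I = "{..<kvec.dim ?W}"
  note sv = sig(1)[OF v]
  have fV: "finite (V (sg v))" by (rule finite_subset[OF V(2) repD(2)[OF R sv]])
  obtain f where f: "linear_between (coords ?A) (V (sg v)) f" "bij_betw f (coords ?A) (V (sg v))"
   using exists_frame[OF V(1) fV, of ?A] by auto
  have f': "linear_between (coords ?A) ?W f"
   by (rule linear_between_mono[OF f(1) subset_refl]) (use bij_betw_imp_surj_on[OF f(2)] V(2) in simp)
  have "?A <= ?I" using dim_mono[OF V(1) repD[OF R sv] V(2)] by simp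
  then obtain ph where ph: "linear_between (coords ?I) ?W ph" "bij_betw ph (coords ?I) ?W" "!!x. x : coords ?A ==> ph x = f x"
   using linear_extend[OF repD[OF R sv] _ _ f' bij_betw_imp_inj_on[OF f(2)], of ?I] by auto
  have phA: "ph ` coords ?A = V (sg v)" using ph(3) bij_betw_imp_surj_on[OF f(2)] by simp
  note phI = bij_betw_imp_surj_on[OF ph(2)]
  define T where "T y = comb ?I (%i. nform M (sg v) (ph (unitv i)) y)" for y
  have u: "ph (unitv i) : ?W" if "i : ?I" for i using linear_between_in[OF ph(1)] that by simp
  have bl: "bilin ?W (vsp M v) (nform M (sg v))" using sdD(3)[OF M sv] sig(2)[OF v] by simp
  have lT: "linear_between (vsp M v) (coords ?I) T"
   unfolding linear_between_def T_def
  proof (intro conjI ballI allI)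
   show "(%y. comb ?I (%i. nform M (sg v) (ph (unitv i)) y)) : vsp M v \<rightarrow> coords ?I"
    by (simp add: comb_in_coords)
   show "comb ?I (%i. nform M (sg v) (ph (unitv i)) (x + y)) =
    comb ?I (%i. nform M (sg v) (ph (unitv i)) x) + comb ?I (%i. nform M (sg v) (ph (unitv i)) y)"
    if "x : vsp M v" "y : vsp M v" for x y
    by (rule poly_mapping_eqI) (use bilinD(3)[OF bl u that] in \<open>simp add: lookup_comb lookup_add\<close>)
   show "comb ?I (%i. nform M (sg v) (ph (unitv i)) (kscale c x)) = kscale c (comb ?I (%i. nform M (sg v) (ph (unitv i)) x))"
    if "x : vsp M v" for c x
    by (rule poly_mapping_eqI) (use bilinD(4)[OF bl u that] in \<open>simp add: lookup_comb lookup_kscale\<close>)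
  qed
  have key: "(\<forall>x\<in>ph ` coords A'. nform M (sg v) x y = 0) \<longleftrightarrow> T y : coords (?I - A')"
   if A': "A' <= ?I" and y: "y : vsp M v" for A' y
  proof
   assume h: "\<forall>x\<in>ph ` coords A'. nform M (sg v) x y = 0"
   have "nform M (sg v) (ph (unitv i)) y = 0" if "i : A'" for i
    using h that by simp
   then show "T y : coords (?I - A')" by (simp add: coords_def T_def lookup_comb)
  next
   assume h: "T y : coords (?I - A')"
   have z: "nform M (sg v) (ph (unitv i)) y = 0" if "i : A'" for i
   proof -
    have "i : ?I" using A' that by blast
    moreover have "entry (T y) i = 0" by (rule coords_lookup[OF h]) (use that in blast)
    ultimately show ?thesis by (simp add: T_def lookup_comb)
   qed
   show "\<forall>x\<in>ph ` coords A'. nform M (sg v) x y = 0"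
   proof
    fix x assume "x : ph ` coords A'"
    then obtain w where w: "w : coords A'" "x = ph w" by blast
    have wI: "w : coords ?I" by (rule subsetD[OF coords_mono[OF A'] w(1)])
    have "bilin (coords ?I) (vsp M v) (%x y. nform M (sg v) (ph x) y)"
     by (rule bilin_comp[OF bl ph(1)]) (simp add: linear_between_def)
    from bilin_expand_left[OF this finite_lessThan wI y]
    have "nform M (sg v) x y = (\<Sum>i\<in>?I. entry w i * nform M (sg v) (ph (unitv i)) y)"
     by (simp only: w(2))
    also have "\<dots> = 0"
    proof (rule sum.neutral, rule ballI)
     fix i
     show "entry w i * nform M (sg v) (ph (unitv i)) y = 0"
      using z[of i] coords_lookup[OF w(1), of i] by (cases "i : A'") simp_all
    qed
    finally show "nform M (sg v) x y = 0" .
   qed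
  qed
  have "inj_on T (vsp M v)"
   unfolding linear_between_inj_iff[OF lT repD(1)[OF R v]]
  proof (intro ballI impI)
   fix y assume y: "y : vsp M v" "T y = 0"
   then have "\<forall>x\<in>ph ` coords ?I. nform M (sg v) x y = 0" using key[OF subset_refl y(1)] by simp
   then show "y = 0" unfolding phI by (intro nform_nondeg_right[OF M v y(1)]) blast
  qed
  then show ?thesis using lT key[OF \<open>?A <= ?I\<close>] unfolding phA by blast
 qed
 have le: "kvec.dim (vsp M v) <= kvec.dim (vsp M (sg v))" if v: "v : verts Q" for v
 proof -
  obtain T where T': "linear_between (vsp M v) (coords {..<kvec.dim (vsp M (sg v))}) T" "inj_on T (vsp M v)"
   using T[of v "vsp M", OF v repD(1)[OF R sig(1)[OF v]] subset_refl] by blast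
  have "kvec.dim (T ` vsp M v) <= kvec.dim (coords {..<kvec.dim (vsp M (sg v))} :: 'k vec set)"
   using linear_between_in[OF T'(1)]
   by (intro dim_mono[OF linear_between_image_subspace[OF T'(1) repD(1)[OF R v]] subspace_coords finite_coords]) auto
  then show ?thesis using dim_image_inj[OF T' repD[OF R v]] by (simp add: dim_coords)
 qed
 show ?dims using le[OF v] le[OF sig(1)[OF v]] sig(2)[OF v] by simp
 let ?n = "kvec.dim (vsp M (sg v))" and ?a = "kvec.dim (V (sg v))"
 obtain T where T': "linear_between (vsp M v) (coords {..<?n}) T" "inj_on T (vsp M v)"
   "!!y. y : vsp M v ==> (\<forall>x\<in>V (sg v). nform M (sg v) x y = 0) \<longleftrightarrow> T y : coords ({..<?n} - {..<?a})"
  using T[of v V, OF v V] by blast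
 have img: "T ` vsp M v = coords {..<?n}"
 proof (rule dim_eq_imp_eq)
  show "kvec.subspace (T ` vsp M v)" by (rule linear_between_image_subspace[OF T'(1) repD(1)[OF R v]])
  show "T ` vsp M v <= coords {..<?n}" using linear_between_in[OF T'(1)] by blast
  show "kvec.dim (T ` vsp M v) = kvec.dim (coords {..<?n} :: 'k vec set)"
   using dim_image_inj[OF T'(1,2) repD[OF R v]] \<open>?dims\<close> by (simp add: dim_coords)
 qed (simp_all add: subspace_coords finite_coords)
 have bl: "bilin (vsp M (sg v)) (vsp M v) (nform M (sg v))" using sdD(3)[OF M sig(1)[OF v]] sig(2)[OF v] by simp
 show s: ?sub
  unfolding kvec.subspace_def
 proof (intro conjI ballI allI)
  show "0 : perp M V v"
   using kvec.subspace_0[OF repD(1)[OF R v]] bilin_0(2)[OF bl subsetD[OF V(2)]] v by (simp add: perp_iff)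
  fix x y assume xy: "x : perp M V v" "y : perp M V v"
  show "x + y : perp M V v"
   using xy kvec.subspace_add[OF repD(1)[OF R v]] bilinD(3)[OF bl subsetD[OF V(2)]] v by (simp add: perp_iff)
 next
  fix c x assume x: "x : perp M V v"
  show "kscale c x : perp M V v"
   using x kvec.subspace_scale[OF repD(1)[OF R v]] bilinD(4)[OF bl subsetD[OF V(2)]] v by (simp add: perp_iff)
 qed
 have pv: "perp M V v <= vsp M v" using v by (auto simp: perp_iff)
 have "T ` perp M V v = coords ({..<?n} - {..<?a})"
 proof (intro equalityI subsetI)
  fix z assume "z : T ` perp M V v"
  then obtain y where y: "y : perp M V v" "z = T y" by blast
  then show "z : coords ({..<?n} - {..<?a})" using T'(3)[of y] v by (simp add: perp_iff)
 next
  fix z :: "'k vec" assume z: "z : coords ({..<?n} - {..<?a})"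
  then have "z : coords {..<?n}" using coords_mono[of "{..<?n} - {..<?a}" "{..<?n}"] by blast
  then obtain y where y: "y : vsp M v" "z = T y" using img by blast
  then show "z : T ` perp M V v" using T'(3)[OF y(1)] z v by (auto simp: perp_iff)
 qed
 moreover have "kvec.dim (T ` perp M V v) = kvec.dim (perp M V v)"
 proof (rule dim_image_inj)
  show "linear_between (perp M V v) (coords {..<?n}) T"
   by (rule linear_between_mono[OF T'(1) pv]) (use img pv in blast)
 qed (use inj_on_subset[OF T'(2) pv] s finite_subset[OF pv repD(2)[OF R v]] in auto)
 moreover have "?a <= ?n" by (rule dim_mono[OF V(1) repD[OF R sig(1)[OF v]] V(2)])
 ultimately show ?perp using \<open>?dims\<close> by (simp add: dim_coords card_Diff_subset)
qed

lemma perp_antimono: "(!!v. v : verts Q ==> V v <= W v) ==> perp M W <= perp M V"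
 unfolding perp_def le_fun_def onverts_def using sig(1) by auto

text \<open>One inclusion is the symmetry of the form, equality then follows from
  dimensions.\<close>

lemma perp_perp:
 fixes M :: "('v, 'a, 'k::{field,finite}) sdrep"
 assumes M: "self_dual Q D M"
  and V: "!!v. v : verts Q ==> kvec.subspace (V v)" "!!v. v : verts Q ==> V v <= vsp M v"
   "!!v. v ~: verts Q ==> V v = {0}"
 shows "perp M (perp M V) = V"
proof (rule ext)
 fix v
 show "perp M (perp M V) v = V v"
 proof (cases "v : verts Q")
  case v: True
  have sv: "sg v : verts Q" by (rule sig(1)[OF v])
  have d1: "kvec.dim (perp M V (sg v)) + kvec.dim (V v) = kvec.dim (vsp M (sg v))"
   and p1: "kvec.subspace (perp M V (sg v))"
   using dim_sig_and_perp(2,3)[OF M sv, of V] V(1,2)[OF v] sig(2)[OF v] by simp_all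
  have p2: "perp M V (sg v) <= vsp M (sg v)" using sv by (auto simp: perp_iff)
  note d2 = dim_sig_and_perp[where V = "perp M V", OF M v p1 p2]
  have "V v <= perp M (perp M V) v"
  proof
   fix x assume x: "x : V v"
   have "nform M (sg v) y x = 0" if y: "y : perp M V (sg v)" for y
   proof -
    have "nform M v x y = 0" using y x sv sig(2)[OF v] by (simp add: perp_iff)
    then show ?thesis
     using sdD(4)[OF M sv, of y x] subsetD[OF p2 y] subsetD[OF V(2)[OF v] x] sig(2)[OF v] by simp
   qed
   then show "x : perp M (perp M V) v" using x V(2)[OF v] v by (auto simp: perp_iff)
  qed
  moreover have "finite (perp M (perp M V) v)"
   by (rule finite_subset[OF _ repD(2)[OF sdD(1)[OF M] v]]) (use v in \<open>auto simp: perp_iff\<close>)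
  moreover have "kvec.dim (V v) = kvec.dim (perp M (perp M V) v)" using d1 d2(1,3) by simp
  ultimately show ?thesis using dim_eq_imp_eq[OF V(1)[OF v] d2(2)] by simp
 qed (simp add: perp_def V(3))
qed

text \<open>Up to sign, the adjoint of the map along an arrow is the map along the dual arrow, which
  preserves \<open>V\<close>.\<close>

lemma perp_in_subs:
 fixes M :: "('v, 'a, 'k::{field,finite}) sdrep"
 assumes M: "self_dual Q D M" and V: "V : subs Q M"
 shows "perp M V : subs Q M"
proof (rule subsI)
 note R = sdD(1)[OF M]
 fix v assume v: "v : verts Q"
 show "kvec.subspace (perp M V v)"
  by (rule dim_sig_and_perp(2)[where V = V, OF M v subsD(1)[OF R V] subsD(3)[OF R V sig(1)[OF v]]])
 show "perp M V v <= vsp M v" using v by (auto simp: perp_iff)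
next
 note R = sdD(1)[OF M]
 fix ar y assume a: "ar : arcs Q" and y: "y : perp M V (tail Q ar)"
 let ?t = "tail Q ar" and ?h = "head Q ar"
 have th: "?t : verts Q" "?h : verts Q" using a by auto
 have yv: "y : vsp M ?t" using y th by (simp add: perp_iff)
 have my: "vmap M ar y : vsp M ?h" by (rule linear_between_in[OF rep_linear[OF R a] yv])
 have "nform M (sg ?h) x (vmap M ar y) = 0" if x: "x : V (sg ?h)" for x
 proof -
  have xv: "x : vsp M (sg ?h)" by (rule subsetD[OF subsD(3)[OF R V sig(1)[OF th(2)]] x])
  have "vmap M (asig D ar) x : V (sg ?t)"
   using subsD(5)[OF R V asig(1)[OF a], of x] x asig(3,4)[OF a] by simp
  then have "nform M (sg ?t) (vmap M (asig D ar) x) y = 0" using y th by (simp add: perp_iff)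
  then have "eform M (einv (Inr ar)) x y = 0" using asig(4)[OF a] by simp
  moreover have "eform M (einv (Inr ar)) x y = of_int (eps (Inr ar)) * eform M (Inr ar) y x"
   by (rule eform_sym[OF M]) (use a yv xv in simp_all)
  ultimately have "of_int (eps (Inr ar)) * eform M (Inr ar) y x = 0" by (simp only:)
  then have "eform M (Inr ar) y x = 0"
   using of_int_eps_eps[of "Inr ar" "eform M (Inr ar) y x"] a
   by (simp only: mult_zero_right edges_iff)
  then show ?thesis
   using sdD(4)[OF M th(2) my xv] nsgn_cases[OF th(2)] by auto
 qed
 then show "vmap M ar y : perp M V ?h" using my th by (simp add: perp_iff)
qed (simp add: perp_def)

text \<open>At \<open>v\<close> the orthogonal has the dimension of \<open>M\<close> minus that of
  \<open>V\<close> at the dual node. The weight is odd under the involution, so the two sign changes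
  cancel and the contribution of \<open>M\<close> is 0.\<close>

lemma wdim_perp:
 fixes M :: "('v, 'a, 'k::{field,finite}) sdrep"
 assumes M: "self_dual Q D M" and V: "V : subs Q M" and t: "!!v. v : verts Q ==> t (sg v) = - t v"
 shows "wdim Q t (perp M V) = wdim Q t V" "wdim Q t (vsp M) = 0"
proof -
 note R = sdD(1)[OF M]
 have re: "(\<Sum>v\<in>verts Q. f (sg v)) = (\<Sum>v\<in>verts Q. f v)" for f :: "'v => rat"
  by (rule sum.reindex_bij_witness[of _ "sg" "sg"]) (simp_all add: sig)
 have d: "of_nat (kvec.dim (perp M V v)) = (of_nat (kvec.dim (vsp M v)) - of_nat (kvec.dim (V (sg v))) :: rat)"
   and ds: "kvec.dim (vsp M (sg v)) = kvec.dim (vsp M v)" if v: "v : verts Q" for v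
  using dim_sig_and_perp(1,3)[where V = V, OF M v subsD(1)[OF R V] subsD(3)[OF R V sig(1)[OF v]]]
  by (simp_all add: eq_diff_eq of_nat_add[symmetric] del: of_nat_add)
 have "wdim Q t (vsp M) = (\<Sum>v\<in>verts Q. t (sg v) * of_nat (kvec.dim (vsp M (sg v))))"
  unfolding wdim_def by (rule re[symmetric])
 also have "\<dots> = - wdim Q t (vsp M)"
  unfolding wdim_def sum_negf[symmetric] by (rule sum.cong[OF refl]) (simp add: t ds)
 finally show 0: "wdim Q t (vsp M) = 0" by simp
 have "wdim Q t (perp M V) = wdim Q t (vsp M) + (\<Sum>v\<in>verts Q. t (sg v) * of_nat (kvec.dim (V (sg v))))"
  unfolding wdim_def sum.distrib[symmetric] by (rule sum.cong[OF refl]) (simp add: t d right_diff_distrib)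
 also have "(\<Sum>v\<in>verts Q. t (sg v) * of_nat (kvec.dim (V (sg v)))) = wdim Q t V"
  unfolding wdim_def by (rule re)
 finally show "wdim Q t (perp M V) = wdim Q t V" using 0 by simp
qed

lemma isotropic_iff:
 fixes M :: "('v, 'a, 'k::{field,finite}) sdrep"
 assumes M: "self_dual Q D M" and V: "V : subs Q M"
 shows "isotropic Q M V \<longleftrightarrow> V <= perp M V"
proof
 note R = sdD(1)[OF M]
 have sub: "dsum Q V <= dsum Q (vsp M)" by (rule PiE_mono) (rule subsD(3)[OF R V])
 show "V <= perp M V" if iso: "isotropic Q M V"
 proof (rule le_funI, rule subsetI)
  fix v y assume y: "y : V v"
  show "y : perp M V v"
  proof (cases "v : verts Q")
   case v: True
   have e: "emb Q i x : dsum Q V" if "x : V i" for i x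
    by (rule emb_in_dsum[of V]) (use kvec.subspace_0[OF subsD(1)[OF R V]] that in auto)
   have "nform M (sg v) x y = 0" if x: "x : V (sg v)" for x
    using iso e[OF x] e[OF y] sig(2)[OF v] unfolding isotropic_def nform_def by simp
   then show ?thesis using y subsD(3)[OF R V v] v by (auto simp: perp_iff)
  next
   case False
   then show ?thesis using y subsD(4)[OF R V] by (simp add: perp_def)
  qed
 qed
 show "isotropic Q M V" if le: "V <= perp M V"
  unfolding isotropic_def
 proof (intro ballI)
  fix u w assume u: "u : dsum Q V" and w: "w : dsum Q V"
  have "nform M v (u v) (w (sg v)) = 0" if v: "v : verts Q" for v
  proof -
   have "w (sg v) : perp M V (sg v)"
    using PiE_mem[OF w sig(1)[OF v]] le_funD[OF le, of "sg v"] by blast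
   then show ?thesis using PiE_mem[OF u v] sig[OF v] by (simp add: perp_iff)
  qed
  then show "bform M u w = 0" by (simp add: sdD(2)[OF M subsetD[OF sub u] subsetD[OF sub w]])
 qed
qed

lemma isometry_iff:
 fixes M N :: "('v, 'a, 'k::{field,finite}) sdrep"
 assumes M: "self_dual Q D M" and N: "self_dual Q D N" and f: "rep_iso Q M N f"
 shows "isometry Q M N f \<longleftrightarrow> (\<forall>v\<in>verts Q. \<forall>x\<in>vsp M v. \<forall>y\<in>vsp M (sg v).
  nform N v (f v x) (f (sg v) y) = nform M v x y)"
proof
 note R = sdD(1)[OF M]
 have fin: "f i x : vsp N i" if "i : verts Q" "x : vsp M i" for i x
  by (rule linear_between_in[OF rep_isoD(1)[OF f that(1)] that(2)])
 show "isometry Q M N f" if h: "\<forall>v\<in>verts Q. \<forall>x\<in>vsp M v. \<forall>y\<in>vsp M (sg v).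
  nform N v (f v x) (f (sg v) y) = nform M v x y"
  unfolding isometry_def
 proof (intro conjI ballI f)
  fix u w assume u: "u : dsum Q (vsp M)" and w: "w : dsum Q (vsp M)"
  have fu: "(\<lambda>i\<in>verts Q. f i (u i)) : dsum Q (vsp N)" "(\<lambda>i\<in>verts Q. f i (w i)) : dsum Q (vsp N)"
   using fin PiE_mem[OF u] PiE_mem[OF w] by simp_all
  show "bform N (\<lambda>i\<in>verts Q. f i (u i)) (\<lambda>i\<in>verts Q. f i (w i)) = bform M u w"
   unfolding sdD(2)[OF N fu] sdD(2)[OF M u w]
   by (rule sum.cong[OF refl]) (use h PiE_mem[OF u] PiE_mem[OF w] sig(1) in simp)
 qed
 show "\<forall>v\<in>verts Q. \<forall>x\<in>vsp M v. \<forall>y\<in>vsp M (sg v). nform N v (f v x) (f (sg v) y) = nform M v x y"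
  if iso: "isometry Q M N f"
 proof (intro ballI)
  fix v x y assume v: "v : verts Q" "x : vsp M v" "y : vsp M (sg v)"
  have z: "0 : vsp M i" if "i : verts Q" for i using kvec.subspace_0[OF repD(1)[OF R that]] .
  have e: "emb Q v x : dsum Q (vsp M)" "emb Q (sg v) y : dsum Q (vsp M)"
   by (rule emb_in_dsum[of "vsp M"]; use z v in simp)+
  have fe: "(\<lambda>i\<in>verts Q. f i (emb Q u w i)) = emb Q u (f u w)" for u w
   using linear_between_0[OF rep_isoD(1)[OF f] repD(1)[OF R]]
   by (intro ext) (simp add: emb_def restrict_def)
  show "nform N v (f v x) (f (sg v) y) = nform M v x y"
  proof -
   have "bform N (\<lambda>i\<in>verts Q. f i (emb Q v x i)) (\<lambda>i\<in>verts Q. f i (emb Q (sg v) y i)) =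
     bform M (emb Q v x) (emb Q (sg v) y)"
    using iso e unfolding isometry_def by blast
   then show ?thesis unfolding fe nform_def .
  qed
 qed
qed

text \<open>Compatibility with the arrows need not be assumed: the difference of
  \<open>f (m x)\<close> and \<open>m (f x)\<close> is orthogonal to the whole space at the dual
  node, because the forms of the node and of the arrow are both preserved.\<close>

lemma eforms_rep_iso:
 fixes M N :: "('v, 'a, 'k::{field,finite}) sdrep"
 assumes M: "self_dual Q D M" and N: "self_dual Q D N"
  and f: "!!i. i : verts Q ==> linear_between (vsp M i) (vsp N i) (f i)"
   "!!i. i : verts Q ==> bij_betw (f i) (vsp M i) (vsp N i)"
  and h: "!!e x y. e : edges ==> x : vsp M (src e) ==> y : vsp M (dst e) ==>
   eform N e (f (src e) x) (f (dst e) y) = eform M e x y"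
 shows "isometry Q M N f"
proof -
 note RM = sdD(1)[OF M] and RN = sdD(1)[OF N]
 have "rep_iso Q M N f"
  unfolding rep_iso_def
 proof (intro conjI ballI f)
  fix ar x assume a: "ar : arcs Q" and x: "x : vsp M (tail Q ar)"
  let ?t = "tail Q ar" and ?h = "head Q ar"
  have th: "?t : verts Q" "?h : verts Q" using a by auto
  have mx: "vmap M ar x : vsp M ?h" by (rule linear_between_in[OF rep_linear[OF RM a] x])
  have 1: "f ?h (vmap M ar x) : vsp N ?h" by (rule linear_between_in[OF f(1)[OF th(2)] mx])
  have 2: "vmap N ar (f ?t x) : vsp N ?h"
   by (rule linear_between_in[OF rep_linear[OF RN a] linear_between_in[OF f(1)[OF th(1)] x]])
  have "f ?h (vmap M ar x) - vmap N ar (f ?t x) = 0"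
  proof (rule sdD(5)[OF N th(2) kvec.subspace_diff[OF repD(1)[OF RN th(2)] 1 2]])
   fix y' assume "y' : vsp N (sg ?h)"
   then obtain y where y: "y : vsp M (sg ?h)" "y' = f (sg ?h) y"
    using bij_betw_imp_surj_on[OF f(2)[OF sig(1)[OF th(2)]]] by blast
   have y'N: "y' : vsp N (sg ?h)" by fact
   have "nform N ?h (f ?h (vmap M ar x)) y' = nform N ?h (vmap N ar (f ?t x)) y'"
    using h[of "Inl ?h" "vmap M ar x" y] h[of "Inr ar" x y] th a mx x y by simp
   moreover have "linear_between (vsp N ?h) (vsp N ?h) (%x. x)" by (simp add: linear_between_def)
   ultimately show "nform N ?h (f ?h (vmap M ar x) - vmap N ar (f ?t x)) y' = 0"
    using bilinD(1)[OF sdD(3)[OF N th(2)] kvec.subspace_diff[OF repD(1)[OF RN th(2)] 1 2] 2 y'N] by simp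
  qed
  then show "f ?h (vmap M ar x) = vmap N ar (f ?t x)" by simp
 qed
 moreover have "nform N v (f v x) (f (sg v) y) = nform M v x y"
  if "v : verts Q" "x : vsp M v" "y : vsp M (sg v)" for v x y
  using h[of "Inl v" x y] that by simp
 ultimately show ?thesis using isometry_iff[OF M N] by blast
qed

lemma isometry_eforms:
 fixes M N :: "('v, 'a, 'k::{field,finite}) sdrep"
 assumes M: "self_dual Q D M" and N: "self_dual Q D N" and f: "isometry Q M N f"
  and e: "e : edges" "x : vsp M (src e)" "y : vsp M (dst e)"
 shows "eform N e (f (src e) x) (f (dst e) y) = eform M e x y"
proof -
 have r: "rep_iso Q M N f" using f by (simp add: isometry_def)
 note h = isometry_iff[OF M N r, THEN iffD1, OF f, rule_format]
 show ?thesis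
  using e(1)
 proof (cases rule: edges_cases)
  case (1 v)
  then show ?thesis using h e by simp
 next
  case (2 ar)
  have x: "x : vsp M (tail Q ar)" using e 2 by simp
  have "vmap M ar x : vsp M (head Q ar)" by (rule linear_between_in[OF rep_linear[OF sdD(1)[OF M] 2(2)] x])
  then show ?thesis using h[OF head_in_verts[OF 2(2)]] rep_isoD(3)[OF r 2(2) x, symmetric] e 2 by simp
 qed
qed

section \<open>Matrix models of self-dual representations and their masses\<close>

definition eix :: "('v => nat set) => ('v => nat set) => (('v + 'a) \<times> nat \<times> nat) set"
 where "eix A B = (SIGMA e:edges. A (src e) \<times> B (dst e))"

definition esf :: "('v => nat set) => ('v => nat set) => (('v, 'a, 'k::field) esys) => 'v + 'a =>
  'k vec => 'k vec => 'k"
 where "esf J J' x e = bf (J (src e)) (J' (dst e)) (%i j. x (e, i, j))"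

text \<open>Two index families are allowed because in a flag the part indexed by \<open>A\<close>
  pairs perfectly with the part indexed by \<open>C\<close>; \<open>J' = J\<close> is the self-dual
  case.\<close>

definition nd2 :: "('v => nat set) => ('v => nat set) => (('v, 'a, 'k::field) esys) => bool"
 where "nd2 J J' x \<longleftrightarrow> (\<forall>v\<in>verts Q. \<forall>w\<in>coords (J' (sg v)).
  mat_app (J v) (J' (sg v)) (%i j. x (Inl v, i, j)) w = 0 --> w = 0)"

definition good2 :: "('v => nat set) => ('v => nat set) => bool"
 where "good2 J J' \<longleftrightarrow> (\<forall>v\<in>verts Q. finite (J v) & finite (J' v) & card (J v) = card (J' (sg v)))"

text \<open>The linear map \<open>m\<close> along \<open>ar : i \<rightarrow> j\<close> with \<open>\<langle>m z, w\<rangle>\<close> prescribed by the form of \<open>ar\<close>.\<close>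

definition vm2 :: "('v => nat set) => ('v => nat set) => (('v, 'a, 'k::field) esys) => 'a =>
  'k vec => 'k vec"
 where "vm2 J J' x ar z = the_inv_into (coords (J (head Q ar)))
  (mat_app (J' (sg (head Q ar))) (J (head Q ar)) (%j i. x (Inl (head Q ar), i, j)))
  (mat_app (J' (sg (head Q ar))) (J (tail Q ar)) (%j i. x (Inr ar, i, j)) z)"

lemma good2D:
 assumes "good2 J J'" "v : verts Q"
 shows "finite (J v)" "finite (J' v)" "card (J v) = card (J' (sg v))" "finite (J' (sg v))"
 using assms sig(1)[OF assms(2)] unfolding good2_def by blast+

lemma nd2_right:
 assumes "nd2 J J' x" "v : verts Q" "finite (J v)" "w : coords (J' (sg v))"
  and "!!i. i : J v ==> esf J J' x (Inl v) (unitv i) w = 0"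
 shows "w = 0"
proof -
 have "mat_app (J v) (J' (sg v)) (%i j. x (Inl v, i, j)) w = 0"
 proof (rule poly_mapping_eqI)
  fix i
  show "entry (mat_app (J v) (J' (sg v)) (%i j. x (Inl v, i, j)) w) i = entry 0 i"
   using assms(5)[of i] assms(3) by (cases "i : J v") (simp_all add: esf_def bf_unitv_left lookup_mat_app)
 qed
 then show ?thesis using assms(1,2,4) unfolding nd2_def by blast
qed

text \<open>\<open>nd2\<close> excludes a right kernel; as the pairing is square, there is no left
  kernel either, and this is what lets \<open>vm2\<close> be defined by inversion.\<close>

lemma nd2_left_bij:
 fixes x :: "('v, 'a, 'k::{field,finite}) esys"
 assumes g: "good2 J J'" and nd: "nd2 J J' x" and v: "v : verts Q"
 shows "bij_betw (mat_app (J' (sg v)) (J v) (%j i. x (Inl v, i, j))) (coords (J v)) (coords (J' (sg v)))"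
proof -
 note f = good2D[OF g v]
 have l: "linear_between (coords (J v)) (coords (J' (sg v))) (mat_app (J' (sg v)) (J v) (%j i. x (Inl v, i, j)))"
  by (rule linear_between_mat_app[OF f(4)])
 have "inj_on (mat_app (J' (sg v)) (J v) (%j i. x (Inl v, i, j))) (coords (J v))"
  unfolding linear_between_inj_iff[OF l subspace_coords]
 proof (intro ballI impI)
  fix y assume y: "y : coords (J v)" "mat_app (J' (sg v)) (J v) (%j i. x (Inl v, i, j)) y = 0"
  show "y = 0"
   by (rule transpose_inj[where a = "%i j. x (Inl v, i, j)", OF f(1,4,3) _ y])
    (use nd v in \<open>auto simp: nd2_def\<close>)
 qed
 then show ?thesis by (rule bij_betw_linear_coordsI[OF f(4,1) f(3)[symmetric] l])
qed

lemma vm2_eq_iff: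
 fixes x :: "('v, 'a, 'k::{field,finite}) esys"
 assumes g: "good2 J J'" and a: "ar : arcs Q"
 shows "mat_app (J' (sg (head Q ar))) (J (head Q ar)) (%j i. x (Inl (head Q ar), i, j)) y =
   mat_app (J' (sg (head Q ar))) (J (tail Q ar)) (%j i. x (Inr ar, i, j)) z \<longleftrightarrow>
  (\<forall>w\<in>coords (J' (sg (head Q ar))). esf J J' x (Inl (head Q ar)) y w = esf J J' x (Inr ar) z w)"
  (is "?T = ?S \<longleftrightarrow> _")
proof
 have h: "head Q ar : verts Q" using a by auto
 have f: "finite (J' (sg (head Q ar)))" by (rule good2D(4)[OF g h])
 show "\<forall>w\<in>coords (J' (sg (head Q ar))). esf J J' x (Inl (head Q ar)) y w = esf J J' x (Inr ar) z w" if "?T = ?S"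
  using that by (simp add: esf_def bf_mat_app[OF f])
 show "?T = ?S" if e: "\<forall>w\<in>coords (J' (sg (head Q ar))). esf J J' x (Inl (head Q ar)) y w = esf J J' x (Inr ar) z w"
 proof (rule poly_mapping_eqI)
  fix j
  show "entry ?T j = entry ?S j"
  proof (cases "j : J' (sg (head Q ar))")
   case True
   then have "esf J J' x (Inl (head Q ar)) y (unitv j) = esf J J' x (Inr ar) z (unitv j)" using e by simp
   then show ?thesis using True f by (simp add: esf_def bf_unitv_right)
  qed (simp add: lookup_mat_app[OF f])
 qed
qed

lemma vm2:
 fixes x :: "('v, 'a, 'k::{field,finite}) esys"
 assumes g: "good2 J J'" and nd: "nd2 J J' x" and a: "ar : arcs Q"
 shows "linear_between (coords (J (tail Q ar))) (coords (J (head Q ar))) (vm2 J J' x ar)"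
  and "w : coords (J' (sg (head Q ar))) ==>
   esf J J' x (Inl (head Q ar)) (vm2 J J' x ar z) w = esf J J' x (Inr ar) z w"
  and "y : coords (J (head Q ar)) ==>
   (!!w. w : coords (J' (sg (head Q ar))) ==> esf J J' x (Inl (head Q ar)) y w = esf J J' x (Inr ar) z w) ==>
   vm2 J J' x ar z = y"
proof -
 have th: "tail Q ar : verts Q" "head Q ar : verts Q" using a by auto
 note f = good2D[OF g th(2)] and b = nd2_left_bij[OF g nd th(2)]
 let ?T = "mat_app (J' (sg (head Q ar))) (J (head Q ar)) (%j i. x (Inl (head Q ar), i, j))"
 let ?S = "mat_app (J' (sg (head Q ar))) (J (tail Q ar)) (%j i. x (Inr ar, i, j))"
 show "linear_between (coords (J (tail Q ar))) (coords (J (head Q ar))) (vm2 J J' x ar)"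
  unfolding vm2_def
  by (rule linear_between_comp[OF linear_between_mat_app[OF f(4)]
   linear_between_inv[OF linear_between_mat_app[OF f(4)] b subspace_coords]])
 have "?T (vm2 J J' x ar z) = ?S z"
  unfolding vm2_def by (rule f_the_inv_into_f_bij_betw[OF b]) (simp add: f)
 then show "w : coords (J' (sg (head Q ar))) ==>
   esf J J' x (Inl (head Q ar)) (vm2 J J' x ar z) w = esf J J' x (Inr ar) z w"
  unfolding vm2_eq_iff[OF g a] by blast
 assume y: "y : coords (J (head Q ar))"
  and e: "!!w. w : coords (J' (sg (head Q ar))) ==> esf J J' x (Inl (head Q ar)) y w = esf J J' x (Inr ar) z w"
 then have "?T y = ?S z" unfolding vm2_eq_iff[OF g a] by blast
 then show "vm2 J J' x ar z = y"
  unfolding vm2_def using the_inv_into_f_f[OF bij_betw_imp_inj_on[OF b] y] by simp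
qed

text \<open>For nodes this is the symmetry of the form, for arrows the adjointness of the maps along
  dual arrows; both have become linear conditions on entries.\<close>

definition sym_on :: "(('v + 'a) \<times> nat \<times> nat) set => (('v, 'a, 'k::field) esys) => bool"
 where "sym_on Z x \<longleftrightarrow> (\<forall>e i j. (e, i, j) : Z --> x (einv e, j, i) = of_int (eps e) * x (e, i, j))"

definition sys :: "('v => nat set) => (('v, 'a, 'k::field) esys) set"
 where "sys J = {x : eix J J \<rightarrow>\<^sub>E UNIV. sym_on (eix J J) x & nd2 J J x}"

definition rho_sd :: "('v => nat set) => (('v, 'a, 'k::field) esys) => ('v, 'a, 'k) sdrep"
 where "rho_sd J x = \<lparr>vsp = kcf J, vmap = vm2 J J x,
  bform = %u w. \<Sum>v\<in>verts Q. esf J J x (Inl v) (u v) (w (sg v))\<rparr>"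

lemma rho_sd_simps [simp]: "vsp (rho_sd J x) = kcf J" "vmap (rho_sd J x) = vm2 J J x"
 by (simp_all add: rho_sd_def)

lemma esf_sym:
 assumes "sym_on (eix J J) x" "e : edges"
 shows "esf J J x (einv e) w u = of_int (eps e) * esf J J x e u w"
proof -
 have "esf J J x (einv e) w u = bf (J (dst e)) (J (src e)) (%j i. of_int (eps e) * x (e, i, j)) w u"
  unfolding esf_def edge_facts(3,4)[OF assms(2)]
  using assms by (intro bf_cong) (auto simp: sym_on_def eix_def)
 also have "\<dots> = bf (J (src e)) (J (dst e)) (%i j. of_int (eps e) * x (e, i, j)) u w"
  by (rule bf_swap)
 also have "\<dots> = of_int (eps e) * esf J J x e u w"
  unfolding esf_def bf_def sum_distrib_left by (intro sum.cong refl) (simp add: mult_ac)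
 finally show ?thesis .
qed

text \<open>Both sides of the adjointness relation equal the form of the arrow: one by the choice of
  \<open>vm2\<close>, the other through the dual arrow and \<open>sym_on\<close>.\<close>

lemma sd_forms_rho:
 fixes x :: "('v, 'a, 'k::{field,finite}) esys"
 assumes g: "good2 J J" and x: "x : sys J"
 shows "sd_forms (rho_sd J x) (%v. esf J J x (Inl v))"
proof -
 have nd: "nd2 J J x" and sy: "sym_on (eix J J) x" using x by (auto simp: sys_def)
 have R: "representation Q (rho_sd J x)"
  unfolding representation_def
  using good2D(1)[OF g] vm2(1)[OF g nd] by (simp add: fd_subspace_iff subspace_coords finite_coords)
 have sym: "esf J J x (Inl v) u w = of_int (nsgn D v) * esf J J x (Inl (sg v)) w u" if v: "v : verts Q" for v u w
  using esf_sym[OF sy, of "Inl v" w u] v nsgn_cases[OF v] by auto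
 have ndl: "u = 0" if v: "v : verts Q" and u: "u : coords (J v)" and h: "\<forall>w\<in>coords (J (sg v)). esf J J x (Inl v) u w = 0" for v u
 proof (rule nd2_right[OF nd sig(1)[OF v] good2D(1)[OF g sig(1)[OF v]]])
  show "u : coords (J (sg (sg v)))" using u sig(2)[OF v] by simp
  fix i assume "i : J (sg v)"
  then have "esf J J x (Inl v) u (unitv i) = 0" using h by simp
  then show "esf J J x (Inl (sg v)) (unitv i) u = 0"
   using sym[OF v, of u "unitv i"] nsgn_cases[OF v] by auto
 qed
 have adj: "esf J J x (Inl (head Q ar)) (vm2 J J x ar z) y = of_int (asgn D ar) * esf J J x (Inl (tail Q ar)) z (vm2 J J x (asig D ar) y)"
  if a: "ar : arcs Q" and z: "z : coords (J (tail Q ar))" and y: "y : coords (J (sg (head Q ar)))" for ar z y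
 proof -
  have th: "tail Q ar : verts Q" "head Q ar : verts Q" using a by auto
  have "esf J J x (Inl (head Q (asig D ar))) (vm2 J J x (asig D ar) y) z = esf J J x (Inr (asig D ar)) y z"
   by (rule vm2(2)[OF g nd asig(1)[OF a]]) (use z asig(4)[OF a] sig(2)[OF th(1)] in simp)
  then have "esf J J x (Inl (sg (tail Q ar))) (vm2 J J x (asig D ar) y) z = esf J J x (einv (Inr ar)) y z"
   using asig(4)[OF a] by simp
  also have "\<dots> = of_int (eps (Inr ar)) * esf J J x (Inr ar) z y"
   by (rule esf_sym[OF sy]) (simp add: a)
  finally have "of_int (asgn D ar) * esf J J x (Inl (tail Q ar)) z (vm2 J J x (asig D ar) y) =
    of_int (eps (Inr ar)) * (of_int (eps (Inr ar)) * esf J J x (Inr ar) z y)"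
   using sym[OF th(1), of z "vm2 J J x (asig D ar) y"] by (simp add: mult.assoc)
  also have "\<dots> = esf J J x (Inr ar) z y" by (rule of_int_eps_eps) (simp add: a)
  finally show ?thesis using vm2(2)[OF g nd a y] by simp
 qed
 show ?thesis
  unfolding sd_forms_def
 proof (intro conjI ballI impI)
  fix u w
  show "bform (rho_sd J x) u w = (\<Sum>v\<in>verts Q. esf J J x (Inl v) (u v) (w (sg v)))"
   by (simp add: rho_sd_def)
 next
  fix v
  show "bilin (vsp (rho_sd J x) v) (vsp (rho_sd J x) (sg v)) (esf J J x (Inl v))"
   unfolding esf_def by (rule bilin_bf)
 qed (use R sym ndl adj sig(1) in simp_all)
qed

lemma self_dual_rho:
 fixes x :: "('v, 'a, 'k::{field,finite}) esys"
 assumes g: "good2 J J" and x: "x : sys J"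
 shows "self_dual Q D (rho_sd J x)"
 by (rule forms_self_dual(1)[OF sd_forms_rho[OF assms]])

lemma eform_rho:
 fixes x :: "('v, 'a, 'k::{field,finite}) esys"
 assumes g: "good2 J J" and x: "x : sys J" and e: "e : edges" "u : coords (J (src e))" "w : coords (J (dst e))"
 shows "eform (rho_sd J x) e u w = esf J J x e u w"
proof -
 have nd: "nd2 J J x" using x by (auto simp: sys_def)
 have n: "nform (rho_sd J x) v u w = esf J J x (Inl v) u w"
  if "v : verts Q" "u : coords (J v)" "w : coords (J (sg v))" for v u w
  by (rule forms_self_dual(2)[OF sd_forms_rho[OF g x]]) (use that sig(1) in simp_all)
 show ?thesis
  using e(1)
 proof (cases rule: edges_cases)
  case (1 v)
  then show ?thesis using n e by simp
 next
  case (2 ar)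
  have h: "head Q ar : verts Q" using 2 by auto
  have u: "u : coords (J (tail Q ar))" and w: "w : coords (J (sg (head Q ar)))" using e 2 by simp_all
  have "vm2 J J x ar u : coords (J (head Q ar))" by (rule linear_between_in[OF vm2(1)[OF g nd 2(2)] u])
  then show ?thesis using n[OF h _ w] vm2(2)[OF g nd 2(2) w] 2 by simp
 qed
qed

definition SIsos :: "('v, 'a, 'k::field) sdrep => ('v, 'a, 'k) sdrep => ('v => 'k vec => 'k vec) set"
 where "SIsos M N = {f : Isos M N. isometry Q M N f}"

lemma SIsosD: "f : SIsos M N ==> f : Isos M N" "f : SIsos M N ==> isometry Q M N f"
 by (simp_all add: SIsos_def)

text \<open>The self-dual analogue of \<open>frame_lifts\<close>: the system consists of all edge
  forms pulled back along \<open>ph\<close>. By \<open>eforms_rep_iso\<close>, agreement of the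
  forms is enough for an isometry, and unit vectors give uniqueness.\<close>

lemma sd_frame_lifts:
 fixes M :: "('v, 'a, 'k::{field,finite}) sdrep"
 assumes M: "self_dual Q D M" and g: "good2 J J" and ph: "ph : frames J M"
 shows "\<exists>!x. x : sys J & ph : SIsos (rho_sd J x) M"
proof -
 note R = sdD(1)[OF M]
 have I: "linear_between (coords (J i)) (vsp M i) (ph i)" "bij_betw (ph i) (coords (J i)) (vsp M i)"
  "ph i : coords (J i) \<rightarrow>\<^sub>E vsp M i" if "i : verts Q" for i
  using PiE_mem[OF ph[unfolded frames_def] that] by (auto simp: Iso_def Lin_def)
 have ext: "ph : (\<Pi>\<^sub>E i\<in>verts Q. vsp (rho_sd J x) i \<rightarrow>\<^sub>E vsp M i)" for x :: "('v, 'a, 'k) esys"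
  using ph I(3) by (auto simp: frames_def PiE_iff)
 have phin: "ph i u : vsp M i" if "i : verts Q" "u : coords (J i)" for i u
  by (rule linear_between_in[OF I(1)[OF that(1)] that(2)])
 define x where "x = restrict (%(e, i, j). eform M e (ph (src e) (unitv i)) (ph (dst e) (unitv j))) (eix J J)"
 have esf_x: "esf J J x e u w = eform M e (ph (src e) u) (ph (dst e) w)"
  if e: "e : edges" "u : coords (J (src e))" "w : coords (J (dst e))" for e u w
 proof -
  note sd = edge_facts(5,6)[OF e(1)]
  have b: "bilin (coords (J (src e))) (coords (J (dst e))) (%u w. eform M e (ph (src e) u) (ph (dst e) w))"
   by (rule bilin_comp[OF eform_bilin[OF M e(1)] I(1)[OF sd(1)] I(1)[OF sd(2)]])
  have "eform M e (ph (src e) u) (ph (dst e) w) =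
   bf (J (src e)) (J (dst e)) (%i j. eform M e (ph (src e) (unitv i)) (ph (dst e) (unitv j))) u w"
   by (rule bilin_coords[OF b good2D(1)[OF g sd(1)] good2D(1)[OF g sd(2)] e(2,3)])
  also have "\<dots> = esf J J x e u w"
   unfolding esf_def by (rule bf_cong) (use e in \<open>simp add: x_def eix_def\<close>)
  finally show ?thesis by simp
 qed
 have x: "x : sys J"
  unfolding sys_def
 proof (intro CollectI conjI)
  show "x : eix J J \<rightarrow>\<^sub>E UNIV" by (simp add: x_def)
  show "sym_on (eix J J) x"
   unfolding sym_on_def
  proof (intro allI impI)
   fix e i j assume p: "(e, i, j) : eix J J"
   then have e: "e : edges" "i : J (src e)" "j : J (dst e)" by (auto simp: eix_def)
   note ef = edge_facts[OF e(1)]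
   have "(einv e, j, i) : eix J J" using e ef by (simp add: eix_def)
   then show "x (einv e, j, i) = of_int (eps e) * x (e, i, j)"
    using p eform_sym[OF M e(1) phin[OF ef(5)] phin[OF ef(6)], of "unitv i" "unitv j"] e ef by (simp add: x_def)
  qed
  show "nd2 J J x"
   unfolding nd2_def
  proof (intro ballI impI)
   fix v w assume v: "v : verts Q" and w: "w : coords (J (sg v))"
    and z: "mat_app (J v) (J (sg v)) (%i j. x (Inl v, i, j)) w = 0"
   note sv = sig(1)[OF v]
   have "ph (sg v) w = 0"
   proof (rule nform_nondeg_right[OF M sv phin[OF sv w]])
    fix y assume "y : vsp M (sg (sg v))"
    then have "y : vsp M v" using sig(2)[OF v] by simp
    then obtain u where u: "u : coords (J v)" "y = ph v u" using bij_betw_imp_surj_on[OF I(2)[OF v]] by blast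
    have "nform M v y (ph (sg v) w) = esf J J x (Inl v) u w"
     using esf_x[of "Inl v" u w] u v w by simp
    also have "\<dots> = 0"
     unfolding esf_def using z by (simp add: bf_mat_app_left[OF good2D(1)[OF g v]])
    finally show "nform M (sg (sg v)) y (ph (sg v) w) = 0" using sig(2)[OF v] by simp
   qed
   then show "w = 0"
    using linear_between_inj_iff[OF I(1)[OF sv] subspace_coords] bij_betw_imp_inj_on[OF I(2)[OF sv]] w by blast
  qed
 qed
 have "isometry Q (rho_sd J x) M ph"
  by (rule eforms_rep_iso[OF self_dual_rho[OF g x] M])
   (use I edge_facts(5,6) in \<open>simp_all add: eform_rho[OF g x] esf_x\<close>)
 then have "ph : SIsos (rho_sd J x) M"
  using ext unfolding SIsos_def Isos_def isometry_def by blast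
 moreover have "y = x" if y: "y : sys J" "ph : SIsos (rho_sd J y) M" for y
 proof (rule PiE_ext[of _ "eix J J" "%_. UNIV"])
  show "y : eix J J \<rightarrow>\<^sub>E UNIV" "x : eix J J \<rightarrow>\<^sub>E UNIV" using x y by (auto simp: sys_def)
  fix p assume "p : eix J J"
  then obtain e i j where p: "p = (e, i, j)" "e : edges" "i : J (src e)" "j : J (dst e)" by (auto simp: eix_def)
  note ef = edge_facts(5,6)[OF p(2)]
  have u: "unitv i : coords (J (src e))" "unitv j : coords (J (dst e))" using p by simp_all
  have "eform M e (ph (src e) (unitv i)) (ph (dst e) (unitv j)) = eform (rho_sd J y) e (unitv i) (unitv j)"
   by (rule isometry_eforms[OF self_dual_rho[OF g y(1)] M SIsosD(2)[OF y(2)] p(2)]) (use u ef in simp_all)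
  then have "esf J J x e (unitv i) (unitv j) = esf J J y e (unitv i) (unitv j)"
   using esf_x[OF p(2) u] eform_rho[OF g y(1) p(2) u] by simp
  then show "y p = x p"
   unfolding esf_def bf_unitv[OF good2D(1)[OF g ef(1)] good2D(1)[OF g ef(2)] p(3,4)] p(1) by simp
 qed
 ultimately show ?thesis using x by blast
qed

text \<open>Yields inverses, composition and the bijections between sets of isometries from one
  statement.\<close>

lemma isometry_comp_iff:
 fixes M N P :: "('v, 'a, 'k::{field,finite}) sdrep"
 assumes M: "self_dual Q D M" and N: "self_dual Q D N" and P: "self_dual Q D P"
  and f: "isometry Q M N f" and h: "rep_iso Q N P h" and k: "rep_iso Q M P k"
  and e: "!!i x. i : verts Q ==> x : vsp M i ==> k i x = h i (f i x)"
 shows "isometry Q M P k \<longleftrightarrow> isometry Q N P h"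
proof -
 have rf: "rep_iso Q M N f" using f by (simp add: isometry_def)
 note fi = isometry_iff[OF M N rf, THEN iffD1, OF f, rule_format]
 have "isometry Q M P k \<longleftrightarrow> (\<forall>v\<in>verts Q. \<forall>x\<in>vsp M v. \<forall>y\<in>vsp M (sg v).
   nform P v (h v (f v x)) (h (sg v) (f (sg v) y)) = nform N v (f v x) (f (sg v) y))"
  unfolding isometry_iff[OF M P k] by (intro ball_cong refl) (simp add: e sig(1) fi)
 also have "\<dots> \<longleftrightarrow> (\<forall>v\<in>verts Q. \<forall>x\<in>vsp N v. \<forall>y\<in>vsp N (sg v).
   nform P v (h v x) (h (sg v) y) = nform N v x y)"
 proof (rule ball_cong[OF refl])
  fix v assume v: "v : verts Q"
  show "(\<forall>x\<in>vsp M v. \<forall>y\<in>vsp M (sg v).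
    nform P v (h v (f v x)) (h (sg v) (f (sg v) y)) = nform N v (f v x) (f (sg v) y)) \<longleftrightarrow>
   (\<forall>x\<in>vsp N v. \<forall>y\<in>vsp N (sg v). nform P v (h v x) (h (sg v) y) = nform N v x y)"
   unfolding ball_bij_betw[OF rep_isoD(2)[OF rf v]] ball_bij_betw[OF rep_isoD(2)[OF rf sig(1)[OF v]]] ..
 qed
 also have "\<dots> \<longleftrightarrow> isometry Q N P h" by (rule isometry_iff[OF N P h, symmetric])
 finally show ?thesis .
qed

lemma isometry_inv:
 fixes M N :: "('v, 'a, 'k::{field,finite}) sdrep"
 assumes M: "self_dual Q D M" and N: "self_dual Q D N" and f: "isometry Q M N f"
 shows "isometry Q N M (%i. the_inv_into (vsp M i) (f i))"
proof -
 have rf: "rep_iso Q M N f" using f by (simp add: isometry_def)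
 have id: "isometry Q M M (%i x. x)"
  using isometry_iff[OF M M rep_iso_id[OF sdD(1)[OF M]]] by simp
 have "isometry Q M M (%i x. x) \<longleftrightarrow> isometry Q N M (%i. the_inv_into (vsp M i) (f i))"
  by (rule isometry_comp_iff[OF M N M f rep_iso_inv[OF sdD(1)[OF M] rf] rep_iso_id[OF sdD(1)[OF M]]])
   (use rep_isoD(2)[OF rf] in \<open>simp add: bij_betw_def the_inv_into_f_f\<close>)
 then show ?thesis using id by blast
qed

lemma card_SIsos:
 fixes M N :: "('v, 'a, 'k::{field,finite}) sdrep"
 assumes M: "self_dual Q D M" and N: "self_dual Q D N" and f: "isometry Q M N f"
 shows "card (SIsos M N) = card (SIsos N N)"
proof -
 have rf: "rep_iso Q M N f" using f by (simp add: isometry_def)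
 note b = bij_betw_Isos_comp[OF sdD(1)[OF M] sdD(1)[OF N] rf, of N]
 have "bij_betw (%h. mkext (vsp M) (%i x. h i (f i x))) (SIsos N N) (SIsos M N)"
  unfolding SIsos_def[of N N]
 proof (rule bij_betw_filter[OF b])
  fix h assume h: "h : Isos N N"
  have k: "mkext (vsp M) (%i x. h i (f i x)) : Isos M N" using bij_betwE[OF b] h by blast
  have "isometry Q M N (mkext (vsp M) (%i x. h i (f i x))) \<longleftrightarrow> isometry Q N N h"
   by (rule isometry_comp_iff[OF M N N f IsosD[OF h] IsosD[OF k]]) simp
  then show "mkext (vsp M) (%i x. h i (f i x)) : SIsos M N \<longleftrightarrow> isometry Q N N h"
   unfolding SIsos_def using k by simp
 qed (auto simp: SIsos_def)
 then show ?thesis by (rule bij_betw_same_card[symmetric])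
qed

lemma equiv_isometry_rel: "equiv {M :: ('v, 'a, 'k::{field,finite}) sdrep. self_dual Q D M} (isometry_rel Q D)"
proof (rule equivI)
 show "refl_on {M :: ('v, 'a, 'k) sdrep. self_dual Q D M} (isometry_rel Q D)"
  using isometry_iff[OF _ _ rep_iso_id[OF sdD(1)]] by (fastforce simp: refl_on_def isometry_rel_def)
 show "sym (isometry_rel Q D :: (('v, 'a, 'k) sdrep \<times> _) set)"
  unfolding sym_def isometry_rel_def using isometry_inv by blast
 show "trans (isometry_rel Q D :: (('v, 'a, 'k) sdrep \<times> _) set)"
 proof (rule transI)
  fix M N P :: "('v, 'a, 'k) sdrep" assume "(M, N) : isometry_rel Q D" "(N, P) : isometry_rel Q D"
  then obtain f g where sd: "self_dual Q D M" "self_dual Q D N" "self_dual Q D P"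
   and f: "isometry Q M N f" and gg: "isometry Q N P g" unfolding isometry_rel_def by blast
  have r: "rep_iso Q M N f" "rep_iso Q N P g" using f gg by (simp_all add: isometry_def)
  have "isometry Q M P (%i x. g i (f i x))"
   using isometry_comp_iff[OF sd f r(2) rep_iso_comp[OF r]] gg by simp
  then show "(M, P) : isometry_rel Q D" unfolding isometry_rel_def using sd by blast
 qed
qed (auto simp: isometry_rel_def)

definition smass :: "('v, 'a, 'k::{field,finite}) sdrep set => real"
 where "smass S = (\<Sum>C\<in>S // isometry_rel Q D. 1 / real (card (Aut_S Q (SOME M. M : C))))"

lemma finite_eix: "good2 J J' ==> finite (eix J J')"
 unfolding eix_def using finite_edges edge_facts(5,6) good2D(1,2)
 by (intro finite_SigmaI finite_cartesian_product) auto

lemma smass_eq: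
 fixes S :: "('v, 'a, 'k::{field,finite}) sdrep set"
 assumes g: "good2 J J"
  and S: "!!M. M : S ==> self_dual Q D M" "!!M. M : S ==> dims M (%i. card (J i))"
   "!!M N f. M : S ==> self_dual Q D N ==> isometry Q M N f ==> N : S"
  and X: "X <= sys J" "!!x. x : X ==> rho_sd J x : S"
  and FR: "!!M. M : S ==> FR M <= frames J M" "!!M. M : S ==> card (FR M) = n" "0 < n"
   "!!M x ph. M : S ==> x : sys J ==> ph : FR M ==> ph : SIsos (rho_sd J x) M ==> x : X"
   "!!M x ph. M : S ==> x : X ==> ph : SIsos (rho_sd J x) M ==> ph : FR M"
 shows "smass S = real (card X) / real n"
 unfolding smass_def
proof (rule groupoid_mass[where iso = SIsos and fr = FR and \<rho> = "rho_sd J", OF _ X(2) equiv_isometry_rel])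
 have "finite (eix J J \<rightarrow>\<^sub>E (UNIV :: 'k set))" using finite_eix[OF g] by (simp add: finite_PiE)
 moreover have "X <= eix J J \<rightarrow>\<^sub>E (UNIV :: 'k set)" using X(1) unfolding sys_def by blast
 ultimately show "finite X" by (rule rev_finite_subset)
 show "S <= {M. self_dual Q D M}" using S(1) by blast
 show "!!M N. M : S ==> (M, N) : isometry_rel Q D ==> N : S" using S(3) unfolding isometry_rel_def by blast
 show "!!M. M : S ==> finite (FR M)"
  by (rule finite_subset[OF FR(1) card_frames(2)[OF sdD(1)[OF S(1)] good2D(1)[OF g] S(2)]])
 show "!!M. M : S ==> card (FR M) = n" "0 < n" by (fact FR)+
 show "\<exists>!x. x : X & ph : SIsos (rho_sd J x) M" if "M : S" "ph : FR M" for M ph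
 proof -
  from sd_frame_lifts[OF S(1)[OF that(1)] g subsetD[OF FR(1)[OF that(1)] that(2)]]
  obtain x where x': "x : sys J & ph : SIsos (rho_sd J x) M"
   "\<forall>y. y : sys J & ph : SIsos (rho_sd J y) M --> y = x" by (rule ex1E)
  note x = conjunct1[OF x'(1)] conjunct2[OF x'(1)]
  show ?thesis
  proof (rule ex1I[of _ x])
   show "x : X & ph : SIsos (rho_sd J x) M" using FR(4)[OF that(1) x(1) that(2) x(2)] x(2) by blast
   show "y = x" if "y : X & ph : SIsos (rho_sd J y) M" for y
    using x'(2)[rule_format, of y] subsetD[OF X(1), of y] that by simp
  qed
 qed
 show "SIsos (rho_sd J x) M <= FR M" if "x : X" "M : S" for x M using FR(5)[OF that(2,1)] by blast
 show "card (SIsos (rho_sd J x) M) = card (Aut_S Q M)" if x: "x : X" and M: "M : S" and r: "(M, rho_sd J x) : isometry_rel Q D" for x M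
 proof -
  note sx = self_dual_rho[OF g subsetD[OF X(1) x]]
  obtain f where "isometry Q M (rho_sd J x) f" using r unfolding isometry_rel_def by blast
  from isometry_inv[OF S(1)[OF M] sx this]
  obtain h where h: "isometry Q (rho_sd J x) M h" by blast
  have "Aut_S Q M = SIsos M M" unfolding Aut_S_def SIsos_def Isos_def isometry_def by blast
  then show ?thesis using card_SIsos[OF sx S(1)[OF M] h] by simp
 qed
 show "(M, rho_sd J x) : isometry_rel Q D" if x: "x : X" and M: "M : S" and ne: "SIsos (rho_sd J x) M ~= {}" for x M
 proof -
  note sx = self_dual_rho[OF g subsetD[OF X(1) x]]
  obtain f where "f : SIsos (rho_sd J x) M" using ne by blast
  from isometry_inv[OF sx S(1)[OF M] SIsosD(2)[OF this]] show ?thesis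
   unfolding isometry_rel_def using S(1)[OF M] sx by blast
 qed
qed

lemma smass_full:
 fixes S :: "('v, 'a, 'k::{field,finite}) sdrep set"
 assumes g: "good2 J J"
  and S: "!!M. M : S ==> self_dual Q D M" "!!M. M : S ==> dims M (%i. card (J i))"
   "!!M N f. M : S ==> self_dual Q D N ==> isometry Q M N f ==> N : S"
 shows "smass S = real (card {x : sys J. rho_sd J x : S}) / real (\<Prod>i\<in>verts Q. gl TYPE('k) (card (J i)))"
proof (rule smass_eq[where FR = "frames J", OF g S])
 show "card (frames J M) = (\<Prod>i\<in>verts Q. gl TYPE('k) (card (J i)))" if "M : S" for M
  by (rule card_frames(1)[OF sdD(1)[OF S(1)[OF that]] good2D(1)[OF g] S(2)[OF that]])
 show "x : {x : sys J. rho_sd J x : S}"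
  if "M : S" "x : sys J" "ph : SIsos (rho_sd J x) M" for M x ph
  using that S(3)[OF that(1) self_dual_rho[OF g that(2)] isometry_inv[OF self_dual_rho[OF g that(2)] S(1)[OF that(1)] SIsosD(2)[OF that(3)]]]
  by blast
 show "ph : frames J M" if "ph : SIsos (rho_sd J x) M" for M x ph
  using Isos_subset_frames[of "rho_sd J x" J M] SIsosD(1)[OF that] by auto
qed (auto intro!: prod_pos gl_pos)

text \<open>Lives on \<open>J\<close> only; \<open>J'\<close> enters through the forms that
  determine the maps. In a flag, \<open>rep2 A C\<close> is the isotropic subrepresentation and
  \<open>rep2 N N\<close> the orthogonal modulo it.\<close>

definition rep2 :: "('v => nat set) => ('v => nat set) => (('v, 'a, 'k::field) esys) => ('v, 'a, 'k) qrep"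
 where "rep2 J J' x = \<lparr>vsp = kcf J, vmap = vm2 J J' x\<rparr>"

lemma rep2_simps [simp]: "vsp (rep2 J J' x) = kcf J" "vmap (rep2 J J' x) = vm2 J J' x"
 by (simp_all add: rep2_def)

lemma rep_rep2:
 fixes x :: "('v, 'a, 'k::{field,finite}) esys"
 assumes "good2 J J'" "nd2 J J' x"
 shows "representation Q (rep2 J J' x)"
 unfolding representation_def
 using good2D(1)[OF assms(1)] vm2(1)[OF assms] by (simp add: fd_subspace_iff subspace_coords finite_coords)

lemma esf_sub:
 assumes "e : edges" "!!v. v : verts Q ==> finite (J v)" "!!v. v : verts Q ==> A v <= J v" "!!v. v : verts Q ==> C v <= J v"
  "u : coords (A (src e))" "w : coords (C (dst e))"
 shows "esf J J x e u w = esf A C x e u w"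
 unfolding esf_def using assms edge_facts(5,6)[OF assms(1)] by (intro bf_sub) auto

lemma esf_zero:
 assumes "e : edges" "!!p. p : eix A C ==> x p = 0"
 shows "esf A C x e u w = 0"
proof -
 have "x (e, i, j) = 0" if "i : A (src e)" "j : C (dst e)" for i j
  using assms that by (auto simp: eix_def)
 then show ?thesis unfolding esf_def bf_def by simp
qed

definition smax :: "('v => rat) => ('v, 'a, 'k::field, 'z) qrep_scheme => ('v => 'k vec set) => bool"
 where "smax t M U \<longleftrightarrow> U : subs Q M &
  (\<forall>V\<in>subs Q M. wdim Q t V <= wdim Q t U & (wdim Q t V = wdim Q t U --> U <= V))"

lemma smax_eq:
 assumes "representation Q (M :: ('v, 'a, 'k::{field,finite}, 'z) qrep_scheme)"
 shows "smax t M U = modular_lattice.smallest_max (subs Q M) (wdim Q t) U"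
 unfolding smax_def modular_lattice.smallest_max_def[OF modular_lattice_subs[OF assms]] ..

end

section \<open>Models adapted to an isotropic subrepresentation and its orthogonal\<close>

text \<open>\<open>A\<close> indexes the isotropic subrepresentation, \<open>A Un N\<close> its
  orthogonal, and \<open>C\<close> a complement of the latter. Hence \<open>A\<close> is dual to
  \<open>C\<close> and \<open>N\<close> is dual to itself.\<close>

locale flag = sd_quiver Q D for Q :: "('v, 'a) pre_digraph" and D :: "('v, 'a) duality_data" +
 fixes A N C :: "'v => nat set"
 assumes fin: "v : verts Q ==> finite (A v)" "v : verts Q ==> finite (N v)" "v : verts Q ==> finite (C v)"
  and disj: "v : verts Q ==> A v Int N v = {}" "v : verts Q ==> A v Int C v = {}" "v : verts Q ==> N v Int C v = {}"
  and gAC: "good2 A C" and gNN: "good2 N N"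
begin

abbreviation "I \<equiv> %v. A v Un N v Un C v"

lemma finI: "v : verts Q ==> finite (I v)"
 using fin by simp

lemma gII: "good2 I I"
 unfolding good2_def
proof (intro ballI conjI)
 fix v assume v: "v : verts Q"
 note sv = sig(1)[OF v]
 have "card (I u) = card (A u) + card (N u) + card (C u)" if u: "u : verts Q" for u
 proof -
  have "(A u Un N u) Int C u = {}" using disj[OF u] by blast
  then show ?thesis using fin[OF u] disj(1)[OF u] by (simp add: card_Un_disjoint)
 qed
 then show "card (I v) = card (I (sg v))"
  using v sv good2D(3)[OF gAC v] good2D(3)[OF gAC sv] good2D(3)[OF gNN v] sig(2)[OF v] by simp
qed (use finI in auto)

text \<open>Block anti-triangular shape: \<open>A\<close> is orthogonal to \<open>A Un N\<close>,
  and the blocks \<open>A\<close> by \<open>C\<close> and \<open>N\<close> by \<open>N\<close> are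
  nondegenerate.\<close>

definition flag_form :: "(('v, 'a, 'k::{field,finite}) esys) => bool"
 where "flag_form x \<longleftrightarrow> (\<forall>p\<in>eix A A Un eix A N Un eix N A. x p = 0) & nd2 A C x & nd2 N N x"

lemma subI: "A v <= I v" "N v <= I v" "C v <= I v" "A v Un N v <= I v"
 by auto

lemma decompI:
 fixes w :: "nat \<Rightarrow>\<^sub>0 'k::field"
 assumes v: "v : verts Q" and w: "w : coords (I v)"
 shows "w = proj (A v) w + (proj (N v) w + proj (C v) w)"
  "w : coords (A v Un N v) \<longleftrightarrow> proj (C v) w = 0" "w : coords (A v) \<longleftrightarrow> proj (C v) w = 0 & proj (N v) w = 0"
proof -
 show d: "w = proj (A v) w + (proj (N v) w + proj (C v) w)"
  by (rule poly_mapping_eqI)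
   (use fin[OF v] disj[OF v] w in \<open>auto simp: lookup_add lookup_proj coords_def\<close>)
 show "w : coords (A v Un N v) \<longleftrightarrow> proj (C v) w = 0"
  by (rule proj_eq_0_iff[symmetric]) (use fin[OF v] disj[OF v] w in auto)
 have "w : coords (A v) \<longleftrightarrow> proj (N v Un C v) w = 0"
  by (rule proj_eq_0_iff[symmetric]) (use fin[OF v] disj[OF v] w in \<open>auto simp: Un_assoc\<close>)
 also have "\<dots> \<longleftrightarrow> proj (C v) w = 0 & proj (N v) w = 0"
 proof
  assume z: "proj (N v Un C v) w = 0"
  have "proj S w = 0" if "S <= N v Un C v" for S
  proof (rule poly_mapping_eqI)
   fix i
   have fS: "finite S" using that fin[OF v] by (meson finite_UnI finite_subset)
   have "entry (proj (N v Un C v) w) i = 0" using z by simp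
   then show "entry (proj S w) i = entry 0 i"
    using that fS fin[OF v] by (auto simp: lookup_proj split: if_splits)
  qed
  then show "proj (C v) w = 0 & proj (N v) w = 0" by simp
 next
  assume "proj (C v) w = 0 & proj (N v) w = 0"
  then have w': "w = proj (A v) w" using d by simp
  show "proj (N v Un C v) w = 0"
   by (subst w', rule proj_disjoint[OF _ proj_in_coords]) (use fin[OF v] disj[OF v] in auto)
 qed
 finally show "w : coords (A v) \<longleftrightarrow> proj (C v) w = 0 & proj (N v) w = 0" .
qed

text \<open>Decomposing the arguments along \<open>A\<close>, \<open>N\<close>, \<open>C\<close> and
  dropping the zero blocks: against \<open>A\<close> only the \<open>C\<close>-component counts, and
  within \<open>A Un N\<close> only the \<open>N\<close>-components do.\<close>

lemma esf_parts:
 fixes x :: "('v, 'a, 'k::{field,finite}) esys"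
 assumes e: "e : edges" and z: "\<forall>p\<in>eix A A Un eix A N Un eix N A. x p = 0"
  and w: "w : coords (I (dst e))"
 shows "u : coords (A (src e)) ==> esf I I x e u w = esf A C x e u (proj (C (dst e)) w)"
  "u : coords (N (src e)) ==> w : coords (A (dst e) Un N (dst e)) ==>
   esf I I x e u w = esf N N x e u (proj (N (dst e)) w)"
  "u : coords (A (src e) Un N (src e)) ==> w : coords (N (dst e)) ==>
   esf I I x e u w = esf N N x e (proj (N (src e)) u) w"
proof -
 note sd = edge_facts(5,6)[OF e]
 have b: "bilin (coords (I (src e))) (coords (I (dst e))) (esf I I x e)" unfolding esf_def by (rule bilin_bf)
 have pin: "proj (A (dst e)) w : coords (A (dst e))" "proj (N (dst e)) w : coords (N (dst e))" "proj (C (dst e)) w : coords (C (dst e))"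
  using fin[OF sd(2)] by simp_all
 have cI: "coords (A v) <= (coords (I v) :: 'k vec set)" "coords (N v) <= (coords (I v) :: 'k vec set)"
  "coords (C v) <= (coords (I v) :: 'k vec set)" "coords (A v Un N v) <= (coords (I v) :: 'k vec set)" for v
  by (rule coords_mono, blast)+
 have AA: "esf I I x e u w = 0" if "u : coords (A (src e))" "w : coords (A (dst e))" for u w
  using esf_sub[OF e finI subI(1) subI(1) that] esf_zero[OF e, of A A x] z by auto
 have AN: "esf I I x e u w = 0" if "u : coords (A (src e))" "w : coords (N (dst e))" for u w
  using esf_sub[OF e finI subI(1) subI(2) that] esf_zero[OF e, of A N x] z by auto
 have NA: "esf I I x e u w = 0" if "u : coords (N (src e))" "w : coords (A (dst e))" for u w
  using esf_sub[OF e finI subI(2) subI(1) that] esf_zero[OF e, of N A x] z by auto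
 have dw: "esf I I x e u w = esf I I x e u (proj (A (dst e)) w) + (esf I I x e u (proj (N (dst e)) w) + esf I I x e u (proj (C (dst e)) w))"
  if u: "u : coords (I (src e))" for u
 proof -
  have m: "proj (A (dst e)) w : coords (I (dst e))" "proj (N (dst e)) w : coords (I (dst e))" "proj (C (dst e)) w : coords (I (dst e))"
   using pin cI by blast+
  have "esf I I x e u w = esf I I x e u (proj (A (dst e)) w + (proj (N (dst e)) w + proj (C (dst e)) w))"
   using decompI(1)[OF sd(2) w] by simp
  then show ?thesis
   unfolding bilinD(3)[OF b u m(1) kvec.subspace_add[OF subspace_coords m(2,3)]] bilinD(3)[OF b u m(2,3)] .
 qed
 show "esf I I x e u w = esf A C x e u (proj (C (dst e)) w)" if u: "u : coords (A (src e))"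
 proof -
  have uI: "u : coords (I (src e))" using cI(1) u by blast
  show ?thesis
   unfolding dw[OF uI] AA[OF u pin(1)] AN[OF u pin(2)]
   using esf_sub[OF e finI subI(1) subI(3) u pin(3)] by simp
 qed
 show "esf I I x e u w = esf N N x e u (proj (N (dst e)) w)"
  if u: "u : coords (N (src e))" and w': "w : coords (A (dst e) Un N (dst e))"
 proof -
  have uI: "u : coords (I (src e))" using cI(2) u by blast
  have "proj (C (dst e)) w = 0" using decompI(2)[OF sd(2) w] w' by simp
  moreover have "esf I I x e u 0 = 0" by (rule bilin_0(2)[OF b uI]) simp
  ultimately show ?thesis
   unfolding dw[OF uI] NA[OF u pin(1)]
   using esf_sub[OF e finI subI(2) subI(2) u pin(2)] by simp
 qed
 show "esf I I x e u w = esf N N x e (proj (N (src e)) u) w"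
  if u: "u : coords (A (src e) Un N (src e))" and w': "w : coords (N (dst e))"
 proof -
  have p: "proj (A (src e)) u : coords (A (src e))" "proj (N (src e)) u : coords (N (src e))" using fin[OF sd(1)] by simp_all
  have "proj (A (src e)) u + proj (N (src e)) u = u"
   by (rule proj_decomp[OF fin(1,2)[OF sd(1)] disj(1)[OF sd(1)] u])
  then have "esf I I x e u w = esf I I x e (proj (A (src e)) u + proj (N (src e)) u) w" by simp
  also have "\<dots> = esf I I x e (proj (A (src e)) u) w + esf I I x e (proj (N (src e)) u) w"
   by (rule bilinD(1)[OF b subsetD[OF cI(1) p(1)] subsetD[OF cI(2) p(2)] w])
  also have "\<dots> = esf N N x e (proj (N (src e)) u) w"
   unfolding AN[OF p(1) w'] using esf_sub[OF e finI subI(2) subI(2) p(2) w'] by simp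
  finally show ?thesis .
 qed
qed

text \<open>Back substitution: testing a kernel vector against \<open>A\<close> removes its
  \<open>C\<close>-component, then testing against \<open>N\<close> its \<open>N\<close>-component.
  What is left lies in \<open>A\<close> and is tested against \<open>C\<close>, where symmetry lets
  the block \<open>A\<close> by \<open>C\<close> be used from the other side.\<close>

lemma flag_form_nd2:
 fixes x :: "('v, 'a, 'k::{field,finite}) esys"
 assumes sy: "sym_on (eix I I) x" and ff: "flag_form x"
 shows "nd2 I I x"
 unfolding nd2_def
proof (intro ballI impI)
 fix v w assume v: "v : verts Q" and w: "w : coords (I (sg v))"
  and 0: "mat_app (I v) (I (sg v)) (%i j. x (Inl v, i, j)) w = 0"
 note sv = sig(1)[OF v]
 have z: "\<forall>p\<in>eix A A Un eix A N Un eix N A. x p = 0" and AC: "nd2 A C x" and NN: "nd2 N N x"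
  using ff by (auto simp: flag_form_def)
 have e: "Inl v : edges" using v by simp
 have wd: "w : coords (I (dst (Inl v)))" using w by simp
 note parts = esf_parts[OF e z wd]
 have zero: "esf I I x (Inl v) u w = 0" for u
  unfolding esf_def using 0 by (simp add: bf_mat_app_left[OF finI[OF v]])
 have pC: "proj (C (sg v)) w = 0"
 proof (rule nd2_right[OF AC v fin(1)[OF v]])
  fix i assume "i : A v"
  then show "esf A C x (Inl v) (unitv i) (proj (C (sg v)) w) = 0"
   using parts(1)[of "unitv i"] zero by simp
 qed (simp add: fin[OF sv])
 have wAN: "w : coords (A (sg v) Un N (sg v))" using decompI(2)[OF sv w] pC by simp
 have pN: "proj (N (sg v)) w = 0"
 proof (rule nd2_right[OF NN v fin(2)[OF v]])
  fix i assume "i : N v"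
  then show "esf N N x (Inl v) (unitv i) (proj (N (sg v)) w) = 0"
   using parts(2)[of "unitv i"] wAN zero by simp
 qed (simp add: fin[OF sv])
 have wA: "w : coords (A (sg v))" using decompI(3)[OF sv w] pC pN by simp
 have b: "bij_betw (mat_app (C (sg (sg v))) (A (sg v)) (%j i. x (Inl (sg v), i, j))) (coords (A (sg v))) (coords (C (sg (sg v))))"
  by (rule nd2_left_bij[OF gAC AC sv])
 have "mat_app (C v) (A (sg v)) (%j i. x (Inl (sg v), i, j)) w = 0"
 proof (rule poly_mapping_eqI)
  fix j
  show "entry (mat_app (C v) (A (sg v)) (%j i. x (Inl (sg v), i, j)) w) j = entry 0 j"
  proof (cases "j : C v")
   case True
   have u: "unitv j : coords (C (dst (Inl (sg v))))" using True sig(2)[OF v] by simp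
   have "esf A C x (Inl (sg v)) w (unitv j) = esf I I x (Inl (sg v)) w (unitv j)"
    by (rule esf_sub[symmetric]) (use sv wA u fin in auto)
   also have "\<dots> = of_int (eps (Inl v)) * esf I I x (Inl v) (unitv j) w"
    using esf_sym[OF sy e, of w "unitv j"] by simp
   also have "\<dots> = 0" by (simp add: zero)
   finally show ?thesis
    using True fin(3)[OF v] sig(2)[OF v] by (simp add: esf_def bf_unitv_right)
  qed (simp add: lookup_mat_app fin[OF v])
 qed
 moreover have "linear_between (coords (A (sg v))) (coords (C v)) (mat_app (C v) (A (sg v)) (%j i. x (Inl (sg v), i, j)))"
  by (rule linear_between_mat_app[OF fin(3)[OF v]])
 from linear_between_inj_iff[OF this subspace_coords] bij_betw_imp_inj_on[OF b] sig(2)[OF v]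
 have "\<forall>y\<in>coords (A (sg v)). mat_app (C v) (A (sg v)) (%j i. x (Inl (sg v), i, j)) y = 0 --> y = 0"
  by simp
 ultimately show "w = 0" using wA by blast
qed

lemma kcf_perp:
 fixes x :: "('v, 'a, 'k::{field,finite}) esys"
 assumes x: "x : sys I" and ff: "flag_form x"
 shows "perp (rho_sd I x) (kcf A) = kcf (%v. A v Un N v)"
 unfolding perp_def
proof (rule onverts_eqI)
 fix v assume v: "v : verts Q"
 note sv = sig(1)[OF v]
 have z: "\<forall>p\<in>eix A A Un eix A N Un eix N A. x p = 0" and AC: "nd2 A C x"
  using ff by (auto simp: flag_form_def)
 have e: "Inl (sg v) : edges" using sv by simp
 have nf: "nform (rho_sd I x) (sg v) u y = esf A C x (Inl (sg v)) u (proj (C v) y)"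
  if u: "u : coords (A (sg v))" and y: "y : coords (I v)" for u y
 proof -
  have "u : coords (I (sg v))" using coords_mono[OF subI(1)] u by blast
  then have "eform (rho_sd I x) (Inl (sg v)) u y = esf I I x (Inl (sg v)) u y"
   using eform_rho[OF gII x e] y sig(2)[OF v] by simp
  moreover have "y : coords (I (dst (Inl (sg v))))" using y sig(2)[OF v] by simp
  from esf_parts(1)[OF e z this] u have "esf I I x (Inl (sg v)) u y = esf A C x (Inl (sg v)) u (proj (C v) y)"
   using sig(2)[OF v] by simp
  ultimately show ?thesis by simp
 qed
 have "(\<forall>u\<in>coords (A (sg v)). nform (rho_sd I x) (sg v) u y = 0) \<longleftrightarrow> y : coords (A v Un N v)"
  if y: "y : coords (I v)" for y
 proof -
  have "(\<forall>u\<in>coords (A (sg v)). esf A C x (Inl (sg v)) u (proj (C v) y) = 0) \<longleftrightarrow> proj (C v) y = 0"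
  proof
   assume h: "\<forall>u\<in>coords (A (sg v)). esf A C x (Inl (sg v)) u (proj (C v) y) = 0"
   show "proj (C v) y = 0"
    by (rule nd2_right[OF AC sv fin(1)[OF sv]]) (use h fin[OF v] sig(2)[OF v] in simp_all)
  qed (simp add: esf_def bf_def)
  then show ?thesis using nf[OF _ y] decompI(2)[OF v y] by simp
 qed
 moreover have "coords (A v Un N v) <= (coords (I v) :: 'k vec set)" by (rule coords_mono) blast
 ultimately show "{y : vsp (rho_sd I x) v. \<forall>u\<in>kcf A (sg v). nform (rho_sd I x) (sg v) u y = 0} = kcf (%v. A v Un N v) v"
  using v sv by auto
qed simp

text \<open>Since \<open>perp\<close> is an involution, membership in \<open>coords A\<close> can be
  tested by orthogonality to \<open>A Un N\<close>. The maps built from single blocks are then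
  recognised by their pairings, through the uniqueness part of \<open>vm2\<close>.\<close>

lemma vm2_flag:
 fixes x :: "('v, 'a, 'k::{field,finite}) esys"
 assumes x: "x : sys I" and ff: "flag_form x" and a: "ar : arcs Q"
 shows "y : coords (A (tail Q ar)) ==> vm2 I I x ar y : coords (A (head Q ar))"
  "y : coords (A (tail Q ar)) ==> vm2 A C x ar y = vm2 I I x ar y"
  "y : coords (A (tail Q ar) Un N (tail Q ar)) ==> vm2 I I x ar y : coords (A (head Q ar) Un N (head Q ar))"
  "y : coords (N (tail Q ar)) ==> vm2 N N x ar y = proj (N (head Q ar)) (vm2 I I x ar y)"
proof -
 let ?t = "tail Q ar" and ?h = "head Q ar" and ?M = "rho_sd I x"
 have th: "?t : verts Q" "?h : verts Q" using a by auto
 note sh = sig(1)[OF th(2)]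
 have z: "\<forall>p\<in>eix A A Un eix A N Un eix N A. x p = 0" and AC: "nd2 A C x" and NN: "nd2 N N x"
  using ff by (auto simp: flag_form_def)
 have II: "nd2 I I x" and sy: "sym_on (eix I I) x" using x by (auto simp: sys_def)
 have e: "Inr ar : edges" and eh: "Inl ?h : edges" using a th by simp_all
 note M = self_dual_rho[OF gII x]
 have cI: "coords (A v) <= (coords (I v) :: 'k vec set)" "coords (N v) <= (coords (I v) :: 'k vec set)"
  "coords (C v) <= (coords (I v) :: 'k vec set)" "coords (A v Un N v) <= (coords (I v) :: 'k vec set)" for v
  by (rule coords_mono, blast)+
 have mI: "vm2 I I x ar y : coords (I ?h)" if "y : coords (I ?t)" for y
  by (rule linear_between_in[OF vm2(1)[OF gII II a] that])
 have ch: "esf I I x (Inl ?h) (vm2 I I x ar y) w = esf I I x (Inr ar) y w" if "w : coords (I (sg ?h))" for y w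
  by (rule vm2(2)[OF gII II a that])
 have pp: "perp ?M (kcf (%v. A v Un N v)) = kcf A"
  unfolding kcf_perp[OF x ff, symmetric]
  by (rule perp_perp[OF M]) (simp_all add: subspace_coords cI(1))
 have toA: "m : coords (A ?h)"
  if m: "m : coords (I ?h)" and h: "!!w. w : coords (A (sg ?h) Un N (sg ?h)) ==> esf I I x (Inl ?h) m w = 0" for m
 proof -
  have "nform ?M (sg ?h) w m = 0" if w: "w : coords (A (sg ?h) Un N (sg ?h))" for w
  proof -
   have wI: "w : coords (I (sg ?h))" using cI(4) w by blast
   have "eform ?M (Inl (sg ?h)) w m = esf I I x (Inl (sg ?h)) w m"
    by (rule eform_rho[OF gII x]) (use wI m sh sig(2)[OF th(2)] in simp_all)
   also have "\<dots> = of_int (eps (Inl ?h)) * esf I I x (Inl ?h) m w"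
    using esf_sym[OF sy eh, of w m] by simp
   finally show ?thesis using h[OF w] by simp
  qed
  then have "m : perp ?M (kcf (%v. A v Un N v)) ?h" using m th sh by (simp add: perp_iff)
  then show ?thesis unfolding pp using th by simp
 qed
 show 1: "vm2 I I x ar y : coords (A ?h)" if y: "y : coords (A ?t)" for y
 proof (rule toA[OF mI])
  show "y : coords (I ?t)" using cI(1) y by blast
  fix w :: "'k vec" assume w: "w : coords (A (sg ?h) Un N (sg ?h))"
  have wI: "w : coords (I (sg ?h))" using cI(4) w by blast
  have "esf I I x (Inr ar) y w = esf A C x (Inr ar) y (proj (C (sg ?h)) w)"
   using esf_parts(1)[OF e z, of w y] wI y by simp
  also have "\<dots> = 0" using decompI(2)[OF sh wI] w by (simp add: esf_def bf_def)
  finally show "esf I I x (Inl ?h) (vm2 I I x ar y) w = 0" using ch[OF wI] by simp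
 qed
 show "vm2 A C x ar y = vm2 I I x ar y" if y: "y : coords (A ?t)"
 proof (rule vm2(3)[OF gAC AC a 1[OF y]])
  fix w :: "'k vec" assume w: "w : coords (C (sg ?h))"
  have wI: "w : coords (I (sg ?h))" using cI(3) w by blast
  have "esf A C x (Inl ?h) (vm2 I I x ar y) w = esf I I x (Inl ?h) (vm2 I I x ar y) w"
   by (rule esf_sub[symmetric]) (use eh fin 1[OF y] w in auto)
  also have "\<dots> = esf I I x (Inr ar) y w" by (rule ch[OF wI])
  also have "\<dots> = esf A C x (Inr ar) y w"
   by (rule esf_sub) (use e fin y w in auto)
  finally show "esf A C x (Inl ?h) (vm2 I I x ar y) w = esf A C x (Inr ar) y w" .
 qed
 \<comment> \<open>Invariance of \<open>A Un N\<close> is dual to that of \<open>A\<close>, which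
   has to hold along all arrows first and not just along \<open>ar\<close>.\<close>
 have perpsub: "kcf (%v. A v Un N v) : subs Q ?M"
 proof -
  have "kcf A : subs Q ?M"
  proof (rule subsI)
   fix \<beta> and y :: "'k vec" assume b: "\<beta> : arcs Q" and y: "y : kcf A (tail Q \<beta>)"
   let ?t' = "tail Q \<beta>" and ?h' = "head Q \<beta>"
   have th': "?t' : verts Q" "?h' : verts Q" using b by auto
   note sh' = sig(1)[OF th'(2)]
   have y': "y : coords (A ?t')" using y th' by simp
   have yI: "y : coords (I ?t')" using cI(1) y' by blast
   have m: "vm2 I I x \<beta> y : coords (I ?h')" by (rule linear_between_in[OF vm2(1)[OF gII II b] yI])
   have "nform ?M (sg ?h') w (vm2 I I x \<beta> y) = 0" if w: "w : coords (A (sg ?h') Un N (sg ?h'))" for w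
   proof -
    have wI: "w : coords (I (sg ?h'))" using cI(4) w by blast
    have "eform ?M (Inl (sg ?h')) w (vm2 I I x \<beta> y) = esf I I x (Inl (sg ?h')) w (vm2 I I x \<beta> y)"
     by (rule eform_rho[OF gII x]) (use wI m sh' sig(2)[OF th'(2)] in simp_all)
    also have "\<dots> = of_int (eps (Inl ?h')) * esf I I x (Inl ?h') (vm2 I I x \<beta> y) w"
     using esf_sym[OF sy, of "Inl ?h'" w "vm2 I I x \<beta> y"] th' by simp
    also have "esf I I x (Inl ?h') (vm2 I I x \<beta> y) w = esf I I x (Inr \<beta>) y w"
     by (rule vm2(2)[OF gII II b wI])
    also have "\<dots> = esf A C x (Inr \<beta>) y (proj (C (sg ?h')) w)"
     using esf_parts(1)[where e = "Inr \<beta>" and w = w and u = y, OF _ z] wI y' b by simp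
    also have "\<dots> = 0" using decompI(2)[OF sh' wI] w by (simp add: esf_def bf_def)
    finally show ?thesis by simp
   qed
   then have "vm2 I I x \<beta> y : perp ?M (kcf (%v. A v Un N v)) ?h'" using m th' sh' by (simp add: perp_iff)
   then show "vmap ?M \<beta> y : kcf A ?h'" unfolding pp by simp
  qed (use cI(1) in \<open>simp_all add: subspace_coords\<close>)
  from perp_in_subs[OF M this] show ?thesis unfolding kcf_perp[OF x ff] .
 qed
 show 3: "vm2 I I x ar y : coords (A ?h Un N ?h)" if y: "y : coords (A ?t Un N ?t)" for y
  using subsD(5)[OF sdD(1)[OF M] perpsub a, of y] y th by simp
 show "vm2 N N x ar y = proj (N ?h) (vm2 I I x ar y)" if y: "y : coords (N ?t)"
 proof (rule vm2(3)[OF gNN NN a proj_in_coords[OF fin(2)[OF th(2)]]])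
  fix w :: "'k vec" assume w: "w : coords (N (sg ?h))"
  have wI: "w : coords (I (sg ?h))" using cI(2) w by blast
  have yAN: "y : coords (A ?t Un N ?t)" using coords_mono[of "N ?t" "A ?t Un N ?t"] y by blast
  have "esf N N x (Inl ?h) (proj (N ?h) (vm2 I I x ar y)) w = esf I I x (Inl ?h) (vm2 I I x ar y) w"
   using esf_parts(3)[OF eh z, of w "vm2 I I x ar y"] wI w 3[OF yAN] by simp
  also have "\<dots> = esf I I x (Inr ar) y w" by (rule ch[OF wI])
  also have "\<dots> = esf N N x (Inr ar) y w"
   by (rule esf_sub) (use e fin y w in auto)
  finally show "esf N N x (Inl ?h) (proj (N ?h) (vm2 I I x ar y)) w = esf N N x (Inr ar) y w" .
 qed
qed

lemma coords_subI:
 "coords (A v) <= (coords (I v) :: ('k::field) vec set)" "coords (N v) <= (coords (I v) :: 'k vec set)"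
 "coords (C v) <= (coords (I v) :: 'k vec set)" "coords (A v Un N v) <= (coords (I v) :: 'k vec set)"
 by (rule coords_mono, blast)+

lemma kcf_A_subs:
 fixes x :: "('v, 'a, 'k::{field,finite}) esys"
 assumes x: "x : sys I" and ff: "flag_form x"
 shows "kcf A : subs Q (rho_sd I x)"
proof (rule subsI)
 fix ar and y :: "'k vec" assume a: "ar : arcs Q" and y: "y : kcf A (tail Q ar)"
 have th: "tail Q ar : verts Q" "head Q ar : verts Q" using a by auto
 show "vmap (rho_sd I x) ar y : kcf A (head Q ar)"
  using vm2_flag(1)[OF x ff a] y th by simp
qed (use coords_subI(1) in \<open>simp_all add: subspace_coords\<close>)

text \<open>Orthogonality makes the blocks with first index in \<open>A\<close> vanish, and symmetry
  adds \<open>N\<close> by \<open>A\<close>. A vector of \<open>coords C\<close> orthogonal to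
  \<open>A\<close> lies in \<open>coords (A Un N)\<close>, one of \<open>coords N\<close> orthogonal
  to \<open>A Un N\<close> lies in \<open>coords A\<close>; disjointness makes both zero.\<close>

lemma flag_formI:
 fixes x :: "('v, 'a, 'k::{field,finite}) esys"
 assumes x: "x : sys I" and A: "kcf A : subs Q (rho_sd I x)"
  and p: "perp (rho_sd I x) (kcf A) = kcf (%v. A v Un N v)"
 shows "flag_form x"
proof -
 let ?M = "rho_sd I x"
 note M = self_dual_rho[OF gII x]
 have II: "nd2 I I x" and sy: "sym_on (eix I I) x" using x by (auto simp: sys_def)
 have orth: "nform ?M v u w = 0"
  if v: "v : verts Q" and u: "u : coords (A v)" and w: "w : coords (A (sg v) Un N (sg v))"
  for v and u w :: "'k vec"
 proof -
  have "w : perp ?M (kcf A) (sg v)" unfolding p using w sig(1)[OF v] by simp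
  then show ?thesis using u v sig[OF v] by (simp add: perp_iff)
 qed
 have eorth: "eform ?M e u w = 0"
  if e: "e : edges" and u: "u : coords (A (src e))" and w: "w : coords (A (dst e) Un N (dst e))"
  for e and u w :: "'k vec"
  using e
 proof (cases rule: edges_cases)
  case (1 v)
  then show ?thesis using orth[of v u w] u w by simp
 next
  case (2 ar)
  have th: "tail Q ar : verts Q" "head Q ar : verts Q" using 2 by auto
  have "vmap ?M ar u : coords (A (head Q ar))"
   using subsD(5)[OF sdD(1)[OF M] A 2(2), of u] u 2 th by simp
  then show ?thesis using orth[OF th(2)] w 2 by simp
 qed
 have xe: "x (e, i, j) = eform ?M e (unitv i) (unitv j)" if "e : edges" "i : I (src e)" "j : I (dst e)" for e i j
 proof -
  note sd = edge_facts(5,6)[OF that(1)]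
  have "eform ?M e (unitv i) (unitv j) = esf I I x e (unitv i) (unitv j)"
   by (rule eform_rho[OF gII x that(1)]) (use that in simp_all)
  also have "\<dots> = x (e, i, j)"
   unfolding esf_def by (rule bf_unitv) (use finI[OF sd(1)] finI[OF sd(2)] that in auto)
  finally show ?thesis by simp
 qed
 have z1: "x (e, i, j) = 0" if "e : edges" "i : A (src e)" "j : A (dst e) Un N (dst e)" for e i j
  using xe[of e i j] eorth[of e "unitv i" "unitv j"] that by auto
 have z2: "x (e, i, j) = 0" if e: "e : edges" and ij: "i : N (src e)" "j : A (dst e)" for e i j
 proof -
  have "x (einv e, j, i) = 0"
   by (rule z1) (use edge_facts[OF e] ij in simp_all)
  moreover have "x (einv e, j, i) = of_int (eps e) * x (e, i, j)"
   using sy e ij by (auto simp: sym_on_def eix_def)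
  ultimately show ?thesis using eps_facts(1)[OF e] by auto
 qed
 have z: "\<forall>p\<in>eix A A Un eix A N Un eix N A. x p = 0"
  using z1 z2 by (auto simp: eix_def)
 have pp: "perp ?M (kcf (%v. A v Un N v)) = kcf A"
  unfolding p[symmetric]
  by (rule perp_perp[OF M]) (simp_all add: subspace_coords coords_subI(1))
 have "nd2 A C x"
  unfolding nd2_def
 proof (intro ballI impI)
  fix v w assume v: "v : verts Q" and w: "w : coords (C (sg v))"
   and 0: "mat_app (A v) (C (sg v)) (%i j. x (Inl v, i, j)) w = 0"
  note sv = sig(1)[OF v]
  have wI: "w : coords (I (sg v))" using coords_subI(3) w by blast
  have "nform ?M v u w = 0" if u: "u : coords (A v)" for u
  proof -
   have uI: "u : coords (I v)" using coords_subI(1) u by blast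
   have "eform ?M (Inl v) u w = esf I I x (Inl v) u w"
    by (rule eform_rho[OF gII x]) (use v uI wI in simp_all)
   also have "\<dots> = esf A C x (Inl v) u w"
    by (rule esf_sub) (use v fin u w in auto)
   also have "\<dots> = 0" unfolding esf_def using 0 by (simp add: bf_mat_app_left[OF fin(1)[OF v]])
   finally show ?thesis by simp
  qed
  then have "w : perp ?M (kcf A) (sg v)" using wI v sig[OF v] by (simp add: perp_iff)
  then have "proj (C (sg v)) w = 0" unfolding p using decompI(2)[OF sv wI] sv by simp
  moreover have "proj (C (sg v)) w = w"
   by (rule proj_id) (use w fin[OF sv] in simp_all)
  ultimately show "w = 0" by simp
 qed
 moreover have "nd2 N N x"
  unfolding nd2_def
 proof (intro ballI impI)
  fix v w assume v: "v : verts Q" and w: "w : coords (N (sg v))"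
   and 0: "mat_app (N v) (N (sg v)) (%i j. x (Inl v, i, j)) w = 0"
  note sv = sig(1)[OF v]
  have wI: "w : coords (I (sg v))" using coords_subI(2) w by blast
  have "nform ?M v u w = 0" if u: "u : coords (A v Un N v)" for u
  proof -
   have uI: "u : coords (I v)" using coords_subI(4) u by blast
   have e: "Inl v : edges" using v by simp
   have "eform ?M (Inl v) u w = esf I I x (Inl v) u w"
    by (rule eform_rho[OF gII x e]) (use uI wI in simp_all)
   also have "\<dots> = esf N N x (Inl v) (proj (N v) u) w"
    using esf_parts(3)[OF e z, of w u] wI u w by simp
   also have "\<dots> = 0" unfolding esf_def using 0 by (simp add: bf_mat_app_left[OF fin(2)[OF v]])
   finally show ?thesis by simp
  qed
  then have "w : perp ?M (kcf (%v. A v Un N v)) (sg v)" using wI v sig[OF v] by (simp add: perp_iff)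
  then have wA: "w : coords (A (sg v))" unfolding pp using sv by simp
  show "w = 0"
  proof (rule poly_mapping_eqI)
   fix i
   show "entry w i = entry 0 i"
    using coords_lookup[OF wA, of i] coords_lookup[OF w, of i] disj(1)[OF sv] by auto
  qed
 qed
 ultimately show ?thesis unfolding flag_form_def using z by blast
qed

text \<open>\<open>smallest_max_perp_iff\<close> translated to blocks by the subquotient lemma, once
  below \<open>kcf A\<close> and once between \<open>kcf A\<close> and its orthogonal.\<close>

lemma smax_flag_iff:
 fixes x :: "('v, 'a, 'k::{field,finite}) esys"
 assumes x: "x : sys I" and ff: "flag_form x" and t: "!!v. v : verts Q ==> t (sg v) = - t v"
 shows "smax t (rho_sd I x) (kcf A) \<longleftrightarrow> tors t (rep2 A C x) & fle t (rep2 N N x)"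
proof -
 let ?M = "rho_sd I x"
 note sdM = self_dual_rho[OF gII x]
 note M = sdD(1)[OF sdM]
 have AC: "nd2 A C x" and NN: "nd2 N N x" using ff by (simp_all add: flag_form_def)
 note MA = rep_rep2[OF gAC AC] and MN = rep_rep2[OF gNN NN]
 note U = kcf_A_subs[OF x ff]
 interpret modular_lattice "subs Q ?M" fsum finter "%_. {0}" "onverts Q (vsp ?M)"
  by (rule modular_lattice_subs[OF M])
 have pA: "perp ?M (kcf A) = kcf (%v. A v Un N v)" by (rule kcf_perp[OF x ff])
 have AN: "kcf (%v. A v Un N v) : subs Q ?M" using perp_in_subs[OF sdM U] unfolding pA .
 have kc0: "kcf (%_. {}) = (%_. {0 :: nat \<Rightarrow>\<^sub>0 'k})"
  unfolding kcf_def by (intro onverts_eqI) simp_all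
 define \<Phi> where "\<Phi> V = onverts Q (%i. ssum (V i) (coords {} :: 'k vec set))" for V
 define \<Psi> where "\<Psi> V = onverts Q (%i. ssum (V i) (coords (A i) :: 'k vec set))" for V
 have mA: "vmap (rep2 A C x) ar y = proj (A (head Q ar)) (vmap ?M ar y)"
  if a: "ar : arcs Q" and y: "y : coords (A (tail Q ar))" for ar y
 proof -
  have h: "head Q ar : verts Q" using a by simp
  show ?thesis
   using vm2_flag(2)[OF x ff a y] proj_id[OF fin(1)[OF h] vm2_flag(1)[OF x ff a y]] by simp
 qed
 have mN: "vmap (rep2 N N x) ar y = proj (N (head Q ar)) (vmap ?M ar y)"
  if a: "ar : arcs Q" and y: "y : coords (N (tail Q ar))" for ar y
  using vm2_flag(4)[OF x ff a y] by simp
 have e: "finite {}" "{} Int A i = {}" for i :: 'v by simp_all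
 have vA: "vsp (rep2 A C x) i = coords (A i)" and vN: "vsp (rep2 N N x) i = coords (N i)" if "i : verts Q" for i
  using that by simp_all
 have U0: "kcf (%_. {}) : subs Q ?M" and U1: "kcf (%i. {} Un A i) : subs Q ?M"
  using bt_in U kc0 by simp_all
 have PA: "bij_betw \<Phi> (subs Q (rep2 A C x)) {V : subs Q ?M. kcf (%_. {}) <= V & V <= kcf (%i. {} Un A i)}"
  "!!V u. V : subs Q (rep2 A C x) ==> wdim Q u (\<Phi> V) = wdim Q u V + wdim Q u (kcf (%_. {}) :: 'v => 'k vec set)"
  "\<Phi> (onverts Q (vsp (rep2 A C x))) = kcf (%i. {} Un A i)"
  by (rule subquotient[OF M MA e(1) fin(1) e(2) vA mA U0 U1, folded \<Phi>_def]; assumption)+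
 have PN: "bij_betw \<Psi> (subs Q (rep2 N N x)) {V : subs Q ?M. kcf A <= V & V <= kcf (%i. A i Un N i)}"
  "!!V u. V : subs Q (rep2 N N x) ==> wdim Q u (\<Psi> V) = wdim Q u V + wdim Q u (kcf A :: 'v => 'k vec set)"
  by (rule subquotient[OF M MN fin(1,2) disj(1) vN mN U AN, folded \<Psi>_def]; assumption)+
 have rA: "{V : subs Q ?M. kcf (%_. {}) <= V & V <= kcf (%i. {} Un A i)} = {V : subs Q ?M. V <= kcf A}"
  using bt_le unfolding kc0 by auto
 have wA: "wdim Q u (\<Phi> V) = wdim Q u V" if "V : subs Q (rep2 A C x)" for V u
  using PA(2)[OF that, of u] unfolding kc0 wdim_zero by simp
 have tA: "onverts Q (vsp (rep2 A C x)) : subs Q (rep2 A C x)"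
  by (rule modular_lattice.tp_in[OF modular_lattice_subs[OF MA]])
 have PA3: "\<Phi> (onverts Q (vsp (rep2 A C x))) = kcf A" using PA(3) by simp
 have injA: "\<Phi> V = kcf A \<longleftrightarrow> V = onverts Q (vsp (rep2 A C x))" if "V : subs Q (rep2 A C x)" for V
  unfolding PA3[symmetric] using bij_betw_imp_inj_on[OF PA(1)] that tA by (auto dest: inj_onD)
 have r1: "(\<forall>V\<in>subs Q ?M. V <= kcf A --> V ~= kcf A --> wdim Q t V < wdim Q t (kcf A :: 'v => 'k vec set)) \<longleftrightarrow>
   tors t (rep2 A C x)"
 proof -
  have "(\<forall>V\<in>{V : subs Q ?M. V <= kcf A}. V ~= kcf A --> wdim Q t V < wdim Q t (kcf A :: 'v => 'k vec set)) \<longleftrightarrow>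
   (\<forall>V\<in>subs Q (rep2 A C x). \<Phi> V ~= kcf A --> wdim Q t (\<Phi> V) < wdim Q t (\<Phi> (onverts Q (vsp (rep2 A C x)))))"
   unfolding ball_bij_betw[OF PA(1)[unfolded rA]] PA3 ..
  also have "\<dots> \<longleftrightarrow> tors t (rep2 A C x)"
   unfolding tors_def wA[OF tA] by (rule ball_cong[OF refl]) (simp only: injA wA)
  finally show ?thesis by blast
 qed
 have r2: "(\<forall>V\<in>subs Q ?M. kcf A <= V --> V <= perp ?M (kcf A) --> wdim Q t V <= wdim Q t (kcf A :: 'v => 'k vec set)) \<longleftrightarrow>
   fle t (rep2 N N x)"
 proof -
  have "(\<forall>V\<in>{V : subs Q ?M. kcf A <= V & V <= kcf (%i. A i Un N i)}. wdim Q t V <= wdim Q t (kcf A :: 'v => 'k vec set)) \<longleftrightarrow>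
   fle t (rep2 N N x)"
   unfolding ball_bij_betw[OF PN(1)] fle_def by (rule ball_cong[OF refl]) (simp add: PN(2))
  then show ?thesis unfolding pA by blast
 qed
 have Uperp: "kcf A <= perp ?M (kcf A)" unfolding pA by (rule kcf_mono) blast
 have "smax t ?M (kcf A) \<longleftrightarrow> smallest_max (wdim Q t) (kcf A)"
  by (rule smax_eq[OF M])
 also have "\<dots> \<longleftrightarrow> tors t (rep2 A C x) & fle t (rep2 N N x)"
  unfolding r1[symmetric] r2[symmetric]
 proof (rule smallest_max_perp_iff[where perp = "perp ?M", OF modular_wdim[OF M] U Uperp])
  fix V W assume V: "V : subs Q ?M"
  show "perp ?M V : subs Q ?M" by (rule perp_in_subs[OF sdM V])
  show "wdim Q t (perp ?M V) = wdim Q t V" by (rule wdim_perp(1)[where t = t and V = V, OF sdM V t])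
  show "perp ?M (perp ?M V) = V"
   by (rule perp_perp[OF sdM]) (use subsD[OF M V] in auto)
  show "perp ?M W <= perp ?M V" if "V <= W" by (rule perp_antimono) (use that in \<open>simp add: le_fun_def\<close>)
 qed
 finally show ?thesis .
qed

definition Std :: "('v => rat) => (('v, 'a, 'k::{field,finite}) esys) set"
 where "Std t = {x : sys I. smax t (rho_sd I x) (kcf A) & perp (rho_sd I x) (kcf A) = kcf (%v. A v Un N v)}"

text \<open>The description by a maximiser and its orthogonal becomes one by zero blocks and by
  conditions on the blocks \<open>A\<close> by \<open>C\<close> and \<open>N\<close> by
  \<open>N\<close>, which can be counted.\<close>

lemma Std_eq:
 assumes t: "!!v. v : verts Q ==> t (sg v) = - t v"
 shows "Std t = {x : eix I I \<rightarrow>\<^sub>E (UNIV :: 'k::{field,finite} set).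
  sym_on (eix I I) x & flag_form x & tors t (rep2 A C x) & fle t (rep2 N N x)}"
proof (intro equalityI subsetI)
 fix x :: "('v, 'a, 'k) esys" assume x: "x : Std t"
 then have s: "x : sys I" and m: "smax t (rho_sd I x) (kcf A)"
  and p: "perp (rho_sd I x) (kcf A) = kcf (%v. A v Un N v)" by (simp_all add: Std_def)
 have "kcf A : subs Q (rho_sd I x)" using m by (simp add: smax_def)
 note ff = flag_formI[OF s this p]
 show "x : {x : eix I I \<rightarrow>\<^sub>E UNIV. sym_on (eix I I) x & flag_form x & tors t (rep2 A C x) & fle t (rep2 N N x)}"
  using smax_flag_iff[where t = t, OF s ff t] m s ff unfolding sys_def by blast
next
 fix x :: "('v, 'a, 'k) esys"
 assume x: "x : {x : eix I I \<rightarrow>\<^sub>E UNIV. sym_on (eix I I) x & flag_form x & tors t (rep2 A C x) & fle t (rep2 N N x)}"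
 then have ff: "flag_form x" and sy: "sym_on (eix I I) x" by simp_all
 have s: "x : sys I" using x flag_form_nd2[OF sy ff] by (simp add: sys_def)
 show "x : Std t"
  unfolding Std_def using s smax_flag_iff[where t = t, OF s ff t] kcf_perp[OF s ff] x by simp
qed

end

section \<open>Counting the systems in standard position\<close>

text \<open>There is one free value for each orbit of \<open>\<iota>\<close>, except at fixed points
  of sign -1, where y = -y forces 0 because 2 is nonzero. So \<open>n\<close> counts the two-element
  orbits and the fixed points of sign 1; doubling avoids fractions.\<close>

lemma card_twisted_symmetric:
 fixes Z :: "'b set" and \<iota> :: "'b => 'b" and s :: "'b => int"
 assumes fin: "finite Z" and \<iota>: "!!p. p : Z ==> \<iota> p : Z" "!!p. p : Z ==> \<iota> (\<iota> p) = p"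
  and s: "!!p. p : Z ==> s p = 1 | s p = -1" "!!p. p : Z ==> s (\<iota> p) = s p"
  and two: "(2 :: 'k::{field,finite}) ~= 0"
 shows "\<exists>n. card {y : Z \<rightarrow>\<^sub>E (UNIV :: 'k set). \<forall>p\<in>Z. y (\<iota> p) = of_int (s p) * y p} = CARD('k) ^ n
  & 2 * int n = int (card Z) + (\<Sum>p | p : Z & \<iota> p = p. s p)"
proof -
 \<comment> \<open>Comparing values of \<open>f\<close> selects one representative from each
   two-element orbit.\<close>
 obtain f :: "'b => nat" where f: "inj_on f Z" using finite_imp_inj_to_nat_seg[OF fin] by blast
 define U where "U = {p : Z. \<iota> p ~= p & f p < f (\<iota> p)}"
 define Fp where "Fp = {p : Z. \<iota> p = p & s p = 1}"
 define Fm where "Fm = {p : Z. \<iota> p = p & s p = -1}"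
 define Y where "Y = U Un Fp"
 let ?S = "{y : Z \<rightarrow>\<^sub>E (UNIV :: 'k set). \<forall>p\<in>Z. y (\<iota> p) = of_int (s p) * y p}"
 let ?g = "%z. \<lambda>p\<in>Z. if p : Y then z p else if \<iota> p : Y then of_int (s p) * z (\<iota> p) else (0 :: 'k)"
 have YZ: "Y <= Z" by (auto simp: Y_def U_def Fp_def)
 have tri: "p : Y | \<iota> p : Y | (\<iota> p = p & s p = -1)" if "p : Z" for p
 proof (cases "\<iota> p = p")
  case False
  then have "f p ~= f (\<iota> p)" using inj_onD[OF f, of p "\<iota> p"] that \<iota>(1)[OF that] by auto
  then show ?thesis using False that \<iota>[OF that] by (auto simp: Y_def U_def)
 qed (use s(1)[OF that] that in \<open>auto simp: Y_def Fp_def\<close>)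
 have not2: "\<iota> p ~: Y" if "p : Y" "\<iota> p ~= p" for p
  using that \<iota> by (auto simp: Y_def U_def Fp_def)
 have ss: "of_int (s p) * (of_int (s p) * c) = (c :: 'k)" if "p : Z" for p c
  using s(1)[OF that] by auto
 have "bij_betw (%y. restrict y Y) ?S (Y \<rightarrow>\<^sub>E (UNIV :: 'k set))"
 proof (rule bij_betw_byWitness[where f' = ?g])
  show "\<forall>y\<in>?S. ?g (restrict y Y) = y"
  proof
   fix y assume y: "y : ?S"
   have y': "y (\<iota> p) = of_int (s p) * y p" if "p : Z" for p using y that by blast
   show "?g (restrict y Y) = y"
   proof (rule extensionalityI[of _ Z])
    show "y : extensional Z" using y by (simp add: PiE_def)
    fix p assume p: "p : Z"
    show "?g (restrict y Y) p = y p"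
    proof (cases "p : Y | \<iota> p : Y")
     case True
     have "of_int (s p) * y (\<iota> p) = y p" unfolding y'[OF p] by (rule ss[OF p])
     then show ?thesis using p True by (auto simp only: restrict_apply if_True split: if_splits)
    next
     case False
     then have "\<iota> p = p" "s p = -1" using tri[OF p] by auto
     then have "y p = - y p" using y'[OF p] by simp
     then have "y p + y p = 0" by (metis add.right_inverse)
     then have "2 * y p = 0" by (simp only: mult_2)
     then have "y p = 0" using two by (simp only: mult_eq_0_iff) blast
     then show ?thesis using False p by simp
    qed
   qed simp
  qed
  show "\<forall>z\<in>Y \<rightarrow>\<^sub>E UNIV. restrict (?g z) Y = z"
  proof
   fix z assume z: "z : Y \<rightarrow>\<^sub>E (UNIV :: 'k set)"
   show "restrict (?g z) Y = z"
    by (rule extensionalityI[of _ Y]) (use z YZ in \<open>auto simp: PiE_def\<close>)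
  qed
  show "(%y. restrict y Y) ` ?S <= Y \<rightarrow>\<^sub>E UNIV" by auto
  show "?g ` (Y \<rightarrow>\<^sub>E UNIV) <= ?S"
  proof (rule image_subsetI)
   fix z assume z: "z : Y \<rightarrow>\<^sub>E (UNIV :: 'k set)"
   have "?g z (\<iota> p) = of_int (s p) * ?g z p" if p: "p : Z" for p
   proof -
    note ip = \<iota>[OF p]
    have fixY: "s p = 1" if "p : Y" "\<iota> p = p" using that by (auto simp: Y_def U_def Fp_def)
    show ?thesis
    proof (cases "p : Y")
     case True
     then show ?thesis
     proof (cases "\<iota> p = p")
      case True
      then show ?thesis using \<open>p : Y\<close> fixY p by simp
     next
      case False
      then show ?thesis using not2[OF True False] True p ip s(2)[OF p] by simp
     qed
    next
     case False
     then show ?thesis using p ip ss[OF p] s(2)[OF p] by simp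
    qed
   qed
   then show "?g z : ?S" by simp
  qed
 qed
 then have "card ?S = card (Y \<rightarrow>\<^sub>E (UNIV :: 'k set))" by (rule bij_betw_same_card)
 also have "\<dots> = CARD('k) ^ card Y" using finite_subset[OF YZ fin] by (simp add: card_PiE)
 finally have c: "card ?S = CARD('k) ^ card Y" .
 have fU: "finite U" "finite Fp" "finite Fm" using fin by (auto simp: U_def Fp_def Fm_def)
 have inj: "inj_on \<iota> U" by (rule inj_on_inverseI[of _ \<iota>]) (use \<iota> in \<open>simp add: U_def\<close>)
 have Z: "Z = (U Un \<iota> ` U) Un (Fp Un Fm)"
 proof (intro equalityI subsetI)
  fix p assume p: "p : Z"
  have "\<iota> p : U ==> p : \<iota> ` U" using \<iota>(2)[OF p] by (metis imageI)
  moreover have "\<iota> p : Fp ==> p : Fp" using \<iota>[OF p] by (auto simp: Fp_def)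
  ultimately show "p : (U Un \<iota> ` U) Un (Fp Un Fm)" using tri[OF p] p by (auto simp: Y_def Fm_def)
 qed (use \<iota> in \<open>auto simp: U_def Fp_def Fm_def\<close>)
 have dj: "U Int \<iota> ` U = {}" "(U Un \<iota> ` U) Int (Fp Un Fm) = {}" "Fp Int Fm = {}" "U Int Fp = {}"
  using \<iota> by (auto simp: U_def Fp_def Fm_def)
 have "card Z = (card U + card U) + (card Fp + card Fm)"
  unfolding Z using fU dj by (simp add: card_Un_disjoint card_image[OF inj])
 moreover have "(\<Sum>p | p : Z & \<iota> p = p. s p) = int (card Fp) - int (card Fm)"
 proof -
  have e: "{p. p : Z & \<iota> p = p} = Fp Un Fm" using s(1) by (auto simp: Fp_def Fm_def)
  have "(\<Sum>p\<in>Fp. s p) = (\<Sum>p\<in>Fp. 1)" "(\<Sum>p\<in>Fm. s p) = (\<Sum>p\<in>Fm. -1)"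
   by (rule sum.cong; simp add: Fp_def Fm_def)+
  then show ?thesis unfolding e using fU dj by (simp add: sum.union_disjoint)
 qed
 moreover have "card Y = card U + card Fp" unfolding Y_def using fU dj by (simp add: card_Un_disjoint)
 ultimately have "2 * int (card Y) = int (card Z) + (\<Sum>p | p : Z & \<iota> p = p. s p)" by simp
 with c show ?thesis by blast
qed

context sd_quiver
begin

lemma subs_cong:
 fixes M :: "('v, 'a, 'k::field, 'y) qrep_scheme" and N :: "('v, 'a, 'k, 'z) qrep_scheme"
 assumes v: "!!i. i : verts Q ==> vsp M i = vsp N i"
  and m: "!!ar x. ar : arcs Q ==> x : vsp M (tail Q ar) ==> vmap M ar x = vmap N ar x"
 shows "subs Q M = subs Q N" "onverts Q (vsp M) = onverts Q (vsp N)"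
proof -
 have "subrepresentation Q M V \<longleftrightarrow> subrepresentation Q N V" for V
 proof -
  have "vmap M ar ` V (tail Q ar) = vmap N ar ` V (tail Q ar)"
   if "\<forall>i\<in>verts Q. kvec.subspace (V i) & V i <= vsp M i" "ar : arcs Q" for ar
  proof (rule image_cong[OF refl], rule m[OF that(2)])
   fix x assume "x : V (tail Q ar)"
   then show "x : vsp M (tail Q ar)" using that tail_in_verts[OF that(2)] by blast
  qed
  note im = this
  have c: "(\<forall>i\<in>verts Q. kvec.subspace (V i) & V i <= vsp M i) \<longleftrightarrow> (\<forall>i\<in>verts Q. kvec.subspace (V i) & V i <= vsp N i)"
   by (simp add: v)
  show ?thesis
  proof (cases "\<forall>i\<in>verts Q. kvec.subspace (V i) & V i <= vsp M i")
   case True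
   then show ?thesis unfolding subrepresentation_def c[symmetric] using im[OF True] by simp
  next
   case False
   then show ?thesis unfolding subrepresentation_def c[symmetric] by blast
  qed
 qed
 then show "subs Q M = subs Q N" unfolding subs_def by simp
 show "onverts Q (vsp M) = onverts Q (vsp N)" using v by (intro onverts_eqI) simp_all
qed

lemma tors_cong:
 fixes M :: "('v, 'a, 'k::field, 'y) qrep_scheme" and N :: "('v, 'a, 'k, 'z) qrep_scheme"
 assumes "!!i. i : verts Q ==> vsp M i = vsp N i"
  "!!ar x. ar : arcs Q ==> x : vsp M (tail Q ar) ==> vmap M ar x = vmap N ar x"
 shows "tors t M \<longleftrightarrow> tors t N" "fle t M \<longleftrightarrow> fle t N"
proof -
 have s: "subs Q M = subs Q N" "onverts Q (vsp M) = onverts Q (vsp N)"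
  by (rule subs_cong; fact assms)+
 show "tors t M \<longleftrightarrow> tors t N" "fle t M \<longleftrightarrow> fle t N"
  unfolding tors_def fle_def s by (rule refl)+
qed

lemma eix_cong:
 assumes xy: "!!p. p : eix J J' ==> x p = y p"
 shows "nd2 J J' x \<longleftrightarrow> nd2 J J' y" "tors t (rep2 J J' x) \<longleftrightarrow> tors t (rep2 J J' y)"
  "fle t (rep2 J J' x) \<longleftrightarrow> fle t (rep2 J J' y)"
proof -
 have n: "mat_app (J v) (J' (sg v)) (%i j. x (Inl v, i, j)) = mat_app (J v) (J' (sg v)) (%i j. y (Inl v, i, j))"
  "mat_app (J' (sg v)) (J v) (%j i. x (Inl v, i, j)) = mat_app (J' (sg v)) (J v) (%j i. y (Inl v, i, j))"
  if "v : verts Q" for v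
  using that xy by (auto simp: fun_eq_iff eix_def intro!: mat_app_cong)
 then show "nd2 J J' x \<longleftrightarrow> nd2 J J' y" unfolding nd2_def by simp
 have a: "vmap (rep2 J J' x) ar z = vmap (rep2 J J' y) ar z" if "ar : arcs Q" for ar z
 proof -
  have "mat_app (J' (sg (head Q ar))) (J (tail Q ar)) (%j i. x (Inr ar, i, j)) =
    mat_app (J' (sg (head Q ar))) (J (tail Q ar)) (%j i. y (Inr ar, i, j))"
   using that xy by (auto simp: fun_eq_iff eix_def intro!: mat_app_cong)
  then show ?thesis using n(2)[OF head_in_verts[OF that]] by (simp add: vm2_def)
 qed
 show "tors t (rep2 J J' x) \<longleftrightarrow> tors t (rep2 J J' y)" "fle t (rep2 J J' x) \<longleftrightarrow> fle t (rep2 J J' y)"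
  by (rule tors_cong; simp add: a del: rep2_simps(2))+
qed

text \<open>Once the node pairings are nondegenerate, a form along an arrow is the same as a linear
  map. A system thus consists of an invertible matrix at each node and an ordinary representation on
  \<open>J\<close>, and \<open>tors\<close> depends on the latter only.\<close>

lemma card_tors_systems:
 assumes g: "good2 J J'"
 shows "card {y : eix J J' \<rightarrow>\<^sub>E (UNIV :: 'k::{field,finite} set). nd2 J J' y & tors t (rep2 J J' y)} =
  (\<Prod>v\<in>verts Q. gl TYPE('k) (card (J v))) * card {x : arrow_ix J J \<rightarrow>\<^sub>E (UNIV :: 'k set). tors t (rho J x)}"
proof -
 define B where "B v = {m : J v \<times> J' (sg v) \<rightarrow>\<^sub>E (UNIV :: 'k set).
  \<forall>w\<in>coords (J' (sg v)). mat_app (J v) (J' (sg v)) (%i j. m (i, j)) w = 0 --> w = 0}" for v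
 let ?Y = "{y : eix J J' \<rightarrow>\<^sub>E (UNIV :: 'k set). nd2 J J' y & tors t (rep2 J J' y)}"
 let ?X = "{x : arrow_ix J J \<rightarrow>\<^sub>E (UNIV :: 'k set). tors t (rho J x)}"
 let ?T = "(\<Pi>\<^sub>E v\<in>verts Q. B v) \<times> ?X"
 define \<beta> where "\<beta> b v = bf (J v) (J' (sg v)) (%i j. b v (i, j))" for b :: "'v => nat \<times> nat => 'k" and v
 define mt where "mt x ar = mat_app (J (head Q ar)) (J (tail Q ar)) (%i j. x (ar, i, j))" for x :: "'a \<times> nat \<times> nat => 'k" and ar
 \<comment> \<open>\<open>F\<close> composes maps with pairings to obtain forms; its inverse
   \<open>G\<close> recovers the maps by \<open>vm2\<close>.\<close>
 define F where "F = (%(b, x). restrict (%(e, i, j). case e of Inl v => b v (i, j)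
  | Inr ar => \<beta> b (head Q ar) (mt x ar (unitv i)) (unitv j)) (eix J J'))"
 define G where "G y = (\<lambda>v\<in>verts Q. \<lambda>p\<in>J v \<times> J' (sg v). y (Inl v, fst p, snd p),
  restrict (%(ar, i, j). entry (vm2 J J' y ar (unitv j)) i) (arrow_ix J J))"
  for y :: "('v, 'a, 'k) esys"
 have FInl: "F (b, x) (Inl v, i, j) = b v (i, j)" if "v : verts Q" "i : J v" "j : J' (sg v)" for b x v i j
  using that by (simp add: F_def eix_def)
 have FInr: "F (b, x) (Inr ar, i, j) = \<beta> b (head Q ar) (mt x ar (unitv i)) (unitv j)"
  if "ar : arcs Q" "i : J (tail Q ar)" "j : J' (sg (head Q ar))" for b x ar i j
  using that by (simp add: F_def eix_def)
 have ndF: "nd2 J J' (F (b, x))" if b: "b : (\<Pi>\<^sub>E v\<in>verts Q. B v)" for b x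
  unfolding nd2_def
 proof (intro ballI impI)
  fix v w assume v: "v : verts Q" and w: "w : coords (J' (sg v))"
   and 0: "mat_app (J v) (J' (sg v)) (%i j. F (b, x) (Inl v, i, j)) w = 0"
  have "mat_app (J v) (J' (sg v)) (%i j. F (b, x) (Inl v, i, j)) w = mat_app (J v) (J' (sg v)) (%i j. b v (i, j)) w"
   by (rule mat_app_cong) (simp add: FInl v)
  then show "w = 0" using PiE_mem[OF b v] w 0 by (simp add: B_def)
 qed
 have esfF: "esf J J' (F (b, x)) (Inl v) u w = \<beta> b v u w" if "v : verts Q" for b x v u w
  unfolding esf_def \<beta>_def by (simp, rule bf_cong) (simp add: FInl that)
 have vmF: "vm2 J J' (F (b, x)) ar z = mt x ar z"
  if b: "b : (\<Pi>\<^sub>E v\<in>verts Q. B v)" and a: "ar : arcs Q" and z: "z : coords (J (tail Q ar))" for b x ar z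
 proof (rule vm2(3)[OF g ndF[OF b] a])
  have th: "tail Q ar : verts Q" "head Q ar : verts Q" using a by auto
  show "mt x ar z : coords (J (head Q ar))" unfolding mt_def using good2D(1)[OF g th(2)] by simp
  fix w :: "'k vec" assume w: "w : coords (J' (sg (head Q ar)))"
  have l: "linear_between (coords (J (tail Q ar))) (coords (J (head Q ar))) (mt x ar)"
   unfolding mt_def by (rule linear_between_mat_app[OF good2D(1)[OF g th(2)]])
  have id: "linear_between (coords (J' (sg (head Q ar)))) (coords (J' (sg (head Q ar)))) (%w. w :: nat \<Rightarrow>\<^sub>0 'k)"
   by (simp add: linear_between_def)
  have "bilin (coords (J (tail Q ar))) (coords (J' (sg (head Q ar)))) (%u w. \<beta> b (head Q ar) (mt x ar u) w)"
   by (rule bilin_comp[OF _ l id]) (simp add: \<beta>_def bilin_bf)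
  from bilin_coords[OF this good2D(1)[OF g th(1)] good2D(4)[OF g th(2)] z w]
  have "\<beta> b (head Q ar) (mt x ar z) w = bf (J (tail Q ar)) (J' (sg (head Q ar)))
   (%i j. \<beta> b (head Q ar) (mt x ar (unitv i)) (unitv j)) z w" .
  also have "\<dots> = esf J J' (F (b, x)) (Inr ar) z w"
   unfolding esf_def by (simp, rule bf_cong) (simp add: FInr a)
  finally show "esf J J' (F (b, x)) (Inl (head Q ar)) (mt x ar z) w = esf J J' (F (b, x)) (Inr ar) z w"
   using esfF[OF th(2)] by simp
 qed
 have torsF: "tors t (rep2 J J' (F (b, x))) \<longleftrightarrow> tors t (rho J x)" if b: "b : (\<Pi>\<^sub>E v\<in>verts Q. B v)" for b x
  by (rule tors_cong(1)) (use vmF[OF b] in \<open>auto simp: mt_def\<close>)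
 have G1: "fst (G y) : (\<Pi>\<^sub>E v\<in>verts Q. B v)" if y: "nd2 J J' y" for y :: "('v, 'a, 'k) esys"
 proof -
  have "(\<lambda>p\<in>J v \<times> J' (sg v). y (Inl v, fst p, snd p)) : B v" if v: "v : verts Q" for v
  proof -
   have "mat_app (J v) (J' (sg v)) (%i j. (\<lambda>p\<in>J v \<times> J' (sg v). y (Inl v, fst p, snd p)) (i, j)) w =
     mat_app (J v) (J' (sg v)) (%i j. y (Inl v, i, j)) w" for w
    by (rule mat_app_cong) simp
   then show ?thesis using y v unfolding B_def nd2_def by simp
  qed
  then show ?thesis by (simp add: G_def)
 qed
 have FG: "F (G y) = y" if y: "y : eix J J' \<rightarrow>\<^sub>E UNIV" "nd2 J J' y" for y :: "('v, 'a, 'k) esys"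
 proof (rule extensionalityI[of _ "eix J J'"])
  show "F (G y) : extensional (eix J J')" by (simp add: F_def split: prod.split)
  show "y : extensional (eix J J')" using y by (simp add: PiE_def)
  fix p assume p: "p : eix J J'"
  obtain e i j where e: "p = (e, i, j)" by (cases p)
  have ei: "e : edges" "i : J (src e)" "j : J' (dst e)" using p e by (auto simp: eix_def)
  obtain b x where bx: "G y = (b, x)" by (cases "G y")
  have b: "b v (i, j) = y (Inl v, i, j)" if "v : verts Q" "i : J v" "j : J' (sg v)" for v i j
   using bx that by (auto simp: G_def)
  have x: "x (ar, i, j) = entry (vm2 J J' y ar (unitv j)) i"
   if "ar : arcs Q" "i : J (head Q ar)" "j : J (tail Q ar)" for ar i j
   using bx that by (auto simp: G_def arrow_ix_def)
  show "F (G y) p = y p"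
   using ei(1)
  proof (cases rule: edges_cases)
   case (1 v)
   then show ?thesis unfolding bx e using FInl[of v i j b x] b[of v i j] ei by simp
  next
   case (2 ar)
   have th: "tail Q ar : verts Q" "head Q ar : verts Q" using 2 by auto
   have i: "i : J (tail Q ar)" and j: "j : J' (sg (head Q ar))" using ei 2 by simp_all
   have ui: "unitv i : (coords (J (tail Q ar)) :: 'k vec set)" using i by simp
   have uj: "unitv j : (coords (J' (sg (head Q ar))) :: 'k vec set)" using j by simp
   have m: "mt x ar (unitv i) = vm2 J J' y ar (unitv i)"
   proof (rule poly_mapping_eqI)
    fix r
    have c: "vm2 J J' y ar (unitv i) : coords (J (head Q ar))"
     by (rule linear_between_in[OF vm2(1)[OF g y(2) 2(2)] ui])
    show "entry (mt x ar (unitv i)) r = entry (vm2 J J' y ar (unitv i)) r"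
    proof (cases "r : J (head Q ar)")
     case True
     then show ?thesis
      unfolding mt_def lookup_mat_app[OF good2D(1)[OF g th(2)]]
      using sum_lookup_unitv[OF good2D(1)[OF g th(1)] i, of "%j. x (ar, r, j)"] x[OF 2(2) True i] by simp
    next
     case False
     then show ?thesis
      unfolding mt_def lookup_mat_app[OF good2D(1)[OF g th(2)]] using coords_lookup[OF c False] by simp
    qed
   qed
   have "F (G y) p = \<beta> b (head Q ar) (mt x ar (unitv i)) (unitv j)"
    unfolding bx e 2(1) by (rule FInr[OF 2(2) i j])
   also have "\<dots> = esf J J' y (Inl (head Q ar)) (vm2 J J' y ar (unitv i)) (unitv j)"
    unfolding m \<beta>_def esf_def by (simp, rule bf_cong) (simp add: b th)
   also have "\<dots> = esf J J' y (Inr ar) (unitv i) (unitv j)" by (rule vm2(2)[OF g y(2) 2(2) uj])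
   also have "\<dots> = y p"
    unfolding esf_def e 2(1) src.simps dst.simps
    by (rule bf_unitv[OF good2D(1)[OF g th(1)] good2D(4)[OF g th(2)] i j])
   finally show ?thesis .
  qed
 qed
 have "bij_betw G ?Y ?T"
 proof (rule bij_betw_byWitness[where f' = F])
  show "\<forall>y\<in>?Y. F (G y) = y" using FG by blast
  have GY: "G y : ?T" if y: "y : ?Y" for y
  proof -
   have nd: "nd2 J J' y" and ty: "tors t (rep2 J J' y)" and ye: "y : eix J J' \<rightarrow>\<^sub>E UNIV" using y by simp_all
   have eq: "F (fst (G y), snd (G y)) = y" using FG[OF ye nd] by simp
   have "tors t (rho J (snd (G y)))" using torsF[OF G1[OF nd], of "snd (G y)"] ty unfolding eq by simp
   moreover have "snd (G y) : arrow_ix J J \<rightarrow>\<^sub>E UNIV" by (simp add: G_def)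
   ultimately show ?thesis using G1[OF nd] by (cases "G y") simp
  qed
  then show "G ` ?Y <= ?T" by blast
  have FT: "F p : ?Y" if p: "p : ?T" for p
  proof -
   obtain b x where bx: "p = (b, x)" by (cases p)
   have b: "b : (\<Pi>\<^sub>E v\<in>verts Q. B v)" and x: "tors t (rho J x)" using p bx by auto
   have "F (b, x) : eix J J' \<rightarrow>\<^sub>E UNIV" by (simp add: F_def)
   then show ?thesis unfolding bx using ndF[OF b] torsF[OF b] x by simp
  qed
  then show "F ` ?T <= ?Y" by blast
  show "\<forall>p\<in>?T. G (F p) = p"
  proof
   fix p assume p: "p : ?T"
   obtain b x where bx: "p = (b, x)" by (cases p)
   have b: "b : (\<Pi>\<^sub>E v\<in>verts Q. B v)" and x: "x : arrow_ix J J \<rightarrow>\<^sub>E UNIV" using p bx by auto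
   have "fst (G (F (b, x))) = b"
   proof (rule extensionalityI[of _ "verts Q"])
    fix v assume v: "v : verts Q"
    have "b v : extensional (J v \<times> J' (sg v))" using PiE_mem[OF b v] by (simp add: B_def PiE_def)
    then show "fst (G (F (b, x))) v = b v"
     using v by (auto simp: G_def FInl fun_eq_iff restrict_def extensional_def)
   qed (use b in \<open>simp_all add: G_def PiE_def\<close>)
   moreover have "snd (G (F (b, x))) = x"
   proof (rule extensionalityI[of _ "arrow_ix J J"])
    fix r assume r: "r : arrow_ix J J"
    obtain ar i j where e: "r = (ar, i, j)" by (cases r)
    have a: "ar : arcs Q" "i : J (head Q ar)" "j : J (tail Q ar)" using r e by (auto simp: arrow_ix_def)
    have th: "tail Q ar : verts Q" "head Q ar : verts Q" using a by auto
    have "snd (G (F (b, x))) r = entry (mt x ar (unitv j)) i"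
     using r vmF[OF b a(1), of "unitv j" x] a by (simp add: G_def e)
    also have "\<dots> = x r"
     unfolding mt_def lookup_mat_app[OF good2D(1)[OF g th(2)]] e
     using sum_lookup_unitv[OF good2D(1)[OF g th(1)] a(3), of "%j. x (ar, i, j)"] a(2) by simp
    finally show "snd (G (F (b, x))) r = x r" .
   qed (use x in \<open>simp_all add: G_def PiE_def\<close>)
   ultimately show "G (F p) = p" unfolding bx by (metis prod.collapse)
  qed
 qed
 then have "card ?Y = card ?T" by (rule bij_betw_same_card)
 also have "\<dots> = (\<Prod>v\<in>verts Q. card (B v)) * card ?X" by (simp add: card_cartesian_product card_PiE)
 also have "(\<Prod>v\<in>verts Q. card (B v)) = (\<Prod>v\<in>verts Q. gl TYPE('k) (card (J v)))"
 proof (rule prod.cong[OF refl])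
  fix v assume v: "v : verts Q"
  note f = good2D[OF g v]
  show "card (B v) = gl TYPE('k) (card (J v))"
   unfolding B_def card_nondegenerate_matrices[OF f(1,4,3)]
   by (rule card_Iso_coords[OF f(1,4,3)])
 qed
 finally show ?thesis .
qed

text \<open>The involution on entries is transposition combined with \<open>einv\<close>; its fixed
  points are the diagonal entries of the edges fixed by \<open>einv\<close>.\<close>

lemma card_sym_systems:
 assumes two: "(2 :: 'k::{field,finite}) ~= 0" and fin: "!!v. v : verts Q ==> finite (C v)"
 shows "\<exists>n. card {y : eix C C \<rightarrow>\<^sub>E (UNIV :: 'k set). sym_on (eix C C) y} = CARD('k) ^ n &
  2 * int n = (\<Sum>e\<in>edges. int (card (C (src e))) * int (card (C (dst e)))) +
   (\<Sum>e | e : edges & einv e = e. eps e * int (card (C (src e))))"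
proof -
 let ?\<iota> = "%(e, i, j). (einv e, j, i) :: ('v + 'a) \<times> nat \<times> nat"
 have fZ: "finite (eix C C)"
  unfolding eix_def using finite_edges edge_facts(5,6) fin by (intro finite_SigmaI finite_cartesian_product) auto
 have \<iota>: "?\<iota> p : eix C C" "?\<iota> (?\<iota> p) = p" "eps (fst (?\<iota> p)) = eps (fst p)" if "p : eix C C" for p
  using that edge_facts eps_facts(3) by (auto simp: eix_def)
 have s: "eps (fst p) = 1 | eps (fst p) = -1" if "p : eix C C" for p
 proof -
  have "fst p : edges" using that by (auto simp: eix_def)
  then show ?thesis by (rule eps_facts(1))
 qed
 have "\<exists>n. card {y : eix C C \<rightarrow>\<^sub>E (UNIV :: 'k set). \<forall>p\<in>eix C C. y (?\<iota> p) = of_int (eps (fst p)) * y p} = CARD('k) ^ n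
  & 2 * int n = int (card (eix C C)) + (\<Sum>p | p : eix C C & ?\<iota> p = p. eps (fst p))"
  by (rule card_twisted_symmetric[where \<iota> = ?\<iota> and s = "%p. eps (fst p)", OF fZ \<iota>(1,2) s \<iota>(3) two]; assumption)
 then obtain n where n: "card {y : eix C C \<rightarrow>\<^sub>E (UNIV :: 'k set). \<forall>p\<in>eix C C. y (?\<iota> p) = of_int (eps (fst p)) * y p} = CARD('k) ^ n"
  "2 * int n = int (card (eix C C)) + (\<Sum>p | p : eix C C & ?\<iota> p = p. eps (fst p))" by blast
 have "sym_on (eix C C) y \<longleftrightarrow> (\<forall>p\<in>eix C C. y (?\<iota> p) = of_int (eps (fst p)) * y p)" for y :: "_ => 'k"
  unfolding sym_on_def by auto
 then have 1: "card {y : eix C C \<rightarrow>\<^sub>E (UNIV :: 'k set). sym_on (eix C C) y} = CARD('k) ^ n" using n(1) by simp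
 have "card (eix C C) = (\<Sum>e\<in>edges. card (C (src e)) * card (C (dst e)))"
  unfolding eix_def by (subst card_SigmaI) (use finite_edges edge_facts(5,6) fin in \<open>auto simp: card_cartesian_product\<close>)
 moreover have "(\<Sum>p | p : eix C C & ?\<iota> p = p. eps (fst p)) = (\<Sum>e | e : edges & einv e = e. eps e * int (card (C (src e))))"
 proof -
  have sd: "dst e = src e" if "e : edges" "einv e = e" for e
   using edge_facts(4)[OF that(1)] that(2) by simp
  have S: "{p. p : eix C C & ?\<iota> p = p} = (%(e, i). (e, i, i)) ` (SIGMA e:{e. e : edges & einv e = e}. C (src e))"
   using sd by (auto simp: eix_def image_iff)
  have "inj_on (%(e, i). (e, i, i)) (SIGMA e:{e. e : edges & einv e = e}. C (src e))" by (auto simp: inj_on_def)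
  then have "(\<Sum>p | p : eix C C & ?\<iota> p = p. eps (fst p)) = (\<Sum>(e, i)\<in>(SIGMA e:{e. e : edges & einv e = e}. C (src e)). eps e)"
   unfolding S by (subst sum.reindex) (auto simp: case_prod_unfold)
  also have "\<dots> = (\<Sum>e | e : edges & einv e = e. \<Sum>i\<in>C (src e). eps e)"
   by (rule sum.Sigma[symmetric]) (use finite_edges edge_facts(5) fin in auto)
  finally show ?thesis by (simp add: mult.commute)
 qed
 ultimately show ?thesis using 1 n(2) by (intro exI[of _ n]) simp
qed

end

context flag
begin

text \<open>Of the nine blocks, three vanish, and \<open>C\<close> by \<open>A\<close> and
  \<open>N\<close> by \<open>C\<close> are mirror images of \<open>A\<close> by \<open>C\<close> and
  \<open>C\<close> by \<open>N\<close> under the symmetry. The other four are independent, and of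
  these only \<open>N\<close> by \<open>N\<close> and \<open>C\<close> by \<open>C\<close> carry a
  symmetry condition of their own. \<open>g\<close> reassembles a system from them.\<close>

lemma card_Std:
 assumes two: "(2 :: 'k::{field,finite}) ~= 0" and t: "!!v. v : verts Q ==> t (sg v) = - t v"
 shows "card (Std t :: (('v, 'a, 'k) esys) set) =
   (\<Prod>v\<in>verts Q. gl TYPE('k) (card (A v))) * card {x : arrow_ix A A \<rightarrow>\<^sub>E (UNIV :: 'k set). tors t (rho A x)} *
   (card {y : sys N. fle t (rep2 N N (y :: _ => 'k))} *
   (CARD('k) ^ (\<Sum>e\<in>edges. card (C (src e)) * card (N (dst e))) *
    card {y : eix C C \<rightarrow>\<^sub>E (UNIV :: 'k set). sym_on (eix C C) y}))"
proof -
 let ?YA = "{y : eix A C \<rightarrow>\<^sub>E (UNIV :: 'k set). nd2 A C y & tors t (rep2 A C y)}"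
 let ?YN = "{y : sys N. fle t (rep2 N N (y :: _ => 'k))}"
 let ?YC = "{y : eix C C \<rightarrow>\<^sub>E (UNIV :: 'k set). sym_on (eix C C) y}"
 let ?S = "{x : eix I I \<rightarrow>\<^sub>E (UNIV :: 'k set). sym_on (eix I I) x & flag_form x & tors t (rep2 A C x) & fle t (rep2 N N x)}"
 let ?T = "?YA \<times> (?YN \<times> ((eix C N \<rightarrow>\<^sub>E (UNIV :: 'k set)) \<times> ?YC))"
 define h where "h x = (restrict x (eix A C), restrict x (eix N N), restrict x (eix C N), restrict x (eix C C))"
  for x :: "('v, 'a, 'k) esys"
 define g where "g = (%(a, n, c, s). restrict (%(e, i, j).
   if (e, i, j) : eix A C then a (e, i, j) else if (einv e, j, i) : eix A C then of_int (eps e) * a (einv e, j, i)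
   else if (e, i, j) : eix N N then n (e, i, j) else if (e, i, j) : eix C N then c (e, i, j)
   else if (einv e, j, i) : eix C N then of_int (eps e) * c (einv e, j, i)
   else if (e, i, j) : eix C C then s (e, i, j) else (0 :: 'k)) (eix I I))"
 have dj: "i : A v ==> i ~: N v" "i : A v ==> i ~: C v" "i : N v ==> i ~: C v"
   "i : N v ==> i ~: A v" "i : C v ==> i ~: A v" "i : C v ==> i ~: N v" if "v : verts Q" for i v
  using disj[OF that] by auto
 have gv: "g (a, n, c, s) (e, i, j) = (if i : A (src e) & j : C (dst e) then a (e, i, j)
   else if j : A (dst e) & i : C (src e) then of_int (eps e) * a (einv e, j, i)
   else if i : N (src e) & j : N (dst e) then n (e, i, j) else if i : C (src e) & j : N (dst e) then c (e, i, j)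
   else if j : C (dst e) & i : N (src e) then of_int (eps e) * c (einv e, j, i)
   else if i : C (src e) & j : C (dst e) then s (e, i, j) else 0)"
  if e: "e : edges" and i: "i : I (src e)" and j: "j : I (dst e)" for a n c s e i j
 proof -
  note ef = edge_facts[OF e]
  have m: "(e, i, j) : eix X Y \<longleftrightarrow> i : X (src e) & j : Y (dst e)"
   "(einv e, j, i) : eix X Y \<longleftrightarrow> j : X (dst e) & i : Y (src e)" for X Y
   using e ef by (simp_all add: eix_def)
  have "i : I (src e) & j : I (dst e)" using i j by blast
  then show ?thesis unfolding g_def prod.case restrict_apply m by (rule if_P)
 qed
 have g_AC: "g (a, n, c, s) (e, i, j) = a (e, i, j)"
  if e: "e : edges" and i: "i : A (src e)" and j: "j : C (dst e)" for a n c s e i j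
  using gv[OF e, of i j a n c s] i j dj(1,2)[OF edge_facts(5)[OF e] i] dj(5,6)[OF edge_facts(6)[OF e] j] by simp
 have g_NN: "g (a, n, c, s) (e, i, j) = n (e, i, j)"
  if e: "e : edges" and i: "i : N (src e)" and j: "j : N (dst e)" for a n c s e i j
  using gv[OF e, of i j a n c s] i j dj(3,4)[OF edge_facts(5)[OF e] i] dj(3,4)[OF edge_facts(6)[OF e] j] by simp
 have g_CN: "g (a, n, c, s) (e, i, j) = c (e, i, j)"
  if e: "e : edges" and i: "i : C (src e)" and j: "j : N (dst e)" for a n c s e i j
  using gv[OF e, of i j a n c s] i j dj(5,6)[OF edge_facts(5)[OF e] i] dj(3,4)[OF edge_facts(6)[OF e] j] by simp
 have g_CC: "g (a, n, c, s) (e, i, j) = s (e, i, j)"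
  if e: "e : edges" and i: "i : C (src e)" and j: "j : C (dst e)" for a n c s e i j
  using gv[OF e, of i j a n c s] i j dj(5,6)[OF edge_facts(5)[OF e] i] dj(5,6)[OF edge_facts(6)[OF e] j] by simp
 have g_AA: "g (a, n, c, s) (e, i, j) = 0"
  if e: "e : edges" and i: "i : A (src e)" and j: "j : A (dst e)" for a n c s e i j
  using gv[OF e, of i j a n c s] i j dj(1,2)[OF edge_facts(5)[OF e] i] dj(1,2)[OF edge_facts(6)[OF e] j] by simp
 have g_AN: "g (a, n, c, s) (e, i, j) = 0"
  if e: "e : edges" and i: "i : A (src e)" and j: "j : N (dst e)" for a n c s e i j
  using gv[OF e, of i j a n c s] i j dj(1,2)[OF edge_facts(5)[OF e] i] dj(3,4)[OF edge_facts(6)[OF e] j] by simp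
 have g_NA: "g (a, n, c, s) (e, i, j) = 0"
  if e: "e : edges" and i: "i : N (src e)" and j: "j : A (dst e)" for a n c s e i j
  using gv[OF e, of i j a n c s] i j dj(3,4)[OF edge_facts(5)[OF e] i] dj(1,2)[OF edge_facts(6)[OF e] j] by simp
 have g_CA: "g (a, n, c, s) (e, i, j) = of_int (eps e) * a (einv e, j, i)"
  if e: "e : edges" and i: "i : C (src e)" and j: "j : A (dst e)" for a n c s e i j
  using gv[OF e, of i j a n c s] i j dj(5,6)[OF edge_facts(5)[OF e] i] dj(1,2)[OF edge_facts(6)[OF e] j] by simp
 have g_NC: "g (a, n, c, s) (e, i, j) = of_int (eps e) * c (einv e, j, i)"
  if e: "e : edges" and i: "i : N (src e)" and j: "j : C (dst e)" for a n c s e i j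
  using gv[OF e, of i j a n c s] i j dj(3,4)[OF edge_facts(5)[OF e] i] dj(5,6)[OF edge_facts(6)[OF e] j] by simp
 note gval = g_AC g_NN g_CN g_CC g_AA g_AN g_NA g_CA g_NC
 have ginC: "g p : eix I I \<rightarrow>\<^sub>E UNIV" for p
  by (cases p) (simp add: g_def)
 have sub: "eix A C <= eix I I" "eix N N <= eix I I" "eix C N <= eix I I" "eix C C <= eix I I"
  unfolding eix_def by auto
 have sub': "eix A A <= eix I I" "eix A N <= eix I I" "eix N A <= eix I I"
  unfolding eix_def by auto
 have rg: "restrict (g (a, n, c, s)) (eix A C) = restrict a (eix A C)"
  "restrict (g (a, n, c, s)) (eix N N) = restrict n (eix N N)"
  "restrict (g (a, n, c, s)) (eix C N) = restrict c (eix C N)"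
  "restrict (g (a, n, c, s)) (eix C C) = restrict s (eix C C)" for a n c s
  by (rule restrict_ext; use gval in \<open>auto simp: eix_def\<close>)+
 have gz: "g (a, n, c, s) p = 0" if "p : eix A A Un eix A N Un eix N A" for a n c s p
  using that gval by (auto simp: eix_def)
 have agree: "!!p. p : Z ==> x p = y p" if "restrict x Z = restrict y Z" for x y :: "('v, 'a, 'k) esys" and Z
  using that by (metis restrict_apply')
 have rx: "!!p. p : Z ==> restrict x Z p = x p" for x :: "('v, 'a, 'k) esys" and Z by simp
 have "bij_betw h ?S ?T"
 proof (rule bij_betw_byWitness[where f' = g])
  show "\<forall>x\<in>?S. g (h x) = x"
  proof
   fix x assume x: "x : ?S"
   then have sy: "!!e i j. (e, i, j) : eix I I ==> x (einv e, j, i) = of_int (eps e) * x (e, i, j)"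
    and z: "!!p. p : eix A A Un eix A N Un eix N A ==> x p = 0"
    unfolding sym_on_def flag_form_def by blast+
   show "g (h x) = x"
   proof (rule extensionalityI[of _ "eix I I"])
    show "g (h x) : extensional (eix I I)" using ginC by (simp add: PiE_def)
    show "x : extensional (eix I I)" using x by (simp add: PiE_def)
    fix p assume p: "p : eix I I"
    obtain e i j where e: "p = (e, i, j)" by (cases p)
    have ei: "e : edges" "i : I (src e)" "j : I (dst e)" using p e by (auto simp: eix_def)
    note ef = edge_facts[OF ei(1)]
    have m: "(e, i, j) : eix X Y \<longleftrightarrow> i : X (src e) & j : Y (dst e)"
     "(einv e, j, i) : eix X Y \<longleftrightarrow> j : X (dst e) & i : Y (src e)" for X Y
     using ei ef by (simp_all add: eix_def)
    have s: "of_int (eps e) * x (einv e, j, i) = x (e, i, j)"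
     unfolding sy[OF p[unfolded e]] by (rule of_int_eps_eps[OF ei(1)])
    have z': "i : A (src e) ==> j : A (dst e) ==> x (e, i, j) = 0" "i : A (src e) ==> j : N (dst e) ==> x (e, i, j) = 0"
     "i : N (src e) ==> j : A (dst e) ==> x (e, i, j) = 0"
     by (rule z; simp add: m)+
    show "g (h x) p = x p"
     unfolding h_def e using ei(2,3) s z'
     by (elim UnE) (simp_all add: m gval[OF ei(1)])
   qed
  qed
  show "h ` ?S <= ?T"
  proof (rule image_subsetI)
   fix x assume x: "x : ?S"
   have sy: "sym_on (eix X X) (restrict x (eix X X))" if "eix X X <= eix I I" for X
    unfolding sym_on_def
   proof (intro allI impI)
    fix e i j assume p: "(e, i, j) : eix X X"
    then have "(einv e, j, i) : eix X X" using edge_facts[of e] by (auto simp: eix_def)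
    moreover have "x (einv e, j, i) = of_int (eps e) * x (e, i, j)"
     using x subsetD[OF that p] by (auto simp: sym_on_def)
    ultimately show "restrict x (eix X X) (einv e, j, i) = of_int (eps e) * restrict x (eix X X) (e, i, j)"
     using p by simp
   qed
   show "h x : ?T"
    using x sy[OF sub(2)] sy[OF sub(4)] unfolding h_def sys_def flag_form_def
    by (simp add: eix_cong[OF rx])
  qed
  show "\<forall>p\<in>?T. h (g p) = p"
  proof
   fix p assume p: "p : ?T"
   obtain a n c s where e: "p = (a, n, c, s)" by (cases p)
   have "restrict a (eix A C) = a" "restrict n (eix N N) = n" "restrict c (eix C N) = c" "restrict s (eix C C) = s"
    using p unfolding e sys_def by (auto intro: extensional_restrict simp: PiE_def)
   then show "h (g p) = p" unfolding e h_def rg by simp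
  qed
  show "g ` ?T <= ?S"
  proof (rule image_subsetI)
   fix p assume p: "p : ?T"
   obtain a n c s where e: "p = (a, n, c, s)" by (cases p)
   note ag = rg[of a n c s, THEN agree]
   have na: "nd2 A C a" "tors t (rep2 A C a)" "nd2 N N n" "sym_on (eix N N) n" "fle t (rep2 N N n)" "sym_on (eix C C) s"
    using p unfolding e sys_def by auto
   have nn: "nd2 A C (g p)" "tors t (rep2 A C (g p))" "nd2 N N (g p)" "fle t (rep2 N N (g p))"
    using na eix_cong[OF ag(1)] eix_cong[OF ag(2)] unfolding e by simp_all
   have "sym_on (eix I I) (g p)"
    unfolding sym_on_def
   proof (intro allI impI)
    fix e' i j assume q: "(e', i, j) : eix I I"
    have ei: "e' : edges" "i : I (src e')" "j : I (dst e')" using q by (auto simp: eix_def)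
    note ef = edge_facts[OF ei(1)]
    have ej: "einv e' : edges" "j : I (src (einv e'))" "i : I (dst (einv e'))" using ei ef by simp_all
    have s1: "i : N (src e') ==> j : N (dst e') ==> n (einv e', j, i) = of_int (eps e') * n (e', i, j)"
     using na(4) ei(1) unfolding sym_on_def eix_def by blast
    have s2: "i : C (src e') ==> j : C (dst e') ==> s (einv e', j, i) = of_int (eps e') * s (e', i, j)"
     using na(6) ei(1) unfolding sym_on_def eix_def by blast
    show "g p (einv e', j, i) = of_int (eps e') * g p (e', i, j)"
     unfolding e using ei(2,3) s1 s2
     by (elim UnE) (simp_all add: gval[OF ei(1)] gval[OF ej(1)] ef eps_facts(3)[OF ei(1)] of_int_eps_eps[OF ei(1)])
   qed
   moreover have "flag_form (g p)" unfolding flag_form_def using nn gz unfolding e by blast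
   ultimately show "g p : ?S" using nn ginC by blast
  qed
 qed
 then have "card ?S = card ?T" by (rule bij_betw_same_card)
 moreover have "card (eix C N \<rightarrow>\<^sub>E (UNIV :: 'k set)) = CARD('k) ^ (\<Sum>e\<in>edges. card (C (src e)) * card (N (dst e)))"
 proof -
  have "finite (eix C N)"
   unfolding eix_def using finite_edges edge_facts(5,6) fin by (intro finite_SigmaI finite_cartesian_product) auto
  moreover have "card (eix C N) = (\<Sum>e\<in>edges. card (C (src e)) * card (N (dst e)))"
   unfolding eix_def by (subst card_SigmaI) (use finite_edges edge_facts(5,6) fin in \<open>auto simp: card_cartesian_product\<close>)
  ultimately show ?thesis by (simp add: card_PiE)
 qed
 moreover have "Std t = ?S" by (rule Std_eq) (rule t)
 ultimately show ?thesis
  by (simp add: card_cartesian_product card_tors_systems[OF gAC] mult.assoc)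
qed

end

section \<open>Masses of self-dual representations with given type\<close>

context sd_quiver
begin

lemma fimg_eq_iff:
 fixes M N :: "('v, 'a, 'k::{field,finite}) sdrep"
 assumes f: "rep_iso Q M N f"
  and V: "!!i. i : verts Q ==> V i <= vsp M i" "!!i. i ~: verts Q ==> V i = {0}"
  and W: "!!i. i : verts Q ==> W i <= vsp M i" "!!i. i ~: verts Q ==> W i = {0}"
 shows "fimg f V = fimg f W \<longleftrightarrow> V = W"
proof
 assume e: "fimg f V = fimg f W"
 show "V = W"
 proof (rule ext)
  fix i
  show "V i = W i"
  proof (cases "i : verts Q")
   case True
   have "fimg f V i = fimg f W i" using e by simp
   then have "f i ` V i = f i ` W i" using True by (simp add: fimg_def)
   then show ?thesis
    using inj_on_image_eq_iff[OF bij_betw_imp_inj_on[OF rep_isoD(2)[OF f True]] V(1)[OF True] W(1)[OF True]] by simp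
  qed (simp add: V W)
 qed
qed simp

lemma smax_iso:
 fixes M N :: "('v, 'a, 'k::{field,finite}) sdrep"
 assumes M: "representation Q M" and N: "representation Q N" and f: "rep_iso Q M N f" and U: "U : subs Q M"
 shows "smax w N (fimg f U) \<longleftrightarrow> smax w M U"
 unfolding smax_def ball_bij_betw[OF bij_betw_fimg[OF M N f]]
 using U fimg_in_subs(1)[OF M f U]
 by (simp add: fimg_in_subs(2)[OF M f] fimg_le_iff[OF M f] cong: ball_cong)

lemma ex1_smax:
 fixes M :: "('v, 'a, 'k::{field,finite}) sdrep"
 assumes M: "representation Q M"
 shows "\<exists>!U. smax t M U"
proof -
 note L = modular_lattice_subs[OF M]
 obtain U where U: "smax t M U"
  using modular_lattice.ex_smallest_max[OF L modular_wdim[OF M]] unfolding smax_eq[OF M] by blast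
 show ?thesis
 proof (rule ex1I[of _ U])
  show "U' = U" if "smax t M U'" for U'
   by (rule modular_lattice.smallest_max_unique[OF L that[unfolded smax_eq[OF M]] U[unfolded smax_eq[OF M]]])
 qed (rule U)
qed

text \<open>\<open>V\<close> is merely a family of subsets, since \<open>kcf A\<close> is not yet
  known to be a subrepresentation where this is used; uniqueness of the smallest maximiser supplies
  that.\<close>

lemma smax_iso_iff:
 fixes M N :: "('v, 'a, 'k::{field,finite}) sdrep"
 assumes M: "representation Q M" and N: "representation Q N" and f: "rep_iso Q M N f"
  and V: "!!i. i : verts Q ==> V i <= vsp M i" "!!i. i ~: verts Q ==> V i = {0}"
 shows "smax t N (fimg f V) \<longleftrightarrow> smax t M V"
proof
 assume n: "smax t N (fimg f V)"
 obtain U where U: "smax t M U" using ex1_smax[OF M] by blast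
 have Us: "U : subs Q M" using U by (simp add: smax_def)
 have "smax t N (fimg f U)" using smax_iso[OF M N f Us] U by simp
 then have "fimg f U = fimg f V" using n ex1_smax[OF N] by blast
 then have "U = V"
  using fimg_eq_iff[where V = U and W = V, OF f] V subsD(3,4)[OF M Us] by blast
 then show "smax t M V" using U by simp
next
 assume V: "smax t M V"
 then have "V : subs Q M" by (simp add: smax_def)
 from smax_iso[OF M N f this] V show "smax t N (fimg f V)" by simp
qed

lemma perp_isometry:
 fixes M N :: "('v, 'a, 'k::{field,finite}) sdrep"
 assumes M: "self_dual Q D M" and N: "self_dual Q D N" and f: "isometry Q M N f"
  and V: "!!i. i : verts Q ==> V i <= vsp M i"
 shows "fimg f (perp M V) = perp N (fimg f V)"
proof -
 have r: "rep_iso Q M N f" using f by (simp add: isometry_def)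
 note fi = isometry_iff[OF M N r, THEN iffD1, OF f, rule_format]
 show ?thesis
  unfolding fimg_def[of f "perp M V"]
 proof (rule onverts_eqI)
  fix v assume v: "v : verts Q"
  note sv = sig(1)[OF v]
  have e: "nform N (sg v) (f (sg v) x) (f v y) = nform M (sg v) x y"
   if "x : V (sg v)" "y : vsp M v" for x y
   using fi[OF sv, of x y] that V[OF sv] sig(2)[OF v] by auto
  have s: "f v ` vsp M v = vsp N v" by (rule bij_betw_imp_surj_on[OF rep_isoD(2)[OF r v]])
  have "z : perp N (fimg f V) v \<longleftrightarrow> z : f v ` perp M V v" for z
  proof -
   have "z : perp N (fimg f V) v \<longleftrightarrow> z : f v ` vsp M v & (\<forall>x\<in>V (sg v). nform N (sg v) (f (sg v) x) z = 0)"
    unfolding perp_iff[OF v] s using sv by (simp add: fimg_def)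
   also have "\<dots> \<longleftrightarrow> (\<exists>y\<in>vsp M v. z = f v y & (\<forall>x\<in>V (sg v). nform M (sg v) x y = 0))"
    using e by auto
   also have "\<dots> \<longleftrightarrow> z : f v ` perp M V v" by (auto simp: perp_iff[OF v])
   finally show ?thesis .
  qed
  then show "f v ` perp M V v = perp N (fimg f V) v" by blast
 qed (simp add: perp_def)
qed

definition tors_reps :: "('v => rat) => ('v => nat) => ('v, 'a, 'k::{field,finite}) qrep set"
 where "tors_reps t d = {M. representation Q M & tors t M & dims M d}"

definition sd_reps :: "('v => nat) => ('v, 'a, 'k::{field,finite}) sdrep set"
 where "sd_reps c = {M. self_dual Q D M & dims M c}"

definition sd_ss :: "('v => rat) => ('v => nat) => ('v, 'a, 'k::{field,finite}) sdrep set"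
 where "sd_ss t c = {M. self_dual Q D M & fle t M & dims M c}"

definition sd_type :: "('v => rat) => ('v => nat) => ('v => nat) => ('v, 'a, 'k::{field,finite}) sdrep set"
 where "sd_type t c d = {M. self_dual Q D M & dims M c & (\<exists>U. smax t M U & (\<forall>i\<in>verts Q. kvec.dim (U i) = d i))}"

lemma sd_reps_closed:
 fixes M N :: "('v, 'a, 'k::{field,finite}) sdrep"
 assumes N: "self_dual Q D N" and f: "isometry Q M N f"
 shows "M : sd_reps c ==> N : sd_reps c" "M : sd_ss t c ==> N : sd_ss t c" "M : sd_type t c d ==> N : sd_type t c d"
proof -
 have r: "rep_iso Q M N f" using f by (simp add: isometry_def)
 note RN = sdD(1)[OF N]
 show "M : sd_reps c ==> N : sd_reps c" "M : sd_ss t c ==> N : sd_ss t c"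
  unfolding sd_reps_def sd_ss_def using N sdD(1)[of M] dims_iso[OF _ RN r] fle_iso[OF _ RN r] by blast+
 assume "M : sd_type t c d"
 then obtain U where M: "self_dual Q D M" "dims M c" and U: "smax t M U" "\<forall>i\<in>verts Q. kvec.dim (U i) = d i"
  unfolding sd_type_def by blast
 note RM = sdD(1)[OF M(1)]
 have Us: "U : subs Q M" using U by (simp add: smax_def)
 have "smax t N (fimg f U)" using smax_iso[OF RM RN r Us] U by simp
 moreover have "kvec.dim (fimg f U i) = d i" if i: "i : verts Q" for i
 proof -
  have "linear_between (U i) (vsp N i) (f i)"
   by (rule linear_between_mono[OF rep_isoD(1)[OF r i] subsD(3)[OF RM Us i]])
    (use rep_isoD(1)[OF r i] subsD(3)[OF RM Us i] in \<open>auto simp: linear_between_def\<close>)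
  moreover have "inj_on (f i) (U i)"
   by (rule inj_on_subset[OF bij_betw_imp_inj_on[OF rep_isoD(2)[OF r i]] subsD(3)[OF RM Us i]])
  ultimately have "kvec.dim (f i ` U i) = kvec.dim (U i)"
   using dim_image_inj[OF _ _ subsD(1)[OF RM Us] subsD(2)[OF RM Us]] by blast
  then show ?thesis using i U(2) by (simp add: fimg_def)
 qed
 ultimately show "N : sd_type t c d"
  unfolding sd_type_def using N dims_iso[OF RM RN r] M(2) by blast
qed

end

context flag
begin

lemma card_sd_flag_frames:
 fixes M :: "('v, 'a, 'k::{field,finite}) sdrep"
 assumes M: "self_dual Q D M" and d: "dims M (%v. card (I v))"
  and U: "U : subs Q M" "U <= perp M U" "!!v. v : verts Q ==> kvec.dim (U v) = card (A v)"
 shows "card {ph : frames I M. fimg ph (kcf A) = U & fimg ph (kcf (%v. A v Un N v)) = perp M U} =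
  (\<Prod>v\<in>verts Q. gl TYPE('k) (card (A v)) * gl TYPE('k) (card (N v)) * gl TYPE('k) (card (C v)) *
   CARD('k) ^ (card (A v) * card (N v) + card (A v) * card (C v) + card (N v) * card (C v)))"
proof -
 note R = sdD(1)[OF M]
 note P = perp_in_subs[OF M U(1)]
 let ?F = "%v. {f : Iso (coords (I v)) (vsp M v). f ` coords (A v) = U v & f ` coords (A v Un N v) = perp M U v}"
 have "{ph : frames I M. fimg ph (kcf A) = U & fimg ph (kcf (%v. A v Un N v)) = perp M U} = (\<Pi>\<^sub>E v\<in>verts Q. ?F v)"
 proof (intro equalityI subsetI)
  fix ph assume p: "ph : {ph : frames I M. fimg ph (kcf A) = U & fimg ph (kcf (%v. A v Un N v)) = perp M U}"
  have "ph i ` coords (A i) = U i & ph i ` coords (A i Un N i) = perp M U i" if "i : verts Q" for i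
  proof -
   have "fimg ph (kcf A) i = U i" "fimg ph (kcf (%v. A v Un N v)) i = perp M U i" using p by simp_all
   then show ?thesis using that by (simp add: fimg_def)
  qed
  then show "ph : (\<Pi>\<^sub>E v\<in>verts Q. ?F v)"
   using p by (simp add: frames_def PiE_iff)
 next
  fix ph assume p: "ph : (\<Pi>\<^sub>E v\<in>verts Q. ?F v)"
  have "fimg ph (kcf A) = U" "fimg ph (kcf (%v. A v Un N v)) = perp M U"
   unfolding fimg_def using p subsD(4)[OF R U(1)] subsD(4)[OF R P]
   by (intro onverts_eqI; simp add: PiE_iff)+
  then show "ph : {ph : frames I M. fimg ph (kcf A) = U & fimg ph (kcf (%v. A v Un N v)) = perp M U}"
   using p by (simp add: frames_def PiE_iff)
 qed
 also have "card \<dots> = (\<Prod>v\<in>verts Q. card (?F v))" by (simp add: card_PiE)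
 also have "\<dots> = (\<Prod>v\<in>verts Q. gl TYPE('k) (card (A v)) * gl TYPE('k) (card (N v)) * gl TYPE('k) (card (C v)) *
   CARD('k) ^ (card (A v) * card (N v) + card (A v) * card (C v) + card (N v) * card (C v)))"
 proof (rule prod.cong[OF refl])
  fix v assume v: "v : verts Q"
  note sv = sig(1)[OF v]
  have dj: "(A v Un N v) Int C v = {}" using disj[OF v] by blast
  have cI: "card (I v) = card (A v Un N v) + card (C v)"
   using fin[OF v] dj by (simp add: card_Un_disjoint)
  have "kvec.dim (perp M U v) + kvec.dim (U (sg v)) = kvec.dim (vsp M v)"
   by (rule dim_sig_and_perp(3)[where V = U, OF M v subsD(1)[OF R U(1)] subsD(3)[OF R U(1) sv]])
  moreover have "kvec.dim (U (sg v)) = card (C v)"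
   using U(3)[OF sv] good2D(3)[OF gAC sv] sig(2)[OF v] by simp
  moreover have "kvec.dim (vsp M v) = card (I v)" using d v by (simp add: dims_def)
  ultimately have dp: "kvec.dim (perp M U v) = card (A v Un N v)" using cI by simp
  show "card (?F v) = gl TYPE('k) (card (A v)) * gl TYPE('k) (card (N v)) * gl TYPE('k) (card (C v)) *
   CARD('k) ^ (card (A v) * card (N v) + card (A v) * card (C v) + card (N v) * card (C v))"
   by (rule card_flag_frames[OF fin[OF v] disj(1)[OF v] dj repD[OF R v] subsD(1)[OF R P] subsD(1)[OF R U(1)]
    le_funD[OF U(2)] subsD(3)[OF R P v] U(3)[OF v] dp]) (use d v in \<open>simp add: dims_def\<close>)
 qed
 finally show ?thesis .
qed

text \<open>The smallest maximiser is canonical, so the frames adapted to it and its orthogonal are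
  equally many for all members, and \<open>mass_eq\<close> has its analogue with \<open>Std\<close>
  as the systems in standard position.\<close>

lemma smass_sd_type:
 assumes two: "(2 :: 'k::{field,finite}) ~= 0" and t: "!!v. v : verts Q ==> t (sg v) = - t v"
 shows "smass (sd_type t (%v. card (I v)) (%v. card (A v)) :: ('v, 'a, 'k) sdrep set) =
  real (card (Std t :: (('v, 'a, 'k) esys) set)) /
  real (\<Prod>v\<in>verts Q. gl TYPE('k) (card (A v)) * gl TYPE('k) (card (N v)) * gl TYPE('k) (card (C v)) *
   CARD('k) ^ (card (A v) * card (N v) + card (A v) * card (C v) + card (N v) * card (C v)))"
proof (rule smass_eq[where J = I and FR = "%M. {ph : frames I M. smax t M (fimg ph (kcf A)) &
  fimg ph (kcf (%v. A v Un N v)) = perp M (fimg ph (kcf A))}", OF gII])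
 let ?S = "sd_type t (%v. card (I v)) (%v. card (A v)) :: ('v, 'a, 'k) sdrep set"
 let ?FR = "%M :: ('v, 'a, 'k) sdrep. {ph : frames I M. smax t M (fimg ph (kcf A)) &
  fimg ph (kcf (%v. A v Un N v)) = perp M (fimg ph (kcf A))}"
 show sd: "self_dual Q D M" and dm: "dims M (%v. card (I v))" if "M : ?S" for M
  using that by (auto simp: sd_type_def)
 show "!!M N f. M : ?S ==> self_dual Q D N ==> isometry Q M N f ==> N : ?S"
  by (rule sd_reps_closed(3))
 show "(Std t :: (('v, 'a, 'k) esys) set) <= sys I" unfolding Std_def by blast
 have dI: "dims (rho_sd I x) (%v. card (I v))" for x :: "('v, 'a, 'k) esys"
  unfolding dims_def using finI by (simp add: dim_coords)
 have dA: "kvec.dim (kcf A v :: 'k vec set) = card (A v)" if "v : verts Q" for v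
  using that fin by (simp add: dim_coords)
 show "rho_sd I x : ?S" if "x : Std t" for x :: "('v, 'a, 'k) esys"
  unfolding sd_type_def using that self_dual_rho[OF gII, of x] dI dA unfolding Std_def by blast
 show "?FR M <= frames I M" for M by blast
 show "card (?FR M) = (\<Prod>v\<in>verts Q. gl TYPE('k) (card (A v)) * gl TYPE('k) (card (N v)) * gl TYPE('k) (card (C v)) *
   CARD('k) ^ (card (A v) * card (N v) + card (A v) * card (C v) + card (N v) * card (C v)))" if M: "M : ?S" for M
 proof -
  note R = sdD(1)[OF sd[OF M]]
  obtain U where U: "smax t M U" "\<forall>i\<in>verts Q. kvec.dim (U i) = card (A i)" using M by (auto simp: sd_type_def)
  have u: "smax t M V \<longleftrightarrow> V = U" for V using U(1) ex1_smax[OF R] by blast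
  have F: "?FR M = {ph : frames I M. fimg ph (kcf A) = U & fimg ph (kcf (%v. A v Un N v)) = perp M U}"
   unfolding u by auto
  have Us: "U : subs Q M" using U(1) by (simp add: smax_def)
  have "U <= perp M U"
  proof (rule modular_lattice.smallest_max_le_perp[OF modular_lattice_subs[OF R] _ _ U(1)[unfolded smax_eq[OF R]]])
   show "!!V. V : subs Q M ==> perp M V : subs Q M" by (rule perp_in_subs[OF sd[OF M]])
   show "wdim Q t (perp M V) = wdim Q t V" if "V : subs Q M" for V
    by (rule wdim_perp(1)[OF sd[OF M] that]) (rule t)
  qed
  then show ?thesis unfolding F by (rule card_sd_flag_frames[OF sd[OF M] dm[OF M] Us]) (use U(2) in blast)
 qed
 show "0 < (\<Prod>v\<in>verts Q. gl TYPE('k) (card (A v)) * gl TYPE('k) (card (N v)) * gl TYPE('k) (card (C v)) *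
   CARD('k) ^ (card (A v) * card (N v) + card (A v) * card (C v) + card (N v) * card (C v)))"
  by (intro prod_pos) (simp add: gl_pos)
 have kA: "kcf A v <= vsp (rho_sd I x) v" "kcf (%v. A v Un N v) v <= vsp (rho_sd I x) v"
  for v and x :: "('v, 'a, 'k) esys"
  using coords_subI[of v] by (cases "v : verts Q"; simp)+
 show "x : Std t" if M: "M : ?S" and x: "x : sys I" and ph: "ph : ?FR M" "ph : SIsos (rho_sd I x) M" for M x ph
 proof -
  note sx = self_dual_rho[OF gII x] and f = SIsosD(2)[OF ph(2)]
  have r: "rep_iso Q (rho_sd I x) M ph" using f by (simp add: isometry_def)
  have 1: "smax t (rho_sd I x) (kcf A)"
   using smax_iso_iff[where V = "kcf A", OF sdD(1)[OF sx] sdD(1)[OF sd[OF M]] r kA(1) kcf_out] ph(1) by blast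
  have "fimg ph (perp (rho_sd I x) (kcf A)) = perp M (fimg ph (kcf A))"
   by (rule perp_isometry[OF sx sd[OF M] f kA(1)])
  then have "fimg ph (perp (rho_sd I x) (kcf A)) = fimg ph (kcf (%v. A v Un N v))" using ph(1) by simp
  moreover have "fimg ph (perp (rho_sd I x) (kcf A)) = fimg ph (kcf (%v. A v Un N v)) \<longleftrightarrow>
   perp (rho_sd I x) (kcf A) = kcf (%v. A v Un N v)"
   by (rule fimg_eq_iff[OF r _ _ kA(2) kcf_out]) (auto simp: perp_def)
  ultimately show ?thesis unfolding Std_def using x 1 by blast
 qed
 show "ph : ?FR M" if M: "M : ?S" and x: "x : Std t" and ph: "ph : SIsos (rho_sd I x) M" for M x ph
 proof -
  have xs: "x : sys I" "smax t (rho_sd I x) (kcf A)" "perp (rho_sd I x) (kcf A) = kcf (%v. A v Un N v)"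
   using x by (simp_all add: Std_def)
  note sx = self_dual_rho[OF gII xs(1)] and f = SIsosD(2)[OF ph]
  have r: "rep_iso Q (rho_sd I x) M ph" using f by (simp add: isometry_def)
  have "smax t M (fimg ph (kcf A))"
   using smax_iso_iff[where V = "kcf A", OF sdD(1)[OF sx] sdD(1)[OF sd[OF M]] r kA(1) kcf_out] xs(2) by blast
  moreover have "fimg ph (kcf (%v. A v Un N v)) = perp M (fimg ph (kcf A))"
   using perp_isometry[OF sx sd[OF M] f kA(1)] unfolding xs(3) .
  moreover have "ph : frames I M" using Isos_subset_frames[of "rho_sd I x" I M] SIsosD(1)[OF ph] by auto
  ultimately show ?thesis by blast
 qed
qed

end

context sd_quiver
begin

text \<open>The index sets are consecutive intervals of lengths \<open>d v\<close>,
  \<open>e v\<close> and \<open>d (sg v)\<close>, and \<open>n\<close> is the exponent that counts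
  symmetric systems on \<open>C\<close>. The \<open>gl\<close> factors of \<open>C\<close> are those
  of \<open>A\<close> reindexed by the involution; they cancel against the node pairings between
  \<open>A\<close> and \<open>C\<close>.\<close>

lemma smass_type:
 fixes d c :: "'v => nat"
 assumes two: "(2 :: 'k::{field,finite}) ~= 0" and t: "!!v. v : verts Q ==> t (sg v) = - t v"
  and e: "!!v. v : verts Q ==> e (sg v) = e v"
 shows "\<exists>n. smass (sd_type t (%v. d v + e v + d (sg v)) d :: ('v, 'a, 'k) sdrep set) =
   mass (tors_reps t d :: ('v, 'a, 'k) qrep set) * smass (sd_ss t e :: ('v, 'a, 'k) sdrep set) *
   (real CARD('k) ^ ((\<Sum>r\<in>edges. d (sg (src r)) * e (dst r)) + n) /
    real CARD('k) ^ (\<Sum>v\<in>verts Q. d v * e v + d v * d (sg v) + e v * d (sg v))) &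
  2 * int n = (\<Sum>r\<in>edges. int (d (sg (src r))) * int (d (sg (dst r)))) +
   (\<Sum>r | r : edges & einv r = r. eps r * int (d (sg (src r))))"
proof -
 define A where "A v = {..<d v}" for v
 define N where "N v = {d v..<d v + e v}" for v
 define C where "C v = {d v + e v..<d v + e v + d (sg v)}" for v
 have fin: "finite (A v)" "finite (N v)" "finite (C v)" for v by (simp_all add: A_def N_def C_def)
 have cA: "card (A v) = d v" and cN: "card (N v) = e v" and cC: "card (C v) = d (sg v)" for v
  by (simp_all add: A_def N_def C_def)
 have gAC: "good2 A C" and gNN: "good2 N N" unfolding good2_def using fin sig e by (simp_all add: cA cN cC)
 interpret flag Q D A N C
  by unfold_locales (use fin gAC gNN in \<open>auto simp: A_def N_def C_def\<close>)
 have "I v = {..<d v + e v + d (sg v)}" for v unfolding A_def N_def C_def by auto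
 then have cI: "card (I v) = d v + e v + d (sg v)" for v by simp
 obtain n where n: "card {y : eix C C \<rightarrow>\<^sub>E (UNIV :: 'k set). sym_on (eix C C) y} = CARD('k) ^ n"
  "2 * int n = (\<Sum>e\<in>edges. int (card (C (src e))) * int (card (C (dst e)))) +
   (\<Sum>e | e : edges & einv e = e. eps e * int (card (C (src e))))"
  using card_sym_systems[OF two, of C] fin(3) by blast
 have pC: "(\<Prod>v\<in>verts Q. gl TYPE('k) (d (sg v))) = (\<Prod>v\<in>verts Q. gl TYPE('k) (d v))"
  by (rule prod.reindex_bij_witness[of _ "sg" "sg"]) (simp_all add: sig)
 let ?gA = "\<Prod>v\<in>verts Q. gl TYPE('k) (d v)" and ?gN = "\<Prod>v\<in>verts Q. gl TYPE('k) (e v)"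
 let ?R = "card {x : arrow_ix A A \<rightarrow>\<^sub>E (UNIV :: 'k set). tors t (rho A x)}"
 let ?S = "card {y : sys N. fle t (rep2 N N (y :: _ => 'k))}"
 have pos: "?gA > 0" "?gN > 0" by (auto intro!: prod_pos gl_pos)
 have m1: "mass (tors_reps t d :: ('v, 'a, 'k) qrep set) = real ?R / real ?gA"
 proof -
  have "mass (tors_reps t (%v. card (A v)) :: ('v, 'a, 'k) qrep set) =
    real (card {x : arrow_ix A A \<rightarrow>\<^sub>E UNIV. rho A x : (tors_reps t (%v. card (A v)) :: ('v, 'a, 'k) qrep set)}) /
    real (\<Prod>v\<in>verts Q. gl TYPE('k) (card (A v)))"
  proof (rule mass_full[where J = A])
   fix M N' :: "('v, 'a, 'k) qrep" and f
   assume M: "M : tors_reps t (%v. card (A v))" and N': "representation Q N'" and f: "rep_iso Q M N' f"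
   then show "N' : tors_reps t (%v. card (A v))"
    unfolding tors_reps_def using tors_iso[OF _ N' f] dims_iso[OF _ N' f] by blast
  qed (use fin in \<open>simp_all add: tors_reps_def\<close>)
  moreover have "rho A x : tors_reps t (%v. card (A v)) \<longleftrightarrow> tors t (rho A x)" for x :: "_ => 'k"
   unfolding tors_reps_def using rep_rho[of A x] dims_rho[of A x] fin(1) by simp
  ultimately show ?thesis by (simp only: cA)
 qed
 have m2: "smass (sd_ss t e :: ('v, 'a, 'k) sdrep set) = real ?S / real ?gN"
 proof -
  have "smass (sd_ss t (%v. card (N v)) :: ('v, 'a, 'k) sdrep set) =
    real (card {x : sys N. rho_sd N x : (sd_ss t (%v. card (N v)) :: ('v, 'a, 'k) sdrep set)}) /
    real (\<Prod>v\<in>verts Q. gl TYPE('k) (card (N v)))"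
  proof (rule smass_full[where J = N, OF gNN])
   show "!!M N' f. M : sd_ss t (%v. card (N v)) ==> self_dual Q D N' ==> isometry Q M N' f ==>
    N' : (sd_ss t (%v. card (N v)) :: ('v, 'a, 'k) sdrep set)"
    by (rule sd_reps_closed(2))
  qed (simp_all add: sd_ss_def)
  moreover have "rho_sd N x : sd_ss t (%v. card (N v)) \<longleftrightarrow> fle t (rep2 N N x)" if "x : sys N" for x :: "_ => 'k"
  proof -
   have "fle t (rho_sd N x) \<longleftrightarrow> fle t (rep2 N N x)" by (rule tors_cong(2)) simp_all
   then show ?thesis
    unfolding sd_ss_def using self_dual_rho[OF gNN that] fin(2) by (simp add: dims_def dim_coords)
  qed
  then have "{x : sys N. rho_sd N x : (sd_ss t (%v. card (N v)) :: ('v, 'a, 'k) sdrep set)} = {y : sys N. fle t (rep2 N N y)}"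
   by blast
  ultimately show ?thesis by (simp only: cN)
 qed
 have m3: "smass (sd_type t (%v. d v + e v + d (sg v)) d :: ('v, 'a, 'k) sdrep set) =
   real (?gA * ?R * (?S * (CARD('k) ^ (\<Sum>r\<in>edges. d (sg (src r)) * e (dst r)) * CARD('k) ^ n))) /
   real (?gA * ?gN * ?gA * CARD('k) ^ (\<Sum>v\<in>verts Q. d v * e v + d v * d (sg v) + e v * d (sg v)))"
  (is "_ = real ?num / real ?den")
 proof -
  have cS: "card (Std t :: (('v, 'a, 'k) esys) set) = ?num"
   using card_Std[where t = t, OF two t] unfolding n(1) cA cN cC .
  have "smass (sd_type t (%v. card (I v)) (%v. card (A v)) :: ('v, 'a, 'k) sdrep set) = real (card (Std t :: (('v, 'a, 'k) esys) set)) /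
  real (\<Prod>v\<in>verts Q. gl TYPE('k) (card (A v)) * gl TYPE('k) (card (N v)) * gl TYPE('k) (card (C v)) *
   CARD('k) ^ (card (A v) * card (N v) + card (A v) * card (C v) + card (N v) * card (C v)))"
   by (rule smass_sd_type[OF two]) (rule t)
  then show ?thesis
   unfolding cS cI cA cN cC by (simp add: prod.distrib power_sum pC)
 qed
 show ?thesis
 proof (rule exI[of _ n], rule conjI)
  show "2 * int n = (\<Sum>r\<in>edges. int (d (sg (src r))) * int (d (sg (dst r)))) +
   (\<Sum>r | r : edges & einv r = r. eps r * int (d (sg (src r))))"
   using n(2) by (simp only: cC)
  have p: "real ?gA ~= 0" "real ?gN ~= 0" using pos by linarith+
  have "(a::real) ~= 0 ==> b ~= 0 ==> a * r * (s * (u * w)) / (a * b * a * z) = r / a * (s / b) * (u * w / z)" for a b r s u w z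
   by (simp add: field_simps)
  from this[OF p] show "smass (sd_type t (%v. d v + e v + d (sg v)) d :: ('v, 'a, 'k) sdrep set) =
   mass (tors_reps t d :: ('v, 'a, 'k) qrep set) * smass (sd_ss t e :: ('v, 'a, 'k) sdrep set) *
   (real CARD('k) ^ ((\<Sum>r\<in>edges. d (sg (src r)) * e (dst r)) + n) /
    real CARD('k) ^ (\<Sum>v\<in>verts Q. d v * e v + d v * d (sg v) + e v * d (sg v)))"
   unfolding m1 m2 m3 by (simp only: of_nat_mult of_nat_power power_add)
 qed
qed

text \<open>The bound on \<open>d v + d (sg v)\<close> expresses that the smallest maximiser lies in
  its own orthogonal.\<close>

lemma smass_sd_reps:
 fixes c :: "'v => nat"
 assumes t: "!!v. v : verts Q ==> t (sg v) = - t v" and c: "!!v. v : verts Q ==> c (sg v) = c v"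
 shows "smass (sd_reps c :: ('v, 'a, 'k::{field,finite}) sdrep set) =
  (\<Sum>d | d : (\<Pi>\<^sub>E v\<in>verts Q. {..c v}) & (\<forall>v\<in>verts Q. d v + d (sg v) <= c v).
   smass (sd_type t c d :: ('v, 'a, 'k) sdrep set))"
proof -
 define J where "J i = {..<c i}" for i :: 'v
 have J: "finite (J i)" "card (J i) = c i" for i by (simp_all add: J_def)
 have gJ: "good2 J J" unfolding good2_def using J c by simp
 let ?D = "{d. d : (\<Pi>\<^sub>E v\<in>verts Q. {..c v}) & (\<forall>v\<in>verts Q. d v + d (sg v) <= c v)}"
 define X where "X d = {x : sys J. rho_sd J x : (sd_type t c d :: ('v, 'a, 'k) sdrep set)}" for d
 have full: "smass S = real (card {x : sys J. rho_sd J x : S}) / real (\<Prod>i\<in>verts Q. gl TYPE('k) (c i))"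
  if "S <= sd_reps c" "!!M N f. M : S ==> self_dual Q D N ==> isometry Q M N f ==> N : S"
  for S :: "('v, 'a, 'k) sdrep set"
 proof -
  have "smass S = real (card {x : sys J. rho_sd J x : S}) / real (\<Prod>i\<in>verts Q. gl TYPE('k) (card (J i)))"
  proof (rule smass_full[OF gJ])
   show "!!M N f. M : S ==> self_dual Q D N ==> isometry Q M N f ==> N : S" by (rule that(2))
   fix M assume "M : S"
   then have "M : sd_reps c" by (rule subsetD[OF that(1)])
   then show "self_dual Q D M" "dims M (%i. card (J i))" by (simp_all add: sd_reps_def J)
  qed
  then show ?thesis by (simp only: J)
 qed
 have "{x : sys J. rho_sd J x : (sd_reps c :: ('v, 'a, 'k) sdrep set)} = (\<Union>d\<in>?D. X d)"
 proof (intro equalityI subsetI)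
  fix x :: "('v, 'a, 'k) esys"
  assume x: "x : {x : sys J. rho_sd J x : sd_reps c}"
  let ?M = "rho_sd J x"
  have sx: "self_dual Q D ?M" using x by (simp add: sd_reps_def)
  note rx = sdD(1)[OF sx]
  obtain U where U: "smax t ?M U" using ex1_smax[OF rx] by blast
  have Us: "U : subs Q ?M" using U by (simp add: smax_def)
  have Up: "U <= perp ?M U"
  proof (rule modular_lattice.smallest_max_le_perp[OF modular_lattice_subs[OF rx] _ _ U[unfolded smax_eq[OF rx]]])
   show "!!V. V : subs Q ?M ==> perp ?M V : subs Q ?M" by (rule perp_in_subs[OF sx])
   show "wdim Q t (perp ?M V) = wdim Q t V" if "V : subs Q ?M" for V
    by (rule wdim_perp(1)[OF sx that]) (rule t)
  qed
  define d where "d = restrict (%i. kvec.dim (U i)) (verts Q)"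
  have le: "kvec.dim (U i) + kvec.dim (U (sg i)) <= c i" if i: "i : verts Q" for i
  proof -
   note P = perp_in_subs[OF sx Us]
   have "kvec.dim (U i) <= kvec.dim (perp ?M U i)"
    by (rule dim_mono[OF subsD(1)[OF rx Us] subsD(1,2)[OF rx P] le_funD[OF Up]])
   moreover have "kvec.dim (perp ?M U i) + kvec.dim (U (sg i)) = kvec.dim (vsp ?M i)"
    by (rule dim_sig_and_perp(3)[where V = U, OF sx i subsD(1)[OF rx Us] subsD(3)[OF rx Us sig(1)[OF i]]])
   moreover have "kvec.dim (vsp ?M i) = c i" using i J by (simp add: dim_coords)
   ultimately show ?thesis by simp
  qed
  have "kvec.dim (U i) <= c i" if "i : verts Q" for i using le[OF that] by simp
  then have "d : (\<Pi>\<^sub>E v\<in>verts Q. {..c v})" by (simp add: d_def)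
  moreover have "\<forall>v\<in>verts Q. d v + d (sg v) <= c v" using le sig(1) by (simp add: d_def)
  ultimately have "d : ?D" by blast
  moreover have "x : X d" unfolding X_def sd_type_def using x U by (auto simp: d_def sd_reps_def)
  ultimately show "x : (\<Union>d\<in>?D. X d)" by blast
 qed (auto simp: X_def sd_type_def sd_reps_def)
 moreover have fD: "finite ?D"
  by (rule finite_subset[of _ "\<Pi>\<^sub>E v\<in>verts Q. {..c v}"]) (auto intro!: finite_PiE)
 have "card (\<Union>d\<in>?D. X d) = (\<Sum>d\<in>?D. card (X d))"
 proof (rule card_UN_disjoint[OF fD])
  have "finite (eix J J \<rightarrow>\<^sub>E (UNIV :: 'k set))" using finite_eix[OF gJ] by (simp add: finite_PiE)
  then have "finite (sys J :: (('v, 'a, 'k) esys) set)" by (rule rev_finite_subset) (auto simp: sys_def)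
  then show "\<forall>d\<in>?D. finite (X d)" unfolding X_def by simp
  show "\<forall>d\<in>?D. \<forall>d'\<in>?D. d ~= d' --> X d Int X d' = {}"
  proof (intro ballI impI)
   fix d d' assume d: "d : ?D" "d' : ?D" "d ~= d'"
   show "X d Int X d' = {}"
   proof (rule ccontr)
    assume "X d Int X d' ~= {}"
    then obtain x :: "('v, 'a, 'k) esys" where x: "rho_sd J x : sd_type t c d" "rho_sd J x : sd_type t c d'"
     unfolding X_def by blast
    then have rx: "representation Q (rho_sd J x)" using sdD(1) by (auto simp: sd_type_def)
    obtain U where U: "smax t (rho_sd J x) U" "\<forall>i\<in>verts Q. kvec.dim (U i) = d i" using x(1) by (auto simp: sd_type_def)
    obtain U' where U': "smax t (rho_sd J x) U'" "\<forall>i\<in>verts Q. kvec.dim (U' i) = d' i" using x(2) by (auto simp: sd_type_def)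
    have "U = U'" using ex1_smax[OF rx] U(1) U'(1) by blast
    then have e: "d i = d' i" if "i : verts Q" for i using U(2) U'(2) that by metis
    have "d = d'"
     by (rule PiE_ext[of d "verts Q" "%v. {..c v}"]) (use d e in auto)
    then show False using d(3) by simp
   qed
  qed
 qed
 ultimately have "smass (sd_reps c :: ('v, 'a, 'k) sdrep set) = (\<Sum>d\<in>?D. real (card (X d)) / real (\<Prod>i\<in>verts Q. gl TYPE('k) (c i)))"
  using full[OF subset_refl sd_reps_closed(1)] by (simp add: sum_divide_distrib)
 also have "\<dots> = (\<Sum>d\<in>?D. smass (sd_type t c d :: ('v, 'a, 'k) sdrep set))"
 proof (rule sum.cong[OF refl])
  fix d
  have "sd_type t c d <= (sd_reps c :: ('v, 'a, 'k) sdrep set)" unfolding sd_type_def sd_reps_def by blast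
  then show "real (card (X d)) / real (\<Prod>i\<in>verts Q. gl TYPE('k) (c i)) = smass (sd_type t c d :: ('v, 'a, 'k) sdrep set)"
   unfolding X_def by (rule full[symmetric, OF _ sd_reps_closed(3)])
 qed
 finally show ?thesis .
qed

end

section \<open>From masses to coefficients of series\<close>

lemma qhalf_add: "0 < q ==> qhalf q (m + n) = qhalf q m * qhalf q n"
 unfolding qhalf_def by (rule power_int_add) simp

lemma qhalf_double: "qhalf q (2 * int n) = real q ^ n"
 unfolding qhalf_def by (simp add: power_int_mult power_int_def nat_mult_distrib power_mult)

lemma qhalf_quotient:
 assumes q: "0 < q"
 shows "qhalf q (m + 2 * int x - 2 * int y) = qhalf q m * (real q ^ x / real q ^ y)"
proof -
 have "qhalf q (m + 2 * int x - 2 * int y) * real q ^ y = qhalf q (m + 2 * int x)"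
  using qhalf_add[OF q, of "m + 2 * int x - 2 * int y" "2 * int y"] by (simp only: diff_add_cancel qhalf_double)
 also have "\<dots> = qhalf q m * real q ^ x"
  using qhalf_add[OF q, of m "2 * int x"] by (simp only: qhalf_double)
 finally show ?thesis unfolding times_divide_eq_right by (intro eq_divide_imp) (use q in simp_all)
qed

lemma coeff_field_mult_Rats:
 assumes "x : \<rat>" "y : coeff_field q"
 shows "x * y : coeff_field q"
proof -
 obtain a b where "y = a + b * sqrt (real q)" "a : \<rat>" "b : \<rat>" using assms(2) by (auto simp: coeff_field_def)
 then have "x * y = x * a + (x * b) * sqrt (real q)" "x * a : \<rat>" "x * b : \<rat>"
  using assms(1) by (simp_all add: algebra_simps)
 then show ?thesis unfolding coeff_field_def by blast
qed

lemma qhalf_in_coeff_field: "0 < q ==> qhalf q n : coeff_field q"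
proof -
 assume q: "0 < q"
 let ?s = "sqrt (real q)"
 have ss: "?s powi (2 * m) : \<rat>" for m
 proof -
  have "?s powi (2 * m) = (real q) powi m" by (simp add: power_int_mult)
  then show ?thesis by (simp add: power_int_def)
 qed
 show ?thesis
 proof (cases "even n")
  case True
  then obtain m where "n = 2 * m" by (rule evenE)
  then have "qhalf q n : \<rat>" using ss by (simp add: qhalf_def)
  then show ?thesis
   unfolding coeff_field_def by (intro CollectI exI[of _ "qhalf q n"] exI[of _ 0]) simp
 next
  case False
  then obtain m where n: "n = 2 * m + 1" by (rule oddE)
  have "qhalf q n = 0 + ?s powi (2 * m) * ?s"
   using q unfolding qhalf_def n by (simp add: power_int_add)
  then show ?thesis
   unfolding coeff_field_def using ss[of m] by (intro CollectI exI[of _ 0] exI[of _ "?s powi (2 * m)"]) simp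
 qed
qed

context quiver
begin

text \<open>Masses are computed for natural-valued functions on nodes, series live on the lattice.
  \<open>lat\<close> and \<open>nd\<close> pass between the two; \<open>nd\<close> is extensional so
  that it falls into the index sets of the sums.\<close>

definition lat :: "('v => nat) => ('v \<Rightarrow>\<^sub>0 int)"
 where "lat f = (\<Sum>v\<in>verts Q. frag_cmul (int (f v)) (frag_of v))"

definition nd :: "('v \<Rightarrow>\<^sub>0 int) => 'v => nat"
 where "nd d = (\<lambda>v\<in>verts Q. nat (coef d v))"

lemma coef_lat: "coef (lat f) v = (if v : verts Q then int (f v) else 0)"
proof -
 have "coef (lat f) v = (\<Sum>u\<in>verts Q. coef (frag_cmul (int (f u)) (frag_of u)) v)"
  unfolding lat_def by (rule lookup_sum)
 also have "\<dots> = (\<Sum>u\<in>verts Q. if u = v then int (f u) else 0)"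
  by (rule sum.cong) auto
 finally show ?thesis by simp
qed

lemma Lam_iff: "d : Lam Q \<longleftrightarrow> (\<forall>v. v ~: verts Q --> coef d v = 0)"
 unfolding Lam_def free_Abelian_group_def by (auto simp: in_keys_iff)

lemma Lam_pos_iff: "d : Lam_pos Q \<longleftrightarrow> (\<forall>v. v ~: verts Q --> coef d v = 0) & (\<forall>v\<in>verts Q. 0 <= coef d v)"
 unfolding Lam_pos_def Lam_iff by blast

lemma Lam_eqI:
 assumes "d : Lam_pos Q" "e : Lam_pos Q" "!!v. v : verts Q ==> coef d v = coef e v"
 shows "d = e"
proof (rule poly_mapping_eqI)
 fix v show "coef d v = coef e v" using assms by (cases "v : verts Q") (simp_all add: Lam_pos_iff)
qed

lemma lat_in [simp]: "lat f : Lam_pos Q"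
 by (simp add: Lam_pos_iff coef_lat)

lemma nd_lat: "nd (lat f) = restrict f (verts Q)"
 unfolding nd_def by (rule restrict_ext) (simp add: coef_lat)

lemma coef_nd: "d : Lam_pos Q ==> v : verts Q ==> coef d v = int (nd d v)"
 by (simp add: nd_def Lam_pos_iff)

lemma lat_nd: "d : Lam_pos Q ==> lat (nd d) = d"
 by (rule Lam_eqI) (simp_all add: coef_lat coef_nd)

lemma lat_cong: "(!!v. v : verts Q ==> f v = g v) ==> lat f = lat g"
 unfolding lat_def by (rule sum.cong) simp_all

lemma Lam_pos_add: "d : Lam_pos Q ==> e : Lam_pos Q ==> d + e : Lam_pos Q"
 by (simp add: Lam_pos_iff lookup_add)

lemma dimvec_lat: "dimvec Q V = lat (%v. kvec.dim (V v))"
 by (simp add: dimvec_def lat_def)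

lemma dimvec_eq_iff: "d : Lam_pos Q ==> dimvec Q (vsp M) = d \<longleftrightarrow> dims M (nd d)"
proof
 assume "d : Lam_pos Q" "dims M (nd d)"
 then show "dimvec Q (vsp M) = d"
  using lat_nd[of d] lat_cong[of "%v. kvec.dim (vsp M v)" "nd d"] by (simp add: dimvec_lat dims_def)
next
 assume "d : Lam_pos Q" and d: "dimvec Q (vsp M) = d"
 show "dims M (nd d)" unfolding dims_def d[symmetric] dimvec_lat nd_lat by simp
qed

lemma theta_lat:
 assumes th: "stability Q \<theta>"
 shows "\<theta> (lat f) = (\<Sum>v\<in>verts Q. int (f v) * \<theta> (frag_of v))"
proof -
 have add: "\<theta> (x + y) = \<theta> x + \<theta> y" if "x : Lam Q" "y : Lam Q" for x y
  using th that unfolding stability_def hom_def Lam_def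
  by (simp add: free_Abelian_group_def integer_group_def)
 have L: "frag_cmul c (frag_of v) : Lam Q" if "v : verts Q" for c v using that by (auto simp: Lam_iff)
 have L0: "0 : Lam Q" by (simp add: Lam_iff)
 have 0: "\<theta> 0 = 0" using add[OF L0 L0] by simp
 have c: "\<theta> (frag_cmul (int n) (frag_of v)) = int n * \<theta> (frag_of v)" if v: "v : verts Q" for n v
 proof (induction n)
  case (Suc n)
  have "frag_cmul (int (Suc n)) (frag_of v) = frag_cmul (int n) (frag_of v) + frag_cmul 1 (frag_of v)"
   by (rule poly_mapping_eqI) (simp add: lookup_add algebra_simps)
  then have "\<theta> (frag_cmul (int (Suc n)) (frag_of v)) = \<theta> (frag_cmul (int n) (frag_of v)) + \<theta> (frag_cmul 1 (frag_of v))"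
   by (simp only: add[OF L[OF v] L[OF v]])
  then show ?case unfolding Suc.IH frag_cmul_one by (simp only: of_nat_Suc) (simp add: distrib_right)
 qed (simp add: 0)
 have "\<theta> (\<Sum>v\<in>S. frag_cmul (int (f v)) (frag_of v)) = (\<Sum>v\<in>S. int (f v) * \<theta> (frag_of v))"
  if "finite S" "S <= verts Q" for S
  using that
 proof (induction S)
  case (insert v S)
  have "(\<Sum>v\<in>S. frag_cmul (int (f v)) (frag_of v)) : Lam Q"
   unfolding Lam_iff using insert.prems by (auto simp: lookup_sum intro!: sum.neutral)
  then show ?case using insert add[OF L] c by simp
 qed (simp add: 0)
 then show ?thesis unfolding lat_def by simp
qed

definition tw :: "(('v \<Rightarrow>\<^sub>0 int) => int) => 'v => rat"
 where "tw \<theta> v = of_int (\<theta> (frag_of v))"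

lemma wdim_tw: "stability Q \<theta> ==> of_int (\<theta> (dimvec Q V)) = wdim Q (tw \<theta>) V"
 unfolding dimvec_lat theta_lat wdim_def tw_def by (simp add: mult.commute)

lemma wdim_one: "wdim Q (%_. 1) V = of_nat (\<Sum>v\<in>verts Q. kvec.dim (V v))"
 by (simp add: wdim_def)

lemma slope_eq: "stability Q \<theta> ==> slope Q \<theta> V = wdim Q (tw \<theta>) V / wdim Q (%_. 1) V"
 unfolding slope_def wdim_tw wdim_one ..

lemma wdim_diff: "wdim Q (%v. t v - \<mu>) V = wdim Q t V - \<mu> * wdim Q (%_. 1) V"
 using wdim_shift[where w = t and \<mu> = "- \<mu>" and V = V] by simp

lemma zero_family_wdim:
 fixes V :: "'v => ('k::{field,finite}) vec set"
 assumes "!!v. v : verts Q ==> kvec.subspace (V v)" "!!v. v : verts Q ==> finite (V v)"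
 shows "zero_family Q V \<longleftrightarrow> wdim Q (%_. 1) V = 0" "~ zero_family Q V ==> 0 < wdim Q (%_. 1) V"
  "zero_family Q V ==> wdim Q w V = 0"
proof -
 show 1: "zero_family Q V \<longleftrightarrow> wdim Q (%_. 1) V = 0"
  unfolding wdim_one zero_family_def of_nat_eq_0_iff sum_eq_0_iff[OF finite_verts] using dim_eq_0_iff[OF assms] by simp
 have "0 <= wdim Q (%_. 1) V" unfolding wdim_one by (rule of_nat_0_le_iff)
 then show "~ zero_family Q V ==> 0 < wdim Q (%_. 1) V" using 1 by simp
 show "zero_family Q V ==> wdim Q w V = 0"
  unfolding zero_family_def wdim_def by (simp add: dim_zero_space)
qed

lemma subs_zero_iff:
 fixes M :: "('v, 'a, 'k::{field,finite}, 'z) qrep_scheme"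
 assumes M: "representation Q M" and V: "V : subs Q M"
 shows "zero_family Q V \<longleftrightarrow> V = (%_. {0})"
 unfolding zero_family_def using subsD(4)[OF M V] by (auto simp: fun_eq_iff)

text \<open>For positive dimension, slope at most \<mu> means that the weight \<theta> minus \<mu>
  is at most 0. The zero representation satisfies \<open>sst\<close> for every \<mu>, in accordance
  with its presence in every factor.\<close>

lemma sst_semistable:
 fixes M :: "('v, 'a, 'k::{field,finite}) qrep"
 assumes th: "stability Q \<theta>" and M: "representation Q M"
 shows "zero_family Q (vsp M) | semistable Q \<theta> M & slope Q \<theta> (vsp M) = \<mu> \<longleftrightarrow> sst (%v. tw \<theta> v - \<mu>) M"
proof -
 let ?w = "%v. tw \<theta> v - \<mu>"
 note z = zero_family_wdim
 note R = repD[OF M]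
 have sl: "slope Q \<theta> V <= \<mu> \<longleftrightarrow> wdim Q ?w V <= 0" "slope Q \<theta> V = \<mu> \<longleftrightarrow> wdim Q ?w V = 0"
  if "0 < wdim Q (%_. 1) V" for V :: "'v => 'k vec set"
  using that unfolding slope_eq[OF th] wdim_diff by (auto simp: field_simps)
 show ?thesis
 proof (cases "zero_family Q (vsp M)")
  case True
  have "wdim Q ?w V = 0" if V: "V : subs Q M" for V
  proof -
   have "V v = {0}" if "v : verts Q" for v
   proof -
    have "vsp M v = {0}" using True that by (simp add: zero_family_def)
    then show ?thesis using subsD(3)[OF M V that] kvec.subspace_0[OF subsD(1)[OF M V, of v]] by auto
   qed
   then have "zero_family Q V" by (simp add: zero_family_def)
   then show ?thesis by (rule z(3)[OF subsD(1,2)[OF M V]])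
  qed
  then have "sst ?w M" unfolding sst_def fle_def using z(3)[OF R True] by simp
  then show ?thesis using True by blast
 next
  case False
  note pos = z(2)[OF R False]
  show ?thesis
  proof
   assume "zero_family Q (vsp M) | semistable Q \<theta> M & slope Q \<theta> (vsp M) = \<mu>"
   then have ss: "semistable Q \<theta> M" and s: "slope Q \<theta> (vsp M) = \<mu>" using False by simp_all
   have w0: "wdim Q ?w (vsp M) = 0" using sl(2)[OF pos] s by blast
   have "wdim Q ?w V <= 0" if V: "V : subs Q M" for V
   proof (cases "zero_family Q V")
    case True
    from z(3)[where w = ?w, OF subsD(1,2)[OF M V] True] show ?thesis by (rule eq_refl)
   next
    case nz: False
    show ?thesis
    proof (cases "\<exists>i\<in>verts Q. V i ~= vsp M i")
     case True
     have "slope Q \<theta> V <= slope Q \<theta> (vsp M)"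
      by (rule ss[unfolded semistable_def, rule_format]) (use True nz V in \<open>simp add: subs_def\<close>)
     then show ?thesis using sl(1)[OF z(2)[OF subsD(1,2)[OF M V] nz]] s by simp
    next
     case False
     then have "wdim Q ?w V = wdim Q ?w (vsp M)" unfolding wdim_def by (intro sum.cong) simp_all
     then show ?thesis using w0 by (simp only: order_refl)
    qed
   qed
   then show "sst ?w M" unfolding sst_def fle_def wdim_onverts using w0 by blast
  next
   assume ss: "sst ?w M"
   have s: "slope Q \<theta> (vsp M) = \<mu>" using ss sl(2)[OF pos] unfolding sst_def by simp
   have "slope Q \<theta> V <= slope Q \<theta> (vsp M)"
    if V: "subrepresentation Q M V" "~ zero_family Q V" for V
   proof -
    have sub: "kvec.subspace (V i)" "V i <= vsp M i" if "i : verts Q" for i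
     using V(1) that by (simp_all add: subrepresentation_def)
    have sV: "kvec.subspace (V i)" "finite (V i)" if "i : verts Q" for i
     using sub(1)[OF that] finite_subset[OF sub(2)[OF that] R(2)[OF that]] .
    have "onverts Q V : subs Q M"
     unfolding onverts_subs_iff using V(1) by (simp add: subrepresentation_def)
    then have "wdim Q ?w (onverts Q V) <= 0" using ss unfolding sst_def fle_def by blast
    then have "wdim Q ?w V <= 0" by simp
    then show ?thesis using sl(1)[OF z(2)[OF sV V(2)]] s by simp
   qed
   then show "zero_family Q (vsp M) | semistable Q \<theta> M & slope Q \<theta> (vsp M) = \<mu>"
    unfolding semistable_def using s by simp
  qed
 qed
qed

lemma A_series_eq:
 assumes th: "stability Q \<theta>"
 shows "A_series (K :: 'k::{field,finite} itself) Q \<theta> \<mu> d = (if d : Lam_pos Q then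
  qhalf (CARD('k)) (euler_form Q d d) * mass (ss_reps (%v. tw \<theta> v - \<mu>) (nd d) :: ('v, 'a, 'k) qrep set) else 0)"
proof -
 have "{U :: ('v, 'a, 'k) qrep. representation Q U &
   (zero_family Q (vsp U) | semistable Q \<theta> U & slope Q \<theta> (vsp U) = \<mu>) & dimvec Q (vsp U) = d} =
  (if d : Lam_pos Q then ss_reps (%v. tw \<theta> v - \<mu>) (nd d) else {})"
  using sst_semistable[OF th] dimvec_eq_iff[of d] by (auto simp: ss_reps_def dimvec_lat)
 then show ?thesis
  unfolding A_series_def mass_def by (simp add: sum_distrib_left)
qed

lemma mass_Rats: "mass S : \<rat>"
 unfolding mass_def by (intro Rats_sum Rats_divide) simp_all

lemma euler_form_add:
 "euler_form Q (a + b) c = euler_form Q a c + euler_form Q b c"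
 "euler_form Q c (a + b) = euler_form Q c a + euler_form Q c b"
 unfolding euler_form_def by (simp_all add: lookup_add algebra_simps sum.distrib)

text \<open>A decomposition of \<open>d\<close> is determined by its first summand, which ranges
  below \<open>d\<close>; there the truncated subtraction is exact.\<close>

lemma sum_Lam_pairs:
 assumes d: "d : Lam_pos Q"
 shows "(\<Sum>(a, b) | a : Lam_pos Q & b : Lam_pos Q & a + b = d. G a b :: real) =
  (\<Sum>f\<in>(\<Pi>\<^sub>E v\<in>verts Q. {..nd d v}). G (lat f) (lat (%v. nd d v - f v)))"
proof (rule sum.reindex_bij_witness[where i = "%f. (lat f, lat (%v. nd d v - f v))" and j = "%p. nd (fst p)"])
 fix p assume "p : {(a, b). a : Lam_pos Q & b : Lam_pos Q & a + b = d}"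
 then obtain a b where p: "p = (a, b)" "a : Lam_pos Q" "b : Lam_pos Q" and ab: "a + b = d" by blast
 have n: "nd d v = nd a v + nd b v" if "v : verts Q" for v
 proof -
  have "coef d v = coef a v + coef b v" unfolding ab[symmetric] by (rule lookup_add)
  then show ?thesis using coef_nd[OF d that] coef_nd[OF p(2) that] coef_nd[OF p(3) that] by linarith
 qed
 have b: "lat (%v. nd d v - nd a v) = b"
  by (rule Lam_eqI) (use p n in \<open>simp_all add: coef_lat coef_nd\<close>)
 show "(lat (nd (fst p)), lat (%v. nd d v - nd (fst p) v)) = p" using p b by (simp add: lat_nd)
 show "nd (fst p) : (\<Pi>\<^sub>E v\<in>verts Q. {..nd d v})"
  using n p by (auto simp: PiE_iff nd_def extensional_def)
 show "G (lat (nd (fst p))) (lat (%v. nd d v - nd (fst p) v)) = (case p of (a, b) => G a b)"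
  using p b by (simp add: lat_nd)
next
 fix f assume f: "f : (\<Pi>\<^sub>E v\<in>verts Q. {..nd d v})"
 show "nd (fst (lat f, lat (%v. nd d v - f v))) = f" using f by (simp add: nd_lat PiE_restrict)
 have "f v <= nd d v" if "v : verts Q" for v using PiE_mem[OF f that] by simp
 then have "lat f + lat (%v. nd d v - f v) = d"
  by (intro Lam_eqI Lam_pos_add) (use d in \<open>simp_all add: lookup_add coef_lat coef_nd\<close>)
 then show "(lat f, lat (%v. nd d v - f v)) : {(a, b). a : Lam_pos Q & b : Lam_pos Q & a + b = d}" by simp
qed

lemma euler_form_lat:
 "euler_form Q (lat g) (lat f) = int (\<Sum>v\<in>verts Q. f v * g v) - int (\<Sum>ar\<in>arcs Q. f (head Q ar) * g (tail Q ar))"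
 unfolding euler_form_def by (simp add: coef_lat mult.commute)

lemma reps_cong:
 assumes "!!v. v : verts Q ==> c v = d v"
 shows "lt_reps t w c = lt_reps t w d" "le_reps t w c = le_reps t w d" "ss_reps w c = ss_reps w d"
 using assms unfolding lt_reps_def le_reps_def ss_reps_def dims_def by auto

text \<open>For a + b = d, the exponents satisfy <a,b> + \<chi>(a,a) + \<chi>(b,b) = \<chi>(d,d) -
  2\<chi>(b,a), and the power of q in \<open>mass_le_reps\<close> has exponent -\<chi>(b,a).
  \<open>P\<close> is prescribed only below \<open>d\<close>, which is all that the induction over
  the factors can provide.\<close>

lemma torus_mult_step:
 assumes th: "stability Q \<theta>" and mu: "0 < \<mu>" and d: "d : Lam_pos Q"
  and P: "!!e. e : Lam_pos Q ==> (!!v. v : verts Q ==> nd e v <= nd d v) ==> P e = qhalf (CARD('k)) (euler_form Q e e) *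
   mass (lt_reps (tw \<theta>) (%v. tw \<theta> v - \<mu>) (nd e) :: ('v, 'a, 'k::{field,finite}) qrep set)"
 shows "torus_mult (CARD('k)) Q (A_series (K :: 'k itself) Q \<theta> \<mu>) P d = qhalf (CARD('k)) (euler_form Q d d) *
   mass (le_reps (tw \<theta>) (%v. tw \<theta> v - \<mu>) (nd d) :: ('v, 'a, 'k) qrep set)"
proof -
 let ?q = "CARD('k)" and ?w = "%v. tw \<theta> v - \<mu>"
 let ?D = "\<Pi>\<^sub>E v\<in>verts Q. {..nd d v}"
 have "torus_mult ?q Q (A_series K Q \<theta> \<mu>) P d =
  (\<Sum>f\<in>?D. qhalf ?q (skew_form Q (lat f) (lat (%v. nd d v - f v))) * A_series K Q \<theta> \<mu> (lat f) * P (lat (%v. nd d v - f v)))"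
  unfolding torus_mult_def by (rule sum_Lam_pairs[OF d])
 also have "\<dots> = (\<Sum>f\<in>?D. qhalf ?q (euler_form Q d d) * (mass (ss_reps ?w f :: ('v, 'a, 'k) qrep set) *
   mass (lt_reps (tw \<theta>) ?w (%v. nd d v - f v) :: ('v, 'a, 'k) qrep set) *
   (real ?q ^ (\<Sum>ar\<in>arcs Q. f (head Q ar) * (nd d (tail Q ar) - f (tail Q ar))) /
    real ?q ^ (\<Sum>v\<in>verts Q. f v * (nd d v - f v)))))"
 proof (rule sum.cong[OF refl])
  fix f assume f: "f : ?D"
  let ?g = "%v. nd d v - f v"
  let ?x = "\<Sum>ar\<in>arcs Q. f (head Q ar) * (nd d (tail Q ar) - f (tail Q ar))"
  let ?y = "\<Sum>v\<in>verts Q. f v * (nd d v - f v)"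
  have le: "f v <= nd d v" if "v : verts Q" for v using PiE_mem[OF f that] by simp
  have sum: "lat f + lat ?g = d"
   by (intro Lam_eqI Lam_pos_add) (use d le in \<open>simp_all add: lookup_add coef_lat coef_nd\<close>)
  have A: "A_series K Q \<theta> \<mu> (lat f) = qhalf ?q (euler_form Q (lat f) (lat f)) * mass (ss_reps ?w f :: ('v, 'a, 'k) qrep set)"
   unfolding A_series_eq[OF th] nd_lat using f by (simp add: PiE_restrict)
  have "lt_reps (tw \<theta>) ?w (nd (lat ?g)) = (lt_reps (tw \<theta>) ?w ?g :: ('v, 'a, 'k) qrep set)"
   by (rule reps_cong(1)) (simp add: nd_lat)
  then have B: "P (lat ?g) = qhalf ?q (euler_form Q (lat ?g) (lat ?g)) * mass (lt_reps (tw \<theta>) ?w ?g :: ('v, 'a, 'k) qrep set)"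
   using P[OF lat_in, of ?g] by (simp add: nd_lat)
  have bl: "skew_form Q a b + euler_form Q a a + euler_form Q b b = euler_form Q (a + b) (a + b) - 2 * euler_form Q b a" for a b
   unfolding euler_form_add skew_form_def by simp
  have ar: "s = e + 2 * x - 2 * y" if "s = e - 2 * (y - x)" for s e x y :: int using that by simp
  from bl[of "lat f" "lat ?g"]
  have "skew_form Q (lat f) (lat ?g) + euler_form Q (lat f) (lat f) + euler_form Q (lat ?g) (lat ?g) =
    euler_form Q d d + 2 * int ?x - 2 * int ?y"
   unfolding sum euler_form_lat[of ?g f] by (rule ar)
  note ex = this
  have q: "0 < ?q" by (rule zero_less_card_finite)
  have key: "a * (b * m) * (c * l) = e * (m * l * x)" if "a * b * c = e * x" for a b c e m l x :: real
  proof -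
   have "a * (b * m) * (c * l) = a * b * c * (m * l)" by (simp only: mult_ac)
   then show ?thesis unfolding that by (simp only: mult_ac)
  qed
  have "qhalf ?q (skew_form Q (lat f) (lat ?g)) * qhalf ?q (euler_form Q (lat f) (lat f)) * qhalf ?q (euler_form Q (lat ?g) (lat ?g)) =
    qhalf ?q (skew_form Q (lat f) (lat ?g) + euler_form Q (lat f) (lat f) + euler_form Q (lat ?g) (lat ?g))"
   by (simp only: qhalf_add[OF q])
  also have "\<dots> = qhalf ?q (euler_form Q d d) * (real ?q ^ ?x / real ?q ^ ?y)"
   unfolding ex by (rule qhalf_quotient[OF q])
  finally have "qhalf ?q (skew_form Q (lat f) (lat ?g)) * qhalf ?q (euler_form Q (lat f) (lat f)) * qhalf ?q (euler_form Q (lat ?g) (lat ?g)) =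
    qhalf ?q (euler_form Q d d) * (real ?q ^ ?x / real ?q ^ ?y)" .
  then show "qhalf ?q (skew_form Q (lat f) (lat ?g)) * A_series K Q \<theta> \<mu> (lat f) * P (lat ?g) =
   qhalf ?q (euler_form Q d d) * (mass (ss_reps ?w f :: ('v, 'a, 'k) qrep set) * mass (lt_reps (tw \<theta>) ?w ?g :: ('v, 'a, 'k) qrep set) *
   (real ?q ^ ?x / real ?q ^ ?y))"
   unfolding A B by (rule key)
 qed
 also have "\<dots> = qhalf ?q (euler_form Q d d) * mass (le_reps (tw \<theta>) ?w (nd d) :: ('v, 'a, 'k) qrep set)"
 proof -
  have "mass (le_reps (tw \<theta>) ?w (nd d) :: ('v, 'a, 'k) qrep set) =
   (\<Sum>f\<in>?D. mass (ss_reps ?w f :: ('v, 'a, 'k) qrep set) *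
   mass (lt_reps (tw \<theta>) ?w (%i. nd d i - f i) :: ('v, 'a, 'k) qrep set) *
  (real CARD('k) ^ (\<Sum>ar\<in>arcs Q. f (head Q ar) * (nd d (tail Q ar) - f (tail Q ar))) /
   real CARD('k) ^ (\<Sum>i\<in>verts Q. f i * (nd d i - f i))))"
   by (rule mass_le_reps[OF _ mu]) simp
  then show ?thesis by (simp only: sum_distrib_left)
 qed
 finally show ?thesis .
qed

end

section \<open>The ordered product\<close>

context sd_quiver
begin

text \<open>The positive slopes available to dimension vectors bounded by \<open>c\<close>. Their
  finiteness makes each coefficient of the product stabilise. The zero vector yields 0 divided by 0,
  which is 0, and is excluded by positivity.\<close>

definition slopes :: "('v => rat) => ('v => nat) => rat set"
 where "slopes t c = {s. 0 < s & s : (%f. (\<Sum>v\<in>verts Q. t v * of_nat (f v)) / of_nat (\<Sum>v\<in>verts Q. f v)) ` (\<Pi>\<^sub>E v\<in>verts Q. {..c v})}"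

lemma finite_slopes: "finite (slopes t c)"
proof -
 have "finite ((%f. (\<Sum>v\<in>verts Q. t v * of_nat (f v)) / of_nat (\<Sum>v\<in>verts Q. f v) :: rat) ` (\<Pi>\<^sub>E v\<in>verts Q. {..c v}))"
  by (intro finite_imageI finite_PiE) auto
 then show ?thesis by (rule rev_finite_subset) (auto simp: slopes_def)
qed

lemma slope_in_slopes:
 fixes M :: "('v, 'a, 'k::{field,finite}) qrep"
 assumes M: "representation Q M" and d: "dims M d" "!!v. v : verts Q ==> d v <= c v"
  and V: "V : subs Q M" "0 < wdim Q t V"
 shows "0 < wdim Q (%_. 1) V" "wdim Q t V / wdim Q (%_. 1) V : slopes t c"
proof -
 let ?f = "\<lambda>v\<in>verts Q. kvec.dim (V v)"
 have le: "kvec.dim (V v) <= c v" if v: "v : verts Q" for v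
  using dim_mono[OF subsD(1)[OF M V(1)] repD[OF M v] subsD(3)[OF M V(1) v]] d v by (fastforce simp: dims_def)
 have "~ zero_family Q V" using V(2) zero_family_wdim(3)[where w = t, OF subsD(1,2)[OF M V(1)]] by force
 then show p: "0 < wdim Q (%_. 1) V" by (rule zero_family_wdim(2)[OF subsD(1,2)[OF M V(1)]])
 have "wdim Q t V / wdim Q (%_. 1) V = (\<Sum>v\<in>verts Q. t v * of_nat (?f v)) / of_nat (\<Sum>v\<in>verts Q. ?f v)"
  unfolding wdim_one by (simp add: wdim_def)
 moreover have "?f : (\<Pi>\<^sub>E v\<in>verts Q. {..c v})" using le by simp
 moreover have "0 < wdim Q t V / wdim Q (%_. 1) V" using V(2) p by simp
 ultimately show "wdim Q t V / wdim Q (%_. 1) V : slopes t c" unfolding slopes_def by blast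
qed

lemma mass_zero_dim:
 assumes "!!v. v : verts Q ==> d v = 0"
 shows "mass (lt_reps t w d :: ('v, 'a, 'k::{field,finite}) qrep set) = 1"
proof -
 let ?J = "%_ :: 'v. {} :: nat set"
 have e: "lt_reps t w d = (lt_reps t w (%v. card (?J v)) :: ('v, 'a, 'k) qrep set)"
  by (rule reps_cong(1)) (simp add: assms)
 have r: "rho ?J x : lt_reps t w (%v. card (?J v))" for x :: "_ => 'k"
 proof -
  have R: "representation Q (rho ?J x)" by (rule rep_rho) simp
  have "V = (%_. {0})" if V: "V : subs Q (rho ?J x)" for V
  proof (rule ext)
   fix v
   show "V v = {0}"
    using subsD(3,4)[OF R V, of v] kvec.subspace_0[OF subsD(1)[OF R V, of v]] by (cases "v : verts Q") auto
  qed
  moreover have "onverts Q (vsp (rho ?J x)) = (%_. {0 :: nat \<Rightarrow>\<^sub>0 'k})"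
   by (rule onverts_eqI) simp_all
  ultimately show ?thesis
   unfolding lt_reps_def tors_def flt_def using R dims_rho[of ?J x] by auto
 qed
 have "mass (lt_reps t w (%v. card (?J v)) :: ('v, 'a, 'k) qrep set) =
   real (card {x : arrow_ix ?J ?J \<rightarrow>\<^sub>E UNIV. rho ?J x : (lt_reps t w (%v. card (?J v)) :: ('v, 'a, 'k) qrep set)}) /
   real (\<Prod>v\<in>verts Q. gl TYPE('k) (card (?J v)))"
 proof (rule mass_full[where J = ?J])
  show "!!M N f. M : lt_reps t w (%v. card (?J v)) ==> representation Q N ==> rep_iso Q M N f ==>
    N : (lt_reps t w (%v. card (?J v)) :: ('v, 'a, 'k) qrep set)" by (rule reps_closed(2))
 qed (simp_all add: lt_reps_def)
 moreover have "arrow_ix ?J ?J = {}" by (simp add: arrow_ix_def)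
 ultimately show ?thesis unfolding e using r by (simp add: gl_0)
qed

text \<open>Induction on the number of factors with index below \<open>\<kappa>\<close>. The largest
  such index \<mu> stands leftmost and is split off by \<open>torus_mult_step\<close>. As
  \<open>F\<close> contains all positive slopes possible in this range, none lies strictly between
  \<mu> and \<open>\<kappa>\<close>, and the bounds "at most \<mu>" and "less than
  \<open>\<kappa>\<close>" coincide.\<close>

lemma ordered_prod_lt:
 fixes K :: "'k::{field,finite} itself"
 assumes th: "stability Q \<theta>" and F: "finite F" "F <= {\<mu>. 0 < \<mu>}" and c: "slopes (tw \<theta>) c <= F"
  and lam: "0 < \<kappa>" and d: "d : Lam_pos Q" "!!v. v : verts Q ==> nd d v <= c v"
 shows "finite_ordered_prod (CARD('k)) Q (A_series K Q \<theta>) {\<mu> : F. \<mu> < \<kappa>} d =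
  qhalf (CARD('k)) (euler_form Q d d) * mass (lt_reps (tw \<theta>) (%v. tw \<theta> v - \<kappa>) (nd d) :: ('v, 'a, 'k) qrep set)"
 using lam d
proof (induction "card {\<mu> : F. \<mu> < \<kappa>}" arbitrary: \<kappa> d rule: less_induct)
 case less
 let ?t = "tw \<theta>"
 show ?case
 proof (cases "{\<mu> : F. \<mu> < \<kappa>} = {}")
  case True
  have one: "finite_ordered_prod (CARD('k)) Q (A_series K Q \<theta>) {\<mu> : F. \<mu> < \<kappa>} = torus_one"
   unfolding True finite_ordered_prod_def by simp
  show ?thesis
  proof (cases "d = 0")
   case d0: True
   have "mass (lt_reps ?t (%v. ?t v - \<kappa>) (nd d) :: ('v, 'a, 'k) qrep set) = 1"
    by (rule mass_zero_dim) (simp add: nd_def d0)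
   then show ?thesis unfolding one by (simp add: torus_one_def d0 euler_form_def qhalf_def)
  next
   case d0: False
   \<comment> \<open>A nonzero member would itself have a positive slope by \<open>tors\<close>,
     smaller than \<open>\<kappa>\<close> by \<open>flt\<close>; this slope would lie in
     \<open>F\<close>.\<close>
   have "lt_reps ?t (%v. ?t v - \<kappa>) (nd d) = ({} :: ('v, 'a, 'k) qrep set)"
   proof (rule equals0I)
    fix M :: "('v, 'a, 'k) qrep" assume "M : lt_reps ?t (%v. ?t v - \<kappa>) (nd d)"
    then have M: "representation Q M" "tors ?t M" "flt (%v. ?t v - \<kappa>) M" "dims M (nd d)" by (simp_all add: lt_reps_def)
    let ?U = "onverts Q (vsp M)"
    note L = modular_lattice_subs[OF M(1)]
    note U = modular_lattice.tp_in[OF L] and Z = modular_lattice.bt_in[OF L]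
    have ne: "?U ~= (%_. {0})"
    proof
     assume u: "?U = (%_. {0})"
     have "kvec.dim (vsp M v) = 0" if "v : verts Q" for v
     proof -
      have "vsp M v = {0}" using fun_cong[OF u, of v] that by simp
      then show ?thesis by (simp add: dim_zero_space)
     qed
     then have "nd d v = 0" if "v : verts Q" for v using M(4) that unfolding dims_def by fastforce
     then have "d = 0"
      by (intro Lam_eqI[OF less.prems(2)]) (simp_all add: Lam_pos_iff coef_nd[OF less.prems(2)])
     then show False using d0 by simp
    qed
    have "wdim Q ?t (%_. {0 :: nat \<Rightarrow>\<^sub>0 'k}) < wdim Q ?t ?U" using M(2) Z ne unfolding tors_def by metis
    then have p: "0 < wdim Q ?t ?U" by (simp only: wdim_zero)
    note s = slope_in_slopes[OF M(1) M(4) less.prems(3) U p]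
    have "wdim Q (%v. ?t v - \<kappa>) ?U < 0" using M(3) U ne unfolding flt_def by blast
    then have "wdim Q ?t ?U / wdim Q (%_. 1) ?U < \<kappa>"
     using s(1) unfolding wdim_diff by (simp add: pos_divide_less_eq)
    then have "wdim Q ?t ?U / wdim Q (%_. 1) ?U : {\<mu> : F. \<mu> < \<kappa>}" using subsetD[OF c s(2)] by simp
    then show False unfolding True by simp
   qed
   then show ?thesis unfolding one using d0 by (simp add: torus_one_def mass_def)
  qed
 next
  case False
  let ?S = "{\<mu> : F. \<mu> < \<kappa>}"
  define \<mu> where "\<mu> = Max ?S"
  let ?G = "{\<nu> : F. \<nu> < \<mu>}"
  have fS: "finite ?S" using F(1) by simp
  have mS: "\<mu> : ?S" unfolding \<mu>_def by (rule Max_in[OF fS False])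
  have mx: "\<nu> <= \<mu>" if "\<nu> : ?S" for \<nu> unfolding \<mu>_def by (rule Max_ge[OF fS that])
  have mpos: "0 < \<mu>" using mS F(2) by blast
  have mF: "\<mu> : F" "\<mu> < \<kappa>" using mS by simp_all
  have SG: "?S = insert \<mu> ?G"
  proof (rule Set.set_eqI)
   fix \<nu>
   show "\<nu> : ?S \<longleftrightarrow> \<nu> : insert \<mu> ?G"
    using mF mx[of \<nu>] by (cases "\<nu> = \<mu>") (auto simp: order_less_le)
  qed
  have nG: "\<mu> ~: ?G" by simp
  have fG: "finite ?G" using F(1) by simp
  have "sorted_list_of_set ?S = sorted_list_of_set ?G @ [\<mu>]"
  proof (rule sorted_distinct_set_unique)
   show "set (sorted_list_of_set ?S) = set (sorted_list_of_set ?G @ [\<mu>])"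
    using SG fS fG by (simp only: set_sorted_list_of_set set_append list.set) blast
   show "sorted (sorted_list_of_set ?G @ [\<mu>])" using fG by (simp add: sorted_append less_imp_le)
   show "distinct (sorted_list_of_set ?G @ [\<mu>])" using fG by simp
  qed simp_all
  then have P: "finite_ordered_prod (CARD('k)) Q (A_series K Q \<theta>) ?S =
    torus_mult (CARD('k)) Q (A_series K Q \<theta> \<mu>) (finite_ordered_prod (CARD('k)) Q (A_series K Q \<theta>) ?G)"
   unfolding finite_ordered_prod_def by simp
  have card: "card ?G < card ?S" unfolding SG using fG nG by simp
  have "finite_ordered_prod (CARD('k)) Q (A_series K Q \<theta>) ?S d =
   qhalf (CARD('k)) (euler_form Q d d) * mass (le_reps ?t (%v. ?t v - \<mu>) (nd d) :: ('v, 'a, 'k) qrep set)"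
   unfolding P
  proof (rule torus_mult_step[OF th mpos less.prems(2)])
   fix e assume e: "e : Lam_pos Q" "!!v. v : verts Q ==> nd e v <= nd d v"
   show "finite_ordered_prod (CARD('k)) Q (A_series K Q \<theta>) ?G e =
    qhalf (CARD('k)) (euler_form Q e e) * mass (lt_reps ?t (%v. ?t v - \<mu>) (nd e) :: ('v, 'a, 'k) qrep set)"
    by (rule less.hyps[OF card mpos e(1)]) (use e(2) less.prems(3) order_trans in blast)
  qed
  also have "le_reps ?t (%v. ?t v - \<mu>) (nd d) = (lt_reps ?t (%v. ?t v - \<kappa>) (nd d) :: ('v, 'a, 'k) qrep set)"
  proof -
   have "fle (%v. ?t v - \<mu>) M \<longleftrightarrow> flt (%v. ?t v - \<kappa>) M"
    if M: "representation Q M" "dims M (nd d)" for M :: "('v, 'a, 'k) qrep"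
   proof
    assume f: "fle (%v. ?t v - \<mu>) M"
    show "flt (%v. ?t v - \<kappa>) M"
     unfolding flt_def
    proof (intro ballI impI)
     fix V assume V: "V : subs Q M" "V ~= (%_. {0})"
     have p: "0 < wdim Q (%_. 1) V"
      using zero_family_wdim(2)[where V = V, OF subsD(1,2)[OF M(1) V(1)]] subs_zero_iff[OF M(1) V(1)] V(2) by blast
     have "wdim Q ?t V <= \<mu> * wdim Q (%_. 1) V" using f V(1) unfolding fle_def wdim_diff by auto
     also have "\<dots> < \<kappa> * wdim Q (%_. 1) V" by (rule mult_strict_right_mono[OF mF(2) p])
     finally show "wdim Q (%v. ?t v - \<kappa>) V < 0" unfolding wdim_diff by simp
    qed
   next
    assume f: "flt (%v. ?t v - \<kappa>) M"
    show "fle (%v. ?t v - \<mu>) M"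
     unfolding fle_def
    proof
     fix V assume V: "V : subs Q M"
     have nn: "0 <= wdim Q (%_. 1) V" unfolding wdim_one by (rule of_nat_0_le_iff)
     show "wdim Q (%v. ?t v - \<mu>) V <= 0"
     proof (cases "0 < wdim Q ?t V")
      case True
      note s = slope_in_slopes[OF M less.prems(3) V True]
      have "V ~= (%_. {0})"
      proof
       assume "V = (%_. {0})"
       with True have "0 < wdim Q ?t (%_. {0 :: nat \<Rightarrow>\<^sub>0 'k})" by simp
       then show False by (simp only: wdim_zero less_irrefl)
      qed
      then have "wdim Q (%v. ?t v - \<kappa>) V < 0" using f V unfolding flt_def by blast
      then have "wdim Q ?t V / wdim Q (%_. 1) V < \<kappa>"
       using s(1) unfolding wdim_diff by (simp add: pos_divide_less_eq)
      then have "wdim Q ?t V / wdim Q (%_. 1) V <= \<mu>"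
       by (intro mx CollectI conjI subsetD[OF c s(2)])
      then show ?thesis using s(1) unfolding wdim_diff by (simp add: pos_divide_le_eq)
     next
      case False
      have "0 <= \<mu> * wdim Q (%_. 1) V" using nn mpos by simp
      then show ?thesis using False unfolding wdim_diff by linarith
     qed
    qed
   qed
   then show ?thesis unfolding le_reps_def lt_reps_def by blast
  qed
  finally show ?thesis .
 qed
qed

text \<open>The value of the infinite product: the bound on slopes in \<open>lt_reps\<close>
  disappears as \<open>\<kappa>\<close> grows.\<close>

definition tors_series :: "'k::{field,finite} itself => (('v \<Rightarrow>\<^sub>0 int) => int) => 'v series"
 where "tors_series K \<theta> d = (if d : Lam_pos Q then
  qhalf (CARD('k)) (euler_form Q d d) * mass (tors_reps (tw \<theta>) (nd d) :: ('v, 'a, 'k) qrep set) else 0)"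

text \<open>For the coefficient at \<open>d\<close>, every index set that contains
  \<open>slopes (tw \<theta>) (nd d)\<close> gives the same value: with \<open>\<kappa>\<close>
  above the whole set, the slope bound is satisfied automatically.\<close>

lemma has_ordered_prod_tors:
 fixes K :: "'k::{field,finite} itself"
 assumes th: "stability Q \<theta>"
 shows "has_ordered_prod (CARD('k)) Q (A_series K Q \<theta>) {\<mu>. 0 < \<mu>} (tors_series K \<theta>)"
 unfolding has_ordered_prod_def
proof (intro conjI allI)
 have q: "0 < CARD('k)" by (rule zero_less_card_finite)
 have z: "0 : coeff_field (CARD('k))"
  unfolding coeff_field_def by (intro CollectI exI[of _ 0]) simp
 have "tors_series K \<theta> d : coeff_field (CARD('k))" for d
 proof (cases "d : Lam_pos Q")
  case True
  have "mass (tors_reps (tw \<theta>) (nd d) :: ('v, 'a, 'k) qrep set) * qhalf (CARD('k)) (euler_form Q d d) : coeff_field (CARD('k))"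
   by (rule coeff_field_mult_Rats[OF mass_Rats qhalf_in_coeff_field[OF q]])
  then show ?thesis using True by (simp only: tors_series_def if_True mult.commute)
 qed (simp add: tors_series_def z)
 moreover have "tors_series K \<theta> d = 0" if "d ~: Lam_pos Q" for d using that by (simp add: tors_series_def)
 ultimately show "tors_series K \<theta> : torus (CARD('k)) Q"
  unfolding torus_def by blast
 fix d
 show "\<forall>\<^sub>F F in finite_subsets_at_top {\<mu>. 0 < \<mu>}. finite_ordered_prod (CARD('k)) Q (A_series K Q \<theta>) F d = tors_series K \<theta> d"
 proof (cases "d : Lam_pos Q")
  case False
  have "finite_ordered_prod (CARD('k)) Q (A_series K Q \<theta>) F d = 0" for F
  proof (cases "rev (sorted_list_of_set F)")
   case Nil
   have "d ~= 0" using False by (auto simp: Lam_pos_iff)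
   then show ?thesis unfolding finite_ordered_prod_def Nil by (simp add: torus_one_def)
  next
   case (Cons a as)
   have E: "{(a, b). a : Lam_pos Q & b : Lam_pos Q & a + b = d} = {}" using Lam_pos_add False by auto
   show ?thesis unfolding finite_ordered_prod_def Cons by (simp only: foldr.simps o_apply torus_mult_def E sum.empty)
  qed
  then show ?thesis using False by (simp add: tors_series_def)
 next
  case True
  show ?thesis
   unfolding eventually_finite_subsets_at_top
  proof (intro exI conjI allI impI)
   show "finite (slopes (tw \<theta>) (nd d))" by (rule finite_slopes)
   show "slopes (tw \<theta>) (nd d) <= {\<mu>. 0 < \<mu>}" by (auto simp: slopes_def)
   fix F assume F: "finite F & slopes (tw \<theta>) (nd d) <= F & F <= {\<mu>. 0 < \<mu>}"
   \<comment> \<open>Inserting 0 keeps the maximum defined for empty \<open>F\<close> and makes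
     \<open>\<kappa>\<close> positive.\<close>
   define \<kappa> where "\<kappa> = Max (insert 0 F) + 1"
   have lt: "\<mu> < \<kappa>" if m: "\<mu> : insert 0 F" for \<mu>
   proof -
    have "finite (insert 0 F)" using F by simp
    then have "\<mu> <= Max (insert 0 F)" using m by (rule Max_ge)
    then show ?thesis unfolding \<kappa>_def by linarith
   qed
   have e: "{\<mu> : F. \<mu> < \<kappa>} = F" using lt by auto
   have lp: "0 < \<kappa>" by (rule lt) simp
   have "lt_reps (tw \<theta>) (%v. tw \<theta> v - \<kappa>) (nd d) = (tors_reps (tw \<theta>) (nd d) :: ('v, 'a, 'k) qrep set)"
   proof -
    have "flt (%v. tw \<theta> v - \<kappa>) M" if M: "representation Q M" "dims M (nd d)" for M :: "('v, 'a, 'k) qrep"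
     unfolding flt_def
    proof (intro ballI impI)
     fix V assume V: "V : subs Q M" "V ~= (%_. {0})"
     have p: "0 < wdim Q (%_. 1) V"
      using zero_family_wdim(2)[where V = V, OF subsD(1,2)[OF M(1) V(1)]] subs_zero_iff[OF M(1) V(1)] V(2) by blast
     show "wdim Q (%v. tw \<theta> v - \<kappa>) V < 0"
     proof (cases "0 < wdim Q (tw \<theta>) V")
      case True
      note s = slope_in_slopes[OF M order_refl V(1) True]
      have "wdim Q (tw \<theta>) V / wdim Q (%_. 1) V < \<kappa>"
       by (rule lt) (rule insertI2, rule subsetD[OF conjunct1[OF conjunct2[OF F]] s(2)])
      then show ?thesis using p unfolding wdim_diff by (simp add: pos_divide_less_eq)
     next
      case False
      have "0 < \<kappa> * wdim Q (%_. 1) V" using p lp by simp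
      then show ?thesis using False unfolding wdim_diff by linarith
     qed
    qed
    then show ?thesis unfolding lt_reps_def tors_reps_def by blast
   qed
   moreover have "finite_ordered_prod (CARD('k)) Q (A_series K Q \<theta>) {\<mu> : F. \<mu> < \<kappa>} d =
    qhalf (CARD('k)) (euler_form Q d d) * mass (lt_reps (tw \<theta>) (%v. tw \<theta> v - \<kappa>) (nd d) :: ('v, 'a, 'k) qrep set)"
    by (rule ordered_prod_lt[where c = "nd d", OF th _ _ _ lp True]) (use F in auto)
   ultimately show "finite_ordered_prod (CARD('k)) Q (A_series K Q \<theta>) F d = tors_series K \<theta> d"
    unfolding e tors_series_def using True by simp
  qed
 qed
qed

end

section \<open>The exponents of the module action\<close>

lemma sum_involution:
 fixes F :: "'b => int"
 assumes S: "finite S" "S = P Un {i : S. \<iota> i = i} Un \<iota> ` P" "P Int {i : S. \<iota> i = i} = {}" "P Int \<iota> ` P = {}"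
  and \<iota>: "!!i. i : S ==> \<iota> (\<iota> i) = i" and F: "!!i. i : S ==> F (\<iota> i) = F i"
 shows "sum F S = 2 * sum F P + (\<Sum>i | i : S & \<iota> i = i. F i)"
proof -
 have PS: "P <= S" by (subst S(2)) blast
 have fin: "finite P" "finite {i : S. \<iota> i = i}" using finite_subset[OF PS S(1)] S(1) by simp_all
 have inj: "inj_on \<iota> P" by (rule inj_on_inverseI[of _ \<iota>]) (use \<iota> PS in auto)
 have d: "(P Un {i : S. \<iota> i = i}) Int \<iota> ` P = {}"
 proof -
  have "False" if "p : P" "\<iota> (\<iota> p) = \<iota> p" for p
  proof -
   have "\<iota> p = p" using that \<iota>[of p] PS by auto
   then show False using that S(3) PS by auto
  qed
  then show ?thesis using S(4) by auto
 qed
 have "sum F S = sum F (P Un {i : S. \<iota> i = i}) + sum F (\<iota> ` P)"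
  by (subst S(2), rule sum.union_disjoint) (use fin d in auto)
 also have "sum F (\<iota> ` P) = sum F P"
  unfolding sum.reindex[OF inj] by (rule sum.cong) (use F PS in auto)
 also have "sum F (P Un {i : S. \<iota> i = i}) = sum F P + sum F {i : S. \<iota> i = i}"
  by (rule sum.union_disjoint) (use fin S(3) in auto)
 finally show ?thesis by simp
qed

context sd_quiver
begin

text \<open>Polarisation of \<E>: twice \<E> at x is \<open>Bq x x - Lq x\<close>, which removes the
  halves and the chosen decomposition. \<open>Bq\<close> is symmetric, and reflecting its first
  argument turns it into the Euler form.\<close>

definition Bq :: "('v => int) => ('v => int) => int"
 where "Bq x y = (\<Sum>v\<in>verts Q. x v * y (sg v)) - (\<Sum>ar\<in>arcs Q. x (sg (tail Q ar)) * y (head Q ar))"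

definition Lq :: "('v => int) => int"
 where "Lq x = (\<Sum>v | v : verts Q & sg v = v. nsgn D v * x v) +
  (\<Sum>ar | ar : arcs Q & asig D ar = ar. asgn D ar * nsgn D (head Q ar) * x (head Q ar))"

lemma Bq_add: "Bq (%v. x v + y v) z = Bq x z + Bq y z" "Bq z (%v. x v + y v) = Bq z x + Bq z y"
 unfolding Bq_def by (simp_all add: algebra_simps sum.distrib)

lemma Lq_add: "Lq (%v. x v + y v) = Lq x + Lq y"
 unfolding Lq_def by (simp add: algebra_simps sum.distrib)

lemma sum_verts_sig: "(\<Sum>v\<in>verts Q. F (sg v) :: int) = (\<Sum>v\<in>verts Q. F v)"
 by (rule sum.reindex_bij_witness[of _ "sg" "sg"]) (simp_all add: sig)

lemma sum_arcs_sig: "(\<Sum>ar\<in>arcs Q. F (asig D ar) :: int) = (\<Sum>ar\<in>arcs Q. F ar)"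
 by (rule sum.reindex_bij_witness[of _ "asig D" "asig D"]) (simp_all add: asig)

lemma Bq_sym: "Bq x y = Bq y x"
proof -
 have "(\<Sum>v\<in>verts Q. x v * y (sg v)) = (\<Sum>v\<in>verts Q. y v * x (sg v))"
  using sum_verts_sig[of "%v. y v * x (sg v)"] by (simp add: sig mult.commute)
 moreover have "(\<Sum>ar\<in>arcs Q. x (sg (tail Q ar)) * y (head Q ar)) = (\<Sum>ar\<in>arcs Q. y (sg (tail Q ar)) * x (head Q ar))"
  using sum_arcs_sig[of "%ar. y (sg (tail Q ar)) * x (head Q ar)"] by (simp add: sig asig mult.commute)
 ultimately show ?thesis by (simp add: Bq_def)
qed

lemma Bq_euler: "Bq (%v. int (f (sg v))) (%v. int (g v)) = euler_form Q (lat f) (lat g)"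
proof -
 have "(\<Sum>v\<in>verts Q. int (f (sg v)) * int (g (sg v))) = (\<Sum>v\<in>verts Q. int (f v) * int (g v))"
  by (rule sum_verts_sig)
 moreover have "(\<Sum>ar\<in>arcs Q. int (f (sg (sg (tail Q ar)))) * int (g (head Q ar))) = (\<Sum>ar\<in>arcs Q. int (f (tail Q ar)) * int (g (head Q ar)))"
  by (rule sum.cong) (simp_all add: sig)
 ultimately show ?thesis unfolding Bq_def euler_form_def by (simp add: coef_lat)
qed

lemma Bq_cong:
 assumes "!!v. v : verts Q ==> x v = x' v" "!!v. v : verts Q ==> y v = y' v"
 shows "Bq x y = Bq x' y'"
proof -
 have "(\<Sum>v\<in>verts Q. x v * y (sg v)) = (\<Sum>v\<in>verts Q. x' v * y' (sg v))"
  by (rule sum.cong) (simp_all add: assms sig)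
 moreover have "(\<Sum>ar\<in>arcs Q. x (sg (tail Q ar)) * y (head Q ar)) = (\<Sum>ar\<in>arcs Q. x' (sg (tail Q ar)) * y' (head Q ar))"
  by (rule sum.cong) (simp_all add: assms sig)
 ultimately show ?thesis unfolding Bq_def by (rule arg_cong2[where f = "(-)"])
qed

text \<open>Nodes and arrows that are not fixed come in pairs with equal contributions, which
  accounts for the factor 2. At fixed ones the products m(m - s) with s = 1 or s = -1 are even, so
  that \<open>div\<close> is exact.\<close>

lemma sd_euler_double:
 assumes P: "sig_decomposition Q D P0 P1"
 shows "2 * sd_euler Q D P0 P1 (lat f) = Bq (%v. int (f v)) (%v. int (f v)) - Lq (%v. int (f v))"
proof -
 let ?x = "%v. int (f v)"
 note P' = P[unfolded sig_decomposition_def, THEN conjunct1]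
  P[unfolded sig_decomposition_def, THEN conjunct2, THEN conjunct1]
  P[unfolded sig_decomposition_def, THEN conjunct2, THEN conjunct2, THEN conjunct1]
  P[unfolded sig_decomposition_def, THEN conjunct2, THEN conjunct2, THEN conjunct2, THEN conjunct1]
  P[unfolded sig_decomposition_def, THEN conjunct2, THEN conjunct2, THEN conjunct2, THEN conjunct2, THEN conjunct1]
  P[unfolded sig_decomposition_def, THEN conjunct2, THEN conjunct2, THEN conjunct2, THEN conjunct2, THEN conjunct2]
 have sub: "P0 <= verts Q" "P1 <= arcs Q" by (subst P'(1), blast) (subst P'(4), blast)
 have v: "(\<Sum>v\<in>verts Q. ?x v * ?x (sg v)) = 2 * (\<Sum>v\<in>P0. ?x v * ?x (sg v)) +
   (\<Sum>v | v : verts Q & sg v = v. ?x v * ?x (sg v))"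
  by (rule sum_involution[OF finite_verts P'(1-3)]) (simp_all add: sig)
 have a: "(\<Sum>ar\<in>arcs Q. ?x (sg (tail Q ar)) * ?x (head Q ar)) = 2 * (\<Sum>ar\<in>P1. ?x (sg (tail Q ar)) * ?x (head Q ar)) +
   (\<Sum>ar | ar : arcs Q & asig D ar = ar. ?x (sg (tail Q ar)) * ?x (head Q ar))"
  by (rule sum_involution[OF finite_arcs P'(4-6)]) (simp_all add: sig asig)
 have ev: "2 * ((m * (m - s)) div 2) = m * m - s * m" if "s = 1 | s = -1" for m s :: int
 proof -
  have "even (m * (m - s))" using that by auto
  then show ?thesis by (simp add: algebra_simps)
 qed
 have as: "asgn D ar * nsgn D (head Q ar) = 1 | asgn D ar * nsgn D (head Q ar) = -1" if "ar : arcs Q" for ar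
 proof -
  have "asgn D ar = 1 | asgn D ar = -1" using duality that unfolding duality_structure_def by blast
  moreover have "nsgn D (head Q ar) = 1 | nsgn D (head Q ar) = -1" by (rule nsgn_cases) (use that in simp)
  ultimately show ?thesis by auto
 qed
 have c1: "2 * (\<Sum>i | i : verts Q & sg i = i. (?x i * (?x i - nsgn D i)) div 2) =
   (\<Sum>v | v : verts Q & sg v = v. ?x v * ?x (sg v)) - (\<Sum>v | v : verts Q & sg v = v. nsgn D v * ?x v)"
  unfolding sum_distrib_left sum_subtractf[symmetric]
  by (rule sum.cong[OF refl]) (use ev nsgn_cases in auto)
 have c2: "2 * (\<Sum>ar | ar : arcs Q & asig D ar = ar. (?x (head Q ar) * (?x (head Q ar) + asgn D ar * nsgn D (head Q ar))) div 2) =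
   (\<Sum>ar | ar : arcs Q & asig D ar = ar. ?x (sg (tail Q ar)) * ?x (head Q ar)) +
   (\<Sum>ar | ar : arcs Q & asig D ar = ar. asgn D ar * nsgn D (head Q ar) * ?x (head Q ar))"
  unfolding sum_distrib_left sum.distrib[symmetric]
 proof (rule sum.cong[OF refl])
  fix ar assume al: "ar : {ar : arcs Q. asig D ar = ar}"
  have h: "sg (tail Q ar) = head Q ar" using asig(4)[of ar] al by simp
  let ?s = "- (asgn D ar * nsgn D (head Q ar))"
  have "?s = 1 | ?s = -1" using as[of ar] al by auto
  from ev[OF this, of "?x (head Q ar)"]
  show "2 * ((?x (head Q ar) * (?x (head Q ar) + asgn D ar * nsgn D (head Q ar))) div 2) =
   ?x (sg (tail Q ar)) * ?x (head Q ar) + asgn D ar * nsgn D (head Q ar) * ?x (head Q ar)"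
   unfolding h by simp
 qed
 have E: "sd_euler Q D P0 P1 (lat f) = (\<Sum>i | i : verts Q & sg i = i. (?x i * (?x i - nsgn D i)) div 2) +
  (\<Sum>v\<in>P0. ?x v * ?x (sg v)) -
  (\<Sum>ar | ar : arcs Q & asig D ar = ar. (?x (head Q ar) * (?x (head Q ar) + asgn D ar * nsgn D (head Q ar))) div 2) -
  (\<Sum>ar\<in>P1. ?x (sg (tail Q ar)) * ?x (head Q ar))"
 proof -
  have "(\<Sum>i\<in>P0. coef (lat f) (sg i) * coef (lat f) i) = (\<Sum>v\<in>P0. ?x v * ?x (sg v))"
   by (rule sum.cong[OF refl]) (use sub sig(1) in \<open>auto simp: coef_lat\<close>)
  moreover have "(\<Sum>ar\<in>P1. coef (lat f) (sg (tail Q ar)) * coef (lat f) (head Q ar)) = (\<Sum>ar\<in>P1. ?x (sg (tail Q ar)) * ?x (head Q ar))"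
   by (rule sum.cong[OF refl]) (use sub sig(1) in \<open>auto simp: coef_lat subset_iff\<close>)
  moreover have "(\<Sum>i | i : verts Q & sg i = i. (coef (lat f) i * (coef (lat f) i - nsgn D i)) div 2) =
    (\<Sum>i | i : verts Q & sg i = i. (?x i * (?x i - nsgn D i)) div 2)"
   by (rule sum.cong[OF refl]) (simp add: coef_lat)
  moreover have "(\<Sum>ar | ar : arcs Q & asig D ar = ar. (coef (lat f) (head Q ar) * (coef (lat f) (head Q ar) + asgn D ar * nsgn D (head Q ar))) div 2) =
    (\<Sum>ar | ar : arcs Q & asig D ar = ar. (?x (head Q ar) * (?x (head Q ar) + asgn D ar * nsgn D (head Q ar))) div 2)"
   by (rule sum.cong[OF refl]) (simp add: coef_lat)
  ultimately show ?thesis unfolding sd_euler_def by (simp only:)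
 qed
 have ar: "2 * (X + B - Y - B') = A - A' - (L + L')"
  if "A = 2 * B + C" "A' = 2 * B' + C'" "2 * X = C - L" "2 * Y = C' + L'" for A A' B B' C C' L L' X Y :: int
 proof -
  have "2 * (X + B - Y - B') = 2 * X + 2 * B - 2 * Y - 2 * B'" by (simp only: ring_distribs)
  also have "\<dots> = (C - L) + 2 * B - (C' + L') - 2 * B'" unfolding that(3,4) ..
  also have "\<dots> = (2 * B + C) - (2 * B' + C') - (L + L')" by (simp only: algebra_simps)
  finally show ?thesis unfolding that(1,2) .
 qed
 show ?thesis unfolding E Bq_def Lq_def by (rule ar[OF v a c1 c2])
qed

lemma sig_lam_lat: "sig_lam D (lat f) = lat (%v. f (sg v))"
proof -
 have "sig_lam D (lat f) = (\<Sum>v\<in>verts Q. frag_cmul (int (f v)) (frag_of (sg v)))"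
  unfolding sig_lam_def lat_def by (simp add: frag_extend_sum frag_extend_cmul)
 also have "\<dots> = lat (%v. f (sg v))"
  unfolding lat_def by (rule sum.reindex_bij_witness[of _ "sg" "sg"]) (simp_all add: sig)
 finally show ?thesis .
qed

text \<open>Here \<open>d\<close> belongs to the isotropic part and \<open>e\<close> to the
  semistable middle. In the expansion of \<E> at d + e + \<sigma>(d) by \<open>Bq\<close> the mixed
  terms are Euler forms. The term \<E>(\<sigma>(d)) is the one supplied by the twist of the action,
  and \<E>(d) gets its sign from \<open>n\<close>.\<close>

lemma sd_exponent:
 assumes P: "sig_decomposition Q D P0 P1" and e: "!!v. v : verts Q ==> e (sg v) = e v"
  and n: "2 * int n = (\<Sum>r\<in>edges. int (d (sg (src r))) * int (d (sg (dst r)))) +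
   (\<Sum>r | r : edges & einv r = r. eps r * int (d (sg (src r))))"
 shows "skew_form Q (lat d) (lat e) - sd_euler_tilde Q D P0 P1 (lat d) + euler_form Q (lat d) (lat d) + sd_euler Q D P0 P1 (lat e) =
  sd_euler Q D P0 P1 (lat (%v. d v + e v + d (sg v))) + 2 * int ((\<Sum>r\<in>edges. d (sg (src r)) * e (dst r)) + n)
   - 2 * int (\<Sum>v\<in>verts Q. d v * e v + d v * d (sg v) + e v * d (sg v))"
proof -
 let ?d = "%v. int (d v)" and ?s = "%v. int (d (sg v))" and ?e = "%v. int (e v)"
 have edge_sum: "(\<Sum>r\<in>edges. F r) = (\<Sum>v\<in>verts Q. F (Inl v)) + (\<Sum>ar\<in>arcs Q. F (Inr ar))" for F :: "'v + 'a => int"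
  unfolding edges_def by (subst sum.Plus) simp_all
 have fix_sum: "(\<Sum>r | r : edges & einv r = r. F r) = (\<Sum>v | v : verts Q & sg v = v. F (Inl v)) + (\<Sum>ar | ar : arcs Q & asig D ar = ar. F (Inr ar))"
  for F :: "'v + 'a => int"
 proof -
  have "{r. r : edges & einv r = r} = {v. v : verts Q & sg v = v} <+> {ar. ar : arcs Q & asig D ar = ar}"
   by (auto simp: edges_def)
  then show ?thesis by (simp add: sum.Plus)
 qed
 have sdv: "(\<Sum>v\<in>verts Q. ?s v * ?e v) = (\<Sum>v\<in>verts Q. ?d v * ?e v)"
 proof -
  have "(\<Sum>v\<in>verts Q. ?s v * ?e v) = (\<Sum>v\<in>verts Q. ?d (sg v) * ?e (sg v))" by (rule sum.cong) (simp_all add: e)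
  then show ?thesis unfolding sum_verts_sig[of "%v. ?d v * ?e v"] .
 qed
 have ar: "(\<Sum>ar\<in>arcs Q. ?d (sg (tail Q ar)) * ?e (head Q ar)) = (\<Sum>ar\<in>arcs Q. ?e (tail Q ar) * ?d (head Q ar))"
 proof -
  have "(\<Sum>ar\<in>arcs Q. ?e (tail Q ar) * ?d (head Q ar)) = (\<Sum>ar\<in>arcs Q. ?e (tail Q (asig D ar)) * ?d (head Q (asig D ar)))"
   by (rule sum_arcs_sig[symmetric])
  also have "\<dots> = (\<Sum>ar\<in>arcs Q. ?d (sg (tail Q ar)) * ?e (head Q ar))"
   by (rule sum.cong) (simp_all add: asig e mult.commute)
  finally show ?thesis by simp
 qed
 define S where "S = (\<Sum>v\<in>verts Q. ?d v * ?s v)"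
 \<comment> \<open>The exponent of the count of symmetric systems is \<open>S\<close> minus \<E>(d):
   this is how \<E> arises from counting. The same \<open>S\<close> sits in the denominator and
   cancels.\<close>
 have 1: "2 * int n = 2 * S - 2 * sd_euler Q D P0 P1 (lat d)"
 proof -
  have "(\<Sum>v\<in>verts Q. ?s v * int (d (sg (sg v)))) = S"
   unfolding S_def by (rule sum.cong) (simp_all add: sig)
  moreover have "(\<Sum>ar\<in>arcs Q. int (d (sg (tail Q ar))) * int (d (sg (sg (head Q ar))))) = S - Bq ?d ?d"
  proof -
   have "(\<Sum>ar\<in>arcs Q. int (d (sg (tail Q ar))) * int (d (sg (sg (head Q ar))))) =
    (\<Sum>ar\<in>arcs Q. ?d (sg (tail Q ar)) * ?d (head Q ar))"
    by (rule sum.cong) (simp_all add: sig)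
   then show ?thesis unfolding Bq_def S_def by simp
  qed
  moreover have "(\<Sum>r | r : edges & einv r = r. eps r * int (d (sg (src r)))) = Lq ?d"
  proof -
   have "(\<Sum>v | v : verts Q & sg v = v. nsgn D v * int (d (sg v))) = (\<Sum>v | v : verts Q & sg v = v. nsgn D v * ?d v)"
    by (rule sum.cong) simp_all
   moreover have "(\<Sum>ar | ar : arcs Q & asig D ar = ar. asgn D ar * nsgn D (tail Q ar) * int (d (sg (tail Q ar)))) =
    (\<Sum>ar | ar : arcs Q & asig D ar = ar. asgn D ar * nsgn D (head Q ar) * ?d (head Q ar))"
   proof (rule sum.cong[OF refl])
    fix ar assume al: "ar : {ar : arcs Q. asig D ar = ar}"
    have h: "head Q ar = sg (tail Q ar)" using asig(4)[of ar] al by simp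
    show "asgn D ar * nsgn D (tail Q ar) * int (d (sg (tail Q ar))) = asgn D ar * nsgn D (head Q ar) * ?d (head Q ar)"
     unfolding h using nsgn(2)[of "tail Q ar"] al by simp
   qed
   ultimately show ?thesis unfolding fix_sum Lq_def by simp
  qed
  ultimately show ?thesis unfolding n edge_sum sd_euler_double[OF P] by simp
 qed
 have 2: "int (\<Sum>r\<in>edges. d (sg (src r)) * e (dst r)) = (\<Sum>v\<in>verts Q. ?d v * ?e v) + (\<Sum>ar\<in>arcs Q. ?e (tail Q ar) * ?d (head Q ar))"
 proof -
  have "(\<Sum>v\<in>verts Q. ?s v * int (e (sg v))) = (\<Sum>v\<in>verts Q. ?d v * ?e v)"
   unfolding sdv[symmetric] by (rule sum.cong) (simp_all add: e)
  moreover have "(\<Sum>ar\<in>arcs Q. int (d (sg (tail Q ar))) * int (e (sg (head Q ar)))) = (\<Sum>ar\<in>arcs Q. ?e (tail Q ar) * ?d (head Q ar))"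
   unfolding ar[symmetric] by (rule sum.cong) (simp_all add: e)
  ultimately show ?thesis using edge_sum[of "%r. int (d (sg (src r)) * e (dst r))"] by simp
 qed
 have 3: "int (\<Sum>v\<in>verts Q. d v * e v + d v * d (sg v) + e v * d (sg v)) = 2 * (\<Sum>v\<in>verts Q. ?d v * ?e v) + S"
 proof -
  have "int (\<Sum>v\<in>verts Q. d v * e v + d v * d (sg v) + e v * d (sg v)) =
   (\<Sum>v\<in>verts Q. ?d v * ?e v) + S + (\<Sum>v\<in>verts Q. ?s v * ?e v)"
   unfolding S_def by (simp add: sum.distrib mult.commute)
  then show ?thesis unfolding sdv by simp
 qed
 have 4: "euler_form Q (lat e) (lat d) = (\<Sum>v\<in>verts Q. ?d v * ?e v) - (\<Sum>ar\<in>arcs Q. ?e (tail Q ar) * ?d (head Q ar))"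
  unfolding euler_form_def by (simp add: coef_lat mult.commute)
 have 5: "2 * sd_euler Q D P0 P1 (lat (%v. d v + e v + d (sg v))) =
  2 * sd_euler Q D P0 P1 (lat d) + 2 * sd_euler Q D P0 P1 (lat e) + 2 * sd_euler Q D P0 P1 (lat (%v. d (sg v))) +
  2 * euler_form Q (lat d) (lat d) + 2 * euler_form Q (lat d) (lat e) + 2 * euler_form Q (lat e) (lat d)"
 proof -
  have c: "(%v. int (d v + e v + d (sg v))) = (%v. (?d v + ?e v) + ?s v)" by simp
  have "Bq ?s ?d = euler_form Q (lat d) (lat d)" "Bq ?s ?e = euler_form Q (lat d) (lat e)"
   "Bq (%v. int (e (sg v))) ?d = euler_form Q (lat e) (lat d)" by (rule Bq_euler)+
  moreover have "Bq (%v. int (e (sg v))) ?d = Bq ?e ?d" by (rule Bq_cong) (simp_all add: e)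
  ultimately show ?thesis
   unfolding sd_euler_double[OF P] c Bq_add Lq_add
   using Bq_sym[of ?d ?e] Bq_sym[of ?d ?s] Bq_sym[of ?e ?s] by (linarith | algebra | presburger)
 qed
 show ?thesis
  unfolding skew_form_def sd_euler_tilde_def sig_lam_lat of_nat_add distrib_left 2 3
  using 1 4 5 by (linarith | algebra | presburger)
qed

section \<open>The acted-on series\<close>

lemma tw_sig:
 assumes "sig_compatible Q D \<theta>" "v : verts Q"
 shows "tw \<theta> (sg v) = - tw \<theta> v"
proof -
 have "frag_of v : Lam Q" using assms(2) by (auto simp: Lam_iff)
 then have "\<theta> (sig_lam D (frag_of v)) = - \<theta> (frag_of v)" using assms(1) by (simp add: sig_compatible_def)
 then show ?thesis by (simp add: tw_def sig_lam_def)
qed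

lemma fle_isotropic:
 fixes M :: "('v, 'a, 'k::{field,finite}) sdrep"
 assumes M: "self_dual Q D M" and t: "!!v. v : verts Q ==> t (sg v) = - t v"
 shows "fle t M \<longleftrightarrow> (\<forall>V\<in>subs Q M. isotropic Q M V --> wdim Q t V <= 0)"
proof -
 note R = sdD(1)[OF M]
 have "(\<forall>V\<in>subs Q M. V <= perp M V --> wdim Q t V <= 0) \<longleftrightarrow> (\<forall>V\<in>subs Q M. wdim Q t V <= 0)"
 proof (rule modular_lattice.isotropic_semistable_iff[OF modular_lattice_subs[OF R] modular_wdim[OF R]])
  show "!!V. V : subs Q M ==> perp M V : subs Q M" by (rule perp_in_subs[OF M])
  show "wdim Q t (perp M V) = wdim Q t V" if "V : subs Q M" for V
   by (rule wdim_perp(1)[OF M that]) (rule t)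
 qed
 then show ?thesis unfolding fle_def using isotropic_iff[OF M] by simp
qed

text \<open>The definition tests isotropic subrepresentations only; \<open>fle_isotropic\<close>
  extends the bound to all, which is what the block conditions express.\<close>

lemma sd_semistable_iff:
 fixes M :: "('v, 'a, 'k::{field,finite}) sdrep"
 assumes th: "stability Q \<theta>" "sig_compatible Q D \<theta>" and M: "self_dual Q D M"
 shows "zero_family Q (vsp M) | sd_semistable Q \<theta> M \<longleftrightarrow> fle (tw \<theta>) M"
proof
 note R = sdD(1)[OF M]
 note z = zero_family_wdim
 have sl: "slope Q \<theta> V <= 0 \<longleftrightarrow> wdim Q (tw \<theta>) V <= 0" if "0 < wdim Q (%_. 1) V" for V :: "'v => 'k vec set"
  using that unfolding slope_eq[OF th(1)] by (simp add: divide_le_0_iff)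
 show "fle (tw \<theta>) M" if h: "zero_family Q (vsp M) | sd_semistable Q \<theta> M"
 proof -
  have "wdim Q (tw \<theta>) V <= 0" if V: "V : subs Q M" and iso: "isotropic Q M V" for V
  proof (cases "zero_family Q V")
   case True
   from z(3)[where V = V and w = "tw \<theta>", OF subsD(1,2)[OF R V] True] show ?thesis by (rule eq_refl)
  next
   case False
   have "~ zero_family Q (vsp M)"
   proof
    assume zM: "zero_family Q (vsp M)"
    have "V v = {0}" if "v : verts Q" for v
    proof -
     have "vsp M v = {0}" using zM that by (simp add: zero_family_def)
     then show ?thesis using subsD(3)[OF R V that] kvec.subspace_0[OF subsD(1)[OF R V, of v]] by auto
    qed
    then show False using False by (simp add: zero_family_def)
   qed
   then have "sd_semistable Q \<theta> M" using h by simp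
   moreover have "subrepresentation Q M V" using V by (simp add: subs_def)
   ultimately have "slope Q \<theta> V <= 0" using False iso unfolding sd_semistable_def by simp
   moreover have "0 < wdim Q (%_. 1) V" by (rule z(2)[where V = V, OF subsD(1,2)[OF R V] False])
   ultimately show ?thesis using sl by simp
  qed
  moreover have "fle (tw \<theta>) M \<longleftrightarrow> (\<forall>V\<in>subs Q M. isotropic Q M V --> wdim Q (tw \<theta>) V <= 0)"
   by (rule fle_isotropic[OF M]) (rule tw_sig[OF th(2)])
  ultimately show ?thesis by blast
 qed
 show "zero_family Q (vsp M) | sd_semistable Q \<theta> M" if f: "fle (tw \<theta>) M"
 proof -
  have "slope Q \<theta> V <= 0" if V: "subrepresentation Q M V" "~ zero_family Q V" for V
  proof -
   have sub: "kvec.subspace (V i)" "V i <= vsp M i" if "i : verts Q" for i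
    using V(1) that by (simp_all add: subrepresentation_def)
   have sV: "kvec.subspace (V i)" "finite (V i)" if "i : verts Q" for i
    using sub(1)[OF that] finite_subset[OF sub(2)[OF that] repD(2)[OF R that]] .
   have "onverts Q V : subs Q M"
    unfolding onverts_subs_iff using V(1) by (simp add: subrepresentation_def)
   then have "wdim Q (tw \<theta>) (onverts Q V) <= 0" using f unfolding fle_def by blast
   then have "wdim Q (tw \<theta>) V <= 0" by simp
   then show ?thesis using sl[OF z(2)[OF sV V(2)]] by simp
  qed
  then show ?thesis unfolding sd_semistable_def by simp
 qed
qed

lemma A_sd_series_eq:
 assumes th: "stability Q \<theta>" "sig_compatible Q D \<theta>"
 shows "A_sd_series (K :: 'k::{field,finite} itself) Q D P0 P1 \<theta> e = (if e : Lam_pos Q then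
  qhalf (CARD('k)) (sd_euler Q D P0 P1 e) * smass (sd_ss (tw \<theta>) (nd e) :: ('v, 'a, 'k) sdrep set) else 0)"
proof -
 have "{M :: ('v, 'a, 'k) sdrep. self_dual Q D M &
   (zero_family Q (vsp M) | sd_semistable Q \<theta> M) & dimvec Q (vsp M) = e} =
  (if e : Lam_pos Q then sd_ss (tw \<theta>) (nd e) else {})"
  using sd_semistable_iff[OF th] dimvec_eq_iff[of e] by (auto simp: sd_ss_def dimvec_lat)
 then show ?thesis
  unfolding A_sd_series_def smass_def by (simp add: sum_distrib_left)
qed

lemma smass_Rats: "smass S : \<rat>"
 unfolding smass_def by (intro Rats_sum Rats_divide) simp_all

lemma Lam_sig_pos_iff: "e : Lam_sig_pos Q D \<longleftrightarrow> e : Lam_pos Q & (\<forall>v\<in>verts Q. nd e (sg v) = nd e v)"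
proof (cases "e : Lam_pos Q")
 case True
 have "sig_lam D e = lat (%v. nd e (sg v))" using sig_lam_lat[of "nd e"] lat_nd[OF True] by simp
 moreover have "lat (%v. nd e (sg v)) = e \<longleftrightarrow> (\<forall>v\<in>verts Q. nd e (sg v) = nd e v)"
 proof
  assume h: "lat (%v. nd e (sg v)) = e"
  show "\<forall>v\<in>verts Q. nd e (sg v) = nd e v"
  proof
   fix v assume v: "v : verts Q"
   have "coef (lat (%v. nd e (sg v))) v = coef e v" using h by simp
   then show "nd e (sg v) = nd e v" using v coef_nd[OF True v] by (simp add: coef_lat)
  qed
 next
  assume "\<forall>v\<in>verts Q. nd e (sg v) = nd e v"
  then have "lat (%v. nd e (sg v)) = lat (nd e)" by (intro lat_cong) simp
  then show "lat (%v. nd e (sg v)) = e" using lat_nd[OF True] by simp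
 qed
 ultimately show ?thesis using True by (simp add: Lam_sig_pos_def)
qed (simp add: Lam_sig_pos_def)

text \<open>The vector \<open>e\<close> is determined by \<open>c\<close> and \<open>d\<close>, and
  it is nonnegative exactly under the bound that also indexes the strata in
  \<open>smass_sd_reps\<close>.\<close>

lemma sum_hyperbolic:
 assumes c: "c : Lam_sig_pos Q D"
 shows "(\<Sum>(d, e) | d : Lam_pos Q & e : Lam_sig_pos Q D & hyperbolic D d + e = c. G d e :: real) =
  (\<Sum>f | f : (\<Pi>\<^sub>E v\<in>verts Q. {..nd c v}) & (\<forall>v\<in>verts Q. f v + f (sg v) <= nd c v).
   G (lat f) (lat (%v. nd c v - f v - f (sg v))))"
proof (rule sum.reindex_bij_witness[where i = "%f. (lat f, lat (%v. nd c v - f v - f (sg v)))" and j = "%p. nd (fst p)"])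
 have cp: "c : Lam_pos Q" and cs: "!!v. v : verts Q ==> nd c (sg v) = nd c v" using c by (simp_all add: Lam_sig_pos_iff)
 {
  fix p assume "p : {(d, e). d : Lam_pos Q & e : Lam_sig_pos Q D & hyperbolic D d + e = c}"
  then obtain d e where p: "p = (d, e)" "d : Lam_pos Q" "e : Lam_sig_pos Q D" and de: "hyperbolic D d + e = c" by blast
  have ep: "e : Lam_pos Q" using p(3) by (simp add: Lam_sig_pos_iff)
  have sd: "sig_lam D d = lat (%v. nd d (sg v))" using sig_lam_lat[of "nd d"] lat_nd[OF p(2)] by simp
  have n: "nd c v = nd d v + nd d (sg v) + nd e v" if v: "v : verts Q" for v
  proof -
   have "coef c v = coef d v + coef (sig_lam D d) v + coef e v"
    unfolding de[symmetric] hyperbolic_def lookup_add ..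
   then show ?thesis unfolding sd coef_lat using coef_nd[OF cp v] coef_nd[OF p(2) v] coef_nd[OF ep v] v by simp
  qed
  have e: "lat (%v. nd c v - nd d v - nd d (sg v)) = e"
   by (rule Lam_eqI) (use ep n in \<open>simp_all add: coef_lat coef_nd\<close>)
  show "(lat (nd (fst p)), lat (%v. nd c v - nd (fst p) v - nd (fst p) (sg v))) = p" using p e by (simp add: lat_nd)
  have "nd d v <= nd c v" if "v : verts Q" for v using n[OF that] by simp
  then have "nd d : (\<Pi>\<^sub>E v\<in>verts Q. {..nd c v})" by (simp add: PiE_iff) (simp add: nd_def)
  then show "nd (fst p) : {f. f : (\<Pi>\<^sub>E v\<in>verts Q. {..nd c v}) & (\<forall>v\<in>verts Q. f v + f (sg v) <= nd c v)}"
   using n p by simp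
  show "G (lat (nd (fst p))) (lat (%v. nd c v - nd (fst p) v - nd (fst p) (sg v))) = (case p of (d, e) => G d e)"
   using p e by (simp add: lat_nd)
 }
 fix f assume f: "f : {f. f : (\<Pi>\<^sub>E v\<in>verts Q. {..nd c v}) & (\<forall>v\<in>verts Q. f v + f (sg v) <= nd c v)}"
 let ?g = "%v. nd c v - f v - f (sg v)"
 have fP: "f : (\<Pi>\<^sub>E v\<in>verts Q. {..nd c v})" using f by blast
 show "nd (fst (lat f, lat ?g)) = f" unfolding fst_conv nd_lat by (rule PiE_restrict[OF fP])
 have le: "f v + f (sg v) <= nd c v" if "v : verts Q" for v using f that by blast
 have "lat ?g : Lam_sig_pos Q D"
  unfolding Lam_sig_pos_iff nd_lat using sig cs by (simp add: add.commute)
 moreover have "hyperbolic D (lat f) + lat ?g = c"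
  unfolding hyperbolic_def sig_lam_lat
 proof (intro Lam_eqI Lam_pos_add cp lat_in)
  fix v assume v: "v : verts Q"
  show "coef (lat f + lat (%v. f (sg v)) + lat ?g) v = coef c v"
  proof -
   have "f v + f (sg v) + ?g v = nd c v" using le[OF v] by arith
   then have "int (f v) + int (f (sg v)) + int (?g v) = int (nd c v)" by (simp only: of_nat_add[symmetric])
   then show ?thesis unfolding lookup_add coef_lat coef_nd[OF cp v] using v by (simp only: if_True)
  qed
 qed
 ultimately show "(lat f, lat ?g) : {(d, e). d : Lam_pos Q & e : Lam_sig_pos Q D & hyperbolic D d + e = c}" by simp
qed

text \<open>The right-hand side does not involve \<open>\<theta>\<close>.\<close>

lemma torus_act_eq:
 fixes K :: "'k::{field,finite} itself"
 assumes two: "(2 :: 'k) ~= 0" and P: "sig_decomposition Q D P0 P1"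
  and th: "stability Q \<theta>" "sig_compatible Q D \<theta>"
 shows "torus_act (CARD('k)) Q D P0 P1 (tors_series K \<theta>) (A_sd_series K Q D P0 P1 \<theta>) c =
  (if c : Lam_sig_pos Q D then qhalf (CARD('k)) (sd_euler Q D P0 P1 c) * smass (sd_reps (nd c) :: ('v, 'a, 'k) sdrep set) else 0)"
proof (cases "c : Lam_sig_pos Q D")
 case False
 \<comment> \<open>Every term of the action lies over an invariant vector, so at other
   \<open>c\<close> the sum is empty.\<close>
 have "hyperbolic D d + e : Lam_sig_pos Q D" if d: "d : Lam_pos Q" and e: "e : Lam_sig_pos Q D" for d e
 proof -
  have ep: "e : Lam_pos Q" using e by (simp add: Lam_sig_pos_iff)
  have s: "hyperbolic D d = lat (%v. nd d v + nd d (sg v))"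
   unfolding hyperbolic_def using sig_lam_lat[of "nd d"] lat_nd[OF d]
   by (intro Lam_eqI Lam_pos_add d) (simp_all add: lookup_add coef_lat coef_nd[OF d])
  have "hyperbolic D d + e = lat (%v. nd d v + nd d (sg v) + nd e v)"
   unfolding s by (intro Lam_eqI Lam_pos_add ep lat_in) (simp add: lookup_add coef_lat coef_nd[OF ep])
  then show ?thesis using e sig unfolding Lam_sig_pos_iff by (simp add: nd_lat add.commute)
 qed
 then have E: "{(d, e). d : Lam_pos Q & e : Lam_sig_pos Q D & hyperbolic D d + e = c} = {}" using False by auto
 show ?thesis unfolding torus_act_def E using False by simp
next
 case True
 let ?q = "CARD('k)" and ?t = "tw \<theta>" and ?E = "sd_euler Q D P0 P1"
 let ?T = "{f. f : (\<Pi>\<^sub>E v\<in>verts Q. {..nd c v}) & (\<forall>v\<in>verts Q. f v + f (sg v) <= nd c v)}"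
 have cp: "c : Lam_pos Q" and cs: "!!v. v : verts Q ==> nd c (sg v) = nd c v" using True by (simp_all add: Lam_sig_pos_iff)
 have q: "0 < ?q" by (rule zero_less_card_finite)
 have "torus_act ?q Q D P0 P1 (tors_series K \<theta>) (A_sd_series K Q D P0 P1 \<theta>) c = (\<Sum>f\<in>?T.
   qhalf ?q (skew_form Q (lat f) (lat (%v. nd c v - f v - f (sg v))) - sd_euler_tilde Q D P0 P1 (lat f)) *
   tors_series K \<theta> (lat f) * A_sd_series K Q D P0 P1 \<theta> (lat (%v. nd c v - f v - f (sg v))))"
  unfolding torus_act_def by (rule sum_hyperbolic[OF True])
 also have "\<dots> = (\<Sum>f\<in>?T. qhalf ?q (?E c) * smass (sd_type ?t (nd c) f :: ('v, 'a, 'k) sdrep set))"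
 proof (rule sum.cong[OF refl])
  fix f assume f: "f : ?T"
  let ?g = "%v. nd c v - f v - f (sg v)"
  have fP: "f : (\<Pi>\<^sub>E v\<in>verts Q. {..nd c v})" using f by blast
  have fr: "restrict f (verts Q) = f" by (rule PiE_restrict[OF fP])
  have le: "f v + f (sg v) <= nd c v" if "v : verts Q" for v using f that by blast
  have g: "?g (sg v) = ?g v" if "v : verts Q" for v using that sig cs by (simp add: add.commute)
  have cg: "f v + ?g v + f (sg v) = nd c v" if "v : verts Q" for v using le[OF that] by simp
  have ty: "sd_type ?t (nd c) f = (sd_type ?t (%v. f v + ?g v + f (sg v)) f :: ('v, 'a, 'k) sdrep set)"
   unfolding sd_type_def dims_def using cg by simp
  have lc: "lat (%v. f v + ?g v + f (sg v)) = c"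
   using lat_cong[of "%v. f v + ?g v + f (sg v)" "nd c"] cg lat_nd[OF cp] by simp
  let ?X = "\<Sum>r\<in>edges. f (sg (src r)) * ?g (dst r)"
  let ?Y = "\<Sum>v\<in>verts Q. f v * ?g v + f v * f (sg v) + ?g v * f (sg v)"
  let ?m = "mass (tors_reps ?t f :: ('v, 'a, 'k) qrep set)"
  let ?l = "smass (sd_ss ?t ?g :: ('v, 'a, 'k) sdrep set)"
  have "\<exists>n. smass (sd_type ?t (%v. f v + ?g v + f (sg v)) f :: ('v, 'a, 'k) sdrep set) =
    ?m * ?l * (real ?q ^ (?X + n) / real ?q ^ ?Y) &
   2 * int n = (\<Sum>r\<in>edges. int (f (sg (src r))) * int (f (sg (dst r)))) +
    (\<Sum>r | r : edges & einv r = r. eps r * int (f (sg (src r))))"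
   by (rule smass_type[OF two]) (erule tw_sig[OF th(2)], erule g)
  then obtain n where n: "smass (sd_type ?t (%v. f v + ?g v + f (sg v)) f :: ('v, 'a, 'k) sdrep set) =
    ?m * ?l * (real ?q ^ (?X + n) / real ?q ^ ?Y)"
   and n2: "2 * int n = (\<Sum>r\<in>edges. int (f (sg (src r))) * int (f (sg (dst r)))) +
    (\<Sum>r | r : edges & einv r = r. eps r * int (f (sg (src r))))" by (elim exE conjE)
  have "skew_form Q (lat f) (lat ?g) - sd_euler_tilde Q D P0 P1 (lat f) + euler_form Q (lat f) (lat f) + ?E (lat ?g) =
    ?E (lat (%v. f v + ?g v + f (sg v))) + 2 * int (?X + n) - 2 * int ?Y"
   by (rule sd_exponent[where d = f and e = ?g, OF P _ n2]) (erule g)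
  note ex = this[unfolded lc]
  have "sd_ss ?t (nd (lat ?g)) = (sd_ss ?t ?g :: ('v, 'a, 'k) sdrep set)"
   unfolding sd_ss_def dims_def nd_lat by simp
  then have A: "A_sd_series K Q D P0 P1 \<theta> (lat ?g) = qhalf ?q (?E (lat ?g)) * ?l"
   unfolding A_sd_series_eq[OF th] by simp
  have B: "tors_series K \<theta> (lat f) = qhalf ?q (euler_form Q (lat f) (lat f)) * ?m"
   unfolding tors_series_def nd_lat fr by simp
  have key: "a * (b * m) * (e * l) = x * (m * l * y)" if "a * b * e = x * y" for a b e m l x y :: real
  proof -
   have "a * (b * m) * (e * l) = a * b * e * (m * l)" by (simp only: mult_ac)
   then show ?thesis unfolding that by (simp only: mult_ac)
  qed
  have "qhalf ?q (skew_form Q (lat f) (lat ?g) - sd_euler_tilde Q D P0 P1 (lat f)) * qhalf ?q (euler_form Q (lat f) (lat f)) * qhalf ?q (?E (lat ?g)) =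
    qhalf ?q (skew_form Q (lat f) (lat ?g) - sd_euler_tilde Q D P0 P1 (lat f) + euler_form Q (lat f) (lat f) + ?E (lat ?g))"
   by (simp only: qhalf_add[OF q])
  also have "\<dots> = qhalf ?q (?E c) * (real ?q ^ (?X + n) / real ?q ^ ?Y)"
   unfolding ex by (rule qhalf_quotient[OF q])
  finally show "qhalf ?q (skew_form Q (lat f) (lat ?g) - sd_euler_tilde Q D P0 P1 (lat f)) *
   tors_series K \<theta> (lat f) * A_sd_series K Q D P0 P1 \<theta> (lat ?g) = qhalf ?q (?E c) * smass (sd_type ?t (nd c) f :: ('v, 'a, 'k) sdrep set)"
   unfolding A B ty n by (rule key)
 qed
 also have "\<dots> = qhalf ?q (?E c) * smass (sd_reps (nd c) :: ('v, 'a, 'k) sdrep set)"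
 proof -
  have "smass (sd_reps (nd c) :: ('v, 'a, 'k) sdrep set) = (\<Sum>f\<in>?T. smass (sd_type ?t (nd c) f :: ('v, 'a, 'k) sdrep set))"
   by (rule smass_sd_reps) (erule tw_sig[OF th(2)], erule cs)
  then show ?thesis by (simp only: sum_distrib_left)
 qed
 finally show ?thesis using True by simp
qed

end

theorem theorem3p5:
  fixes Q :: "('v, 'a) pre_digraph"
    and D :: "('v, 'a) duality_data"
    and P0 :: "'v set" and P1 :: "'a set"
    and \<theta> \<theta>' :: "('v \<Rightarrow>\<^sub>0 int) \<Rightarrow> int"
    and K :: "'k::{field,finite} itself"
    and q :: nat
  assumes "odd (CHAR('k))" and "q = CARD('k)"
    and "fin_digraph Q"
    and "quiver_involution Q D" and "duality_structure Q D"
    and "sig_decomposition Q D P0 P1"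
    and "stability Q \<theta>" and "sig_compatible Q D \<theta>"
    and "stability Q \<theta>'" and "sig_compatible Q D \<theta>'"
  shows "\<exists>P P'.
    has_ordered_prod q Q (A_series K Q \<theta>) {\<mu>. 0 < \<mu>} P \<and>
    has_ordered_prod q Q (A_series K Q \<theta>') {\<mu>. 0 < \<mu>} P' \<and>
    torus_act q Q D P0 P1 P (A_sd_series K Q D P0 P1 \<theta>) \<in> torus_module q Q D \<and>
    torus_act q Q D P0 P1 P (A_sd_series K Q D P0 P1 \<theta>) =
      torus_act q Q D P0 P1 P' (A_sd_series K Q D P0 P1 \<theta>')"
proof -
 interpret sd_quiver Q D
  using assms(3-5) by (intro sd_quiver.intro quiver.intro sd_quiver_axioms.intro)
 have two: "(2 :: 'k) ~= 0"
 proof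
  \<comment> \<open>The characteristic would be an odd number dividing 2, hence 1, which no field
    has.\<close>
  assume "(2 :: 'k) = 0"
  then have "of_nat 2 = (0 :: 'k)" by simp
  then have "CHAR('k) dvd 2" by (simp only: of_nat_eq_0_iff_char_dvd)
  then have "CHAR('k) <= 2" by (rule dvd_imp_le) simp
  moreover obtain k where "CHAR('k) = 2 * k + 1" using assms(1) by (rule oddE)
  ultimately have c: "CHAR('k) = 1" by arith
  have "of_nat (CHAR('k)) = (0 :: 'k)" by simp
  then show False unfolding c by simp
 qed
 have q: "0 < CARD('k)" by (rule zero_less_card_finite)
 let ?f = "%c. if c : Lam_sig_pos Q D then qhalf (CARD('k)) (sd_euler Q D P0 P1 c) * smass (sd_reps (nd c) :: ('v, 'a, 'k) sdrep set) else 0"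
 have act: "torus_act (CARD('k)) Q D P0 P1 (tors_series K \<theta>) (A_sd_series K Q D P0 P1 \<theta>) = ?f"
  by (rule ext) (rule torus_act_eq[OF two assms(6-8)])
 have act': "torus_act (CARD('k)) Q D P0 P1 (tors_series K \<theta>') (A_sd_series K Q D P0 P1 \<theta>') = ?f"
  by (rule ext) (rule torus_act_eq[OF two assms(6,9,10)])
 have cf: "?f c : coeff_field (CARD('k))" for c
 proof (cases "c : Lam_sig_pos Q D")
  case True
  have "smass (sd_reps (nd c) :: ('v, 'a, 'k) sdrep set) * qhalf (CARD('k)) (sd_euler Q D P0 P1 c) : coeff_field (CARD('k))"
   by (rule coeff_field_mult_Rats[OF smass_Rats qhalf_in_coeff_field[OF q]])
  then show ?thesis using True by (simp only: if_True mult.commute)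
 next
  case False
  have "0 : coeff_field (CARD('k))" unfolding coeff_field_def by (intro CollectI exI[of _ 0]) simp
  then show ?thesis using False by simp
 qed
 have "range ?f <= coeff_field (CARD('k))" by (rule image_subsetI) (rule cf)
 then have mem: "?f : torus_module (CARD('k)) Q D" unfolding torus_module_def by simp
 show ?thesis
  unfolding assms(2)
 proof (intro exI conjI)
  show "has_ordered_prod (CARD('k)) Q (A_series K Q \<theta>) {\<mu>. 0 < \<mu>} (tors_series K \<theta>)"
   by (rule has_ordered_prod_tors[OF assms(7)])
  show "has_ordered_prod (CARD('k)) Q (A_series K Q \<theta>') {\<mu>. 0 < \<mu>} (tors_series K \<theta>')"
   by (rule has_ordered_prod_tors[OF assms(9)])
  show "torus_act (CARD('k)) Q D P0 P1 (tors_series K \<theta>) (A_sd_series K Q D P0 P1 \<theta>) : torus_module (CARD('k)) Q D"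
   unfolding act by (rule mem)
  show "torus_act (CARD('k)) Q D P0 P1 (tors_series K \<theta>) (A_sd_series K Q D P0 P1 \<theta>) =
    torus_act (CARD('k)) Q D P0 P1 (tors_series K \<theta>') (A_sd_series K Q D P0 P1 \<theta>')"
   unfolding act act' ..
 qed
qed

end
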